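(* Let $\mathcal{G}$ be the subcategory of $\mathrm{mod}\,R$ consisting of all G-projective $R$-modules, and let $\underline{\mathcal{G}}$ be its stable category. The following are equivalent for an $R$-module $M$: (1) $M$ has a right $\mathcal{G}$-approximation; (2) $\widehat{\mathrm{Ext}}{}_R^i(-,M)|_{\underline{\mathcal{G}}}$ is a finitely generated right $\underline{\mathcal{G}}$-module for every $i\in\mathbb{Z}$; (2') $\widehat{\mathrm{Ext}}{}_R^i(-,M)|_{\underline{\mathcal{G}}}$ is a finitely generated right $\underline{\mathcal{G}}$-module for some $i\in\mathbb{Z}$; (3) $\widehat{\mathrm{Ext}}{}_R^i(-,M)|_{\underline{\mathcal{G}}}$ is a finitely presented right $\underline{\mathcal{G}}$-module for every $i\in\mathbb{Z}$; (3') $\widehat{\mathrm{Ext}}{}_R^i(-,M)|_{\underline{\mathcal{G}}}$ is a finitely presented right $\underline{\mathcal{G}}$-module for some $i\in\mathbb{Z}$; (4) $\widehat{\mathrm{Ext}}{}_R^i(-,M)|_{\underline{\mathcal{G}}}$ is a projective object of $\mathrm{mod}\,\underline{\mathcal{G}}$ for every $i\in\mathbb{Z}$; (4') $\widehat{\mathrm{Ext}}{}_R^i(-,M)|_{\underline{\mathcal{G}}}$ is a projective object of $\mathrm{mod}\,\underline{\mathcal{G}}$ for some $i\in\mathbb{Z}$.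
   Context: Throughout, $R$ is a commutative Noetherian Henselian local ring, all $R$-modules are finitely generated, $\mathrm{mod}\,R$ is the category of finitely generated $R$-modules, and a subcategory of $\mathrm{mod}\,R$ means a full subcategory closed under isomorphisms. Write $(-)^{*}=\mathrm{Hom}_R(-,R)$. An $R$-module $X$ is G-projective if the natural map $X\to X^{**}$ is an isomorphism and $\mathrm{Ext}_R^i(X,R)=0=\mathrm{Ext}_R^i(X^{*},R)$ for all $i>0$. A right $\mathcal{G}$-approximation of $M$ is a homomorphism $\phi:X\to M$ with $X\in\mathcal{G}$ such that every homomorphism $X'\to M$ with $X'\in\mathcal{G}$ factors through $\phi$. Stable category: for a subcategory $\mathcal{X}$ of $\mathrm{mod}\,R$, $\underline{\mathcal{X}}$ has the same objects as $\mathcal{X}$, with morphisms $\underline{\mathrm{Hom}}_R(M,N)=\mathrm{Hom}_R(M,N)/\mathfrak{P}_R(M,N)$, where $\mathfrak{P}_R(M,N)$ is the submodule of homomorphisms factoring through some free $R$-module. Syzygies and cosyzygies: $\Omega M$ is the kernel of a minimal free cover $F\to M$ (i.e. a surjection from a free module whose rank is the minimal number of generators of $M$). $\Omega^{-1}M$ is the cokernel of the minimal left $\mathcal{F}$-approximation $\theta:M\to F$, where $\mathcal{F}$ is the subcategory of free modules: $F$ is free, every homomorphism from $M$ to a free module factors through $\theta$, and every endomorphism $g$ of $F$ with $g\theta=\theta$ is an automorphism. Set $\Omega^0M=M$ and, for $n\ge2$, $\Omega^nM=\Omega(\Omega^{n-1}M)$, $\Omega^{-n}M=\Omega^{-1}(\Omega^{-(n-1)}M)$.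 $\Omega$ and $\Omega^{-1}$ induce functors on the stable category of $\mathrm{mod}\,R$, and they preserve $\mathcal{G}$. Tate cohomology: for $X\in\mathcal{G}$, $M\in\mathrm{mod}\,R$ and $i\in\mathbb{Z}$, $\widehat{\mathrm{Ext}}{}_R^i(X,M)=\underline{\mathrm{Hom}}_R(\Omega^iX,M)$; $\widehat{\mathrm{Ext}}{}_R^i(-,M)|_{\underline{\mathcal{G}}}$ denotes the resulting contravariant functor on $\underline{\mathcal{G}}$. Functor categories: for an additive category $\mathcal{A}$, a right $\mathcal{A}$-module is an additive contravariant functor $F$ from $\mathcal{A}$ to abelian groups (morphisms are natural transformations). $F$ is finitely generated if there is an exact sequence $\mathrm{Hom}_{\mathcal{A}}(-,X)\to F\to 0$ with $X\in\mathcal{A}$, and finitely presented if there is an exact sequence $\mathrm{Hom}_{\mathcal{A}}(-,X_1)\to\mathrm{Hom}_{\mathcal{A}}(-,X_0)\to F\to0$ with $X_0,X_1\in\mathcal{A}$. $\mathrm{mod}\,\mathcal{A}$ is the full subcategory of finitely presented right $\mathcal{A}$-modules. *)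

theory Defs
  imports
    "HOL-Algebra.Ring_Divisibility"
    "HOL-Algebra.QuotRing"
    "HOL-Algebra.UnivPoly"
    "HOL-Algebra.Module"
    "HOL-Algebra.Elementary_Groups"
begin

section \<open>Henselian local rings\<close>

definition local_cring :: "('a,'r) ring_scheme \<Rightarrow> bool" where
  "local_cring R \<longleftrightarrow> cring R \<and> (\<exists>!I. maximalideal I R)"

definition max_ideal :: "('a,'r) ring_scheme \<Rightarrow> 'a set" where
  "max_ideal R = (THE I. maximalideal I R)"

definition monic_poly :: "('a,'r) ring_scheme \<Rightarrow> (nat \<Rightarrow> 'a) \<Rightarrow> bool" where
  "monic_poly R p \<longleftrightarrow> p \<in> carrier (UP R) \<and> coeff (UP R) p (deg R p) = \<one>\<^bsub>R\<^esub>"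

definition coprime_poly :: "('a,'r) ring_scheme \<Rightarrow> (nat \<Rightarrow> 'a) \<Rightarrow> (nat \<Rightarrow> 'a) \<Rightarrow> bool" where
  "coprime_poly K p q \<longleftrightarrow>
     (\<exists>u \<in> carrier (UP K). \<exists>v \<in> carrier (UP K).
        (u \<otimes>\<^bsub>UP K\<^esub> p) \<oplus>\<^bsub>UP K\<^esub> (v \<otimes>\<^bsub>UP K\<^esub> q) = \<one>\<^bsub>UP K\<^esub>)"

definition reduce_poly :: "('a,'r) ring_scheme \<Rightarrow> 'a set \<Rightarrow> (nat \<Rightarrow> 'a) \<Rightarrow> (nat \<Rightarrow> 'a set)" where
  "reduce_poly R I p = (\<lambda>n. I +>\<^bsub>R\<^esub> coeff (UP R) p n)"

text \<open>A local ring is Henselian if Hensel's lemma holds in it: a factorization of the reduction of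
  a monic polynomial into coprime monic factors over the residue field lifts.\<close>

definition henselian_local_ring :: "('a,'r) ring_scheme \<Rightarrow> bool" where
  "henselian_local_ring R \<longleftrightarrow> local_cring R \<and>
     (let I = max_ideal R; K = R Quot I in
      \<forall>f g0 h0. monic_poly R f \<and> monic_poly K g0 \<and> monic_poly K h0 \<and> coprime_poly K g0 h0 \<and>
          reduce_poly R I f = g0 \<otimes>\<^bsub>UP K\<^esub> h0 \<longrightarrow>
        (\<exists>g h. monic_poly R g \<and> monic_poly R h \<and> f = g \<otimes>\<^bsub>UP R\<^esub> h \<and>
           reduce_poly R I g = g0 \<and> reduce_poly R I h = h0))"


section \<open>Finitely generated modules\<close>

text \<open>Homomorphisms are extensional functions, so that equality of functions is equality of
  homomorphisms. The library's module records extend ring records; the fields \<open>mult\<close> and \<open>one\<close> of a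
  module carry no meaning, and are left \<open>undefined\<close> in the constructions below.\<close>

definition mod_hom ::
  "('a,'r) ring_scheme \<Rightarrow> ('a,'x,'s) module_scheme \<Rightarrow> ('a,'y,'t) module_scheme \<Rightarrow> ('x \<Rightarrow> 'y) set" where
  "mod_hom R X Y = {f \<in> carrier X \<rightarrow>\<^sub>E carrier Y.
     (\<forall>x \<in> carrier X. \<forall>y \<in> carrier X. f (x \<oplus>\<^bsub>X\<^esub> y) = f x \<oplus>\<^bsub>Y\<^esub> f y) \<and>
     (\<forall>a \<in> carrier R. \<forall>x \<in> carrier X. f (a \<odot>\<^bsub>X\<^esub> x) = a \<odot>\<^bsub>Y\<^esub> f x)}"

definition mod_iso ::
  "('a,'r) ring_scheme \<Rightarrow> ('a,'x,'s) module_scheme \<Rightarrow> ('a,'y,'t) module_scheme \<Rightarrow> ('x \<Rightarrow> 'y) set" where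
  "mod_iso R X Y = {f \<in> mod_hom R X Y. bij_betw f (carrier X) (carrier Y)}"

definition Hom_mod ::
  "('a,'r) ring_scheme \<Rightarrow> ('a,'x,'s) module_scheme \<Rightarrow> ('a,'y,'t) module_scheme \<Rightarrow> ('a, 'x \<Rightarrow> 'y) module" where
  "Hom_mod R X Y = \<lparr>carrier = mod_hom R X Y, mult = undefined, one = undefined,
     zero = (\<lambda>x \<in> carrier X. \<zero>\<^bsub>Y\<^esub>),
     add = (\<lambda>f g. \<lambda>x \<in> carrier X. f x \<oplus>\<^bsub>Y\<^esub> g x),
     smult = (\<lambda>a f. \<lambda>x \<in> carrier X. a \<odot>\<^bsub>Y\<^esub> f x)\<rparr>"

definition mod_span :: "('a,'r) ring_scheme \<Rightarrow> ('a,'x,'s) module_scheme \<Rightarrow> 'x set \<Rightarrow> 'x set" where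
  "mod_span R M S = \<Inter>{N. submodule N R M \<and> S \<subseteq> N}"

definition fg_module :: "('a,'r) ring_scheme \<Rightarrow> ('a,'x,'s) module_scheme \<Rightarrow> bool" where
  "fg_module R M \<longleftrightarrow> module R M \<and>
     (\<exists>S. finite S \<and> S \<subseteq> carrier M \<and> mod_span R M S = carrier M)"

definition min_gens :: "('a,'r) ring_scheme \<Rightarrow> ('a,'x,'s) module_scheme \<Rightarrow> nat" where
  "min_gens R M = (LEAST n. \<exists>S. finite S \<and> card S = n \<and> S \<subseteq> carrier M \<and> mod_span R M S = carrier M)"

definition ring_as_module :: "('a,'r) ring_scheme \<Rightarrow> ('a,'a) module" where
  "ring_as_module R = \<lparr>carrier = carrier R, mult = undefined, one = undefined,
     zero = \<zero>\<^bsub>R\<^esub>, add = (\<oplus>\<^bsub>R\<^esub>), smult = (\<otimes>\<^bsub>R\<^esub>)\<rparr>"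

text \<open>The free module \<open>R\<^sup>n\<close>. Since all modules are finitely generated, ``some free module'' is
  rendered below as \<open>R\<^sup>n\<close> for some \<open>n\<close>.\<close>

definition free_mod :: "('a,'r) ring_scheme \<Rightarrow> nat \<Rightarrow> ('a, nat \<Rightarrow> 'a) module" where
  "free_mod R n = \<lparr>carrier = {..<n} \<rightarrow>\<^sub>E carrier R, mult = undefined, one = undefined,
     zero = (\<lambda>i \<in> {..<n}. \<zero>\<^bsub>R\<^esub>),
     add = (\<lambda>v w. \<lambda>i \<in> {..<n}. v i \<oplus>\<^bsub>R\<^esub> w i),
     smult = (\<lambda>a v. \<lambda>i \<in> {..<n}. a \<otimes>\<^bsub>R\<^esub> v i)\<rparr>"

text \<open>The objects of \<open>mod R\<close> are the finitely generated modules with carrier in a fixed type. This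
  type is large enough to contain a copy of every quotient of every \<open>R\<^sup>n\<close> (as a set of cosets),
  hence of every finitely generated module over \<open>R\<close>.\<close>

type_synonym 'a obj = "('a, (nat \<Rightarrow> 'a) set) module"


section \<open>Ext and G-projective modules\<close>

definition free_resolution ::
  "('a,'r) ring_scheme \<Rightarrow> ('a,'x,'s) module_scheme \<Rightarrow> (nat \<Rightarrow> nat) \<Rightarrow>
     (nat \<Rightarrow> (nat \<Rightarrow> 'a) \<Rightarrow> (nat \<Rightarrow> 'a)) \<Rightarrow> ((nat \<Rightarrow> 'a) \<Rightarrow> 'x) \<Rightarrow> bool" where
  "free_resolution R X b d e \<longleftrightarrow>
     (let F = (\<lambda>k. free_mod R (b k)) in
       e \<in> mod_hom R (F 0) X \<and> e ` carrier (F 0) = carrier X \<and>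
       (\<forall>k. d k \<in> mod_hom R (F (Suc k)) (F k)) \<and>
       a_kernel (F 0) X e = d 0 ` carrier (F 1) \<and>
       (\<forall>k. a_kernel (F (Suc k)) (F k) (d k) = d (Suc k) ` carrier (F (Suc (Suc k)))))"

definition chosen_resolution ::
  "('a,'r) ring_scheme \<Rightarrow> ('a,'x,'s) module_scheme \<Rightarrow>
     (nat \<Rightarrow> nat) \<times> (nat \<Rightarrow> (nat \<Rightarrow> 'a) \<Rightarrow> (nat \<Rightarrow> 'a)) \<times> ((nat \<Rightarrow> 'a) \<Rightarrow> 'x)" where
  "chosen_resolution R X = (SOME (b, d, e). free_resolution R X b d e)"

text \<open>\<open>Ext\<^sup>i(X, N)\<close> as the \<open>i\<close>-th cohomology group of \<open>Hom(F, N)\<close>, for \<open>F\<close> the chosen resolution of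
  \<open>X\<close> by finitely generated free modules (which exists when \<open>R\<close> is Noetherian and \<open>X\<close> is finitely
  generated).\<close>

definition Ext ::
  "('a,'r) ring_scheme \<Rightarrow> nat \<Rightarrow> ('a,'x,'s) module_scheme \<Rightarrow> ('a,'y,'t) module_scheme \<Rightarrow>
     ((nat \<Rightarrow> 'a) \<Rightarrow> 'y) set monoid" where
  "Ext R i X N =
     (let (b, d, e) = chosen_resolution R X;
          F = (\<lambda>k. free_mod R (b k));
          C = (\<lambda>k. Hom_mod R (F k) N);
          \<delta> = (\<lambda>k f. compose (carrier (F (Suc k))) f (d k));
          Z = a_kernel (C i) (C (Suc i)) (\<delta> i);
          B = (case i of 0 \<Rightarrow> {\<zero>\<^bsub>C 0\<^esub>} | Suc j \<Rightarrow> \<delta> j ` carrier (C j))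
      in (C i)\<lparr>carrier := Z\<rparr> A_Mod B)"

definition dual_mod ::
  "('a,'r) ring_scheme \<Rightarrow> ('a,'x,'s) module_scheme \<Rightarrow> ('a, 'x \<Rightarrow> 'a) module" where
  "dual_mod R X = Hom_mod R X (ring_as_module R)"

definition bidual_map ::
  "('a,'r) ring_scheme \<Rightarrow> ('a,'x,'s) module_scheme \<Rightarrow> 'x \<Rightarrow> ('x \<Rightarrow> 'a) \<Rightarrow> 'a" where
  "bidual_map R X = (\<lambda>x \<in> carrier X. \<lambda>f \<in> carrier (dual_mod R X). f x)"

definition G_projective :: "('a,'r) ring_scheme \<Rightarrow> ('a,'x,'s) module_scheme \<Rightarrow> bool" where
  "G_projective R X \<longleftrightarrow> fg_module R X \<and>
     bidual_map R X \<in> mod_iso R X (dual_mod R (dual_mod R X)) \<and>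
     (\<forall>i>0. trivial_group (Ext R i X (ring_as_module R)) \<and>
            trivial_group (Ext R i (dual_mod R X) (ring_as_module R)))"

definition G_proj :: "('a,'r) ring_scheme \<Rightarrow> 'a obj set" where
  "G_proj R = {X. G_projective R X}"

definition has_right_approximation ::
  "('a,'r) ring_scheme \<Rightarrow> 'a obj set \<Rightarrow> ('a,'m,'s) module_scheme \<Rightarrow> bool" where
  "has_right_approximation R \<X> M \<longleftrightarrow>
     (\<exists>X \<in> \<X>. \<exists>\<phi> \<in> mod_hom R X M.
        \<forall>X' \<in> \<X>. \<forall>\<psi> \<in> mod_hom R X' M. \<exists>\<chi> \<in> mod_hom R X' X. \<psi> = compose (carrier X') \<phi> \<chi>)"


section \<open>Preadditive categories and their right modules\<close>

text \<open>\<open>chom \<A> X Y\<close> is the abelian group of morphisms from \<open>X\<close> to \<open>Y\<close>, in the multiplicative notation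
  of the library's groups; \<open>ccomp \<A> X Y Z g f\<close> is the composite of \<open>f\<close> from \<open>X\<close> to \<open>Y\<close> and \<open>g\<close> from
  \<open>Y\<close> to \<open>Z\<close>.\<close>

record ('o, 'h) preadd_cat =
  cobj :: "'o set"
  chom :: "'o \<Rightarrow> 'o \<Rightarrow> 'h monoid"
  ccomp :: "'o \<Rightarrow> 'o \<Rightarrow> 'o \<Rightarrow> 'h \<Rightarrow> 'h \<Rightarrow> 'h"
  cid :: "'o \<Rightarrow> 'h"

text \<open>Contravariant functors to abelian groups: \<open>fmap F X Y f\<close> maps \<open>fobj F Y\<close> to \<open>fobj F X\<close>, for
  \<open>f\<close> a morphism from \<open>X\<close> to \<open>Y\<close>.\<close>

record ('o, 'h, 'g) contra_functor =
  fobj :: "'o \<Rightarrow> 'g monoid"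
  fmap :: "'o \<Rightarrow> 'o \<Rightarrow> 'h \<Rightarrow> 'g \<Rightarrow> 'g"

definition right_module :: "('o,'h) preadd_cat \<Rightarrow> ('o,'h,'g) contra_functor \<Rightarrow> bool" where
  "right_module \<A> F \<longleftrightarrow>
     (\<forall>X \<in> cobj \<A>. comm_group (fobj F X)) \<and>
     (\<forall>X \<in> cobj \<A>. \<forall>Y \<in> cobj \<A>. \<forall>f \<in> carrier (chom \<A> X Y). fmap F X Y f \<in> hom (fobj F Y) (fobj F X)) \<and>
     (\<forall>X \<in> cobj \<A>. \<forall>x \<in> carrier (fobj F X). fmap F X X (cid \<A> X) x = x) \<and>
     (\<forall>X \<in> cobj \<A>. \<forall>Y \<in> cobj \<A>. \<forall>Z \<in> cobj \<A>. \<forall>f \<in> carrier (chom \<A> X Y). \<forall>g \<in> carrier (chom \<A> Y Z).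
        \<forall>z \<in> carrier (fobj F Z). fmap F X Z (ccomp \<A> X Y Z g f) z = fmap F X Y f (fmap F Y Z g z)) \<and>
     (\<forall>X \<in> cobj \<A>. \<forall>Y \<in> cobj \<A>. \<forall>f \<in> carrier (chom \<A> X Y). \<forall>g \<in> carrier (chom \<A> X Y).
        \<forall>y \<in> carrier (fobj F Y).
          fmap F X Y (f \<otimes>\<^bsub>chom \<A> X Y\<^esub> g) y = fmap F X Y f y \<otimes>\<^bsub>fobj F X\<^esub> fmap F X Y g y)"

definition nat_trans ::
  "('o,'h) preadd_cat \<Rightarrow> ('o,'h,'g) contra_functor \<Rightarrow> ('o,'h,'k) contra_functor \<Rightarrow>
     ('o \<Rightarrow> 'g \<Rightarrow> 'k) \<Rightarrow> bool" where
  "nat_trans \<A> F G \<eta> \<longleftrightarrow>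
     (\<forall>X \<in> cobj \<A>. \<eta> X \<in> hom (fobj F X) (fobj G X)) \<and>
     (\<forall>X \<in> cobj \<A>. \<forall>Y \<in> cobj \<A>. \<forall>f \<in> carrier (chom \<A> X Y). \<forall>y \<in> carrier (fobj F Y).
        \<eta> X (fmap F X Y f y) = fmap G X Y f (\<eta> Y y))"

text \<open>Components are only relevant at objects of \<open>\<A>\<close> and on the carriers of \<open>F\<close>.\<close>

definition nat_eq ::
  "('o,'h) preadd_cat \<Rightarrow> ('o,'h,'g) contra_functor \<Rightarrow> ('o \<Rightarrow> 'g \<Rightarrow> 'k) \<Rightarrow> ('o \<Rightarrow> 'g \<Rightarrow> 'k) \<Rightarrow> bool" where
  "nat_eq \<A> F \<eta> \<xi> \<longleftrightarrow> (\<forall>X \<in> cobj \<A>. \<forall>x \<in> carrier (fobj F X). \<eta> X x = \<xi> X x)"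

definition nat_comp :: "('o \<Rightarrow> 'k \<Rightarrow> 'l) \<Rightarrow> ('o \<Rightarrow> 'g \<Rightarrow> 'k) \<Rightarrow> 'o \<Rightarrow> 'g \<Rightarrow> 'l" where
  "nat_comp \<xi> \<eta> = (\<lambda>X. \<xi> X \<circ> \<eta> X)"

definition repr_functor :: "('o,'h) preadd_cat \<Rightarrow> 'o \<Rightarrow> ('o,'h,'h) contra_functor" where
  "repr_functor \<A> W = \<lparr>fobj = (\<lambda>X. chom \<A> X W), fmap = (\<lambda>X Y f h. ccomp \<A> X Y W h f)\<rparr>"

definition fin_generated :: "('o,'h) preadd_cat \<Rightarrow> ('o,'h,'g) contra_functor \<Rightarrow> bool" where
  "fin_generated \<A> F \<longleftrightarrow> right_module \<A> F \<and>
     (\<exists>X \<in> cobj \<A>. \<exists>\<eta>. nat_trans \<A> (repr_functor \<A> X) F \<eta> \<and>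
        (\<forall>Z \<in> cobj \<A>. \<eta> Z ` carrier (chom \<A> Z X) = carrier (fobj F Z)))"

definition fin_presented :: "('o,'h) preadd_cat \<Rightarrow> ('o,'h,'g) contra_functor \<Rightarrow> bool" where
  "fin_presented \<A> F \<longleftrightarrow> right_module \<A> F \<and>
     (\<exists>X1 \<in> cobj \<A>. \<exists>X0 \<in> cobj \<A>. \<exists>\<xi> \<eta>.
        nat_trans \<A> (repr_functor \<A> X1) (repr_functor \<A> X0) \<xi> \<and>
        nat_trans \<A> (repr_functor \<A> X0) F \<eta> \<and>
        (\<forall>Z \<in> cobj \<A>. \<xi> Z ` carrier (chom \<A> Z X1) = kernel (chom \<A> Z X0) (fobj F Z) (\<eta> Z)) \<and>
        (\<forall>Z \<in> cobj \<A>. \<eta> Z ` carrier (chom \<A> Z X0) = carrier (fobj F Z)))"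

text \<open>The objects of \<open>mod \<A>\<close> are the finitely presented right \<open>\<A>\<close>-modules with values in \<open>'h set\<close>,
  where \<open>'h\<close> is the type of the morphisms of \<open>\<A>\<close>: every finitely presented right \<open>\<A>\<close>-module is
  isomorphic to a quotient of a representable functor, whose values are groups of cosets of
  morphisms.\<close>

definition mod_cat :: "('o,'h) preadd_cat \<Rightarrow> ('o,'h,'h set) contra_functor set" where
  "mod_cat \<A> = {F. fin_presented \<A> F}"

definition epi_in_mod ::
  "('o,'h) preadd_cat \<Rightarrow> ('o,'h,'h set) contra_functor \<Rightarrow> ('o,'h,'h set) contra_functor \<Rightarrow>
     ('o \<Rightarrow> 'h set \<Rightarrow> 'h set) \<Rightarrow> bool" where
  "epi_in_mod \<A> B C p \<longleftrightarrow> nat_trans \<A> B C p \<and>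
     (\<forall>D \<in> mod_cat \<A>. \<forall>u v. nat_trans \<A> C D u \<and> nat_trans \<A> C D v \<and>
        nat_eq \<A> B (nat_comp u p) (nat_comp v p) \<longrightarrow> nat_eq \<A> C u v)"

text \<open>Projective objects of \<open>mod \<A>\<close>. The functor \<open>P\<close> may take values in another type than
  \<open>'h set\<close>; being finitely presented, it is isomorphic to a member of \<open>mod_cat \<A>\<close>.\<close>

definition projective_in_mod :: "('o,'h) preadd_cat \<Rightarrow> ('o,'h,'g) contra_functor \<Rightarrow> bool" where
  "projective_in_mod \<A> P \<longleftrightarrow> fin_presented \<A> P \<and>
     (\<forall>B \<in> mod_cat \<A>. \<forall>C \<in> mod_cat \<A>. \<forall>p g. epi_in_mod \<A> B C p \<and> nat_trans \<A> P C g \<longrightarrow>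
        (\<exists>h. nat_trans \<A> P B h \<and> nat_eq \<A> P (nat_comp p h) g))"


section \<open>The stable category\<close>

definition factor_free ::
  "('a,'r) ring_scheme \<Rightarrow> ('a,'x,'s) module_scheme \<Rightarrow> ('a,'y,'t) module_scheme \<Rightarrow> ('x \<Rightarrow> 'y) set" where
  "factor_free R X Y = {f. \<exists>n. \<exists>g \<in> mod_hom R X (free_mod R n). \<exists>h \<in> mod_hom R (free_mod R n) Y.
     f = compose (carrier X) h g}"

definition stable_hom ::
  "('a,'r) ring_scheme \<Rightarrow> ('a,'x,'s) module_scheme \<Rightarrow> ('a,'y,'t) module_scheme \<Rightarrow> ('x \<Rightarrow> 'y) set monoid" where
  "stable_hom R X Y = Hom_mod R X Y A_Mod factor_free R X Y"

definition stable_class ::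
  "('a,'r) ring_scheme \<Rightarrow> ('a,'x,'s) module_scheme \<Rightarrow> ('a,'y,'t) module_scheme \<Rightarrow> ('x \<Rightarrow> 'y) \<Rightarrow> ('x \<Rightarrow> 'y) set" where
  "stable_class R X Y f = factor_free R X Y +>\<^bsub>Hom_mod R X Y\<^esub> f"

text \<open>Composition of stable classes. All composites of representatives lie in one class, so the union
  is that class; the same pattern defines the syzygy and cosyzygy functors on morphisms below.\<close>

definition stable_comp ::
  "('a,'r) ring_scheme \<Rightarrow> ('a,'x,'s) module_scheme \<Rightarrow> ('a,'y,'t) module_scheme \<Rightarrow> ('a,'z,'u) module_scheme \<Rightarrow>
     ('y \<Rightarrow> 'z) set \<Rightarrow> ('x \<Rightarrow> 'y) set \<Rightarrow> ('x \<Rightarrow> 'z) set" where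
  "stable_comp R X Y Z \<psi> \<phi> = (\<Union>g \<in> \<psi>. \<Union>f \<in> \<phi>. stable_class R X Z (compose (carrier X) g f))"

definition stable_cat ::
  "('a,'r) ring_scheme \<Rightarrow> 'a obj set \<Rightarrow> ('a obj, ((nat \<Rightarrow> 'a) set \<Rightarrow> (nat \<Rightarrow> 'a) set) set) preadd_cat" where
  "stable_cat R \<X> = \<lparr>cobj = \<X>,
     chom = stable_hom R,
     ccomp = stable_comp R,
     cid = (\<lambda>X. stable_class R X X (\<lambda>x \<in> carrier X. x))\<rparr>"


section \<open>Syzygies and cosyzygies\<close>

text \<open>An exact sequence \<open>0 \<rightarrow> K \<rightarrow> F \<rightarrow> X \<rightarrow> 0\<close> with maps \<open>i\<close>, \<open>p\<close>, where \<open>p\<close> is a minimal free cover.\<close>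

definition syzygy_seq ::
  "('a,'r) ring_scheme \<Rightarrow> 'a obj \<Rightarrow> 'a obj \<Rightarrow> ((nat \<Rightarrow> 'a) set \<Rightarrow> (nat \<Rightarrow> 'a)) \<Rightarrow>
     ((nat \<Rightarrow> 'a) \<Rightarrow> (nat \<Rightarrow> 'a) set) \<Rightarrow> bool" where
  "syzygy_seq R X K i p \<longleftrightarrow>
     (let F = free_mod R (min_gens R X) in
       module R K \<and>
       p \<in> mod_hom R F X \<and> p ` carrier F = carrier X \<and>
       i \<in> mod_hom R K F \<and> inj_on i (carrier K) \<and> i ` carrier K = a_kernel F X p)"

definition chosen_syzygy_seq ::
  "('a,'r) ring_scheme \<Rightarrow> 'a obj \<Rightarrow>
     'a obj \<times> ((nat \<Rightarrow> 'a) set \<Rightarrow> (nat \<Rightarrow> 'a)) \<times> ((nat \<Rightarrow> 'a) \<Rightarrow> (nat \<Rightarrow> 'a) set)" where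
  "chosen_syzygy_seq R X = (SOME (K, i, p). syzygy_seq R X K i p)"

definition syzygy :: "('a,'r) ring_scheme \<Rightarrow> 'a obj \<Rightarrow> 'a obj" where
  "syzygy R X = fst (chosen_syzygy_seq R X)"

text \<open>\<open>g\<close> is induced on syzygies by a lift \<open>h\<close> of \<open>f\<close> to the minimal free covers.\<close>

definition syzygy_lift ::
  "('a,'r) ring_scheme \<Rightarrow> 'a obj \<Rightarrow> 'a obj \<Rightarrow> ((nat \<Rightarrow> 'a) set \<Rightarrow> (nat \<Rightarrow> 'a) set) \<Rightarrow>
     ((nat \<Rightarrow> 'a) set \<Rightarrow> (nat \<Rightarrow> 'a) set) \<Rightarrow> bool" where
  "syzygy_lift R X Y f g \<longleftrightarrow>
     (let (KX, iX, pX) = chosen_syzygy_seq R X;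
          (KY, iY, pY) = chosen_syzygy_seq R Y;
          FX = free_mod R (min_gens R X);
          FY = free_mod R (min_gens R Y) in
       g \<in> mod_hom R KX KY \<and>
       (\<exists>h \<in> mod_hom R FX FY.
          compose (carrier FX) pY h = compose (carrier FX) f pX \<and>
          compose (carrier KX) iY g = compose (carrier KX) h iX))"

definition syzygy_mor ::
  "('a,'r) ring_scheme \<Rightarrow> 'a obj \<Rightarrow> 'a obj \<Rightarrow> ((nat \<Rightarrow> 'a) set \<Rightarrow> (nat \<Rightarrow> 'a) set) set \<Rightarrow>
     ((nat \<Rightarrow> 'a) set \<Rightarrow> (nat \<Rightarrow> 'a) set) set" where
  "syzygy_mor R X Y \<phi> =
     (\<Union>f \<in> \<phi>. \<Union>g \<in> {g. syzygy_lift R X Y f g}. stable_class R (syzygy R X) (syzygy R Y) g)"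

definition min_left_free_approx ::
  "('a,'r) ring_scheme \<Rightarrow> ('a,'x,'s) module_scheme \<Rightarrow> nat \<Rightarrow> ('x \<Rightarrow> (nat \<Rightarrow> 'a)) \<Rightarrow> bool" where
  "min_left_free_approx R X n t \<longleftrightarrow>
     t \<in> mod_hom R X (free_mod R n) \<and>
     (\<forall>m. \<forall>f \<in> mod_hom R X (free_mod R m).
        \<exists>g \<in> mod_hom R (free_mod R n) (free_mod R m). f = compose (carrier X) g t) \<and>
     (\<forall>g \<in> mod_hom R (free_mod R n) (free_mod R n).
        compose (carrier X) g t = t \<longrightarrow> g \<in> mod_iso R (free_mod R n) (free_mod R n))"

text \<open>An exact sequence \<open>X \<rightarrow> R\<^sup>n \<rightarrow> C \<rightarrow> 0\<close> with maps \<open>t\<close>, \<open>q\<close>, where \<open>t\<close> is a minimal left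
  approximation by free modules.\<close>

definition cosyzygy_seq ::
  "('a,'r) ring_scheme \<Rightarrow> 'a obj \<Rightarrow> 'a obj \<Rightarrow> nat \<Rightarrow> ((nat \<Rightarrow> 'a) set \<Rightarrow> (nat \<Rightarrow> 'a)) \<Rightarrow>
     ((nat \<Rightarrow> 'a) \<Rightarrow> (nat \<Rightarrow> 'a) set) \<Rightarrow> bool" where
  "cosyzygy_seq R X C n t q \<longleftrightarrow>
     module R C \<and> min_left_free_approx R X n t \<and>
     q \<in> mod_hom R (free_mod R n) C \<and> q ` carrier (free_mod R n) = carrier C \<and>
     a_kernel (free_mod R n) C q = t ` carrier X"

definition chosen_cosyzygy_seq ::
  "('a,'r) ring_scheme \<Rightarrow> 'a obj \<Rightarrow>
     'a obj \<times> nat \<times> ((nat \<Rightarrow> 'a) set \<Rightarrow> (nat \<Rightarrow> 'a)) \<times> ((nat \<Rightarrow> 'a) \<Rightarrow> (nat \<Rightarrow> 'a) set)" where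
  "chosen_cosyzygy_seq R X = (SOME (C, n, t, q). cosyzygy_seq R X C n t q)"

definition cosyzygy :: "('a,'r) ring_scheme \<Rightarrow> 'a obj \<Rightarrow> 'a obj" where
  "cosyzygy R X = fst (chosen_cosyzygy_seq R X)"

definition cosyzygy_ext ::
  "('a,'r) ring_scheme \<Rightarrow> 'a obj \<Rightarrow> 'a obj \<Rightarrow> ((nat \<Rightarrow> 'a) set \<Rightarrow> (nat \<Rightarrow> 'a) set) \<Rightarrow>
     ((nat \<Rightarrow> 'a) set \<Rightarrow> (nat \<Rightarrow> 'a) set) \<Rightarrow> bool" where
  "cosyzygy_ext R X Y f g \<longleftrightarrow>
     (let (CX, nX, tX, qX) = chosen_cosyzygy_seq R X;
          (CY, nY, tY, qY) = chosen_cosyzygy_seq R Y;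
          FX = free_mod R nX;
          FY = free_mod R nY in
       g \<in> mod_hom R CX CY \<and>
       (\<exists>h \<in> mod_hom R FX FY.
          compose (carrier X) h tX = compose (carrier X) tY f \<and>
          compose (carrier FX) g qX = compose (carrier FX) qY h))"

definition cosyzygy_mor ::
  "('a,'r) ring_scheme \<Rightarrow> 'a obj \<Rightarrow> 'a obj \<Rightarrow> ((nat \<Rightarrow> 'a) set \<Rightarrow> (nat \<Rightarrow> 'a) set) set \<Rightarrow>
     ((nat \<Rightarrow> 'a) set \<Rightarrow> (nat \<Rightarrow> 'a) set) set" where
  "cosyzygy_mor R X Y \<phi> =
     (\<Union>f \<in> \<phi>. \<Union>g \<in> {g. cosyzygy_ext R X Y f g}. stable_class R (cosyzygy R X) (cosyzygy R Y) g)"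

primrec syzygy_pow_mor ::
  "('a,'r) ring_scheme \<Rightarrow> nat \<Rightarrow> 'a obj \<Rightarrow> 'a obj \<Rightarrow> ((nat \<Rightarrow> 'a) set \<Rightarrow> (nat \<Rightarrow> 'a) set) set \<Rightarrow>
     ((nat \<Rightarrow> 'a) set \<Rightarrow> (nat \<Rightarrow> 'a) set) set" where
  "syzygy_pow_mor R 0 X Y \<phi> = \<phi>"
| "syzygy_pow_mor R (Suc n) X Y \<phi> =
     syzygy_mor R ((syzygy R ^^ n) X) ((syzygy R ^^ n) Y) (syzygy_pow_mor R n X Y \<phi>)"

primrec cosyzygy_pow_mor ::
  "('a,'r) ring_scheme \<Rightarrow> nat \<Rightarrow> 'a obj \<Rightarrow> 'a obj \<Rightarrow> ((nat \<Rightarrow> 'a) set \<Rightarrow> (nat \<Rightarrow> 'a) set) set \<Rightarrow>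
     ((nat \<Rightarrow> 'a) set \<Rightarrow> (nat \<Rightarrow> 'a) set) set" where
  "cosyzygy_pow_mor R 0 X Y \<phi> = \<phi>"
| "cosyzygy_pow_mor R (Suc n) X Y \<phi> =
     cosyzygy_mor R ((cosyzygy R ^^ n) X) ((cosyzygy R ^^ n) Y) (cosyzygy_pow_mor R n X Y \<phi>)"

definition Omega :: "('a,'r) ring_scheme \<Rightarrow> int \<Rightarrow> 'a obj \<Rightarrow> 'a obj" where
  "Omega R i X = (if i \<ge> 0 then (syzygy R ^^ nat i) X else (cosyzygy R ^^ nat (- i)) X)"

definition Omega_mor ::
  "('a,'r) ring_scheme \<Rightarrow> int \<Rightarrow> 'a obj \<Rightarrow> 'a obj \<Rightarrow> ((nat \<Rightarrow> 'a) set \<Rightarrow> (nat \<Rightarrow> 'a) set) set \<Rightarrow>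
     ((nat \<Rightarrow> 'a) set \<Rightarrow> (nat \<Rightarrow> 'a) set) set" where
  "Omega_mor R i X Y \<phi> =
     (if i \<ge> 0 then syzygy_pow_mor R (nat i) X Y \<phi> else cosyzygy_pow_mor R (nat (- i)) X Y \<phi>)"


section \<open>Tate cohomology\<close>

definition Tate_Ext ::
  "('a,'r) ring_scheme \<Rightarrow> int \<Rightarrow> ('a,'m,'s) module_scheme \<Rightarrow>
     ('a obj, ((nat \<Rightarrow> 'a) set \<Rightarrow> (nat \<Rightarrow> 'a) set) set, ((nat \<Rightarrow> 'a) set \<Rightarrow> 'm) set) contra_functor" where
  "Tate_Ext R i M = \<lparr>
     fobj = (\<lambda>X. stable_hom R (Omega R i X) M),
     fmap = (\<lambda>X Y \<phi> \<psi>. stable_comp R (Omega R i X) (Omega R i Y) M \<psi> (Omega_mor R i X Y \<phi>))\<rparr>"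

end

theory Submission
  imports Defs
begin

text \<open>On the stable category of G-projective modules, \<open>\<Omega>\<close> and \<open>\<Omega>\<^sup>-\<^sup>1\<close> are autoequivalences, and the Tate
  cohomology functor of degree \<open>i\<close> is the pullback of \<open>H = stable Hom(-, M)\<close> along \<open>\<Omega>\<^sup>i\<close>; so
  everything is decided for \<open>H\<close>. A generator of \<open>H\<close> and a free cover of \<open>M\<close> together form a right approximation.
  Conversely, let \<open>\<phi> : X \<rightarrow> M\<close> be a right approximation. If \<open>\<phi> g\<close> is stably zero, a pushout provides an
  endomorphism \<open>e\<close> of \<open>X\<close> with \<open>\<phi> e = \<phi>\<close> and \<open>e g\<close> stably zero. The endomorphisms \<open>k\<close> of \<open>X\<close> with
  \<open>\<phi> k\<close> stably zero form a finitely generated \<open>R\<close>-module, so a single \<open>e\<close> with \<open>\<phi> e = \<phi>\<close> annihilates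
  all of them. It then annihilates every \<open>g\<close> with \<open>\<phi> g\<close> stably zero: if \<open>\<phi> e' = \<phi>\<close> and \<open>e' g\<close> is stably
  zero, then \<open>1 - e'\<close> is such a \<open>k\<close>, so \<open>e g\<close> is stably equal to \<open>e e' g\<close>. This
  exhibits \<open>H\<close> as a direct summand of the functor represented by \<open>X\<close>, hence as finitely presented
  and projective.\<close>

subsection \<open>Homomorphisms of modules\<close>

text \<open>Two obstacles shape the proof. First, the maps \<open>g\<close> with
  \<open>\<phi> g\<close> stably zero range over all sources \<open>Z\<close>, so no finite process
  kills them directly; the passage from \<open>g\<close> to \<open>1 - e'\<close> moves the problem
  into the one module of endomorphisms of \<open>X\<close>, where Noetherianity applies. Once
  \<open>e\<close> is found, sending \<open>\<phi> g\<close> to \<open>e g\<close> is well defined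
  and is a section of the surjection onto \<open>H\<close>, and \<open>1 - e\<close> supplies the
  relations. Second, lifting along an epimorphism of finitely presented functors needs its
  surjectivity at every object, whereas epimorphisms are only tested against finitely presented
  functors; so the cokernel must be finitely presented too, which uses direct sums. On the side of
  modules, resolutions, syzygies and cosyzygies are arbitrary choices. Vanishing of Ext is therefore
  recast as a coinductive condition insensitive to the choice, and the shifts as relations between
  the maps at the two ends of a morphism of exact sequences: one end factors through a free module
  exactly when the other does, and this single equivalence gives both well-definedness and
  faithfulness.\<close>

lemma mod_hom_closed: "f \<in> mod_hom R X Y \<Longrightarrow> x \<in> carrier X \<Longrightarrow> f x \<in> carrier Y"
  unfolding mod_hom_def by auto

lemma mod_hom_add:
  "f \<in> mod_hom R X Y \<Longrightarrow> x \<in> carrier X \<Longrightarrow> y \<in> carrier X \<Longrightarrow> f (x \<oplus>\<^bsub>X\<^esub> y) = f x \<oplus>\<^bsub>Y\<^esub> f y"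
  unfolding mod_hom_def by auto

lemma mod_hom_smult:
  "f \<in> mod_hom R X Y \<Longrightarrow> a \<in> carrier R \<Longrightarrow> x \<in> carrier X \<Longrightarrow> f (a \<odot>\<^bsub>X\<^esub> x) = a \<odot>\<^bsub>Y\<^esub> f x"
  unfolding mod_hom_def by auto

lemma mod_hom_eqI:
  "f \<in> mod_hom R X Y \<Longrightarrow> g \<in> mod_hom R X Z \<Longrightarrow> (\<And>x. x \<in> carrier X \<Longrightarrow> f x = g x) \<Longrightarrow> f = g"
  unfolding mod_hom_def by (auto intro!: extensionalityI[where A = "carrier X"] simp: PiE_def)

lemma mod_hom_zero:
  assumes "module R X" "module R Y" "f \<in> mod_hom R X Y"
  shows "f \<zero>\<^bsub>X\<^esub> = \<zero>\<^bsub>Y\<^esub>"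
proof -
  interpret X: module R X by fact
  interpret Y: module R Y by fact
  have "f (\<zero>\<^bsub>R\<^esub> \<odot>\<^bsub>X\<^esub> \<zero>\<^bsub>X\<^esub>) = \<zero>\<^bsub>R\<^esub> \<odot>\<^bsub>Y\<^esub> f \<zero>\<^bsub>X\<^esub>"
    by (rule mod_hom_smult[OF assms(3)]) auto
  then show ?thesis using mod_hom_closed[OF assms(3) X.zero_closed] by simp
qed

lemma mod_hom_neg:
  assumes "module R X" "module R Y" "f \<in> mod_hom R X Y" "x \<in> carrier X"
  shows "f (\<ominus>\<^bsub>X\<^esub> x) = \<ominus>\<^bsub>Y\<^esub> f x"
proof -
  interpret X: module R X by fact
  interpret Y: module R Y by fact
  have "f (\<ominus>\<^bsub>X\<^esub> x) \<oplus>\<^bsub>Y\<^esub> f x = \<zero>\<^bsub>Y\<^esub>"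
    using mod_hom_add[OF assms(3) X.a_inv_closed[OF assms(4)] assms(4)] assms
    by (simp add: X.l_neg mod_hom_zero)
  then show ?thesis
    using mod_hom_closed[OF assms(3)] assms(4) Y.minus_equality by auto
qed

lemma mod_hom_minus:
  assumes "module R X" "module R Y" "f \<in> mod_hom R X Y" "x \<in> carrier X" "y \<in> carrier X"
  shows "f (x \<ominus>\<^bsub>X\<^esub> y) = f x \<ominus>\<^bsub>Y\<^esub> f y"
proof -
  interpret X: module R X by fact
  show ?thesis using assms unfolding a_minus_def by (simp add: mod_hom_add mod_hom_neg)
qed

lemma mod_homI:
  assumes "module R X"
    and "\<And>x. x \<in> carrier X \<Longrightarrow> f x \<in> carrier Y"
    and "\<And>x y. x \<in> carrier X \<Longrightarrow> y \<in> carrier X \<Longrightarrow> f (x \<oplus>\<^bsub>X\<^esub> y) = f x \<oplus>\<^bsub>Y\<^esub> f y"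
    and "\<And>a x. a \<in> carrier R \<Longrightarrow> x \<in> carrier X \<Longrightarrow> f (a \<odot>\<^bsub>X\<^esub> x) = a \<odot>\<^bsub>Y\<^esub> f x"
  shows "(\<lambda>x\<in>carrier X. f x) \<in> mod_hom R X Y"
proof -
  interpret X: module R X by fact
  show ?thesis using assms(2-4) unfolding mod_hom_def by auto
qed

lemma mod_hom_compose:
  assumes "module R X" "f \<in> mod_hom R X Y" "g \<in> mod_hom R Y Z"
  shows "compose (carrier X) g f \<in> mod_hom R X Z"
  unfolding compose_def
  by (rule mod_homI) (use assms in \<open>auto simp: mod_hom_closed mod_hom_add mod_hom_smult\<close>)

lemma mod_hom_id: "module R X \<Longrightarrow> (\<lambda>x\<in>carrier X. x) \<in> mod_hom R X X"
  by (rule mod_homI) auto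

text \<open>Both composites are restricted functions with the same default value off
  \<open>A\<close>, so only the values on \<open>A\<close> matter.\<close>

lemma compose_eq_iff:
  "compose A g f = compose A g' f' \<longleftrightarrow> (\<forall>x\<in>A. g (f x) = g' (f' x))"
  by (auto simp: compose_def restrict_def fun_eq_iff)

lemma (in module) sub_add_cancel: "x \<in> carrier M \<Longrightarrow> y \<in> carrier M \<Longrightarrow> (x \<ominus>\<^bsub>M\<^esub> y) \<oplus>\<^bsub>M\<^esub> y = x"
  by (simp add: a_minus_def M.a_assoc M.l_neg)

lemma (in module) sub_eq_iff [simp]: "x \<in> carrier M \<Longrightarrow> y \<in> carrier M \<Longrightarrow> x \<ominus>\<^bsub>M\<^esub> y = \<zero>\<^bsub>M\<^esub> \<longleftrightarrow> x = y"
  by (metis M.l_zero M.r_neg a_minus_def sub_add_cancel)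

lemma (in module) sub_self [simp]: "x \<in> carrier M \<Longrightarrow> x \<ominus>\<^bsub>M\<^esub> x = \<zero>\<^bsub>M\<^esub>"
  by simp

lemma (in module) add_sub_cancel: "x \<in> carrier M \<Longrightarrow> y \<in> carrier M \<Longrightarrow> (x \<oplus>\<^bsub>M\<^esub> y) \<ominus>\<^bsub>M\<^esub> y = x"
  by (simp add: a_minus_def M.a_assoc M.r_neg)

lemma (in module) add_diff_add:
  "a \<in> carrier M \<Longrightarrow> b \<in> carrier M \<Longrightarrow> c \<in> carrier M \<Longrightarrow> d \<in> carrier M \<Longrightarrow>
    (a \<oplus>\<^bsub>M\<^esub> b) \<ominus>\<^bsub>M\<^esub> (c \<oplus>\<^bsub>M\<^esub> d) = (a \<ominus>\<^bsub>M\<^esub> c) \<oplus>\<^bsub>M\<^esub> (b \<ominus>\<^bsub>M\<^esub> d)"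
  by (simp add: a_minus_def M.minus_add M.a_ac)

lemma (in module) smult_sub:
  "a \<in> carrier R \<Longrightarrow> x \<in> carrier M \<Longrightarrow> y \<in> carrier M \<Longrightarrow>
    a \<odot>\<^bsub>M\<^esub> (x \<ominus>\<^bsub>M\<^esub> y) = (a \<odot>\<^bsub>M\<^esub> x) \<ominus>\<^bsub>M\<^esub> (a \<odot>\<^bsub>M\<^esub> y)"
  by (simp add: a_minus_def smult_r_distr smult_r_minus)

lemma abelian_groupI2:
  fixes G (structure)
  assumes "\<And>x y. x \<in> carrier G \<Longrightarrow> y \<in> carrier G \<Longrightarrow> x \<oplus> y \<in> carrier G"
    and "\<zero> \<in> carrier G"
    and "\<And>x y z. x \<in> carrier G \<Longrightarrow> y \<in> carrier G \<Longrightarrow> z \<in> carrier G \<Longrightarrow> (x \<oplus> y) \<oplus> z = x \<oplus> (y \<oplus> z)"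
    and "\<And>x y. x \<in> carrier G \<Longrightarrow> y \<in> carrier G \<Longrightarrow> x \<oplus> y = y \<oplus> x"
    and "\<And>x. x \<in> carrier G \<Longrightarrow> \<zero> \<oplus> x = x"
    and "\<And>x. x \<in> carrier G \<Longrightarrow> \<exists>y\<in>carrier G. y \<oplus> x = \<zero>"
  shows "abelian_group G"
  by (rule abelian_groupI) (use assms in auto)

subsection \<open>Constructions\<close>

text \<open>Every quotient of \<open>B\<close> can be carried by a set of prescribed type, along any function whose
  fibres are the classes modulo \<open>N\<close>.\<close>

lemma module_on_image:
  fixes B :: "('a,'b,'s) module_scheme" and q :: "'b \<Rightarrow> 'z"
  assumes B: "module R B" and N: "submodule N R B"
    and q: "\<And>x y. x \<in> carrier B \<Longrightarrow> y \<in> carrier B \<Longrightarrow> q x = q y \<longleftrightarrow> x \<ominus>\<^bsub>B\<^esub> y \<in> N"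
  obtains Q :: "('a,'z) module" and f where "module R Q" "f \<in> mod_hom R B Q"
    "f ` carrier B = carrier Q" "\<And>x. x \<in> carrier B \<Longrightarrow> f x = \<zero>\<^bsub>Q\<^esub> \<longleftrightarrow> x \<in> N"
proof -
  interpret B: module R B by fact
  note NE = B.submoduleE[OF N]
  \<comment> \<open>A representative is chosen in each fibre so that the operations of
    \<open>Q\<close> can be written down on the image. By \<open>sN\<close> the choice is off by an
    element of \<open>N\<close>, and this makes the operations independent of it.\<close>
  define s where "s z = (SOME x. x \<in> carrier B \<and> q x = z)" for z
  have s: "s (q x) \<in> carrier B" "q (s (q x)) = q x" if "x \<in> carrier B" for x
    using someI[of "\<lambda>y. y \<in> carrier B \<and> q y = q x" x] that unfolding s_def by auto
  have sN: "s (q x) \<ominus>\<^bsub>B\<^esub> x \<in> N" if "x \<in> carrier B" for x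
    using q[OF s(1) that] s[OF that] that by simp
  define Q :: "('a,'z) module" where "Q = \<lparr>carrier = q ` carrier B, mult = undefined, one = undefined,
    zero = q \<zero>\<^bsub>B\<^esub>, add = (\<lambda>z w. q (s z \<oplus>\<^bsub>B\<^esub> s w)), smult = (\<lambda>a z. q (a \<odot>\<^bsub>B\<^esub> s z))\<rparr>"
  have add: "q x \<oplus>\<^bsub>Q\<^esub> q y = q (x \<oplus>\<^bsub>B\<^esub> y)" if "x \<in> carrier B" "y \<in> carrier B" for x y
  proof -
    have "(s (q x) \<oplus>\<^bsub>B\<^esub> s (q y)) \<ominus>\<^bsub>B\<^esub> (x \<oplus>\<^bsub>B\<^esub> y) \<in> N"
      using B.add_diff_add[of "s (q x)" "s (q y)" x y] NE(5)[OF sN sN] s that by simp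
    then show ?thesis using q s that by (simp add: Q_def)
  qed
  have smult: "a \<odot>\<^bsub>Q\<^esub> q x = q (a \<odot>\<^bsub>B\<^esub> x)" if "x \<in> carrier B" "a \<in> carrier R" for x a
  proof -
    have "(a \<odot>\<^bsub>B\<^esub> s (q x)) \<ominus>\<^bsub>B\<^esub> (a \<odot>\<^bsub>B\<^esub> x) \<in> N"
      using B.smult_sub[of a "s (q x)" x] NE(4)[OF that(2) sN[OF that(1)]] s that by metis
    then show ?thesis using q s that by (simp add: Q_def)
  qed
  have cQ: "carrier Q = q ` carrier B" and zQ: "\<zero>\<^bsub>Q\<^esub> = q \<zero>\<^bsub>B\<^esub>" by (auto simp: Q_def)
  have Q: "module R Q"
  proof (rule moduleI)
    show "abelian_group Q"
    proof (rule abelian_groupI2)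
      fix x assume "x \<in> carrier Q"
      then obtain x' where x': "x = q x'" "x' \<in> carrier B" unfolding cQ by blast
      have "q (\<ominus>\<^bsub>B\<^esub> x') \<oplus>\<^bsub>Q\<^esub> x = \<zero>\<^bsub>Q\<^esub>" using x' by (simp add: add zQ B.l_neg)
      moreover have "q (\<ominus>\<^bsub>B\<^esub> x') \<in> carrier Q" using x' by (simp add: cQ)
      ultimately show "\<exists>y\<in>carrier Q. y \<oplus>\<^bsub>Q\<^esub> x = \<zero>\<^bsub>Q\<^esub>" by blast
    qed (auto simp: cQ zQ add B.a_ac)
  qed (auto simp: cQ add smult B.cring_axioms B.smult_l_distr B.smult_r_distr B.smult_assoc1)
  have qz: "q x = \<zero>\<^bsub>Q\<^esub> \<longleftrightarrow> x \<in> N" if "x \<in> carrier B" for x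
    using q[OF that B.zero_closed] that B.add.inv_one by (simp add: zQ a_minus_def a_inv_def)
  show ?thesis
    by (rule that[OF Q, of "\<lambda>x\<in>carrier B. q x"])
      (use add smult qz in \<open>auto simp: cQ intro!: mod_homI[OF B]\<close>)
qed

lemma ring_as_module_module: "cring R \<Longrightarrow> module R (ring_as_module R)"
proof -
  assume "cring R"
  then interpret cring R .
  have "abelian_group (ring_as_module R)"
    by (rule abelian_groupI2) (auto simp: ring_as_module_def a_ac intro: l_neg)
  then show ?thesis
    by (intro moduleI) (auto simp: ring_as_module_def is_cring l_distr r_distr m_assoc)
qed

lemma free_mod_module: "cring R \<Longrightarrow> module R (free_mod R n)"
proof -
  assume "cring R"
  then interpret cring R .
  have c: "x i \<in> carrier R" if "x \<in> carrier (free_mod R n)" "i < n" for x i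
    using that by (auto simp: free_mod_def)
  have "abelian_group (free_mod R n)"
  proof (rule abelian_groupI2)
    fix x assume x: "x \<in> carrier (free_mod R n)"
    show "\<exists>y\<in>carrier (free_mod R n). y \<oplus>\<^bsub>free_mod R n\<^esub> x = \<zero>\<^bsub>free_mod R n\<^esub>"
      by (rule bexI[of _ "\<lambda>i\<in>{..<n}. \<ominus>\<^bsub>R\<^esub> x i"])
        (use x in \<open>auto simp: free_mod_def l_neg PiE_iff intro!: restrict_ext\<close>)
    show "\<zero>\<^bsub>free_mod R n\<^esub> \<oplus>\<^bsub>free_mod R n\<^esub> x = x"
      using x c[OF x] by (auto simp: free_mod_def PiE_iff restrict_def fun_eq_iff extensional_def)
  next
    fix x y assume x: "x \<in> carrier (free_mod R n)" and y: "y \<in> carrier (free_mod R n)"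
    show "x \<oplus>\<^bsub>free_mod R n\<^esub> y = y \<oplus>\<^bsub>free_mod R n\<^esub> x"
      using c[OF x] c[OF y] by (auto simp: free_mod_def a_comm intro!: restrict_ext)
    fix z assume z: "z \<in> carrier (free_mod R n)"
    show "x \<oplus>\<^bsub>free_mod R n\<^esub> y \<oplus>\<^bsub>free_mod R n\<^esub> z = x \<oplus>\<^bsub>free_mod R n\<^esub> (y \<oplus>\<^bsub>free_mod R n\<^esub> z)"
      using c[OF x] c[OF y] c[OF z] by (auto simp: free_mod_def a_assoc intro!: restrict_ext)
  qed (auto simp: free_mod_def)
  then show ?thesis
    by (intro moduleI)
      (auto simp: free_mod_def is_cring PiE_iff restrict_def fun_eq_iff extensional_def l_distr r_distr m_assoc)
qed

lemma Hom_mod_simps [simp]: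
  "carrier (Hom_mod R X Y) = mod_hom R X Y"
  "\<zero>\<^bsub>Hom_mod R X Y\<^esub> = (\<lambda>x \<in> carrier X. \<zero>\<^bsub>Y\<^esub>)"
  "f \<oplus>\<^bsub>Hom_mod R X Y\<^esub> g = (\<lambda>x \<in> carrier X. f x \<oplus>\<^bsub>Y\<^esub> g x)"
  "a \<odot>\<^bsub>Hom_mod R X Y\<^esub> f = (\<lambda>x \<in> carrier X. a \<odot>\<^bsub>Y\<^esub> f x)"
  by (auto simp: Hom_mod_def)

lemma mod_hom_zero_map: "module R X \<Longrightarrow> module R Y \<Longrightarrow> (\<lambda>x\<in>carrier X. \<zero>\<^bsub>Y\<^esub>) \<in> mod_hom R X Y"
proof (rule mod_homI)
  assume "module R Y" then interpret Y: module R Y .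
  show "\<zero>\<^bsub>Y\<^esub> \<in> carrier Y" by simp
  show "\<zero>\<^bsub>Y\<^esub> = \<zero>\<^bsub>Y\<^esub> \<oplus>\<^bsub>Y\<^esub> \<zero>\<^bsub>Y\<^esub>" by simp
  show "\<And>a. a \<in> carrier R \<Longrightarrow> \<zero>\<^bsub>Y\<^esub> = a \<odot>\<^bsub>Y\<^esub> \<zero>\<^bsub>Y\<^esub>" by simp
qed

lemma mod_hom_add_map:
  assumes "module R X" "module R Y" "f \<in> mod_hom R X Y" "g \<in> mod_hom R X Y"
  shows "(\<lambda>x\<in>carrier X. f x \<oplus>\<^bsub>Y\<^esub> g x) \<in> mod_hom R X Y"
proof -
  interpret Y: module R Y by fact
  show ?thesis
    by (rule mod_homI)
      (use assms in \<open>auto simp: mod_hom_closed mod_hom_add mod_hom_smult Y.a_ac Y.smult_r_distr\<close>)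
qed

lemma mod_hom_smult_map:
  assumes "module R X" "module R Y" "f \<in> mod_hom R X Y" "a \<in> carrier R"
  shows "(\<lambda>x\<in>carrier X. a \<odot>\<^bsub>Y\<^esub> f x) \<in> mod_hom R X Y"
proof -
  interpret Y: module R Y by fact
  show ?thesis
    by (rule mod_homI)
      (use assms in \<open>auto simp: mod_hom_closed mod_hom_add mod_hom_smult Y.smult_r_distr
        Y.smult_assoc1[symmetric] Y.m_comm\<close>)
qed

lemma mod_hom_neg_map:
  assumes "module R X" "module R Y" "f \<in> mod_hom R X Y"
  shows "(\<lambda>x\<in>carrier X. \<ominus>\<^bsub>Y\<^esub> f x) \<in> mod_hom R X Y"
proof -
  interpret Y: module R Y by fact
  show ?thesis
    by (rule mod_homI)
      (use assms in \<open>auto simp: mod_hom_closed mod_hom_add mod_hom_smult Y.minus_add Y.smult_r_minus\<close>)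
qed

lemma mod_hom_minus_map:
  assumes "module R X" "module R Y" "f \<in> mod_hom R X Y" "g \<in> mod_hom R X Y"
  shows "(\<lambda>x\<in>carrier X. f x \<ominus>\<^bsub>Y\<^esub> g x) \<in> mod_hom R X Y"
proof -
  have "(\<lambda>x\<in>carrier X. f x \<ominus>\<^bsub>Y\<^esub> g x) = (\<lambda>x\<in>carrier X. f x \<oplus>\<^bsub>Y\<^esub> (\<lambda>x\<in>carrier X. \<ominus>\<^bsub>Y\<^esub> g x) x)"
    by (auto simp: a_minus_def)
  then show ?thesis using mod_hom_add_map[OF assms(1-3) mod_hom_neg_map[OF assms(1,2,4)]] by simp
qed

lemma Hom_mod_module:
  assumes X: "module R X" and Y: "module R Y"
  shows "module R (Hom_mod R X Y)"
proof -
  interpret X: module R X by fact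
  interpret Y: module R Y by fact
  note eqI = mod_hom_eqI[where R = R and X = X and Y = Y and Z = Y]
  have "abelian_group (Hom_mod R X Y)"
  proof (rule abelian_groupI2)
    fix f assume "f \<in> carrier (Hom_mod R X Y)"
    then have f: "f \<in> mod_hom R X Y" by simp
    show "\<exists>g\<in>carrier (Hom_mod R X Y). g \<oplus>\<^bsub>Hom_mod R X Y\<^esub> f = \<zero>\<^bsub>Hom_mod R X Y\<^esub>"
      using mod_hom_neg_map[OF X Y f] mod_hom_closed[OF f]
      by (intro bexI[of _ "\<lambda>x\<in>carrier X. \<ominus>\<^bsub>Y\<^esub> f x"]) (auto intro!: restrict_ext Y.l_neg)
  next
    fix f assume "f \<in> carrier (Hom_mod R X Y)"
    then have f: "f \<in> mod_hom R X Y" by simp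
    show "\<zero>\<^bsub>Hom_mod R X Y\<^esub> \<oplus>\<^bsub>Hom_mod R X Y\<^esub> f = f"
      unfolding Hom_mod_simps
      by (rule eqI) (use f mod_hom_add_map[OF X Y mod_hom_zero_map[OF X Y] f] in \<open>auto simp: mod_hom_closed\<close>)
  qed (auto simp: mod_hom_zero_map mod_hom_add_map X Y mod_hom_closed Y.a_ac intro!: restrict_ext)
  then show ?thesis
  proof (intro moduleI)
    fix f assume "f \<in> carrier (Hom_mod R X Y)"
    then have f: "f \<in> mod_hom R X Y" by simp
    show "\<one>\<^bsub>R\<^esub> \<odot>\<^bsub>Hom_mod R X Y\<^esub> f = f"
      unfolding Hom_mod_simps
      by (rule eqI) (use f mod_hom_smult_map[OF X Y f] in \<open>auto simp: mod_hom_closed\<close>)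
  qed (auto simp: X.cring_axioms mod_hom_smult_map X Y mod_hom_closed Y.smult_l_distr Y.smult_r_distr
      Y.smult_assoc1 intro!: restrict_ext)
qed

lemma Hom_mod_neg:
  assumes X: "module R X" and Y: "module R Y" and f: "f \<in> mod_hom R X Y"
  shows "\<ominus>\<^bsub>Hom_mod R X Y\<^esub> f = (\<lambda>x\<in>carrier X. \<ominus>\<^bsub>Y\<^esub> f x)"
proof -
  interpret H: module R "Hom_mod R X Y" by (rule Hom_mod_module[OF X Y])
  interpret Y: module R Y by fact
  show ?thesis
    by (rule H.minus_equality)
      (use f mod_hom_neg_map[OF X Y f] in \<open>auto simp: mod_hom_closed Y.l_neg intro!: restrict_ext\<close>)
qed

lemma Hom_mod_minus:
  assumes X: "module R X" and Y: "module R Y" and f: "f \<in> mod_hom R X Y" "g \<in> mod_hom R X Y"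
  shows "f \<ominus>\<^bsub>Hom_mod R X Y\<^esub> g = (\<lambda>x\<in>carrier X. f x \<ominus>\<^bsub>Y\<^esub> g x)"
  by (auto simp: a_minus_def Hom_mod_neg[OF X Y f(2)] intro!: restrict_ext)

text \<open>Pairs lie outside the type of objects; \<open>obj_copy\<close> brings the product back
  into it where an object is needed.\<close>

definition prod_mod :: "('a,'x,'s) module_scheme \<Rightarrow> ('a,'y,'t) module_scheme \<Rightarrow> ('a,'x \<times> 'y) module" where
  "prod_mod X Y = \<lparr>carrier = carrier X \<times> carrier Y, mult = undefined, one = undefined,
     zero = (\<zero>\<^bsub>X\<^esub>, \<zero>\<^bsub>Y\<^esub>),
     add = (\<lambda>(x, y) (x', y'). (x \<oplus>\<^bsub>X\<^esub> x', y \<oplus>\<^bsub>Y\<^esub> y')),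
     smult = (\<lambda>a (x, y). (a \<odot>\<^bsub>X\<^esub> x, a \<odot>\<^bsub>Y\<^esub> y))\<rparr>"

lemma prod_mod_simps [simp]:
  "carrier (prod_mod X Y) = carrier X \<times> carrier Y"
  "\<zero>\<^bsub>prod_mod X Y\<^esub> = (\<zero>\<^bsub>X\<^esub>, \<zero>\<^bsub>Y\<^esub>)"
  "(x, y) \<oplus>\<^bsub>prod_mod X Y\<^esub> (x', y') = (x \<oplus>\<^bsub>X\<^esub> x', y \<oplus>\<^bsub>Y\<^esub> y')"
  "a \<odot>\<^bsub>prod_mod X Y\<^esub> (x, y) = (a \<odot>\<^bsub>X\<^esub> x, a \<odot>\<^bsub>Y\<^esub> y)"
  by (auto simp: prod_mod_def)

lemma prod_mod_module:
  assumes X: "module R X" and Y: "module R Y"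
  shows "module R (prod_mod X Y)"
proof -
  interpret X: module R X by fact
  interpret Y: module R Y by fact
  have "abelian_group (prod_mod X Y)"
  proof (rule abelian_groupI2)
    fix z assume "z \<in> carrier (prod_mod X Y)"
    then obtain x y where "z = (x, y)" "x \<in> carrier X" "y \<in> carrier Y" by auto
    then show "\<exists>w\<in>carrier (prod_mod X Y). w \<oplus>\<^bsub>prod_mod X Y\<^esub> z = \<zero>\<^bsub>prod_mod X Y\<^esub>"
      by (intro bexI[of _ "(\<ominus>\<^bsub>X\<^esub> x, \<ominus>\<^bsub>Y\<^esub> y)"]) (auto simp: X.l_neg Y.l_neg)
  qed (auto simp: X.a_ac Y.a_ac)
  then show ?thesis
    by (intro moduleI)
      (auto simp: X.cring_axioms X.smult_l_distr Y.smult_l_distr X.smult_r_distr Y.smult_r_distr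
        X.smult_assoc1 Y.smult_assoc1)
qed

lemma mod_hom_kernel_submodule:
  assumes X: "module R X" and Y: "module R Y" and f: "f \<in> mod_hom R X Y"
  shows "submodule {x \<in> carrier X. f x = \<zero>\<^bsub>Y\<^esub>} R X"
proof -
  interpret X: module R X by fact
  interpret Y: module R Y by fact
  show ?thesis
    by (rule X.submoduleI) (auto simp: mod_hom_zero[OF X Y f] mod_hom_neg[OF X Y f] mod_hom_add[OF f] mod_hom_smult[OF f])
qed

lemma submodule_zero: "module R X \<Longrightarrow> submodule N R X \<Longrightarrow> \<zero>\<^bsub>X\<^esub> \<in> N"
  by (metis subgroup.one_closed submodule_def monoid.select_convs(2))

lemma mod_hom_image_submodule:
  assumes X: "module R X" and Y: "module R Y" and f: "f \<in> mod_hom R X Y" and N: "submodule N R X"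
  shows "submodule (f ` N) R Y"
proof -
  interpret X: module R X by fact
  interpret Y: module R Y by fact
  note NE = X.submoduleE[OF N]
  have sub: "\<And>x. x \<in> N \<Longrightarrow> x \<in> carrier X" using NE(1) by blast
  have z: "\<zero>\<^bsub>X\<^esub> \<in> N" by (rule submodule_zero[OF X N])
  show ?thesis
  proof (rule Y.submoduleI)
    show "\<zero>\<^bsub>Y\<^esub> \<in> f ` N" using mod_hom_zero[OF X Y f] z by (metis imageI)
    show "\<ominus>\<^bsub>Y\<^esub> b \<in> f ` N" if "b \<in> f ` N" for b
      using that NE(3) mod_hom_neg[OF X Y f, symmetric] sub by auto
    show "b \<oplus>\<^bsub>Y\<^esub> c \<in> f ` N" if "b \<in> f ` N" "c \<in> f ` N" for b c
      using that NE(5) mod_hom_add[OF f, symmetric] sub by auto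
    show "a \<odot>\<^bsub>Y\<^esub> b \<in> f ` N" if "a \<in> carrier R" "b \<in> f ` N" for a b
      using that NE(4) mod_hom_smult[OF f, symmetric] sub by auto
  qed (use sub mod_hom_closed[OF f] in blast)
qed

lemma submodule_Int:
  assumes "module R X" "submodule N R X" "submodule L R X" shows "submodule (N \<inter> L) R X"
proof -
  interpret X: module R X by fact
  show ?thesis
    by (rule X.submoduleI)
      (use assms X.submoduleE[OF assms(2)] X.submoduleE[OF assms(3)] in \<open>auto simp: submodule_zero\<close>)
qed

lemma submodule_zero_set: "module R X \<Longrightarrow> submodule {\<zero>\<^bsub>X\<^esub>} R X"
proof -
  assume "module R X" then interpret X: module R X .
  show ?thesis by (rule X.submoduleI) auto
qed

text \<open>The quotient construction for \<open>N = 0\<close>: the fibres of an injection are the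
  classes modulo zero.\<close>

lemma module_copy:
  fixes B :: "('a,'b,'s) module_scheme" and q :: "'b \<Rightarrow> 'z"
  assumes B: "module R B" and q: "inj_on q (carrier B)"
  obtains Q :: "('a,'z) module" and f where "module R Q" "f \<in> mod_hom R B Q"
    "inj_on f (carrier B)" "f ` carrier B = carrier Q"
proof -
  interpret B: module R B by fact
  have *: "q x = q y \<longleftrightarrow> x \<ominus>\<^bsub>B\<^esub> y \<in> {\<zero>\<^bsub>B\<^esub>}" if "x \<in> carrier B" "y \<in> carrier B" for x y
    using q that B.sub_eq_iff by (auto simp: inj_on_eq_iff)
  obtain Q :: "('a,'z) module" and f where Q: "module R Q" "f \<in> mod_hom R B Q"
    "f ` carrier B = carrier Q" "\<And>x. x \<in> carrier B \<Longrightarrow> f x = \<zero>\<^bsub>Q\<^esub> \<longleftrightarrow> x \<in> {\<zero>\<^bsub>B\<^esub>}"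
    using module_on_image[OF B submodule_zero_set[OF B], of q] * by blast
  interpret Q: module R Q by fact
  have "inj_on f (carrier B)"
  proof (rule inj_onI)
    fix x y assume xy: "x \<in> carrier B" "y \<in> carrier B" "f x = f y"
    then have "f (x \<ominus>\<^bsub>B\<^esub> y) = \<zero>\<^bsub>Q\<^esub>"
      using mod_hom_minus[OF B Q(1,2)] mod_hom_closed[OF Q(2)] by simp
    then show "x = y" using Q(4)[of "x \<ominus>\<^bsub>B\<^esub> y"] xy by simp
  qed
  then show ?thesis using that Q by blast
qed

lemma mod_iso_inverse:
  assumes X: "module R X" and Y: "module R Y" and f: "f \<in> mod_hom R X Y"
    and inj: "inj_on f (carrier X)" and surj: "f ` carrier X = carrier Y"
  obtains g where "g \<in> mod_hom R Y X" "\<And>x. x \<in> carrier X \<Longrightarrow> g (f x) = x"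
    "\<And>y. y \<in> carrier Y \<Longrightarrow> f (g y) = y"
proof -
  interpret X: module R X by fact
  let ?g = "inv_into (carrier X) f"
  have gf: "?g (f x) = x" if "x \<in> carrier X" for x using inj that by simp
  have "(\<lambda>y\<in>carrier Y. ?g y) \<in> mod_hom R Y X"
  proof (rule mod_homI[OF Y])
    fix x y a assume "x \<in> carrier Y" "y \<in> carrier Y"
    then obtain x' y' where *: "x = f x'" "y = f y'" "x' \<in> carrier X" "y' \<in> carrier X"
      using surj by blast
    show "?g x \<in> carrier X" "?g (x \<oplus>\<^bsub>Y\<^esub> y) = ?g x \<oplus>\<^bsub>X\<^esub> ?g y"
      using * gf mod_hom_add[OF f, symmetric] by auto
    show "a \<in> carrier R \<Longrightarrow> ?g (a \<odot>\<^bsub>Y\<^esub> x) = a \<odot>\<^bsub>X\<^esub> ?g x"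
      using * gf mod_hom_smult[OF f, symmetric] by auto
  qed
  moreover have "f (?g y) = y" if "y \<in> carrier Y" for y using that surj by (simp add: f_inv_into_f)
  ultimately show ?thesis
    using that[of "\<lambda>y\<in>carrier Y. ?g y"] gf mod_hom_closed[OF f] by auto
qed

subsection \<open>Factorisations\<close>

text \<open>The homomorphism theorem. The kernel condition makes \<open>g\<close> constant on the
  fibres of \<open>p\<close>, so any set-theoretic section of \<open>p\<close> defines the induced
  map.\<close>

lemma mod_hom_descend:
  assumes B: "module R B" and C: "module R C" and D: "module R D" and p: "p \<in> mod_hom R B C" "p ` carrier B = carrier C"
    and g: "g \<in> mod_hom R B D" and ker: "\<And>b. b \<in> carrier B \<Longrightarrow> p b = \<zero>\<^bsub>C\<^esub> \<Longrightarrow> g b = \<zero>\<^bsub>D\<^esub>"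
  obtains h where "h \<in> mod_hom R C D" "\<And>b. b \<in> carrier B \<Longrightarrow> h (p b) = g b"
proof -
  interpret B: module R B by fact
  interpret C: module R C by fact
  interpret D: module R D by fact
  define s where "s = inv_into (carrier B) p"
  have s: "s c \<in> carrier B" "p (s c) = c" if "c \<in> carrier C" for c
    using that p(2) inv_into_into[of c p "carrier B"] by (auto simp: s_def f_inv_into_f)
  have key: "g b = g b'" if "b \<in> carrier B" "b' \<in> carrier B" "p b = p b'" for b b'
  proof -
    have "p (b \<ominus>\<^bsub>B\<^esub> b') = \<zero>\<^bsub>C\<^esub>" using that mod_hom_minus[OF B C p(1)] mod_hom_closed[OF p(1)] C.sub_self by metis
    then have "g b \<ominus>\<^bsub>D\<^esub> g b' = \<zero>\<^bsub>D\<^esub>" using ker[of "b \<ominus>\<^bsub>B\<^esub> b'"] that mod_hom_minus[OF B D g] by simp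
    then show ?thesis using that mod_hom_closed[OF g] by simp
  qed
  show ?thesis
  proof (rule that[of "\<lambda>c\<in>carrier C. g (s c)"])
    show "(\<lambda>c\<in>carrier C. g (s c)) \<in> mod_hom R C D"
    proof (rule mod_homI[OF C])
      fix x y a assume *: "x \<in> carrier C" "y \<in> carrier C"
      show "g (s x) \<in> carrier D" using s * mod_hom_closed[OF g] by blast
      show "g (s (x \<oplus>\<^bsub>C\<^esub> y)) = g (s x) \<oplus>\<^bsub>D\<^esub> g (s y)"
        using s * by (subst mod_hom_add[OF g, symmetric]) (auto intro!: key simp: mod_hom_add[OF p(1)])
      show "g (s (a \<odot>\<^bsub>C\<^esub> x)) = a \<odot>\<^bsub>D\<^esub> g (s x)" if "a \<in> carrier R"
        using s * that by (subst mod_hom_smult[OF g, symmetric]) (auto intro!: key simp: mod_hom_smult[OF p(1)])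
    qed
    fix b assume b: "b \<in> carrier B"
    then have "p b \<in> carrier C" by (rule mod_hom_closed[OF p(1)])
    then show "(\<lambda>c\<in>carrier C. g (s c)) (p b) = g b" using key[OF s(1) b s(2)] by simp
  qed
qed

text \<open>The dual situation: \<open>i\<close> identifies \<open>K\<close> with its image, and
  inverting it there is linear because \<open>i\<close> is injective.\<close>

lemma mod_hom_into:
  assumes A: "module R A" and K: "module R K" and F: "module R F" and i: "i \<in> mod_hom R K F" "inj_on i (carrier K)"
    and g: "g \<in> mod_hom R A F" and im: "\<And>a. a \<in> carrier A \<Longrightarrow> g a \<in> i ` carrier K"
  obtains h where "h \<in> mod_hom R A K" "\<And>a. a \<in> carrier A \<Longrightarrow> i (h a) = g a"
proof -
  interpret A: module R A by fact
  interpret K: module R K by fact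
  let ?s = "inv_into (carrier K) i"
  have s: "?s (g a) \<in> carrier K" "i (?s (g a)) = g a" if "a \<in> carrier A" for a
    using inv_into_into[OF im[OF that]] f_inv_into_f[OF im[OF that]] by auto
  have key: "k = k'" if "k \<in> carrier K" "k' \<in> carrier K" "i k = i k'" for k k'
    using i(2) that by (auto dest: inj_onD)
  show ?thesis
  proof (rule that[of "\<lambda>a\<in>carrier A. ?s (g a)"])
    show "(\<lambda>a\<in>carrier A. ?s (g a)) \<in> mod_hom R A K"
    proof (rule mod_homI[OF A])
      fix x y a assume *: "x \<in> carrier A" "y \<in> carrier A"
      show "?s (g x) \<in> carrier K" using s * by blast
      show "?s (g (x \<oplus>\<^bsub>A\<^esub> y)) = ?s (g x) \<oplus>\<^bsub>K\<^esub> ?s (g y)"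
        by (rule key) (use * s in \<open>simp_all add: mod_hom_add[OF i(1)] mod_hom_add[OF g, symmetric]\<close>)
      show "?s (g (a \<odot>\<^bsub>A\<^esub> x)) = a \<odot>\<^bsub>K\<^esub> ?s (g x)" if "a \<in> carrier R"
        by (rule key) (use * s that in \<open>simp_all add: mod_hom_smult[OF i(1)] mod_hom_smult[OF g, symmetric]\<close>)
    qed
  qed (use s in auto)
qed

subsection \<open>Free modules\<close>

definition free_basis :: "('a,'r) ring_scheme \<Rightarrow> nat \<Rightarrow> nat \<Rightarrow> nat \<Rightarrow> 'a" where
  "free_basis R n j = (\<lambda>i\<in>{..<n}. if i = j then \<one>\<^bsub>R\<^esub> else \<zero>\<^bsub>R\<^esub>)"

text \<open>The recursion truncates the number of terms and not the vector, so inductions run over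
  partial sums \<open>k \<le> n\<close> with \<open>v\<close> kept fixed in R^n.\<close>

primrec lin_comb :: "('a,'x,'s) module_scheme \<Rightarrow> (nat \<Rightarrow> 'x) \<Rightarrow> nat \<Rightarrow> (nat \<Rightarrow> 'a) \<Rightarrow> 'x" where
  "lin_comb M x 0 v = \<zero>\<^bsub>M\<^esub>"
| "lin_comb M x (Suc k) v = lin_comb M x k v \<oplus>\<^bsub>M\<^esub> v k \<odot>\<^bsub>M\<^esub> x k"

text \<open>Linearity in the first argument comes for free from \<open>free_lift\<close>; the second
  argument is reached through \<open>dot_comm\<close>.\<close>

abbreviation dot :: "('a,'r) ring_scheme \<Rightarrow> nat \<Rightarrow> (nat \<Rightarrow> 'a) \<Rightarrow> (nat \<Rightarrow> 'a) \<Rightarrow> 'a" where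
  "dot R n v w \<equiv> lin_comb (ring_as_module R) w n v"

text \<open>Generators are encoded as a map from a free module, so that images of finitely generated
  submodules are handled by composition, and \<open>N\<close> need not be made a module of its
  own.\<close>

definition fg_sub :: "('a,'r) ring_scheme \<Rightarrow> ('a,'x,'s) module_scheme \<Rightarrow> 'x set \<Rightarrow> bool" where
  "fg_sub R M N \<longleftrightarrow> (\<exists>m. \<exists>p\<in>mod_hom R (free_mod R m) M. p ` carrier (free_mod R m) = N)"

definition noeth_mod :: "('a,'r) ring_scheme \<Rightarrow> ('a,'x,'s) module_scheme \<Rightarrow> bool" where
  "noeth_mod R M \<longleftrightarrow> (\<forall>N. submodule N R M \<longrightarrow> fg_sub R M N)"

lemma ring_as_module_simps [simp]:
  "carrier (ring_as_module R) = carrier R" "\<zero>\<^bsub>ring_as_module R\<^esub> = \<zero>\<^bsub>R\<^esub>"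
  "x \<oplus>\<^bsub>ring_as_module R\<^esub> y = x \<oplus>\<^bsub>R\<^esub> y" "a \<odot>\<^bsub>ring_as_module R\<^esub> x = a \<otimes>\<^bsub>R\<^esub> x"
  by (auto simp: ring_as_module_def)

lemma ring_as_module_neg [simp]: "\<ominus>\<^bsub>ring_as_module R\<^esub> x = \<ominus>\<^bsub>R\<^esub> x"
  unfolding a_inv_def m_inv_def by (simp add: ring_as_module_def)

lemma ring_as_module_minus [simp]: "x \<ominus>\<^bsub>ring_as_module R\<^esub> y = x \<ominus>\<^bsub>R\<^esub> y"
  by (simp add: a_minus_def)

lemma noeth_modD: "noeth_mod R M \<Longrightarrow> submodule N R M \<Longrightarrow> fg_sub R M N"
  by (simp add: noeth_mod_def)

lemma mod_hom_preimage_submodule: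
  assumes X: "module R X" and Y: "module R Y" and f: "f \<in> mod_hom R X Y" and N: "submodule N R Y"
  shows "submodule {x \<in> carrier X. f x \<in> N} R X"
proof -
  interpret X: module R X by fact
  interpret Y: module R Y by fact
  show ?thesis
    by (rule X.submoduleI)
      (use Y.submoduleE[OF N] submodule_zero[OF Y N] in
        \<open>auto simp: mod_hom_zero[OF X Y f] mod_hom_neg[OF X Y f] mod_hom_add[OF f] mod_hom_smult[OF f]\<close>)
qed

context cring
begin

lemmas free_module = free_mod_module[OF is_cring]
lemmas RR_module = ring_as_module_module[OF is_cring]

lemma free_carrier: "v \<in> carrier (free_mod R n) \<longleftrightarrow> (\<forall>i<n. v i \<in> carrier R) \<and> v \<in> extensional {..<n}"
  by (auto simp: free_mod_def PiE_iff)

lemma free_apply [simp]: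
  "i < n \<Longrightarrow> (v \<oplus>\<^bsub>free_mod R n\<^esub> w) i = v i \<oplus> w i" "i < n \<Longrightarrow> (a \<odot>\<^bsub>free_mod R n\<^esub> v) i = a \<otimes> v i"
  "i < n \<Longrightarrow> \<zero>\<^bsub>free_mod R n\<^esub> i = \<zero>"
  by (auto simp: free_mod_def)

lemma free_coord: "v \<in> carrier (free_mod R n) \<Longrightarrow> i < n \<Longrightarrow> v i \<in> carrier R"
  by (simp add: free_carrier)

lemma free_eqI:
  "v \<in> carrier (free_mod R n) \<Longrightarrow> w \<in> carrier (free_mod R n) \<Longrightarrow> (\<And>i. i < n \<Longrightarrow> v i = w i) \<Longrightarrow> v = w"
  by (auto simp: free_carrier intro!: extensionalityI[where A = "{..<n}"])

lemma free_basis_carrier [simp]: "free_basis R n j \<in> carrier (free_mod R n)"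
  by (auto simp: free_basis_def free_carrier)

lemma free_basis_apply: "i < n \<Longrightarrow> free_basis R n j i = (if i = j then \<one> else \<zero>)"
  by (auto simp: free_basis_def)

lemma free_coord_hom:
  assumes "i < n" shows "(\<lambda>v\<in>carrier (free_mod R n). v i) \<in> mod_hom R (free_mod R n) (ring_as_module R)"
  by (rule mod_homI[OF free_module]) (use assms in \<open>auto simp: free_coord\<close>)

lemma free_closed [simp]:
  "v \<in> carrier (free_mod R n) \<Longrightarrow> w \<in> carrier (free_mod R n) \<Longrightarrow> v \<oplus>\<^bsub>free_mod R n\<^esub> w \<in> carrier (free_mod R n)"
  "a \<in> carrier R \<Longrightarrow> v \<in> carrier (free_mod R n) \<Longrightarrow> a \<odot>\<^bsub>free_mod R n\<^esub> v \<in> carrier (free_mod R n)"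
  "\<zero>\<^bsub>free_mod R n\<^esub> \<in> carrier (free_mod R n)"
  by (auto simp: free_mod_def)

lemma free_restrict_carrier [simp]:
  "(\<lambda>i\<in>{..<n}. f i) \<in> carrier (free_mod R n) \<longleftrightarrow> (\<forall>i<n. f i \<in> carrier R)"
  by (auto simp: free_carrier)

lemma free_neg_apply:
  assumes "v \<in> carrier (free_mod R n)" "i < n"
  shows "(\<ominus>\<^bsub>free_mod R n\<^esub> v) i = \<ominus> v i"
proof -
  interpret F: module R "free_mod R n" by (rule free_module)
  show ?thesis using mod_hom_neg[OF free_module RR_module free_coord_hom[OF assms(2)] assms(1)] assms(1) by simp
qed

lemma free_minus_apply:
  "v \<in> carrier (free_mod R n) \<Longrightarrow> w \<in> carrier (free_mod R n) \<Longrightarrow> i < n \<Longrightarrow> (v \<ominus>\<^bsub>free_mod R n\<^esub> w) i = v i \<ominus> w i"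
  by (simp add: a_minus_def free_neg_apply)

text \<open>This serves as an induction principle: a property cut out by a submodule holds on R^n
  once it holds on the basis. The proof restores the coordinates of \<open>v\<close> one at a
  time.\<close>

lemma free_spanned:
  assumes N: "submodule N R (free_mod R n)" and b: "\<And>j. j < n \<Longrightarrow> free_basis R n j \<in> N"
    and v: "v \<in> carrier (free_mod R n)"
  shows "v \<in> N"
proof -
  interpret F: module R "free_mod R n" by (rule free_module)
  note NE = F.submoduleE[OF N]
  let ?t = "\<lambda>k. \<lambda>i\<in>{..<n}. if i < k then v i else \<zero>"
  have "k \<le> n \<Longrightarrow> ?t k \<in> N" for k
  proof (induction k)
    case 0
    have "?t 0 = \<zero>\<^bsub>free_mod R n\<^esub>" by (auto simp: free_mod_def)
    then show ?case using submodule_zero[OF free_module N] by simp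
  next
    case (Suc k)
    then have k: "k < n" by simp
    have "?t (Suc k) = ?t k \<oplus>\<^bsub>free_mod R n\<^esub> v k \<odot>\<^bsub>free_mod R n\<^esub> free_basis R n k"
      using v k by (intro ext) (auto simp: free_mod_def free_basis_def PiE_iff less_Suc_eq)
    moreover have "v k \<odot>\<^bsub>free_mod R n\<^esub> free_basis R n k \<in> N" using v k b NE(4) free_coord by blast
    ultimately show ?case using NE(5)[OF Suc.IH] Suc.prems by (metis Suc_leD)
  qed
  moreover have "?t n = v" by (rule free_eqI[of _ n]) (use v in \<open>auto simp: free_carrier\<close>)
  ultimately show ?thesis by fastforce
qed

text \<open>The kernel of \<open>f - g\<close> is a submodule that contains the basis.\<close>

lemma free_hom_eq:
  assumes M: "module R M" and f: "f \<in> mod_hom R (free_mod R n) M" and g: "g \<in> mod_hom R (free_mod R n) M"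
    and b: "\<And>j. j < n \<Longrightarrow> f (free_basis R n j) = g (free_basis R n j)" and v: "v \<in> carrier (free_mod R n)"
  shows "f v = g v"
proof -
  interpret M: module R M by fact
  note h = mod_hom_minus_map[OF free_module M f g]
  have "v \<in> {v \<in> carrier (free_mod R n). (\<lambda>x\<in>carrier (free_mod R n). f x \<ominus>\<^bsub>M\<^esub> g x) v = \<zero>\<^bsub>M\<^esub>}"
    by (rule free_spanned[OF mod_hom_kernel_submodule[OF free_module M h] _ v])
      (use b mod_hom_closed[OF g] in auto)
  then show ?thesis using mod_hom_closed[OF f v] mod_hom_closed[OF g v] M.sub_eq_iff v by simp
qed

lemma lin_comb_closed:
  assumes M: "module R M" and x: "\<And>j. j < k \<Longrightarrow> x j \<in> carrier M" and v: "\<And>j. j < k \<Longrightarrow> v j \<in> carrier R"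
  shows "lin_comb M x k v \<in> carrier M"
proof -
  interpret M: module R M by fact
  show ?thesis using x v by (induction k) auto
qed

lemma free_lift:
  assumes M: "module R M" and x: "\<And>j. j < n \<Longrightarrow> x j \<in> carrier M"
  shows "(\<lambda>v\<in>carrier (free_mod R n). lin_comb M x n v) \<in> mod_hom R (free_mod R n) M"
    and "\<And>j. j < n \<Longrightarrow> lin_comb M x n (free_basis R n j) = x j"
proof -
  interpret M: module R M by fact
  interpret F: module R "free_mod R n" by (rule free_module)
  have cl: "lin_comb M x k v \<in> carrier M" if "k \<le> n" "v \<in> carrier (free_mod R n)" for k v
    by (rule lin_comb_closed[OF M]) (use that x free_coord in auto)
  have add: "lin_comb M x k (v \<oplus>\<^bsub>free_mod R n\<^esub> w) = lin_comb M x k v \<oplus>\<^bsub>M\<^esub> lin_comb M x k w"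
    if "k \<le> n" "v \<in> carrier (free_mod R n)" "w \<in> carrier (free_mod R n)" for k v w
    using that
  proof (induction k)
    case (Suc k)
    then show ?case using x[of k] cl[of k v] cl[of k w] free_coord[of v n k] free_coord[of w n k]
      by (simp add: M.smult_l_distr M.a_ac)
  qed simp
  have sm: "lin_comb M x k (a \<odot>\<^bsub>free_mod R n\<^esub> v) = a \<odot>\<^bsub>M\<^esub> lin_comb M x k v"
    if "k \<le> n" "v \<in> carrier (free_mod R n)" "a \<in> carrier R" for k v a
    using that
  proof (induction k)
    case (Suc k)
    then show ?case using x[of k] cl[of k v] free_coord[of v n k]
      by (simp add: M.smult_r_distr M.smult_assoc1)
  qed simp
  show "(\<lambda>v\<in>carrier (free_mod R n). lin_comb M x n v) \<in> mod_hom R (free_mod R n) M"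
    by (rule mod_homI[OF free_module]) (use cl add sm in auto)
  fix j assume j: "j < n"
  have "k \<le> n \<Longrightarrow> lin_comb M x k (free_basis R n j) = (if j < k then x j else \<zero>\<^bsub>M\<^esub>)" for k
  proof (induction k)
    case (Suc k)
    then show ?case using x[of k] x[OF j] by (auto simp: free_basis_apply less_Suc_eq)
  qed simp
  then show "lin_comb M x n (free_basis R n j) = x j" using j by simp
qed

lemma free_lift_ex:
  assumes M: "module R M" and x: "\<And>j. j < n \<Longrightarrow> x j \<in> carrier M"
  obtains f where "f \<in> mod_hom R (free_mod R n) M" "\<And>j. j < n \<Longrightarrow> f (free_basis R n j) = x j"
  using that[OF free_lift(1)[OF M, of n x]] free_lift(2)[OF M, of n x] x by simp

lemma free_projective:
  assumes A: "module R A" and B: "module R B" and p: "p \<in> mod_hom R A B" "p ` carrier A = carrier B"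
    and f: "f \<in> mod_hom R (free_mod R n) B"
  obtains g where "g \<in> mod_hom R (free_mod R n) A" "\<And>v. v \<in> carrier (free_mod R n) \<Longrightarrow> p (g v) = f v"
proof -
  let ?x = "\<lambda>j. inv_into (carrier A) p (f (free_basis R n j))"
  have im: "f (free_basis R n j) \<in> p ` carrier A" for j using mod_hom_closed[OF f] p(2) by simp
  obtain g where g: "g \<in> mod_hom R (free_mod R n) A" "\<And>j. j < n \<Longrightarrow> g (free_basis R n j) = ?x j"
    using free_lift_ex[OF A, of n ?x] inv_into_into[OF im] by auto
  have "compose (carrier (free_mod R n)) p g v = f v" if v: "v \<in> carrier (free_mod R n)" for v
    by (rule free_hom_eq[OF B mod_hom_compose[OF free_module g(1) p(1)] f _ v])
      (use g(2) f_inv_into_f[OF im] in \<open>auto simp: compose_def\<close>)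
  then show ?thesis using that[OF g(1)] by (auto simp: compose_def)
qed

lemma free_tuple_hom:
  assumes X: "module R X" and f: "\<And>j. j < n \<Longrightarrow> f j \<in> mod_hom R X (ring_as_module R)"
  shows "(\<lambda>x\<in>carrier X. \<lambda>j\<in>{..<n}. f j x) \<in> mod_hom R X (free_mod R n)"
proof (rule mod_homI[OF X])
  fix x y a assume x: "x \<in> carrier X" "y \<in> carrier X"
  show "(\<lambda>j\<in>{..<n}. f j x) \<in> carrier (free_mod R n)"
    using mod_hom_closed[OF f x(1)] by (auto simp: free_carrier)
  show "(\<lambda>j\<in>{..<n}. f j (x \<oplus>\<^bsub>X\<^esub> y)) = (\<lambda>j\<in>{..<n}. f j x) \<oplus>\<^bsub>free_mod R n\<^esub> (\<lambda>j\<in>{..<n}. f j y)"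
    using mod_hom_add[OF f x] by (auto simp: free_mod_def)
  show "a \<in> carrier R \<Longrightarrow> (\<lambda>j\<in>{..<n}. f j (a \<odot>\<^bsub>X\<^esub> x)) = a \<odot>\<^bsub>free_mod R n\<^esub> (\<lambda>j\<in>{..<n}. f j x)"
    using mod_hom_smult[OF f _ x(1)] by (auto simp: free_mod_def)
qed

lemma dot_comm:
  assumes "v \<in> carrier (free_mod R n)" "w \<in> carrier (free_mod R n)" shows "dot R n v w = dot R n w v"
proof -
  have "k \<le> n \<Longrightarrow> dot R k v w = dot R k w v" for k
  proof (induction k)
    case (Suc k)
    then show ?case using m_comm[of "v k" "w k"] assms free_coord by simp
  qed simp
  then show ?thesis by simp
qed

lemma dot_hom:
  assumes "w \<in> carrier (free_mod R n)"
  shows "(\<lambda>v\<in>carrier (free_mod R n). dot R n v w) \<in> mod_hom R (free_mod R n) (ring_as_module R)"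
  by (rule free_lift(1)[OF RR_module]) (use assms free_coord in auto)

lemma dot_basis: "w \<in> carrier (free_mod R n) \<Longrightarrow> j < n \<Longrightarrow> dot R n (free_basis R n j) w = w j"
  by (rule free_lift(2)[OF RR_module]) (use free_coord in auto)

lemma dot_add:
  "v \<in> carrier (free_mod R n) \<Longrightarrow> v' \<in> carrier (free_mod R n) \<Longrightarrow> w \<in> carrier (free_mod R n) \<Longrightarrow>
    dot R n (v \<oplus>\<^bsub>free_mod R n\<^esub> v') w = dot R n v w \<oplus> dot R n v' w"
proof -
  interpret F: module R "free_mod R n" by (rule free_module)
  show "v \<in> carrier (free_mod R n) \<Longrightarrow> v' \<in> carrier (free_mod R n) \<Longrightarrow> w \<in> carrier (free_mod R n) \<Longrightarrow> ?thesis"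
    using mod_hom_add[OF dot_hom, of w n v v'] by simp
qed

lemma dot_smult:
  "a \<in> carrier R \<Longrightarrow> v \<in> carrier (free_mod R n) \<Longrightarrow> w \<in> carrier (free_mod R n) \<Longrightarrow>
    dot R n (a \<odot>\<^bsub>free_mod R n\<^esub> v) w = a \<otimes> dot R n v w"
proof -
  interpret F: module R "free_mod R n" by (rule free_module)
  show "a \<in> carrier R \<Longrightarrow> v \<in> carrier (free_mod R n) \<Longrightarrow> w \<in> carrier (free_mod R n) \<Longrightarrow> ?thesis"
    using mod_hom_smult[OF dot_hom, of w n a v] by simp
qed

text \<open>The identification of R^n with its dual. It keeps duals of free modules from appearing
  as function spaces in the dual exact sequences.\<close>

lemma free_dual_dot:
  assumes f: "f \<in> mod_hom R (free_mod R n) (ring_as_module R)"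
  shows "(\<lambda>j\<in>{..<n}. f (free_basis R n j)) \<in> carrier (free_mod R n)"
    and "\<And>v. v \<in> carrier (free_mod R n) \<Longrightarrow> f v = dot R n v (\<lambda>j\<in>{..<n}. f (free_basis R n j))"
proof -
  show w: "(\<lambda>j\<in>{..<n}. f (free_basis R n j)) \<in> carrier (free_mod R n)"
    using mod_hom_closed[OF f free_basis_carrier] by (auto simp: free_carrier)
  show "f v = dot R n v (\<lambda>j\<in>{..<n}. f (free_basis R n j))" if v: "v \<in> carrier (free_mod R n)" for v
    using free_hom_eq[OF RR_module f dot_hom[OF w] _ v] v dot_basis[OF w] by simp
qed

text \<open>Factorisations and resolutions admit only the modules \<open>free_mod R n\<close>, so
  the direct sum of two of them has to be one of them again. Concatenation of tuples supplies the
  biproduct structure.\<close>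

lemma free_split:
  fixes m l
  obtains i1 i2 p1 p2 where
    "i1 \<in> mod_hom R (free_mod R m) (free_mod R (m + l))" "i2 \<in> mod_hom R (free_mod R l) (free_mod R (m + l))"
    "p1 \<in> mod_hom R (free_mod R (m + l)) (free_mod R m)" "p2 \<in> mod_hom R (free_mod R (m + l)) (free_mod R l)"
    "\<And>v. v \<in> carrier (free_mod R m) \<Longrightarrow> p1 (i1 v) = v"
    "\<And>v. v \<in> carrier (free_mod R m) \<Longrightarrow> p2 (i1 v) = \<zero>\<^bsub>free_mod R l\<^esub>"
    "\<And>v. v \<in> carrier (free_mod R l) \<Longrightarrow> p1 (i2 v) = \<zero>\<^bsub>free_mod R m\<^esub>"
    "\<And>v. v \<in> carrier (free_mod R l) \<Longrightarrow> p2 (i2 v) = v"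
    "\<And>v. v \<in> carrier (free_mod R (m + l)) \<Longrightarrow> i1 (p1 v) \<oplus>\<^bsub>free_mod R (m + l)\<^esub> i2 (p2 v) = v"
proof -
  let ?F = "free_mod R (m + l)"
  let ?i1 = "\<lambda>v\<in>carrier (free_mod R m). \<lambda>i\<in>{..<m+l}. if i < m then v i else \<zero>"
  let ?i2 = "\<lambda>v\<in>carrier (free_mod R l). \<lambda>i\<in>{..<m+l}. if i < m then \<zero> else v (i - m)"
  let ?p1 = "\<lambda>v\<in>carrier ?F. \<lambda>i\<in>{..<m}. v i"
  let ?p2 = "\<lambda>v\<in>carrier ?F. \<lambda>i\<in>{..<l}. v (m + i)"
  have i1: "?i1 \<in> mod_hom R (free_mod R m) ?F"
    by (rule mod_homI[OF free_module]) (auto simp: free_coord intro!: free_eqI[of _ "m+l"])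
  have i2: "?i2 \<in> mod_hom R (free_mod R l) ?F"
    by (rule mod_homI[OF free_module]) (auto simp: free_coord intro!: free_eqI[of _ "m+l"])
  have p1: "?p1 \<in> mod_hom R ?F (free_mod R m)"
    by (rule mod_homI[OF free_module]) (auto simp: free_coord intro!: free_eqI[of _ m])
  have p2: "?p2 \<in> mod_hom R ?F (free_mod R l)"
    by (rule mod_homI[OF free_module]) (auto simp: free_coord intro!: free_eqI[of _ l])
  show ?thesis
  proof (rule that[OF i1 i2 p1 p2])
    fix v assume v: "v \<in> carrier ?F"
    note c = mod_hom_closed[OF p1 v] mod_hom_closed[OF p2 v]
    show "?i1 (?p1 v) \<oplus>\<^bsub>?F\<^esub> ?i2 (?p2 v) = v"
    proof (rule free_eqI[of _ "m + l"])
      show "?i1 (?p1 v) \<oplus>\<^bsub>?F\<^esub> ?i2 (?p2 v) \<in> carrier ?F"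
        using mod_hom_closed[OF i1 c(1)] mod_hom_closed[OF i2 c(2)] by (rule free_closed)
      fix i assume i: "i < m + l"
      have "?i1 (?p1 v) i = (if i < m then v i else \<zero>)" using c(1) i v by simp
      moreover have "?i2 (?p2 v) i = (if i < m then \<zero> else v i)" using c(2) i v by (cases "i < m") auto
      ultimately show "(?i1 (?p1 v) \<oplus>\<^bsub>?F\<^esub> ?i2 (?p2 v)) i = v i"
        using i free_coord[OF v i] by simp
    qed (rule v)
  next
    fix v assume v: "v \<in> carrier (free_mod R m)"
    note c = mod_hom_closed[OF i1 v]
    show "?p1 (?i1 v) = v"
      by (rule free_eqI[OF mod_hom_closed[OF p1 c] v]) (use v c in simp)
    show "?p2 (?i1 v) = \<zero>\<^bsub>free_mod R l\<^esub>"
      by (rule free_eqI[OF mod_hom_closed[OF p2 c]]) (use v c in simp_all)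
  next
    fix v assume v: "v \<in> carrier (free_mod R l)"
    note c = mod_hom_closed[OF i2 v]
    show "?p1 (?i2 v) = \<zero>\<^bsub>free_mod R m\<^esub>"
      by (rule free_eqI[OF mod_hom_closed[OF p1 c]]) (use v c in simp_all)
    show "?p2 (?i2 v) = v"
      by (rule free_eqI[OF mod_hom_closed[OF p2 c] v]) (use v c in simp)
  qed
qed

lemma free_copair:
  assumes M: "module R M" and f: "f \<in> mod_hom R (free_mod R m) M" and g: "g \<in> mod_hom R (free_mod R l) M"
    and p1: "p1 \<in> mod_hom R F (free_mod R m)" and p2: "p2 \<in> mod_hom R F (free_mod R l)" and F: "module R F"
  shows "(\<lambda>v\<in>carrier F. f (p1 v) \<oplus>\<^bsub>M\<^esub> g (p2 v)) \<in> mod_hom R F M"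
  using mod_hom_add_map[OF F M mod_hom_compose[OF F p1 f] mod_hom_compose[OF F p2 g]]
  by (simp add: compose_def cong: restrict_cong)

subsection \<open>Finite generation\<close>

lemma fg_subI: "p \<in> mod_hom R (free_mod R m) M \<Longrightarrow> p ` carrier (free_mod R m) = N \<Longrightarrow> fg_sub R M N"
  by (auto simp: fg_sub_def)

lemma free_image_span:
  assumes M: "module R M" and p: "p \<in> mod_hom R (free_mod R n) M"
  shows "mod_span R M (p ` free_basis R n ` {..<n}) = p ` carrier (free_mod R n)"
proof -
  interpret F: module R "free_mod R n" by (rule free_module)
  have "p ` carrier (free_mod R n) \<subseteq> N" if N: "submodule N R M" "p ` free_basis R n ` {..<n} \<subseteq> N" for N
  proof
    fix y assume "y \<in> p ` carrier (free_mod R n)"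
    then obtain v where v: "v \<in> carrier (free_mod R n)" "y = p v" by blast
    have "v \<in> {v \<in> carrier (free_mod R n). p v \<in> N}"
      by (rule free_spanned[OF mod_hom_preimage_submodule[OF free_module M p N(1)] _ v(1)]) (use N in auto)
    then show "y \<in> N" using v by simp
  qed
  moreover have "submodule (p ` carrier (free_mod R n)) R M"
    by (rule mod_hom_image_submodule[OF free_module M p F.carrier_is_submodule])
  ultimately show ?thesis unfolding mod_span_def by (intro subset_antisym) (auto intro!: Inter_lower)
qed

lemma span_free_cover:
  assumes M: "module R M" and S: "finite S" "S \<subseteq> carrier M" "mod_span R M S = carrier M"
  obtains p where "p \<in> mod_hom R (free_mod R (card S)) M" "p ` carrier (free_mod R (card S)) = carrier M"
proof -
  interpret F: module R "free_mod R (card S)" by (rule free_module)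
  obtain h where h: "bij_betw h {..<card S} S"
    using ex_bij_betw_nat_finite[OF S(1)] by (auto simp: atLeast0LessThan)
  obtain p where p: "p \<in> mod_hom R (free_mod R (card S)) M" "\<And>j. j < card S \<Longrightarrow> p (free_basis R (card S) j) = h j"
    using free_lift_ex[OF M, of "card S" h] h S(2) unfolding bij_betw_def by (metis imageI lessThan_iff subsetD)
  have "p ` free_basis R (card S) ` {..<card S} = h ` {..<card S}"
    unfolding image_image by (rule image_cong) (use p(2) in auto)
  then have "p ` free_basis R (card S) ` {..<card S} = S" using h by (simp add: bij_betw_def)
  then show ?thesis using that[OF p(1)] free_image_span[OF M p(1)] S(3) by simp
qed

text \<open>From here on finite generation is handled through surjections from free modules instead
  of spanning sets.\<close>

lemma fg_module_iff: "fg_module R M \<longleftrightarrow> module R M \<and> fg_sub R M (carrier M)"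
proof (intro iffI conjI)
  assume "fg_module R M"
  then show M: "module R M" and "fg_sub R M (carrier M)"
    using span_free_cover unfolding fg_module_def fg_sub_def by (blast, metis)
next
  assume *: "module R M \<and> fg_sub R M (carrier M)"
  then obtain m p where p: "p \<in> mod_hom R (free_mod R m) M" "p ` carrier (free_mod R m) = carrier M"
    unfolding fg_sub_def by blast
  have "p ` free_basis R m ` {..<m} \<subseteq> carrier M" using mod_hom_closed[OF p(1)] by auto
  then show "fg_module R M"
    using * free_image_span[of M p m] p unfolding fg_module_def
    by (auto intro!: exI[of _ "p ` free_basis R m ` {..<m}"])
qed

lemma fg_coverE:
  assumes "fg_module R M"
  obtains m p where "p \<in> mod_hom R (free_mod R m) M" "p ` carrier (free_mod R m) = carrier M"
  using assms unfolding fg_module_iff fg_sub_def by blast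

lemma min_gens_cover:
  assumes "fg_module R M"
  obtains p where "p \<in> mod_hom R (free_mod R (min_gens R M)) M" "p ` carrier (free_mod R (min_gens R M)) = carrier M"
proof -
  have "\<exists>n. \<exists>S. finite S \<and> card S = n \<and> S \<subseteq> carrier M \<and> mod_span R M S = carrier M"
    using assms unfolding fg_module_def by blast
  from LeastI_ex[OF this] obtain S where "finite S" "card S = min_gens R M" "S \<subseteq> carrier M" "mod_span R M S = carrier M"
    unfolding min_gens_def by blast
  then show ?thesis using that span_free_cover[of M S] assms unfolding fg_module_def by metis
qed

lemma fg_sub_image:
  assumes X: "module R X" and f: "f \<in> mod_hom R X Y" and N: "fg_sub R X N"
  shows "fg_sub R Y (f ` N)"
proof -
  obtain m p where p: "p \<in> mod_hom R (free_mod R m) X" "p ` carrier (free_mod R m) = N"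
    using N unfolding fg_sub_def by blast
  show ?thesis
    by (rule fg_subI[OF mod_hom_compose[OF free_module p(1) f]]) (auto simp: compose_def p(2)[symmetric])
qed

lemma fg_module_image:
  assumes "fg_module R X" and Y: "module R Y" and f: "f \<in> mod_hom R X Y" "f ` carrier X = carrier Y"
  shows "fg_module R Y"
  using fg_sub_image[of X f Y "carrier X"] assms unfolding fg_module_iff by simp

lemma fg_free: "fg_module R (free_mod R n)"
  unfolding fg_module_iff
  by (auto intro!: fg_subI[OF mod_hom_id[OF free_module]] free_module)

lemma fg_sub_zero: "module R M \<Longrightarrow> fg_sub R M {\<zero>\<^bsub>M\<^esub>}"
  by (rule fg_subI[OF mod_hom_zero_map[OF free_module, of M 0]]) (auto simp: free_mod_def)

text \<open>Generators of the image are lifted to \<open>N\<close> and joined with generators of the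
  part of \<open>N\<close> that \<open>h\<close> kills.\<close>

lemma fg_sub_extension:
  assumes A: "module R A" and B: "module R B" and h: "h \<in> mod_hom R A B" and N: "submodule N R A"
    and im: "fg_sub R B (h ` N)" and ker: "fg_sub R A (N \<inter> {x \<in> carrier A. h x = \<zero>\<^bsub>B\<^esub>})"
  shows "fg_sub R A N"
proof -
  interpret A: module R A by fact
  interpret B: module R B by fact
  note NE = A.submoduleE[OF N]
  obtain m q where q: "q \<in> mod_hom R (free_mod R m) B" "q ` carrier (free_mod R m) = h ` N"
    using im unfolding fg_sub_def by blast
  obtain l r where r: "r \<in> mod_hom R (free_mod R l) A"
    "r ` carrier (free_mod R l) = N \<inter> {x \<in> carrier A. h x = \<zero>\<^bsub>B\<^esub>}"
    using ker unfolding fg_sub_def by blast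
  let ?x = "\<lambda>j. inv_into N h (q (free_basis R m j))"
  have im: "q (free_basis R m j) \<in> h ` N" for j using q(2) free_basis_carrier by blast
  have x: "?x j \<in> N" "h (?x j) = q (free_basis R m j)" for j
    using inv_into_into[OF im] f_inv_into_f[OF im] by auto
  obtain q' where q': "q' \<in> mod_hom R (free_mod R m) A" "\<And>j. j < m \<Longrightarrow> q' (free_basis R m j) = ?x j"
    using free_lift_ex[OF A, of m ?x] x(1) NE(1) by blast
  have hq: "h (q' v) = q v" if v: "v \<in> carrier (free_mod R m)" for v
    using free_hom_eq[OF B mod_hom_compose[OF free_module q'(1) h] q(1) _ v] q'(2) x v by (simp add: compose_def)
  have qN: "q' v \<in> N" if v: "v \<in> carrier (free_mod R m)" for v
    using free_spanned[OF mod_hom_preimage_submodule[OF free_module A q'(1) N] _ v] q'(2) x by simp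
  have rN: "r w \<in> N" if "w \<in> carrier (free_mod R l)" for w using that r(2) by auto
  obtain i1 i2 p1 p2 where s:
    "i1 \<in> mod_hom R (free_mod R m) (free_mod R (m + l))" "i2 \<in> mod_hom R (free_mod R l) (free_mod R (m + l))"
    "p1 \<in> mod_hom R (free_mod R (m + l)) (free_mod R m)" "p2 \<in> mod_hom R (free_mod R (m + l)) (free_mod R l)"
    "\<And>v. v \<in> carrier (free_mod R m) \<Longrightarrow> p1 (i1 v) = v"
    "\<And>v. v \<in> carrier (free_mod R m) \<Longrightarrow> p2 (i1 v) = \<zero>\<^bsub>free_mod R l\<^esub>"
    "\<And>v. v \<in> carrier (free_mod R l) \<Longrightarrow> p1 (i2 v) = \<zero>\<^bsub>free_mod R m\<^esub>"
    "\<And>v. v \<in> carrier (free_mod R l) \<Longrightarrow> p2 (i2 v) = v"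
    "\<And>v. v \<in> carrier (free_mod R (m + l)) \<Longrightarrow> i1 (p1 v) \<oplus>\<^bsub>free_mod R (m + l)\<^esub> i2 (p2 v) = v"
    by (rule free_split[of m l]) blast
  interpret F: module R "free_mod R (m + l)" by (rule free_module)
  interpret Fm: module R "free_mod R m" by (rule free_module)
  interpret Fl: module R "free_mod R l" by (rule free_module)
  let ?s = "\<lambda>v\<in>carrier (free_mod R (m+l)). q' (p1 v) \<oplus>\<^bsub>A\<^esub> r (p2 v)"
  show ?thesis
  proof (rule fg_subI[OF free_copair[OF A q'(1) r(1) s(3) s(4) free_module]], rule subset_antisym; rule subsetI)
    fix y assume "y \<in> ?s ` carrier (free_mod R (m+l))"
    then obtain v where v: "v \<in> carrier (free_mod R (m+l))" "y = ?s v" by blast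
    have "q' (p1 v) \<oplus>\<^bsub>A\<^esub> r (p2 v) \<in> N"
      using NE(5)[OF qN rN] mod_hom_closed[OF s(3) v(1)] mod_hom_closed[OF s(4) v(1)] by blast
    then show "y \<in> N" using v by simp
  next
    fix x assume xN: "x \<in> N"
    then have xc: "x \<in> carrier A" using NE(1) by blast
    obtain u where u: "u \<in> carrier (free_mod R m)" "h x = q u" using xN q(2) by (metis imageE imageI)
    have qu: "q' u \<in> carrier A" using qN[OF u(1)] NE(1) by blast
    \<comment> \<open>\<open>q' u\<close> is a combination of the lifted generators with the same
      image as \<open>x\<close>, so the difference lies in \<open>N\<close> and in the kernel of
      \<open>h\<close>.\<close>
    have "x \<ominus>\<^bsub>A\<^esub> q' u \<in> N" using NE(3,5) xN qN[OF u(1)] by (simp add: a_minus_def)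
    moreover have "h (x \<ominus>\<^bsub>A\<^esub> q' u) = \<zero>\<^bsub>B\<^esub>"
      using mod_hom_minus[OF A B h xc qu] hq[OF u(1)] u mod_hom_closed[OF q(1) u(1)] by simp
    ultimately have "x \<ominus>\<^bsub>A\<^esub> q' u \<in> r ` carrier (free_mod R l)" using r(2) xc qu by simp
    then obtain w where w: "w \<in> carrier (free_mod R l)" "x \<ominus>\<^bsub>A\<^esub> q' u = r w" by blast
    let ?v = "i1 u \<oplus>\<^bsub>free_mod R (m + l)\<^esub> i2 w"
    have iu: "i1 u \<in> carrier (free_mod R (m + l))" "i2 w \<in> carrier (free_mod R (m + l))"
      using u w mod_hom_closed[OF s(1)] mod_hom_closed[OF s(2)] by auto
    have "p1 ?v = u" "p2 ?v = w"
      using u w iu by (simp_all add: mod_hom_add[OF s(3)] mod_hom_add[OF s(4)] s(5-8))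
    then have "?s ?v = x" using iu w(2)[symmetric] A.sub_add_cancel[OF xc qu] qu xc by (simp add: A.a_comm)
    then show "x \<in> ?s ` carrier (free_mod R (m+l))" using iu free_closed(1) by blast
  qed
qed

text \<open>The part of a submodule killed by \<open>h\<close> is again a submodule, so only
  submodules inside the kernel remain to be tested; the kernel is never turned into a
  module.\<close>

lemma noeth_mod_extension:
  assumes A: "module R A" and B: "module R B" and h: "h \<in> mod_hom R A B" and "noeth_mod R B"
    and "\<And>N. submodule N R A \<Longrightarrow> (\<And>x. x \<in> N \<Longrightarrow> h x = \<zero>\<^bsub>B\<^esub>) \<Longrightarrow> fg_sub R A N"
  shows "noeth_mod R A"
  unfolding noeth_mod_def
proof (intro allI impI)
  fix N assume N: "submodule N R A"
  show "fg_sub R A N"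
  proof (rule fg_sub_extension[OF A B h N])
    show "fg_sub R B (h ` N)"
      by (rule noeth_modD[OF assms(4) mod_hom_image_submodule[OF A B h N]])
    show "fg_sub R A (N \<inter> {x \<in> carrier A. h x = \<zero>\<^bsub>B\<^esub>})"
      by (rule assms(5)[OF submodule_Int[OF A N mod_hom_kernel_submodule[OF A B h]]]) simp
  qed
qed

lemma noeth_mod_image:
  assumes X: "module R X" and Y: "module R Y" and f: "f \<in> mod_hom R X Y" "f ` carrier X = carrier Y"
    and nX: "noeth_mod R X"
  shows "noeth_mod R Y"
  unfolding noeth_mod_def
proof (intro allI impI)
  fix N assume N: "submodule N R Y"
  interpret Y: module R Y by fact
  have "fg_sub R X {x \<in> carrier X. f x \<in> N}"
    using nX mod_hom_preimage_submodule[OF X Y f(1) N] unfolding noeth_mod_def by blast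
  moreover have "f ` {x \<in> carrier X. f x \<in> N} = N" using f(2) Y.submoduleE(1)[OF N] by auto
  ultimately show "fg_sub R Y N" using fg_sub_image[OF X f(1)] by metis
qed

end

section \<open>Noetherian modules\<close>

locale noetherian_cring = cring R + noetherian_ring R for R (structure)
begin

text \<open>Submodules of the regular module are ideals, whose finite generating sets define
  surjections from free modules.\<close>

lemma noeth_RR: "noeth_mod R (ring_as_module R)"
  unfolding noeth_mod_def
proof (intro allI impI)
  fix N assume N: "submodule N R (ring_as_module R)"
  interpret RR: module R "ring_as_module R" by (rule RR_module)
  have idl: "ideal L R" if "submodule L R (ring_as_module R)" for L
  proof (rule idealI[OF ring_axioms])
    note LE = RR.submoduleE[OF that]
    show "subgroup L (add_monoid R)"
      by (rule add.subgroupI) (use LE in \<open>auto simp flip: a_inv_def\<close>)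
    show "\<And>a x. a \<in> L \<Longrightarrow> x \<in> carrier R \<Longrightarrow> x \<otimes> a \<in> L" using LE(4) by simp
    then show "\<And>a x. a \<in> L \<Longrightarrow> x \<in> carrier R \<Longrightarrow> a \<otimes> x \<in> L" using LE(1) m_comm by (metis ring_as_module_simps(1) subsetD)
  qed
  obtain S where S: "S \<subseteq> carrier R" "finite S" "N = Idl S" using finetely_gen[OF idl[OF N]] by blast
  obtain h where h: "bij_betw h {..<card S} S"
    using ex_bij_betw_nat_finite[OF S(2)] by (auto simp: atLeast0LessThan)
  obtain p where p: "p \<in> mod_hom R (free_mod R (card S)) (ring_as_module R)"
    "\<And>j. j < card S \<Longrightarrow> p (free_basis R (card S) j) = h j"
    using free_lift_ex[OF RR_module, of "card S" h] h S(1) unfolding bij_betw_def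
    by (metis imageI lessThan_iff subsetD ring_as_module_simps(1))
  interpret F: module R "free_mod R (card S)" by (rule free_module)
  have sub: "S \<subseteq> p ` carrier (free_mod R (card S))"
  proof
    fix x assume "x \<in> S"
    then obtain j where "j < card S" "x = h j" using h by (auto simp: bij_betw_def)
    then show "x \<in> p ` carrier (free_mod R (card S))" using p(2) free_basis_carrier by (metis imageI)
  qed
  have "N \<subseteq> p ` carrier (free_mod R (card S))"
    unfolding S(3)
    by (rule genideal_minimal[OF idl[OF mod_hom_image_submodule[OF free_module RR_module p(1) F.carrier_is_submodule]] sub])
  moreover have "p v \<in> N" if "v \<in> carrier (free_mod R (card S))" for v
    using free_spanned[OF mod_hom_preimage_submodule[OF free_module RR_module p(1) N] _ that] p(2)
      genideal_self[OF S(1)] h S(3) by (auto simp: bij_betw_def)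
  ultimately show "fg_sub R (ring_as_module R) N" by (intro fg_subI[OF p(1)]) auto
qed

text \<open>Induction along the projection that forgets the last coordinate; its kernel embeds into
  \<open>R\<close> by that coordinate.\<close>

lemma noeth_free: "noeth_mod R (free_mod R n)"
proof (induction n)
  case 0
  interpret F: module R "free_mod R 0" by (rule free_module)
  show ?case unfolding noeth_mod_def
  proof (intro allI impI)
    fix N assume N: "submodule N R (free_mod R 0)"
    have "N = {\<zero>\<^bsub>free_mod R 0\<^esub>}"
      using F.submoduleE(1)[OF N] submodule_zero[OF free_module N] by (auto simp: free_mod_def restrict_def)
    then show "fg_sub R (free_mod R 0) N" using fg_sub_zero[OF free_module] by simp
  qed
next
  case (Suc n)
  let ?h = "\<lambda>v\<in>carrier (free_mod R (Suc n)). \<lambda>i\<in>{..<n}. v i"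
  have h: "?h \<in> mod_hom R (free_mod R (Suc n)) (free_mod R n)"
    by (rule mod_homI[OF free_module]) (auto simp: free_coord intro!: free_eqI[of _ n])
  show ?case
  proof (rule noeth_mod_extension[OF free_module free_module h Suc])
    fix N assume N: "submodule N R (free_mod R (Suc n))" and z: "\<And>x. x \<in> N \<Longrightarrow> ?h x = \<zero>\<^bsub>free_mod R n\<^esub>"
    interpret F: module R "free_mod R (Suc n)" by (rule free_module)
    have c: "(\<lambda>v\<in>carrier (free_mod R (Suc n)). v n) \<in> mod_hom R (free_mod R (Suc n)) (ring_as_module R)"
      by (rule free_coord_hom) simp
    show "fg_sub R (free_mod R (Suc n)) N"
    proof (rule fg_sub_extension[OF free_module RR_module c N])
      show "fg_sub R (ring_as_module R) ((\<lambda>v\<in>carrier (free_mod R (Suc n)). v n) ` N)"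
        using noeth_RR mod_hom_image_submodule[OF free_module RR_module c N] unfolding noeth_mod_def by blast
      have *: "x = \<zero>\<^bsub>free_mod R (Suc n)\<^esub>" if x: "x \<in> N" "x n = \<zero>" for x
      proof (rule free_eqI[of _ "Suc n"])
        show xc: "x \<in> carrier (free_mod R (Suc n))" using x F.submoduleE(1)[OF N] by blast
        fix i assume i: "i < Suc n"
        show "x i = \<zero>\<^bsub>free_mod R (Suc n)\<^esub> i"
        proof (cases "i = n")
          case False
          then have "i < n" using i by simp
          then show ?thesis using fun_cong[OF z[OF x(1)], of i] xc i by simp
        qed (use x i in simp)
      qed simp
      have "\<zero>\<^bsub>free_mod R (Suc n)\<^esub> \<in> N" by (rule submodule_zero[OF free_module N])
      then have "N \<inter> {x \<in> carrier (free_mod R (Suc n)). (\<lambda>v\<in>carrier (free_mod R (Suc n)). v n) x = \<zero>\<^bsub>ring_as_module R\<^esub>}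
          = {\<zero>\<^bsub>free_mod R (Suc n)\<^esub>}"
      proof (intro subset_antisym subsetI)
        fix x assume "x \<in> N \<inter> {x \<in> carrier (free_mod R (Suc n)). (\<lambda>v\<in>carrier (free_mod R (Suc n)). v n) x = \<zero>\<^bsub>ring_as_module R\<^esub>}"
        then have "x \<in> N" "x n = \<zero>" by auto
        then have "x = \<zero>\<^bsub>free_mod R (Suc n)\<^esub>" by (rule *)
        then show "x \<in> {\<zero>\<^bsub>free_mod R (Suc n)\<^esub>}" by blast
      qed simp
      then show "fg_sub R (free_mod R (Suc n)) (N \<inter> {x \<in> carrier (free_mod R (Suc n)).
          (\<lambda>v\<in>carrier (free_mod R (Suc n)). v n) x = \<zero>\<^bsub>ring_as_module R\<^esub>})"
        using fg_sub_zero[OF free_module] by simp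
    qed
  qed
qed

lemma noeth_fg: "fg_module R M \<Longrightarrow> noeth_mod R M"
  by (metis fg_coverE fg_module_iff noeth_free noeth_mod_image free_module)

text \<open>Evaluation at \<open>n\<close> generators of \<open>X\<close> embeds the homomorphisms
  into the \<open>n\<close>-fold power of \<open>Y\<close>. Instead of forming the power, the
  induction treats submodules whose members vanish on the generators from number \<open>k\<close>
  on. Applied to endomorphisms of an approximation, this is the finiteness that produces a single
  \<open>e\<close>.\<close>

lemma noeth_Hom:
  assumes X: "fg_module R X" and Y: "fg_module R Y"
  shows "noeth_mod R (Hom_mod R X Y)"
proof -
  have Xm: "module R X" and Ym: "module R Y" using X Y by (auto simp: fg_module_iff)
  interpret Y: module R Y by (rule Ym)
  interpret H: module R "Hom_mod R X Y" by (rule Hom_mod_module[OF Xm Ym])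
  obtain n p where p: "p \<in> mod_hom R (free_mod R n) X" "p ` carrier (free_mod R n) = carrier X"
    using X by (rule fg_coverE)
  let ?b = "\<lambda>j. p (free_basis R n j)"
  have b: "?b j \<in> carrier X" for j using mod_hom_closed[OF p(1)] by simp
  have "fg_sub R (Hom_mod R X Y) N"
    if "k \<le> n" "submodule N R (Hom_mod R X Y)" "\<And>f j. f \<in> N \<Longrightarrow> k \<le> j \<Longrightarrow> j < n \<Longrightarrow> f (?b j) = \<zero>\<^bsub>Y\<^esub>" for k N
    using that
  proof (induction k arbitrary: N)
    case 0
    have "f = \<zero>\<^bsub>Hom_mod R X Y\<^esub>" if f: "f \<in> N" for f
    proof -
      have fh: "f \<in> mod_hom R X Y" using f H.submoduleE(1)[OF 0(2)] by auto
      have "f x = \<zero>\<^bsub>Y\<^esub>" if x: "x \<in> carrier X" for x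
      proof -
        obtain v where v: "v \<in> carrier (free_mod R n)" "x = p v" using x p(2) by blast
        have "compose (carrier (free_mod R n)) f p v = (\<lambda>x\<in>carrier (free_mod R n). \<zero>\<^bsub>Y\<^esub>) v"
          by (rule free_hom_eq[OF Ym mod_hom_compose[OF free_module p(1) fh] mod_hom_zero_map[OF free_module Ym] _ v(1)])
            (use 0(3)[OF f] in \<open>simp add: compose_def\<close>)
        then show ?thesis using v by (simp add: compose_def)
      qed
      then show ?thesis using mod_hom_eqI[OF fh mod_hom_zero_map[OF Xm Ym]] by simp
    qed
    then have "N = {\<zero>\<^bsub>Hom_mod R X Y\<^esub>}" using submodule_zero[OF H.module_axioms 0(2)] by blast
    then show ?case using fg_sub_zero[OF H.module_axioms] by simp
  next
    case (Suc k)
    let ?e = "\<lambda>f\<in>carrier (Hom_mod R X Y). f (?b k)"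
    have e: "?e \<in> mod_hom R (Hom_mod R X Y) Y"
      by (rule mod_homI[OF H.module_axioms]) (use b in \<open>auto simp: mod_hom_closed\<close>)
    show ?case
    proof (rule fg_sub_extension[OF H.module_axioms Ym e Suc(3)])
      show "fg_sub R Y (?e ` N)"
        using noeth_fg[OF Y] mod_hom_image_submodule[OF H.module_axioms Ym e Suc(3)] unfolding noeth_mod_def by blast
      show "fg_sub R (Hom_mod R X Y) (N \<inter> {f \<in> carrier (Hom_mod R X Y). ?e f = \<zero>\<^bsub>Y\<^esub>})"
      proof (rule Suc.IH)
        show "submodule (N \<inter> {f \<in> carrier (Hom_mod R X Y). ?e f = \<zero>\<^bsub>Y\<^esub>}) R (Hom_mod R X Y)"
          by (rule submodule_Int[OF H.module_axioms Suc(3) mod_hom_kernel_submodule[OF H.module_axioms Ym e]])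
        fix f j assume f: "f \<in> N \<inter> {f \<in> carrier (Hom_mod R X Y). ?e f = \<zero>\<^bsub>Y\<^esub>}" and j: "k \<le> j" "j < n"
        show "f (?b j) = \<zero>\<^bsub>Y\<^esub>"
          using f j Suc(4)[of f j] by (cases "j = k") auto
      qed (use Suc.prems(1) in simp)
    qed
  qed
  from this[of n] show ?thesis unfolding noeth_mod_def by auto
qed

text \<open>Noetherianity of \<open>M\<close> generates the image of \<open>i\<close>; injectivity
  carries the generators back to \<open>K\<close>.\<close>

lemma fg_submodule:
  assumes "fg_module R M" "module R K" "i \<in> mod_hom R K M" "inj_on i (carrier K)"
  shows "fg_module R K"
proof -
  have M: "module R M" using assms(1) by (simp add: fg_module_iff)
  interpret K: module R K by fact
  have "fg_sub R M (i ` carrier K)"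
    using noeth_fg[OF assms(1)] mod_hom_image_submodule[OF assms(2) M assms(3) K.carrier_is_submodule]
    unfolding noeth_mod_def by blast
  then obtain m p where p: "p \<in> mod_hom R (free_mod R m) M" "p ` carrier (free_mod R m) = i ` carrier K"
    unfolding fg_sub_def by blast
  obtain h where h: "h \<in> mod_hom R (free_mod R m) K" "\<And>a. a \<in> carrier (free_mod R m) \<Longrightarrow> i (h a) = p a"
    using mod_hom_into[OF free_module assms(2) M assms(3,4) p(1)] p(2) by blast
  have "h ` carrier (free_mod R m) = carrier K"
  proof (intro subset_antisym subsetI)
    fix k assume k: "k \<in> carrier K"
    then obtain v where v: "v \<in> carrier (free_mod R m)" "i k = p v" using p(2) by blast
    then have "i k = i (h v)" using h(2) by simp
    then have "k = h v" using inj_onD[OF assms(4) _ k mod_hom_closed[OF h(1) v(1)]] by simp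
    then show "k \<in> h ` carrier (free_mod R m)" using v by blast
  qed (use mod_hom_closed[OF h(1)] in auto)
  then show ?thesis using assms(2) fg_subI[OF h(1)] unfolding fg_module_iff by blast
qed

end

subsection \<open>Short exact sequences\<close>

lemma mod_hom_closed2: "f \<in> mod_hom R X Y \<Longrightarrow> g \<in> mod_hom R Y Z \<Longrightarrow> x \<in> carrier X \<Longrightarrow> g (f x) \<in> carrier Z"
  using mod_hom_closed[of f R X Y x] mod_hom_closed[of g R Y Z "f x"] by simp

definition exseq ::
  "('a,'r) ring_scheme \<Rightarrow> ('a,'k,'s) module_scheme \<Rightarrow> ('a,'f,'t) module_scheme \<Rightarrow> ('a,'x,'u) module_scheme \<Rightarrow>
    ('k \<Rightarrow> 'f) \<Rightarrow> ('f \<Rightarrow> 'x) \<Rightarrow> bool" where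
  "exseq R K F X i p \<longleftrightarrow> module R K \<and> module R F \<and> module R X \<and>
     i \<in> mod_hom R K F \<and> inj_on i (carrier K) \<and> p \<in> mod_hom R F X \<and> p ` carrier F = carrier X \<and>
     i ` carrier K = {v \<in> carrier F. p v = \<zero>\<^bsub>X\<^esub>}"

text \<open>This is surjectivity of the dual of \<open>i\<close>, so that dualising keeps the
  sequence exact at that end.\<close>

definition extends ::
  "('a,'r) ring_scheme \<Rightarrow> ('a,'k,'s) module_scheme \<Rightarrow> ('a,'f,'t) module_scheme \<Rightarrow> ('k \<Rightarrow> 'f) \<Rightarrow> bool" where
  "extends R K F i \<longleftrightarrow> (\<forall>f\<in>mod_hom R K (ring_as_module R). \<exists>g\<in>mod_hom R F (ring_as_module R).
     \<forall>k\<in>carrier K. g (i k) = f k)"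

lemma exseqD:
  assumes "exseq R K F X i p"
  shows "module R K" "module R F" "module R X" "i \<in> mod_hom R K F" "inj_on i (carrier K)"
    "p \<in> mod_hom R F X" "p ` carrier F = carrier X" "i ` carrier K = {v \<in> carrier F. p v = \<zero>\<^bsub>X\<^esub>}"
  using assms unfolding exseq_def by auto

lemma exseq_zero: "exseq R K F X i p \<Longrightarrow> k \<in> carrier K \<Longrightarrow> p (i k) = \<zero>\<^bsub>X\<^esub>"
  unfolding exseq_def by blast

lemma exseq_inj: "exseq R K F X i p \<Longrightarrow> k \<in> carrier K \<Longrightarrow> k' \<in> carrier K \<Longrightarrow> i k = i k' \<Longrightarrow> k = k'"
  unfolding exseq_def inj_on_def by blast

lemma exseq_exact:
  assumes "exseq R K F X i p" "v \<in> carrier F" "p v = \<zero>\<^bsub>X\<^esub>"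
  obtains k where "k \<in> carrier K" "v = i k"
  using assms unfolding exseq_def by blast

lemma exseq_surj:
  assumes "exseq R K F X i p" "x \<in> carrier X"
  obtains v where "v \<in> carrier F" "x = p v"
  using assms unfolding exseq_def by blast

lemma exseq_into:
  assumes E: "exseq R K F X i p" and A: "module R A" and g: "g \<in> mod_hom R A F"
    and z: "\<And>a. a \<in> carrier A \<Longrightarrow> p (g a) = \<zero>\<^bsub>X\<^esub>"
  obtains h where "h \<in> mod_hom R A K" "\<And>a. a \<in> carrier A \<Longrightarrow> i (h a) = g a"
proof (rule mod_hom_into[OF A exseqD(1,2,4,5)[OF E] g])
  fix a assume a: "a \<in> carrier A"
  show "g a \<in> i ` carrier K" using exseqD(8)[OF E] mod_hom_closed[OF g a] z[OF a] by simp
qed (use that in blast)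

lemma exseq_descend:
  assumes E: "exseq R K F X i p" and A: "module R A" and g: "g \<in> mod_hom R F A"
    and z: "\<And>k. k \<in> carrier K \<Longrightarrow> g (i k) = \<zero>\<^bsub>A\<^esub>"
  obtains h where "h \<in> mod_hom R X A" "\<And>v. v \<in> carrier F \<Longrightarrow> h (p v) = g v"
proof (rule mod_hom_descend[OF exseqD(2,3)[OF E] A exseqD(6,7)[OF E] g])
  fix v assume "v \<in> carrier F" "p v = \<zero>\<^bsub>X\<^esub>"
  then show "g v = \<zero>\<^bsub>A\<^esub>" using exseq_exact[OF E] z by metis
qed (use that in blast)

lemma extendsD:
  assumes "extends R K F i" "f \<in> mod_hom R K (ring_as_module R)"
  obtains g where "g \<in> mod_hom R F (ring_as_module R)" "\<And>k. k \<in> carrier K \<Longrightarrow> g (i k) = f k"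
  using assms unfolding extends_def by blast

context cring
begin

text \<open>A kernel inside R^n consists of tuples, while objects are carried by sets of tuples;
  singletons embed the former into the latter.\<close>

lemma kernel_obj:
  assumes X: "module R X" and p: "p \<in> mod_hom R (free_mod R n) X"
  obtains K :: "'a obj" and i where "module R K" "i \<in> mod_hom R K (free_mod R n)" "inj_on i (carrier K)"
    "i ` carrier K = {v \<in> carrier (free_mod R n). p v = \<zero>\<^bsub>X\<^esub>}"
proof -
  let ?N = "{v \<in> carrier (free_mod R n). p v = \<zero>\<^bsub>X\<^esub>}"
  let ?B = "(free_mod R n)\<lparr>carrier := ?N\<rparr>"
  have N: "submodule ?N R (free_mod R n)" by (rule mod_hom_kernel_submodule[OF free_module X p])
  have B: "module R ?B" by (rule submodule.submodule_is_module[OF N free_module])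
  obtain K :: "'a obj" and f where K: "module R K" "f \<in> mod_hom R ?B K" "inj_on f (carrier ?B)"
    "f ` carrier ?B = carrier K"
    by (rule module_copy[OF B, of "\<lambda>v. {v}"]) (auto simp: inj_on_def)
  obtain g where g: "g \<in> mod_hom R K ?B" "\<And>x. x \<in> carrier ?B \<Longrightarrow> g (f x) = x"
    "\<And>y. y \<in> carrier K \<Longrightarrow> f (g y) = y"
    using mod_iso_inverse[OF B K(1-4)] by blast
  have gN: "g k \<in> ?N" if "k \<in> carrier K" for k using mod_hom_closed[OF g(1) that] by simp
  have gF: "g \<in> mod_hom R K (free_mod R n)"
    using g(1) gN unfolding mod_hom_def by auto
  show ?thesis
  proof (rule that[OF K(1) gF])
    show "inj_on g (carrier K)" by (rule inj_on_inverseI[of _ f]) (rule g(3))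
    show "g ` carrier K = ?N"
    proof (intro subset_antisym subsetI)
      fix v assume v: "v \<in> ?N"
      then have "v = g (f v)" "f v \<in> carrier K" using g(2) mod_hom_closed[OF K(2)] by auto
      then show "v \<in> g ` carrier K" by blast
    qed (use gN in auto)
  qed
qed

lemma kernel_exseq:
  assumes X: "module R X" and p: "p \<in> mod_hom R (free_mod R n) X" "p ` carrier (free_mod R n) = carrier X"
  obtains K :: "'a obj" and i where "exseq R K (free_mod R n) X i p"
proof -
  obtain K :: "'a obj" and i where "module R K" "i \<in> mod_hom R K (free_mod R n)" "inj_on i (carrier K)"
    "i ` carrier K = {v \<in> carrier (free_mod R n). p v = \<zero>\<^bsub>X\<^esub>}"
    using X p(1) by (rule kernel_obj)
  then have "exseq R K (free_mod R n) X i p" using X p free_module unfolding exseq_def by simp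
  then show ?thesis by (rule that)
qed

lemma cover_exseq:
  assumes X: "fg_module R X"
  obtains n and K :: "'a obj" and i p where "exseq R K (free_mod R n) X i p"
  by (metis X fg_coverE fg_module_iff kernel_exseq)

text \<open>\<open>B\<close> may have any carrier type. A class modulo \<open>N\<close> is encoded
  by the set of coordinate vectors that a fixed free cover maps into it, which is a set of the type
  prescribed for objects.\<close>

lemma obj_quotient:
  assumes B: "fg_module R B" and N: "submodule N R B"
  obtains Q :: "'a obj" and f where "fg_module R Q" "f \<in> mod_hom R B Q"
    "f ` carrier B = carrier Q" "\<And>x. x \<in> carrier B \<Longrightarrow> f x = \<zero>\<^bsub>Q\<^esub> \<longleftrightarrow> x \<in> N"
proof -
  have Bm: "module R B" using B by (simp add: fg_module_iff)
  interpret B: module R B by (rule Bm)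
  note NE = B.submoduleE[OF N]
  obtain n p where p: "p \<in> mod_hom R (free_mod R n) B" "p ` carrier (free_mod R n) = carrier B"
    using B by (rule fg_coverE)
  let ?q = "\<lambda>b. {v \<in> carrier (free_mod R n). p v \<ominus>\<^bsub>B\<^esub> b \<in> N}"
  have tri: "(a \<ominus>\<^bsub>B\<^esub> x) \<ominus>\<^bsub>B\<^esub> (a \<ominus>\<^bsub>B\<^esub> y) = y \<ominus>\<^bsub>B\<^esub> x" "(a \<ominus>\<^bsub>B\<^esub> x) \<oplus>\<^bsub>B\<^esub> (x \<ominus>\<^bsub>B\<^esub> y) = a \<ominus>\<^bsub>B\<^esub> y"
    if "a \<in> carrier B" "x \<in> carrier B" "y \<in> carrier B" for a x y
    using that by (simp_all add: a_minus_def B.minus_add B.a_ac B.r_neg1 B.r_neg2)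
  have q: "?q x = ?q y \<longleftrightarrow> x \<ominus>\<^bsub>B\<^esub> y \<in> N" if x: "x \<in> carrier B" and y: "y \<in> carrier B" for x y
  proof
    assume eq: "?q x = ?q y"
    obtain v where v: "v \<in> carrier (free_mod R n)" "x = p v" using p(2) x by blast
    then have "v \<in> ?q x" using x submodule_zero[OF Bm N] by simp
    then have "v \<in> ?q y" using eq by simp
    then show "x \<ominus>\<^bsub>B\<^esub> y \<in> N" using v by simp
  next
    assume xy: "x \<ominus>\<^bsub>B\<^esub> y \<in> N"
    have yx: "y \<ominus>\<^bsub>B\<^esub> x \<in> N" using NE(3)[OF xy] x y by (simp add: a_minus_def B.minus_add B.a_comm)
    show "?q x = ?q y"
    proof (intro Collect_cong conj_cong refl iffI)
      fix v assume v: "v \<in> carrier (free_mod R n)"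
      note pv = mod_hom_closed[OF p(1) v]
      show "p v \<ominus>\<^bsub>B\<^esub> y \<in> N" if "p v \<ominus>\<^bsub>B\<^esub> x \<in> N" using NE(5)[OF that xy] tri(2)[OF pv x y] by simp
      show "p v \<ominus>\<^bsub>B\<^esub> x \<in> N" if "p v \<ominus>\<^bsub>B\<^esub> y \<in> N" using NE(5)[OF that yx] tri(2)[OF pv y x] by simp
    qed
  qed
  show ?thesis
  proof (rule module_on_image[OF Bm N, of ?q])
    fix Q :: "'a obj" and f assume Q: "module R Q" "f \<in> mod_hom R B Q" "f ` carrier B = carrier Q"
      "\<And>x. x \<in> carrier B \<Longrightarrow> f x = \<zero>\<^bsub>Q\<^esub> \<longleftrightarrow> x \<in> N"
    show thesis by (rule that[OF fg_module_image[OF B Q(1,2,3)] Q(2,3,4)])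
  qed (rule q)
qed

lemma kernel_zero_inj:
  assumes A: "module R A" and B: "module R B" and f: "f \<in> mod_hom R A B"
    and z: "\<And>x. x \<in> carrier A \<Longrightarrow> f x = \<zero>\<^bsub>B\<^esub> \<Longrightarrow> x = \<zero>\<^bsub>A\<^esub>"
  shows "inj_on f (carrier A)"
proof (rule inj_onI)
  interpret A: module R A by fact
  interpret B: module R B by fact
  fix x y assume xy: "x \<in> carrier A" "y \<in> carrier A" "f x = f y"
  then have "f (x \<ominus>\<^bsub>A\<^esub> y) = \<zero>\<^bsub>B\<^esub>"
    using mod_hom_minus[OF A B f xy(1,2)] mod_hom_closed[OF f xy(2)] B.sub_self by simp
  then show "x = y" using z[of "x \<ominus>\<^bsub>A\<^esub> y"] xy A.sub_eq_iff by simp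
qed

text \<open>The quotient by zero, used only to change the carrier type of a finitely generated
  module.\<close>

lemma obj_copy:
  assumes B: "fg_module R B"
  obtains Q :: "'a obj" and f g where "fg_module R Q" "f \<in> mod_hom R B Q" "g \<in> mod_hom R Q B"
    "\<And>x. x \<in> carrier B \<Longrightarrow> g (f x) = x" "\<And>y. y \<in> carrier Q \<Longrightarrow> f (g y) = y"
proof -
  have Bm: "module R B" using B by (simp add: fg_module_iff)
  obtain Q :: "'a obj" and f where Q: "fg_module R Q" "f \<in> mod_hom R B Q"
    "f ` carrier B = carrier Q" "\<And>x. x \<in> carrier B \<Longrightarrow> f x = \<zero>\<^bsub>Q\<^esub> \<longleftrightarrow> x \<in> {\<zero>\<^bsub>B\<^esub>}"
    using obj_quotient[OF B submodule_zero_set[OF Bm]] by blast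
  have Qm: "module R Q" using Q(1) by (simp add: fg_module_iff)
  have "inj_on f (carrier B)" by (rule kernel_zero_inj[OF Bm Qm Q(2)]) (use Q(4) in simp)
  then show ?thesis using mod_iso_inverse[OF Bm Qm Q(2) _ Q(3)] that[OF Q(1,2)] by metis
qed

end

subsection \<open>Modules without extensions by free modules\<close>

text \<open>The sequences \<open>0 \<rightarrow> K \<rightarrow> R\<^sup>n \<rightarrow> X \<rightarrow> 0\<close> along which every linear form on \<open>K\<close> extends are those with
  \<open>Ext\<^sup>1(X, R) = 0\<close>; iterating them coinductively expresses that all \<open>Ext\<^sup>i(X, R)\<close>, \<open>i > 0\<close>, vanish.\<close>

coinductive ext_orth_obj :: "('a,'r) ring_scheme \<Rightarrow> 'a obj \<Rightarrow> bool" for R where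
  "exseq R K (free_mod R n) X i p \<Longrightarrow> extends R K (free_mod R n) i \<Longrightarrow> ext_orth_obj R K \<Longrightarrow> ext_orth_obj R X"

text \<open>The coinductive predicate fixes the carrier type of its argument, but vanishing of Ext
  is also needed for duals. Unfolding it once frees the type, since the kernel can always be taken
  among the objects.\<close>

definition ext_orth :: "('a,'r) ring_scheme \<Rightarrow> ('a,'x,'s) module_scheme \<Rightarrow> bool" where
  "ext_orth R X \<longleftrightarrow> (\<exists>K n i p. exseq R K (free_mod R n) X i p \<and> extends R K (free_mod R n) i \<and> ext_orth_obj R K)"

definition stable_retract ::
  "('a,'r) ring_scheme \<Rightarrow> ('a,'k,'s) module_scheme \<Rightarrow> ('a,'l,'t) module_scheme \<Rightarrow> bool" where
  "stable_retract R K L \<longleftrightarrow> (\<exists>a\<in>mod_hom R K L. \<exists>b\<in>mod_hom R L K. \<exists>n. \<exists>s\<in>mod_hom R K (free_mod R n).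
     \<exists>t\<in>mod_hom R (free_mod R n) K. \<forall>x\<in>carrier K. x = b (a x) \<oplus>\<^bsub>K\<^esub> t (s x))"

lemma ext_orth_obj_iff: "ext_orth_obj R X \<longleftrightarrow> ext_orth R X"
  unfolding ext_orth_def by (subst ext_orth_obj.simps) blast

lemma ext_orthI:
  fixes K :: "'a obj"
  shows "exseq R K (free_mod R n) X i p \<Longrightarrow> extends R K (free_mod R n) i \<Longrightarrow> ext_orth R K \<Longrightarrow> ext_orth R X"
  unfolding ext_orth_def[of R X] ext_orth_obj_iff by blast

lemma ext_orthE:
  assumes "ext_orth R (X :: ('a,'x,'s) module_scheme)"
  obtains K :: "'a obj" and n i p where "exseq R K (free_mod R n) X i p" "extends R K (free_mod R n) i" "ext_orth R K"
  using assms unfolding ext_orth_def[of R X] ext_orth_obj_iff by blast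

context cring
begin

lemma stable_retract_iso:
  assumes K: "module R K" and f: "f \<in> mod_hom R K L" and g: "g \<in> mod_hom R L K" and gf: "\<And>x. x \<in> carrier K \<Longrightarrow> g (f x) = x"
  shows "stable_retract R K L"
proof -
  interpret K: module R K by fact
  have z: "(\<lambda>x\<in>carrier K. \<zero>\<^bsub>free_mod R 0\<^esub>) \<in> mod_hom R K (free_mod R 0)"
    "(\<lambda>x\<in>carrier (free_mod R 0). \<zero>\<^bsub>K\<^esub>) \<in> mod_hom R (free_mod R 0) K"
    using mod_hom_zero_map K free_module by blast+
  show ?thesis unfolding stable_retract_def
    by (rule bexI[OF _ f], rule bexI[OF _ g], rule exI[of _ 0], rule bexI[OF _ z(1)], rule bexI[OF _ z(2)])
      (use gf in simp)
qed

lemma stable_retract_refl: "module R K \<Longrightarrow> stable_retract R K K"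
  by (rule stable_retract_iso[OF _ mod_hom_id mod_hom_id]) auto

text \<open>Schanuel's lemma in the generality of stable retracts: \<open>a\<close>,
  \<open>b\<close> and \<open>t\<close> lift to the covers and restrict to the kernels. With
  \<open>K\<close> and \<open>K'\<close> equal it compares two covers of one module.\<close>

lemma stable_retract_syzygy:
  assumes sr: "stable_retract R K K'" and E: "exseq R L (free_mod R m) K l p"
    and E': "exseq R L' (free_mod R m') K' l' p'"
  shows "stable_retract R L L' \<and> (extends R L' (free_mod R m') l' \<longrightarrow> extends R L (free_mod R m) l)"
proof -
  let ?F = "free_mod R m" and ?F' = "free_mod R m'"
  note D = exseqD[OF E] and D' = exseqD[OF E']
  interpret K: module R K by (rule D(3))
  interpret L: module R L by (rule D(1))
  interpret F: module R ?F by (rule free_module)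
  obtain a b n s t where a: "a \<in> mod_hom R K K'" and b: "b \<in> mod_hom R K' K"
    and s: "s \<in> mod_hom R K (free_mod R n)" and t: "t \<in> mod_hom R (free_mod R n) K"
    and eq: "\<And>x. x \<in> carrier K \<Longrightarrow> x = b (a x) \<oplus>\<^bsub>K\<^esub> t (s x)"
    using sr unfolding stable_retract_def by blast
  obtain a1 where a1: "a1 \<in> mod_hom R ?F ?F'" "\<And>v. v \<in> carrier ?F \<Longrightarrow> p' (a1 v) = a (p v)"
    using free_projective[OF D'(2,3,6,7) mod_hom_compose[OF free_module D(6) a]] by (auto simp: compose_def)
  obtain b1 where b1: "b1 \<in> mod_hom R ?F' ?F" "\<And>v. v \<in> carrier ?F' \<Longrightarrow> p (b1 v) = b (p' v)"
    using free_projective[OF D(2,3,6,7) mod_hom_compose[OF free_module D'(6) b]] by (auto simp: compose_def)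
  obtain t1 where t1: "t1 \<in> mod_hom R (free_mod R n) ?F" "\<And>v. v \<in> carrier (free_mod R n) \<Longrightarrow> p (t1 v) = t v"
    using free_projective[OF D(2,3,6,7) t] by auto
  obtain a2 where a2: "a2 \<in> mod_hom R L L'" "\<And>x. x \<in> carrier L \<Longrightarrow> l' (a2 x) = a1 (l x)"
  proof (rule exseq_into[OF E' D(1) mod_hom_compose[OF D(1,4) a1(1)]])
    show "\<And>x. x \<in> carrier L \<Longrightarrow> p' (compose (carrier L) a1 l x) = \<zero>\<^bsub>K'\<^esub>"
      using a1(2) mod_hom_closed[OF D(4)] exseq_zero[OF E] mod_hom_zero[OF D(3) D'(3) a] by (simp add: compose_def)
  qed (auto simp: compose_def)
  obtain b2 where b2: "b2 \<in> mod_hom R L' L" "\<And>x. x \<in> carrier L' \<Longrightarrow> l (b2 x) = b1 (l' x)"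
  proof (rule exseq_into[OF E D'(1) mod_hom_compose[OF D'(1,4) b1(1)]])
    show "\<And>x. x \<in> carrier L' \<Longrightarrow> p (compose (carrier L') b1 l' x) = \<zero>\<^bsub>K\<^esub>"
      using b1(2) mod_hom_closed[OF D'(4)] exseq_zero[OF E'] mod_hom_zero[OF D'(3) D(3) b] by (simp add: compose_def)
  qed (auto simp: compose_def)
  \<comment> \<open>The defect of \<open>b1 a1 + t1 s p\<close> from the identity of the cover. It
    lies over \<open>1 - (b a + t s) = 0\<close> on \<open>K\<close>, so it factors through
    \<open>L\<close>; on \<open>L\<close> itself the term \<open>t1 s p\<close> vanishes because
    \<open>p l = 0\<close>.\<close>
  define d where "d = (\<lambda>v\<in>carrier ?F. v \<ominus>\<^bsub>?F\<^esub> (b1 (a1 v) \<oplus>\<^bsub>?F\<^esub> t1 (s (p v))))"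
  have dh: "d \<in> mod_hom R ?F ?F"
  proof -
    have 1: "compose (carrier ?F) b1 a1 \<in> mod_hom R ?F ?F" by (rule mod_hom_compose[OF free_module a1(1) b1(1)])
    have 2: "compose (carrier ?F) t1 (compose (carrier ?F) s p) \<in> mod_hom R ?F ?F"
      by (rule mod_hom_compose[OF free_module mod_hom_compose[OF free_module D(6) s] t1(1)])
    have "(\<lambda>v\<in>carrier ?F. (\<lambda>v\<in>carrier ?F. v) v \<ominus>\<^bsub>?F\<^esub> (\<lambda>v\<in>carrier ?F. compose (carrier ?F) b1 a1 v \<oplus>\<^bsub>?F\<^esub>
        compose (carrier ?F) t1 (compose (carrier ?F) s p) v) v) = d"
      unfolding d_def by (rule restrict_ext) (simp add: compose_def)
    then show ?thesis
      using mod_hom_minus_map[OF D(2,2) mod_hom_id[OF D(2)] mod_hom_add_map[OF D(2,2) 1 2]] by simp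
  qed
  have c: "b1 (a1 v) \<in> carrier ?F" "s (p v) \<in> carrier (free_mod R n)" "t1 (s (p v)) \<in> carrier ?F"
    if "v \<in> carrier ?F" for v
    using that mod_hom_closed2[OF a1(1) b1(1) that] mod_hom_closed2[OF D(6) s that]
      mod_hom_closed[OF t1(1) mod_hom_closed2[OF D(6) s that]] by auto
  obtain u where u: "u \<in> mod_hom R ?F L" "\<And>v. v \<in> carrier ?F \<Longrightarrow> l (u v) = d v"
  proof (rule exseq_into[OF E D(2) dh])
    fix v assume v: "v \<in> carrier ?F"
    note pv = mod_hom_closed[OF D(6) v]
    have "p (d v) = p v \<ominus>\<^bsub>K\<^esub> (b (a (p v)) \<oplus>\<^bsub>K\<^esub> t (s (p v)))"
      using v c[OF v] a1 b1 t1(2) mod_hom_closed[OF a1(1) v]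
      by (simp add: d_def mod_hom_minus[OF D(2,3,6)] mod_hom_add[OF D(6)])
    also have "\<dots> = \<zero>\<^bsub>K\<^esub>" using eq[OF pv] pv by simp
    finally show "p (d v) = \<zero>\<^bsub>K\<^esub>" .
  qed blast
  have main: "x = b2 (a2 x) \<oplus>\<^bsub>L\<^esub> u (l x)" if x: "x \<in> carrier L" for x
  proof -
    note lx = mod_hom_closed[OF D(4) x]
    have ba: "b2 (a2 x) \<in> carrier L" by (rule mod_hom_closed2[OF a2(1) b2(1) x])
    have tz: "t1 (s (p (l x))) = \<zero>\<^bsub>?F\<^esub>"
      using exseq_zero[OF E x] mod_hom_zero[OF D(3) free_module s] mod_hom_zero[OF free_module D(2) t1(1)] by simp
    have "l (u (l x)) = l x \<ominus>\<^bsub>?F\<^esub> b1 (a1 (l x))" using u(2)[OF lx] lx c(1)[OF lx] by (simp add: d_def tz)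
    also have "b1 (a1 (l x)) = l (b2 (a2 x))" using a2 b2 x mod_hom_closed[OF a2(1) x] by simp
    also have "l x \<ominus>\<^bsub>?F\<^esub> l (b2 (a2 x)) = l (x \<ominus>\<^bsub>L\<^esub> b2 (a2 x))"
      using mod_hom_minus[OF D(1,2,4) x ba] by simp
    finally have "u (l x) = x \<ominus>\<^bsub>L\<^esub> b2 (a2 x)"
      using exseq_inj[OF E] mod_hom_closed[OF u(1) lx] x ba by simp
    then show ?thesis using L.sub_add_cancel[OF x ba] x ba by (simp add: L.a_comm)
  qed
  have "extends R L ?F l" if ext: "extends R L' ?F' l'"
    unfolding extends_def
  proof
    fix f assume f: "f \<in> mod_hom R L (ring_as_module R)"
    obtain g where g: "g \<in> mod_hom R ?F' (ring_as_module R)" "\<And>y. y \<in> carrier L' \<Longrightarrow> g (l' y) = f (b2 y)"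
      using extendsD[OF ext mod_hom_compose[OF D'(1) b2(1) f]] by (auto simp: compose_def)
    \<comment> \<open>The identity of \<open>L\<close> is \<open>b2 a2 + u l\<close>, so
      \<open>f\<close> is the sum of \<open>f b2 a2\<close> and \<open>f u l\<close>. The form
      \<open>f b2\<close> extends to \<open>g\<close> on the second cover, and \<open>f u\<close> is
      already defined on the first.\<close>
    have h: "(\<lambda>v\<in>carrier ?F. g (a1 v) \<oplus> f (u v)) \<in> mod_hom R ?F (ring_as_module R)"
      using mod_hom_add_map[OF D(2) RR_module mod_hom_compose[OF D(2) a1(1) g(1)] mod_hom_compose[OF D(2) u(1) f]]
      by (simp add: compose_def cong: restrict_cong)
    have "g (a1 (l x)) \<oplus> f (u (l x)) = f x" if x: "x \<in> carrier L" for x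
    proof -
      have c: "b2 (a2 x) \<in> carrier L" "u (l x) \<in> carrier L" "a2 x \<in> carrier L'"
        using mod_hom_closed2[OF a2(1) b2(1) x] mod_hom_closed2[OF D(4) u(1) x] mod_hom_closed[OF a2(1) x] by auto
      have "f x = f (b2 (a2 x)) \<oplus> f (u (l x))"
        using mod_hom_add[OF f c(1,2)] main[OF x] by simp
      then show ?thesis using g(2)[OF c(3)] a2(2)[OF x] by simp
    qed
    then show "\<exists>g\<in>mod_hom R ?F (ring_as_module R). \<forall>k\<in>carrier L. g (l k) = f k"
      using h mod_hom_closed[OF D(4)] by (intro bexI[OF _ h]) simp
  qed
  moreover have "stable_retract R L L'"
    unfolding stable_retract_def using a2(1) b2(1) D(4) u(1) main by blast
  ultimately show ?thesis by blast
qed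

end

section \<open>Closure properties of the modules with vanishing Ext into the ring\<close>

context noetherian_cring
begin

lemma exseq_fg: "exseq R K F X i p \<Longrightarrow> fg_module R F \<Longrightarrow> fg_module R K"
  using fg_submodule[OF _ exseqD(1,4,5)] .

text \<open>The coinductive invariant is to be a finitely generated stable retract of some module in
  the class: the kernel of any cover inherits it by \<open>stable_retract_syzygy\<close>.\<close>

lemma ext_orth_obj_retract:
  assumes "stable_retract R K K'" "ext_orth_obj R K'" "fg_module R K"
  shows "ext_orth_obj R K"
proof -
  have "\<exists>K'. stable_retract R K K' \<and> ext_orth_obj R K' \<and> fg_module R K" using assms by blast
  then show ?thesis
  proof (coinduction arbitrary: K)
    case (ext_orth_obj K)
    then obtain K' :: "'a obj" where K': "stable_retract R K K'" "ext_orth R K'" "fg_module R K"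
      unfolding ext_orth_obj_iff by blast
    obtain L' :: "'a obj" and n' i' p' where L': "exseq R L' (free_mod R n') K' i' p'" "extends R L' (free_mod R n') i'" "ext_orth R L'"
      using K'(2) by (rule ext_orthE)
    obtain n i p and L :: "'a obj" where L: "exseq R L (free_mod R n) K i p"
      using K'(3) by (rule cover_exseq)
    have "stable_retract R L L'" "extends R L (free_mod R n) i"
      using stable_retract_syzygy[OF K'(1) L L'(1)] L'(2) by auto
    moreover have "fg_module R L" by (rule exseq_fg[OF L fg_free])
    ultimately show ?case using L L'(3) unfolding ext_orth_obj_iff by (intro exI conjI disjI1) (assumption | rule refl)+
  qed
qed

lemma ext_orth_retract:
  assumes sr: "stable_retract R K K'" and K': "ext_orth R K'" and K: "fg_module R K"
  shows "ext_orth R K"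
proof -
  obtain L' :: "'a obj" and n' i' p' where L': "exseq R L' (free_mod R n') K' i' p'" "extends R L' (free_mod R n') i'" "ext_orth R L'"
    using K' by (rule ext_orthE)
  obtain n i p and L :: "'a obj" where L: "exseq R L (free_mod R n) K i p"
    using K by (rule cover_exseq)
  have "stable_retract R L L'" "extends R L (free_mod R n) i"
    using stable_retract_syzygy[OF sr L L'(1)] L'(2) by auto
  moreover have "fg_module R L" by (rule exseq_fg[OF L fg_free])
  ultimately show ?thesis
    using ext_orthI[OF L] ext_orth_obj_retract[of L L'] L'(3) unfolding ext_orth_obj_iff by blast
qed

text \<open>Independence of the resolution: the given cover is compared with the one hidden in
  \<open>ext_orth\<close>, both being covers of the same \<open>X\<close>.\<close>

lemma ext_orth_syzygy:
  assumes E: "exseq R L (free_mod R m) X l p" and X: "ext_orth R X"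
  shows "extends R L (free_mod R m) l" "ext_orth R L"
proof -
  obtain L' :: "'a obj" and n' i' p' where L': "exseq R L' (free_mod R n') X i' p'" "extends R L' (free_mod R n') i'" "ext_orth R L'"
    using X by (rule ext_orthE)
  note * = stable_retract_syzygy[OF stable_retract_refl[OF exseqD(3)[OF E]] E L'(1)]
  show "extends R L (free_mod R m) l" using * L'(2) by blast
  show "ext_orth R L" using * ext_orth_retract[OF _ L'(3) exseq_fg[OF E fg_free]] by blast
qed

text \<open>\<open>L\<close> may have any carrier type, so it is first replaced by a kernel among
  the objects, of which it is a stable retract and conversely.\<close>

lemma ext_orth_cosyzygy:
  assumes E: "exseq R L (free_mod R m) X l p" and ext: "extends R L (free_mod R m) l" and L: "ext_orth R L"
  shows "ext_orth R X"
proof -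
  obtain K :: "'a obj" and i where K: "exseq R K (free_mod R m) X i p"
    using kernel_exseq exseqD[OF E] by blast
  note * = stable_retract_syzygy[OF stable_retract_refl[OF exseqD(3)[OF E]] K E]
  have "ext_orth R K" using * ext_orth_retract[OF _ L exseq_fg[OF K fg_free]] by blast
  then show ?thesis using ext_orthI[OF K] * ext by blast
qed

lemma fg_ext_orth: "ext_orth R X \<Longrightarrow> fg_module R X"
  by (metis ext_orthE exseqD(3,6,7) fg_free fg_module_image)

text \<open>The horseshoe lemma. The cover of \<open>B\<close> is the sum of the cover of
  \<open>A\<close>, pushed into \<open>B\<close>, and a lift \<open>c\<close> of the cover of
  \<open>C\<close>; the extension property has to be carried along the resulting sequence of
  kernels.\<close>

lemma horseshoe:
  assumes E: "exseq R A B C i p" and EA: "exseq R KA (free_mod R m) A ia pa" and EC: "exseq R KC (free_mod R l) C ic pc"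
    and xA: "extends R KA (free_mod R m) ia" and xC: "extends R KC (free_mod R l) ic"
  obtains KB :: "'a obj" and ib pb j q where "exseq R KB (free_mod R (m + l)) B ib pb" "exseq R KA KB KC j q"
    "extends R KB (free_mod R (m + l)) ib"
proof -
  let ?F = "free_mod R (m + l)"
  note D = exseqD[OF E] and DA = exseqD[OF EA] and DC = exseqD[OF EC]
  interpret A: module R A by (rule D(1))
  interpret B: module R B by (rule D(2))
  interpret C: module R C by (rule D(3))
  interpret Fm: module R "free_mod R m" by (rule free_module)
  interpret Fl: module R "free_mod R l" by (rule free_module)
  interpret RR: module R "ring_as_module R" by (rule RR_module)
  interpret F: module R ?F by (rule free_module)
  obtain i1 i2 p1 p2 where s:
    "i1 \<in> mod_hom R (free_mod R m) (free_mod R (m + l))" "i2 \<in> mod_hom R (free_mod R l) (free_mod R (m + l))"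
    "p1 \<in> mod_hom R (free_mod R (m + l)) (free_mod R m)" "p2 \<in> mod_hom R (free_mod R (m + l)) (free_mod R l)"
    "\<And>v. v \<in> carrier (free_mod R m) \<Longrightarrow> p1 (i1 v) = v"
    "\<And>v. v \<in> carrier (free_mod R m) \<Longrightarrow> p2 (i1 v) = \<zero>\<^bsub>free_mod R l\<^esub>"
    "\<And>v. v \<in> carrier (free_mod R l) \<Longrightarrow> p1 (i2 v) = \<zero>\<^bsub>free_mod R m\<^esub>"
    "\<And>v. v \<in> carrier (free_mod R l) \<Longrightarrow> p2 (i2 v) = v"
    "\<And>v. v \<in> carrier (free_mod R (m + l)) \<Longrightarrow> i1 (p1 v) \<oplus>\<^bsub>free_mod R (m + l)\<^esub> i2 (p2 v) = v"
    by (rule free_split[of m l]) blast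
  obtain c where c: "c \<in> mod_hom R (free_mod R l) B" "\<And>v. v \<in> carrier (free_mod R l) \<Longrightarrow> p (c v) = pc v"
    using free_projective[OF D(2,3,6,7) DC(6)] by blast
  define pb where "pb = (\<lambda>v\<in>carrier ?F. i (pa (p1 v)) \<oplus>\<^bsub>B\<^esub> c (p2 v))"
  have pbh: "pb \<in> mod_hom R ?F B"
    using free_copair[OF D(2) mod_hom_compose[OF free_module DA(6) D(4)] c(1) s(3,4) free_module]
      mod_hom_closed[OF s(3)] unfolding pb_def by (simp add: compose_def cong: restrict_cong)
  have cl: "pa u \<in> carrier A" "i (pa u) \<in> carrier B" "i1 u \<in> carrier ?F" if "u \<in> carrier (free_mod R m)" for u
    using mod_hom_closed[OF DA(6) that] mod_hom_closed2[OF DA(6) D(4) that] mod_hom_closed[OF s(1) that] by auto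
  have cl2: "c w \<in> carrier B" "i2 w \<in> carrier ?F" "pc w \<in> carrier C" if "w \<in> carrier (free_mod R l)" for w
    using mod_hom_closed[OF c(1) that] mod_hom_closed[OF s(2) that] mod_hom_closed[OF DC(6) that] by auto
  have cl3: "p1 v \<in> carrier (free_mod R m)" "p2 v \<in> carrier (free_mod R l)" if "v \<in> carrier ?F" for v
    using mod_hom_closed[OF s(3) that] mod_hom_closed[OF s(4) that] by auto
  have split: "p1 (i1 u \<oplus>\<^bsub>?F\<^esub> i2 w) = u" "p2 (i1 u \<oplus>\<^bsub>?F\<^esub> i2 w) = w" "i1 u \<oplus>\<^bsub>?F\<^esub> i2 w \<in> carrier ?F"
    if "u \<in> carrier (free_mod R m)" "w \<in> carrier (free_mod R l)" for u w
    using cl(3)[OF that(1)] cl2(2)[OF that(2)] s(5-8) that by (simp_all add: mod_hom_add[OF s(3)] mod_hom_add[OF s(4)])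
  have ppb: "p (pb v) = pc (p2 v)" if v: "v \<in> carrier ?F" for v
    using v cl[OF cl3(1)[OF v]] cl2[OF cl3(2)[OF v]] c(2)[OF cl3(2)[OF v]] exseq_zero[OF E]
    by (simp add: pb_def mod_hom_add[OF D(6)])
  have surj: "pb ` carrier ?F = carrier B"
  proof (rule subset_antisym; rule subsetI)
    fix b assume b: "b \<in> carrier B"
    obtain w where w: "w \<in> carrier (free_mod R l)" "p b = pc w"
      using exseq_surj[OF EC mod_hom_closed[OF D(6) b]] by blast
    have "p (b \<ominus>\<^bsub>B\<^esub> c w) = \<zero>\<^bsub>C\<^esub>" using w b c(2) cl2[OF w(1)] mod_hom_minus[OF D(2,3,6)] by simp
    then obtain a where a: "a \<in> carrier A" "b \<ominus>\<^bsub>B\<^esub> c w = i a"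
      using exseq_exact[OF E] b cl2(1)[OF w(1)] by (metis B.minus_closed)
    obtain u where u: "u \<in> carrier (free_mod R m)" "a = pa u" using exseq_surj[OF EA a(1)] by blast
    have "pb (i1 u \<oplus>\<^bsub>?F\<^esub> i2 w) = b"
      using split[OF u(1) w(1)] a(2) u(2) B.sub_add_cancel[OF b cl2(1)[OF w(1)]] by (simp add: pb_def)
    then show "b \<in> pb ` carrier ?F" using split(3)[OF u(1) w(1)] by blast
  qed (use mod_hom_closed[OF pbh] in auto)
  obtain KB :: "'a obj" and ib where EB: "exseq R KB ?F B ib pb"
    using kernel_exseq[OF D(2) pbh surj] by blast
  note DB = exseqD[OF EB]
  interpret KA: module R KA by (rule DA(1))
  interpret KB: module R KB by (rule DB(1))
  interpret KC: module R KC by (rule DC(1))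
  have ibc: "ib k \<in> carrier ?F" if "k \<in> carrier KB" for k using mod_hom_closed[OF DB(4) that] .
  have iac: "ia k \<in> carrier (free_mod R m)" if "k \<in> carrier KA" for k using mod_hom_closed[OF DA(4) that] .
  obtain j where j: "j \<in> mod_hom R KA KB" "\<And>x. x \<in> carrier KA \<Longrightarrow> ib (j x) = i1 (ia x)"
  proof (rule exseq_into[OF EB DA(1) mod_hom_compose[OF DA(1,4) s(1)]])
    fix x assume x: "x \<in> carrier KA"
    have "pb (i1 (ia x)) = i (pa (ia x)) \<oplus>\<^bsub>B\<^esub> c \<zero>\<^bsub>free_mod R l\<^esub>"
      using iac[OF x] cl(3) s(5,6) by (simp add: pb_def)
    also have "\<dots> = \<zero>\<^bsub>B\<^esub>"
      using exseq_zero[OF EA x] mod_hom_zero[OF D(1,2,4)] mod_hom_zero[OF free_module D(2) c(1)] by simp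
    finally show "pb (compose (carrier KA) i1 ia x) = \<zero>\<^bsub>B\<^esub>" using x by (simp add: compose_def)
  qed (auto simp: compose_def)
  obtain q where q: "q \<in> mod_hom R KB KC" "\<And>x. x \<in> carrier KB \<Longrightarrow> ic (q x) = p2 (ib x)"
  proof (rule exseq_into[OF EC DB(1) mod_hom_compose[OF DB(1,4) s(4)]])
    fix x assume x: "x \<in> carrier KB"
    show "pc (compose (carrier KB) p2 ib x) = \<zero>\<^bsub>C\<^esub>"
      using x ppb[OF ibc[OF x]] exseq_zero[OF EB x] mod_hom_zero[OF D(2,3,6)] by (simp add: compose_def)
  qed (auto simp: compose_def)
  have EK: "exseq R KA KB KC j q"
    unfolding exseq_def
  proof (intro conjI DA(1) DB(1) DC(1) j(1) q(1))
    show "inj_on j (carrier KA)"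
    proof (rule inj_onI)
      fix x y assume xy: "x \<in> carrier KA" "y \<in> carrier KA" "j x = j y"
      then have "p1 (i1 (ia x)) = p1 (i1 (ia y))" using j(2) by metis
      then show "x = y" using s(5)[OF iac] xy exseq_inj[OF EA] by simp
    qed
    show "q ` carrier KB = carrier KC"
    proof (rule subset_antisym; rule subsetI)
      fix z assume z: "z \<in> carrier KC"
      note w = mod_hom_closed[OF DC(4) z]
      have "p (c (ic z)) = \<zero>\<^bsub>C\<^esub>" using c(2)[OF w] exseq_zero[OF EC z] by simp
      then obtain a where a: "a \<in> carrier A" "c (ic z) = i a" using exseq_exact[OF E cl2(1)[OF w]] by blast
      obtain u where u: "u \<in> carrier (free_mod R m)" "a = pa u" using exseq_surj[OF EA a(1)] by blast
      \<comment> \<open>\<open>i2 (ic z)\<close> need not lie in the kernel of \<open>pb\<close>.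
        Its image \<open>c (ic z)\<close> comes from \<open>A\<close>, and adding \<open>i1\<close>
        of \<open>- u\<close> corrects it without changing the second coordinate.\<close>
      let ?u = "\<ominus>\<^bsub>free_mod R m\<^esub> u"
      have u': "?u \<in> carrier (free_mod R m)" using u by simp
      have "i (pa ?u) = \<ominus>\<^bsub>B\<^esub> i a"
        using u mod_hom_neg[OF free_module D(1) DA(6) u(1)] mod_hom_neg[OF D(1,2,4)] a by simp
      then have "pb (i1 ?u \<oplus>\<^bsub>?F\<^esub> i2 (ic z)) = \<zero>\<^bsub>B\<^esub>"
        using split[OF u' w] a mod_hom_closed[OF D(4) a(1)] by (simp add: pb_def B.l_neg)
      then obtain k where k: "k \<in> carrier KB" "i1 ?u \<oplus>\<^bsub>?F\<^esub> i2 (ic z) = ib k"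
        using exseq_exact[OF EB split(3)[OF u' w]] by blast
      have "ic (q k) = ic z" using q(2)[OF k(1)] k(2)[symmetric] split(2)[OF u' w] by simp
      then have "z = q k" using exseq_inj[OF EC] z mod_hom_closed[OF q(1) k(1)] by metis
      then show "z \<in> q ` carrier KB" using k(1) by blast
    qed (use mod_hom_closed[OF q(1)] in auto)
    show "j ` carrier KA = {v \<in> carrier KB. q v = \<zero>\<^bsub>KC\<^esub>}"
    proof (rule subset_antisym; rule subsetI)
      fix y assume "y \<in> j ` carrier KA"
      then obtain x where x: "x \<in> carrier KA" "y = j x" by blast
      note jx = mod_hom_closed[OF j(1) x(1)]
      have "ic (q (j x)) = ic \<zero>\<^bsub>KC\<^esub>"
        using q(2)[OF jx] j(2)[OF x(1)] s(6)[OF iac[OF x(1)]] mod_hom_zero[OF DC(1,2,4)] by simp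
      then have "q (j x) = \<zero>\<^bsub>KC\<^esub>" using exseq_inj[OF EC mod_hom_closed[OF q(1) jx]] by simp
      then show "y \<in> {v \<in> carrier KB. q v = \<zero>\<^bsub>KC\<^esub>}" using x jx by simp
    next
      fix k assume "k \<in> {v \<in> carrier KB. q v = \<zero>\<^bsub>KC\<^esub>}"
      then have k: "k \<in> carrier KB" "q k = \<zero>\<^bsub>KC\<^esub>" by auto
      let ?v = "ib k"
      note v = ibc[OF k(1)]
      have p2v: "p2 ?v = \<zero>\<^bsub>free_mod R l\<^esub>" using q(2)[OF k(1)] k(2) mod_hom_zero[OF DC(1,2,4)] by simp
      then have v1: "i1 (p1 ?v) = ?v"
        using s(9)[OF v] mod_hom_zero[OF free_module free_module s(2)] cl(3)[OF cl3(1)[OF v]] by simp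
      have "i (pa (p1 ?v)) = i \<zero>\<^bsub>A\<^esub>"
        using exseq_zero[OF EB k(1)] v p2v mod_hom_zero[OF free_module D(2) c(1)] mod_hom_zero[OF D(1,2,4)]
          cl[OF cl3(1)[OF v]] by (simp add: pb_def)
      then have "pa (p1 ?v) = \<zero>\<^bsub>A\<^esub>" using exseq_inj[OF E] cl[OF cl3(1)[OF v]] by simp
      then obtain x where x: "x \<in> carrier KA" "p1 ?v = ia x" using exseq_exact[OF EA cl3(1)[OF v]] by blast
      have "ib (j x) = ib k" using j(2)[OF x(1)] x(2) v1 by simp
      then have "k = j x" using exseq_inj[OF EB] k(1) mod_hom_closed[OF j(1) x(1)] by metis
      then show "k \<in> j ` carrier KA" using x(1) by blast
    qed
  qed
  have "extends R KB ?F ib"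
    unfolding extends_def
  proof
    fix f assume f: "f \<in> mod_hom R KB (ring_as_module R)"
    obtain u where u: "u \<in> mod_hom R (free_mod R m) (ring_as_module R)" "\<And>x. x \<in> carrier KA \<Longrightarrow> u (ia x) = f (j x)"
      using extendsD[OF xA mod_hom_compose[OF DA(1) j(1) f]] by (auto simp: compose_def)
    \<comment> \<open>\<open>u p1\<close> extends the restriction of \<open>f\<close> to
      \<open>KA\<close>. Subtracting it leaves a form that vanishes on \<open>KA\<close>, hence
      comes from \<open>KC\<close>, and extends there.\<close>
    let ?f = "\<lambda>k\<in>carrier KB. f k \<ominus> u (p1 (ib k))"
    have fh: "?f \<in> mod_hom R KB (ring_as_module R)"
      using mod_hom_minus_map[OF DB(1) RR_module f mod_hom_compose[OF DB(1,4) mod_hom_compose[OF free_module s(3) u(1)]]] ibc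
      by (simp add: compose_def cong: restrict_cong)
    have uc: "u (p1 v) \<in> carrier R" if "v \<in> carrier ?F" for v
      using mod_hom_closed[OF u(1) cl3(1)[OF that]] by simp
    have fc: "f k \<in> carrier R" if "k \<in> carrier KB" for k using mod_hom_closed[OF f that] by simp
    have "?f (j x) = \<zero>" if x: "x \<in> carrier KA" for x
      using mod_hom_closed[OF j(1) x] j(2)[OF x] s(5)[OF iac[OF x]] u(2)[OF x] fc by (simp add: a_minus_def r_neg)
    then obtain g where g: "g \<in> mod_hom R KC (ring_as_module R)" "\<And>k. k \<in> carrier KB \<Longrightarrow> g (q k) = ?f k"
      using exseq_descend[OF EK RR_module fh] by auto
    obtain w where w: "w \<in> mod_hom R (free_mod R l) (ring_as_module R)" "\<And>x. x \<in> carrier KC \<Longrightarrow> w (ic x) = g x"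
      using extendsD[OF xC g(1)] by blast
    have h: "(\<lambda>v\<in>carrier ?F. u (p1 v) \<oplus> w (p2 v)) \<in> mod_hom R ?F (ring_as_module R)"
      using free_copair[OF RR_module u(1) w(1) s(3,4) free_module] by simp
    have "u (p1 (ib k)) \<oplus> w (p2 (ib k)) = f k" if k: "k \<in> carrier KB" for k
    proof -
      have "w (p2 (ib k)) = f k \<ominus> u (p1 (ib k))"
        using w(2)[OF mod_hom_closed[OF q(1) k]] q(2)[OF k] g(2)[OF k] k by simp
      then show ?thesis using RR.sub_add_cancel[of "f k" "u (p1 (ib k))"] uc[OF ibc[OF k]] fc[OF k] by (simp add: a_comm)
    qed
    then show "\<exists>g\<in>mod_hom R ?F (ring_as_module R). \<forall>k\<in>carrier KB. g (ib k) = f k"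
      using ibc by (intro bexI[OF _ h]) simp
  qed
  then show ?thesis using that EB EK by blast
qed

text \<open>The kernels of the horseshoe again form an extension of modules in the class, which is
  the coinductive invariant.\<close>

lemma ext_orth_obj_extension:
  assumes "exseq R A B C i p" "ext_orth_obj R A" "ext_orth_obj R C"
  shows "ext_orth_obj R B"
proof -
  have "\<exists>A C i p. exseq R A B C i p \<and> ext_orth_obj R A \<and> ext_orth_obj R C" using assms by blast
  then show ?thesis
  proof (coinduction arbitrary: B)
    case (ext_orth_obj B)
    then obtain A C :: "'a obj" and i p where E: "exseq R A B C i p" "ext_orth R A" "ext_orth R C"
      unfolding ext_orth_obj_iff by blast
    obtain KA :: "'a obj" and m ia pa where KA: "exseq R KA (free_mod R m) A ia pa" "extends R KA (free_mod R m) ia" "ext_orth R KA"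
      using E(2) by (rule ext_orthE)
    obtain KC :: "'a obj" and l ic pc where KC: "exseq R KC (free_mod R l) C ic pc" "extends R KC (free_mod R l) ic" "ext_orth R KC"
      using E(3) by (rule ext_orthE)
    obtain KB :: "'a obj" and ib pb j q where KB: "exseq R KB (free_mod R (m + l)) B ib pb" "exseq R KA KB KC j q"
      "extends R KB (free_mod R (m + l)) ib"
      using horseshoe[OF E(1) KA(1) KC(1) KA(2) KC(2)] by metis
    then show ?case using KA(3) KC(3) unfolding ext_orth_obj_iff by (intro exI conjI disjI1) (assumption | rule refl)+
  qed
qed

lemma ext_orth_extension:
  assumes E: "exseq R A B C i p" "ext_orth R A" "ext_orth R C"
  shows "ext_orth R B"
proof -
  obtain KA :: "'a obj" and m ia pa where KA: "exseq R KA (free_mod R m) A ia pa" "extends R KA (free_mod R m) ia" "ext_orth R KA"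
    using E(2) by (rule ext_orthE)
  obtain KC :: "'a obj" and l ic pc where KC: "exseq R KC (free_mod R l) C ic pc" "extends R KC (free_mod R l) ic" "ext_orth R KC"
    using E(3) by (rule ext_orthE)
  obtain KB :: "'a obj" and ib pb j q where KB: "exseq R KB (free_mod R (m + l)) B ib pb" "exseq R KA KB KC j q"
    "extends R KB (free_mod R (m + l)) ib"
    using horseshoe[OF E(1) KA(1) KC(1) KA(2) KC(2)] by metis
  have "ext_orth R KB" by (rule ext_orth_obj_extension[OF KB(2), unfolded ext_orth_obj_iff, OF KA(3) KC(3)])
  then show ?thesis by (rule ext_orthI[OF KB(1,3)])
qed

end

lemma trivial_A_Mod_iff:
  assumes "abelian_subgroup B G"
  shows "trivial_group (G A_Mod B) \<longleftrightarrow> carrier G \<subseteq> B"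
proof -
  interpret abelian_subgroup B G by fact
  have c: "f \<in> B \<longleftrightarrow> B +>\<^bsub>G\<^esub> f = B" if "f \<in> carrier G" for f
    using a_coset_join1[of B f] a_coset_join2[of f B] a_subgroup that a_subset by auto
  have "trivial_group (G A_Mod B) \<longleftrightarrow> a_rcosets\<^bsub>G\<^esub> B = {B}"
    using a_factorgroup_is_group by (simp add: trivial_group_def A_FactGroup_def')
  also have "\<dots> \<longleftrightarrow> (\<forall>f\<in>carrier G. B +>\<^bsub>G\<^esub> f = B)"
    using zero_closed unfolding A_RCOSETS_def' by blast
  also have "\<dots> \<longleftrightarrow> carrier G \<subseteq> B" using c by blast
  finally show ?thesis .
qed

context noetherian_cring
begin

subsection \<open>Vanishing of Ext\<close>

lemma free_resolution_ex:
  assumes X: "fg_module R X"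
  shows "\<exists>b d e. free_resolution R X b d e"
proof -
  have Xm: "module R X" using X by (simp add: fg_module_iff)
  obtain n e where e: "e \<in> mod_hom R (free_mod R n) X" "e ` carrier (free_mod R n) = carrier X"
    using X by (rule fg_coverE)
  have ker: "\<exists>m. \<exists>p\<in>mod_hom R (free_mod R m) (free_mod R k). p ` carrier (free_mod R m) = a_kernel (free_mod R k) Y f"
    if "module R Y" "f \<in> mod_hom R (free_mod R k) Y" for k f and Y :: "('a,'y,'t) module_scheme"
    using noeth_modD[OF noeth_free mod_hom_kernel_submodule[OF free_module that]]
    unfolding fg_sub_def a_kernel_def' by blast
  \<comment> \<open>A state \<open>(b, m, f)\<close> is one differential from R^m to R^b.
    \<open>P\<close> ties the first one to \<open>e\<close>; \<open>Q\<close> demands that the next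
    differential starts from the rank where this one ends and maps onto its kernel.\<close>
  define P where "P k = (\<lambda>(b, m, f). f \<in> mod_hom R (free_mod R m) (free_mod R b) \<and>
     (k = (0::nat) \<longrightarrow> b = n \<and> f ` carrier (free_mod R m) = a_kernel (free_mod R n) X e))" for k
  define Q where "Q = (\<lambda>(b, m, f) (b', m', f'). b' = m \<and>
     f' ` carrier (free_mod R m') = a_kernel (free_mod R m) (free_mod R (b :: nat)) f)"
  have "\<exists>st. \<forall>k. P k (st k) \<and> Q (st k) (st (Suc k))"
  proof (rule dependent_nat_choice)
    show "\<exists>x. P 0 x" using ker[OF Xm e(1)] by (auto simp: P_def)
    fix x :: "nat \<times> nat \<times> ((nat \<Rightarrow> 'a) \<Rightarrow> nat \<Rightarrow> 'a)" and k assume P: "P k x"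
    obtain b m f where x: "x = (b, m, f)" by (cases x)
    then have f: "f \<in> mod_hom R (free_mod R m) (free_mod R b)" using P by (simp add: P_def)
    obtain m' f' where "f' \<in> mod_hom R (free_mod R m') (free_mod R m)"
      "f' ` carrier (free_mod R m') = a_kernel (free_mod R m) (free_mod R b) f"
      using ker[OF free_module f] by blast
    then show "\<exists>y. P (Suc k) y \<and> Q x y" unfolding x by (intro exI[of _ "(m, m', f')"]) (simp add: P_def Q_def)
  qed
  then obtain st where st: "\<And>k. P k (st k)" "\<And>k. Q (st k) (st (Suc k))" by blast
  define b where "b k = fst (st k)" for k
  define d where "d k = snd (snd (st k))" for k
  have stk: "st k = (b k, b (Suc k), d k)" for k
    using st(2)[of k] by (auto simp: b_def d_def Q_def split: prod.splits)
  have "d k \<in> mod_hom R (free_mod R (b (Suc k))) (free_mod R (b k))" for k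
    using st(1)[of k] unfolding stk by (simp add: P_def)
  moreover have "b 0 = n" "d 0 ` carrier (free_mod R (b 1)) = a_kernel (free_mod R n) X e"
    using st(1)[of 0] unfolding stk by (simp_all add: P_def)
  moreover have "a_kernel (free_mod R (b (Suc k))) (free_mod R (b k)) (d k) = d (Suc k) ` carrier (free_mod R (b (Suc (Suc k))))" for k
    using st(2)[of k] unfolding stk by (simp add: Q_def)
  ultimately have "free_resolution R X b d e" unfolding free_resolution_def Let_def using e by simp
  then show ?thesis by blast
qed

lemma chosen_resolutionE:
  assumes X: "fg_module R X"
  obtains b d e where "chosen_resolution R X = (b, d, e)" "free_resolution R X b d e"
proof -
  obtain b d e where "free_resolution R X b d e" using free_resolution_ex[OF X] by blast
  then have "case chosen_resolution R X of (b, d, e) \<Rightarrow> free_resolution R X b d e"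
    unfolding chosen_resolution_def by (intro someI[where P = "\<lambda>(b, d, e). free_resolution R X b d e" and x = "(b, d, e)"]) simp
  then show ?thesis using that by (cases "chosen_resolution R X") auto
qed

text \<open>With \<open>Z j\<close> the image of \<open>d j\<close>, a cocycle in degree
  \<open>j + 1\<close> is the same as a linear form on \<open>Z j\<close>, and it is a coboundary
  exactly when this form extends along the inclusion of \<open>Z j\<close>. So exactness in all
  positive degrees is the extension property for all syzygies.\<close>

lemma ext_orth_iff_resolution:
  assumes X: "module R X" and res: "free_resolution R X b d e"
  shows "ext_orth R X \<longleftrightarrow> (\<forall>j. \<forall>f\<in>mod_hom R (free_mod R (b (Suc j))) (ring_as_module R).
    (\<forall>v\<in>carrier (free_mod R (b (Suc (Suc j)))). f (d (Suc j) v) = \<zero>) \<longrightarrow>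
    (\<exists>g\<in>mod_hom R (free_mod R (b j)) (ring_as_module R). \<forall>v\<in>carrier (free_mod R (b (Suc j))). f v = g (d j v)))"
    (is "_ \<longleftrightarrow> ?ev")
proof -
  let ?F = "\<lambda>k. free_mod R (b k)"
  have e: "e \<in> mod_hom R (?F 0) X" "e ` carrier (?F 0) = carrier X"
    and d: "\<And>k. d k \<in> mod_hom R (?F (Suc k)) (?F k)"
    and k0: "{v \<in> carrier (?F 0). e v = \<zero>\<^bsub>X\<^esub>} = d 0 ` carrier (?F 1)"
    and kS: "\<And>k. {v \<in> carrier (?F (Suc k)). d k v = \<zero>\<^bsub>?F k\<^esub>} = d (Suc k) ` carrier (?F (Suc (Suc k)))"
    using res unfolding free_resolution_def Let_def a_kernel_def' by auto
  have "\<forall>k. \<exists>K i. module R (K :: 'a obj) \<and> i \<in> mod_hom R K (?F k) \<and> inj_on i (carrier K) \<and>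
      i ` carrier K = d k ` carrier (?F (Suc k))"
  proof
    fix k show "\<exists>K i. module R (K :: 'a obj) \<and> i \<in> mod_hom R K (?F k) \<and> inj_on i (carrier K) \<and>
      i ` carrier K = d k ` carrier (?F (Suc k))"
    proof (cases k)
      case 0
      obtain K :: "'a obj" and i where "module R K" "i \<in> mod_hom R K (?F 0)" "inj_on i (carrier K)"
        "i ` carrier K = {v \<in> carrier (?F 0). e v = \<zero>\<^bsub>X\<^esub>}"
        using X e(1) by (rule kernel_obj)
      then show ?thesis unfolding 0 k0 One_nat_def by blast
    next
      case (Suc l)
      obtain K :: "'a obj" and i where "module R K" "i \<in> mod_hom R K (?F (Suc l))" "inj_on i (carrier K)"
        "i ` carrier K = {v \<in> carrier (?F (Suc l)). d l v = \<zero>\<^bsub>?F l\<^esub>}"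
        using free_module d[of l] by (rule kernel_obj)
      then show ?thesis unfolding Suc kS by blast
    qed
  qed
  then obtain Z :: "nat \<Rightarrow> 'a obj" and i where Z: "\<And>k. module R (Z k)" "\<And>k. i k \<in> mod_hom R (Z k) (?F k)"
    "\<And>k. inj_on (i k) (carrier (Z k))" "\<And>k. i k ` carrier (Z k) = d k ` carrier (?F (Suc k))"
    by metis
  have "\<exists>q. q \<in> mod_hom R (?F (Suc k)) (Z k) \<and> (\<forall>v\<in>carrier (?F (Suc k)). i k (q v) = d k v)" for k
    by (rule mod_hom_into[OF free_module Z(1) free_module Z(2) Z(3) d[of k]]) (use Z(4) in blast)+
  then obtain q where q: "\<And>k. q k \<in> mod_hom R (?F (Suc k)) (Z k)"
    "\<And>k v. v \<in> carrier (?F (Suc k)) \<Longrightarrow> i k (q k v) = d k v" by metis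
  have inj: "x = y" if "x \<in> carrier (Z k)" "y \<in> carrier (Z k)" "i k x = i k y" for k x y
    using Z(3)[of k] that by (auto dest: inj_onD)
  have surj: "q k ` carrier (?F (Suc k)) = carrier (Z k)" for k
  proof (rule subset_antisym; rule subsetI)
    fix z assume z: "z \<in> carrier (Z k)"
    then obtain v where v: "v \<in> carrier (?F (Suc k))" "i k z = d k v" using Z(4) by blast
    then have "z = q k v" using inj[OF z mod_hom_closed[OF q(1) v(1)]] q(2) by simp
    then show "z \<in> q k ` carrier (?F (Suc k))" using v by blast
  qed (use mod_hom_closed[OF q(1)] in auto)
  have qz: "q k v = \<zero>\<^bsub>Z k\<^esub> \<longleftrightarrow> d k v = \<zero>\<^bsub>?F k\<^esub>" if v: "v \<in> carrier (?F (Suc k))" for k v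
  proof -
    have z: "i k \<zero>\<^bsub>Z k\<^esub> = \<zero>\<^bsub>?F k\<^esub>" by (rule mod_hom_zero[OF Z(1) free_module Z(2)])
    interpret Zk: module R "Z k" by (rule Z(1))
    show ?thesis using q(2)[OF v] z inj[OF mod_hom_closed[OF q(1) v] Zk.zero_closed] by metis
  qed
  have E0: "exseq R (Z 0) (?F 0) X (i 0) e"
    unfolding exseq_def using Z[of 0] X e free_module k0 by auto
  have ES: "exseq R (Z (Suc k)) (?F (Suc k)) (Z k) (i (Suc k)) (q k)" for k
    unfolding exseq_def
  proof (intro conjI Z free_module q(1) surj)
    show "i (Suc k) ` carrier (Z (Suc k)) = {v \<in> carrier (?F (Suc k)). q k v = \<zero>\<^bsub>Z k\<^esub>}"
      unfolding Z(4) kS[symmetric] using qz by blast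
  qed
  have dd: "d k (d (Suc k) v) = \<zero>\<^bsub>?F k\<^esub>" if "v \<in> carrier (?F (Suc (Suc k)))" for k v
    using kS[of k] that by blast
  show ?thesis
  proof
    assume P: "ext_orth R X"
    have *: "extends R (Z k) (?F k) (i k) \<and> ext_orth R (Z k)" for k
    proof (induction k)
      case 0 show ?case using ext_orth_syzygy[OF E0 P] by blast
    next
      case (Suc k) then show ?case using ext_orth_syzygy[OF ES] by blast
    qed
    show ?ev
    proof (intro allI ballI impI)
      fix j f assume f: "f \<in> mod_hom R (?F (Suc j)) (ring_as_module R)"
        and z: "\<forall>v\<in>carrier (?F (Suc (Suc j))). f (d (Suc j) v) = \<zero>"
      obtain f' where f': "f' \<in> mod_hom R (Z j) (ring_as_module R)" "\<And>v. v \<in> carrier (?F (Suc j)) \<Longrightarrow> f' (q j v) = f v"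
      proof (rule exseq_descend[OF ES RR_module f])
        fix k assume "k \<in> carrier (Z (Suc j))"
        then have "i (Suc j) k \<in> d (Suc j) ` carrier (?F (Suc (Suc j)))" using Z(4) by blast
        then show "f (i (Suc j) k) = \<zero>\<^bsub>ring_as_module R\<^esub>" using z by auto
      qed blast
      have ext: "extends R (Z j) (?F j) (i j)" using * by blast
      obtain g where g: "g \<in> mod_hom R (?F j) (ring_as_module R)" "\<And>k. k \<in> carrier (Z j) \<Longrightarrow> g (i j k) = f' k"
        using extendsD[OF ext f'(1)] by blast
      have "f v = g (d j v)" if "v \<in> carrier (?F (Suc j))" for v
        using g(2)[OF mod_hom_closed[OF q(1) that]] q(2)[OF that] f'(2)[OF that] by simp
      then show "\<exists>g\<in>mod_hom R (?F j) (ring_as_module R). \<forall>v\<in>carrier (?F (Suc j)). f v = g (d j v)"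
        using g(1) by blast
    qed
  next
    assume ev: ?ev
    have ext: "extends R (Z k) (?F k) (i k)" for k
      unfolding extends_def
    proof
      fix f assume f: "f \<in> mod_hom R (Z k) (ring_as_module R)"
      let ?f = "compose (carrier (?F (Suc k))) f (q k)"
      have fh: "?f \<in> mod_hom R (?F (Suc k)) (ring_as_module R)" by (rule mod_hom_compose[OF free_module q(1) f])
      have "?f (d (Suc k) v) = \<zero>" if v: "v \<in> carrier (?F (Suc (Suc k)))" for v
        using dd[OF v] qz[OF mod_hom_closed[OF d v]] mod_hom_closed[OF d v] mod_hom_zero[OF Z(1) RR_module f]
        by (simp add: compose_def)
      then obtain g where g: "g \<in> mod_hom R (?F k) (ring_as_module R)"
        "\<And>v. v \<in> carrier (?F (Suc k)) \<Longrightarrow> ?f v = g (d k v)" using ev fh by blast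
      have "g (i k z) = f z" if z: "z \<in> carrier (Z k)" for z
      proof -
        obtain v where v: "v \<in> carrier (?F (Suc k))" "z = q k v" using surj z by blast
        then show ?thesis using g(2)[OF v(1)] q(2)[OF v(1)] by (simp add: compose_def)
      qed
      then show "\<exists>g\<in>mod_hom R (?F k) (ring_as_module R). \<forall>z\<in>carrier (Z k). g (i k z) = f z" using g(1) by blast
    qed
    have "ext_orth_obj R (Z k)" for k
    proof (coinduction arbitrary: k)
      case (ext_orth_obj k)
      show ?case using ES[of k] ext[of "Suc k"] by blast
    qed
    then show "ext_orth R X" using ext_orthI[OF E0 ext] unfolding ext_orth_obj_iff by blast
  qed
qed

text \<open>Triviality of the quotient group means that every cocycle is a coboundary; the remaining
  work is that cocycles and coboundaries are subgroups of the right records.\<close>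

lemma trivial_Ext_iff:
  assumes X: "module R X" and ch: "chosen_resolution R X = (b, d, e)" and res: "free_resolution R X b d e"
  shows "trivial_group (Ext R (Suc j) X (ring_as_module R)) \<longleftrightarrow>
    (\<forall>f\<in>mod_hom R (free_mod R (b (Suc j))) (ring_as_module R).
    (\<forall>v\<in>carrier (free_mod R (b (Suc (Suc j)))). f (d (Suc j) v) = \<zero>) \<longrightarrow>
    (\<exists>g\<in>mod_hom R (free_mod R (b j)) (ring_as_module R). \<forall>v\<in>carrier (free_mod R (b (Suc j))). f v = g (d j v)))"
proof -
  let ?F = "\<lambda>k. free_mod R (b k)"
  let ?N = "ring_as_module R"
  let ?C = "\<lambda>k. Hom_mod R (?F k) ?N"
  let ?Z = "{f \<in> mod_hom R (?F (Suc j)) ?N. \<forall>v\<in>carrier (?F (Suc (Suc j))). f (d (Suc j) v) = \<zero>}"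
  let ?B = "(\<lambda>f. compose (carrier (?F (Suc j))) f (d j)) ` mod_hom R (?F j) ?N"
  let ?G = "(?C (Suc j))\<lparr>carrier := ?Z\<rparr>"
  have d: "\<And>k. d k \<in> mod_hom R (?F (Suc k)) (?F k)"
    and kS: "\<And>k. {v \<in> carrier (?F (Suc k)). d k v = \<zero>\<^bsub>?F k\<^esub>} = d (Suc k) ` carrier (?F (Suc (Suc k)))"
    using res unfolding free_resolution_def Let_def a_kernel_def' by auto
  have dd: "d k (d (Suc k) v) = \<zero>\<^bsub>?F k\<^esub>" if "v \<in> carrier (?F (Suc (Suc k)))" for k v
    using kS[of k] that by blast
  have cm: "module R (?C k)" for k by (rule Hom_mod_module[OF free_module RR_module])
  have ze: "compose A f g = (\<lambda>x\<in>A. \<zero>) \<longleftrightarrow> (\<forall>v\<in>A. f (g v) = \<zero>)" for A f g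
    by (auto simp: compose_def restrict_def fun_eq_iff)
  have Ext: "Ext R (Suc j) X ?N = ?G A_Mod ?B"
    by (simp add: Ext_def ch a_kernel_def' ze)
  have dl: "(\<lambda>f\<in>carrier (?C k). compose (carrier (?F (Suc k))) f (d k)) \<in> mod_hom R (?C k) (?C (Suc k))" for k
  proof (rule mod_homI[OF cm])
    show "compose (carrier (?F (Suc k))) f (d k) \<in> carrier (?C (Suc k))" if "f \<in> carrier (?C k)" for f
      using mod_hom_compose[OF free_module d, of f k ?N] that by simp
  qed (auto intro!: restrict_ext simp: compose_def mod_hom_closed[OF d])
  have Zs: "submodule ?Z R (?C (Suc j))"
    using mod_hom_kernel_submodule[OF cm cm dl[of "Suc j"]] by (simp add: ze cong: conj_cong)
  have G: "module R ?G" by (rule submodule.submodule_is_module[OF Zs cm])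
  interpret C: module R "?C j" by (rule cm)
  interpret C': module R "?C (Suc j)" by (rule cm)
  interpret G: module R ?G by (rule G)
  have Bs: "submodule ?B R (?C (Suc j))"
    using mod_hom_image_submodule[OF cm cm dl[of j] C.carrier_is_submodule] by (simp cong: image_cong)
  note BE = C'.submoduleE[OF Bs]
  have BZ: "?B \<subseteq> ?Z"
  proof
    fix f assume "f \<in> ?B"
    then obtain g where g: "g \<in> mod_hom R (?F j) ?N" "f = compose (carrier (?F (Suc j))) g (d j)" by blast
    have "f \<in> mod_hom R (?F (Suc j)) ?N" unfolding g(2) by (rule mod_hom_compose[OF free_module d g(1)])
    moreover have "f (d (Suc j) v) = \<zero>" if v: "v \<in> carrier (?F (Suc (Suc j)))" for v
      using dd[OF v] mod_hom_closed[OF d v] mod_hom_zero[OF free_module RR_module g(1)] by (simp add: g(2) compose_def)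
    ultimately show "f \<in> ?Z" by simp
  qed
  have rhs: "(\<forall>f\<in>mod_hom R (?F (Suc j)) ?N. (\<forall>v\<in>carrier (?F (Suc (Suc j))). f (d (Suc j) v) = \<zero>) \<longrightarrow>
    (\<exists>g\<in>mod_hom R (?F j) ?N. \<forall>v\<in>carrier (?F (Suc j)). f v = g (d j v))) \<longleftrightarrow> ?Z \<subseteq> ?B"
  proof -
    have "f \<in> ?B \<longleftrightarrow> (\<exists>g\<in>mod_hom R (?F j) ?N. \<forall>v\<in>carrier (?F (Suc j)). f v = g (d j v))"
      if f: "f \<in> mod_hom R (?F (Suc j)) ?N" for f
    proof
      assume "\<exists>g\<in>mod_hom R (?F j) ?N. \<forall>v\<in>carrier (?F (Suc j)). f v = g (d j v)"
      then obtain g where g: "g \<in> mod_hom R (?F j) ?N" "\<forall>v\<in>carrier (?F (Suc j)). f v = g (d j v)" by blast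
      have "f = compose (carrier (?F (Suc j))) g (d j)"
        by (rule mod_hom_eqI[OF f mod_hom_compose[OF free_module d g(1)]]) (use g(2) in \<open>simp add: compose_def\<close>)
      then show "f \<in> ?B" using g(1) by blast
    qed (auto simp: compose_def)
    then show ?thesis by blast
  qed
  have Bg: "subgroup ?B (add_monoid ?G)"
  proof (rule G.add.subgroupI, goal_cases)
    case 1
    show ?case using BZ by simp
  next
    case 2
    show ?case by (rule BE(2))
  next
    \<comment> \<open>Additive inverses are defined by a description over the carrier, so the
      inverse among the cocycles has to be identified with the one in the full Hom module.\<close>
    case (3 x)
    have "\<ominus>\<^bsub>?G\<^esub> x = \<ominus>\<^bsub>?C (Suc j)\<^esub> x"
    proof (rule G.minus_equality)
      show "\<ominus>\<^bsub>?C (Suc j)\<^esub> x \<oplus>\<^bsub>?G\<^esub> x = \<zero>\<^bsub>?G\<^esub>" using C'.l_neg BE(1) 3 by auto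
      show "x \<in> carrier ?G" "\<ominus>\<^bsub>?C (Suc j)\<^esub> x \<in> carrier ?G" using BZ BE(3)[OF 3] 3 by auto
    qed
    then show ?case using BE(3)[OF 3] unfolding a_inv_def by simp
  next
    case (4 x y)
    then show ?case using BE(5)[of x y] by simp
  qed
  have "abelian_subgroup ?B ?G"
    by (rule abelian_subgroupI3[OF additive_subgroup.intro[OF Bg] G.abelian_group_axioms])
  from trivial_A_Mod_iff[OF this] show ?thesis unfolding Ext rhs by simp
qed

lemma ext_orth_iff_Ext:
  assumes X: "fg_module R X"
  shows "ext_orth R X \<longleftrightarrow> (\<forall>i>0. trivial_group (Ext R i X (ring_as_module R)))"
proof -
  have Xm: "module R X" using X by (simp add: fg_module_iff)
  obtain b d e where "chosen_resolution R X = (b, d, e)" "free_resolution R X b d e"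
    using X by (rule chosen_resolutionE)
  then have "ext_orth R X \<longleftrightarrow> (\<forall>j. trivial_group (Ext R (Suc j) X (ring_as_module R)))"
    using ext_orth_iff_resolution[OF Xm] trivial_Ext_iff[OF Xm] by simp
  then show ?thesis by (metis gr0_conv_Suc zero_less_Suc)
qed

end

subsection \<open>Closure properties of G-projective modules\<close>

text \<open>The conjuncts are injectivity and surjectivity of the map into the bidual, spelled out
  on elements so that diagram chases can use them directly.\<close>

definition reflexive :: "('a,'r) ring_scheme \<Rightarrow> ('a,'x,'s) module_scheme \<Rightarrow> bool" where
  "reflexive R X \<longleftrightarrow>
     (\<forall>x\<in>carrier X. (\<forall>f\<in>mod_hom R X (ring_as_module R). f x = \<zero>\<^bsub>R\<^esub>) \<longrightarrow> x = \<zero>\<^bsub>X\<^esub>) \<and>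
     (\<forall>\<Phi>\<in>mod_hom R (dual_mod R X) (ring_as_module R). \<exists>x\<in>carrier X. \<forall>f\<in>mod_hom R X (ring_as_module R). \<Phi> f = f x)"

lemma reflexiveD1:
  "reflexive R X \<Longrightarrow> x \<in> carrier X \<Longrightarrow> (\<And>f. f \<in> mod_hom R X (ring_as_module R) \<Longrightarrow> f x = \<zero>\<^bsub>R\<^esub>) \<Longrightarrow> x = \<zero>\<^bsub>X\<^esub>"
  by (simp add: reflexive_def)

lemma reflexiveD2:
  assumes "reflexive R X" "\<Phi> \<in> mod_hom R (dual_mod R X) (ring_as_module R)"
  obtains x where "x \<in> carrier X" "\<And>f. f \<in> mod_hom R X (ring_as_module R) \<Longrightarrow> \<Phi> f = f x"
  using assms unfolding reflexive_def by blast

lemma dual_mod_simps [simp]: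
  "carrier (dual_mod R X) = mod_hom R X (ring_as_module R)"
  "\<zero>\<^bsub>dual_mod R X\<^esub> = (\<lambda>x \<in> carrier X. \<zero>\<^bsub>R\<^esub>)"
  "f \<oplus>\<^bsub>dual_mod R X\<^esub> g = (\<lambda>x \<in> carrier X. f x \<oplus>\<^bsub>R\<^esub> g x)"
  "a \<odot>\<^bsub>dual_mod R X\<^esub> f = (\<lambda>x \<in> carrier X. a \<otimes>\<^bsub>R\<^esub> f x)"
  by (simp_all add: dual_mod_def)

text \<open>The working form of G-projectivity, free of chosen resolutions. Finite generation is
  contained in \<open>ext_orth\<close>, which provides a free cover.\<close>

definition Gp :: "('a,'r) ring_scheme \<Rightarrow> ('a,'x,'s) module_scheme \<Rightarrow> bool" where
  "Gp R X \<longleftrightarrow> ext_orth R X \<and> ext_orth R (dual_mod R X) \<and> reflexive R X"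

context cring
begin

lemma dual_module: "module R X \<Longrightarrow> module R (dual_mod R X)"
  unfolding dual_mod_def by (rule Hom_mod_module[OF _ RR_module])

lemma reflexive_iff_bidual:
  assumes X: "module R X"
  shows "bidual_map R X \<in> mod_iso R X (dual_mod R (dual_mod R X)) \<longleftrightarrow> reflexive R X"
proof -
  let ?D = "dual_mod R X" and ?DD = "dual_mod R (dual_mod R X)" and ?b = "bidual_map R X"
  note D = dual_module[OF X] and DD = dual_module[OF dual_module[OF X]]
  interpret X: module R X by fact
  have ev: "(\<lambda>f\<in>carrier ?D. f x) \<in> carrier ?DD" if x: "x \<in> carrier X" for x
    unfolding dual_mod_simps(1)[of R ?D]
    by (rule mod_homI[OF D]) (use x mod_hom_closed[of _ R X "ring_as_module R" x] in auto)
  have bh: "?b \<in> mod_hom R X ?DD"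
    unfolding bidual_map_def
  proof (rule mod_homI[OF X ev])
    fix x y a assume x: "x \<in> carrier X" and y: "y \<in> carrier X"
    show "(\<lambda>f\<in>carrier ?D. f (x \<oplus>\<^bsub>X\<^esub> y)) = (\<lambda>f\<in>carrier ?D. f x) \<oplus>\<^bsub>?DD\<^esub> (\<lambda>f\<in>carrier ?D. f y)"
      using x y by (auto simp: mod_hom_add intro!: restrict_ext)
    show "a \<in> carrier R \<Longrightarrow> (\<lambda>f\<in>carrier ?D. f (a \<odot>\<^bsub>X\<^esub> x)) = a \<odot>\<^bsub>?DD\<^esub> (\<lambda>f\<in>carrier ?D. f x)"
      using x by (auto simp: mod_hom_smult intro!: restrict_ext)
  qed
  have bz: "?b x = \<zero>\<^bsub>?DD\<^esub> \<longleftrightarrow> (\<forall>f\<in>mod_hom R X (ring_as_module R). f x = \<zero>)" if "x \<in> carrier X" for x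
    using that by (auto simp: bidual_map_def restrict_def fun_eq_iff)
  have bs: "?b x = \<Phi> \<longleftrightarrow> (\<forall>f\<in>mod_hom R X (ring_as_module R). \<Phi> f = f x)"
    if "x \<in> carrier X" "\<Phi> \<in> carrier ?DD" for x \<Phi>
  proof
    assume *: "\<forall>f\<in>mod_hom R X (ring_as_module R). \<Phi> f = f x"
    have "?b x = (\<lambda>f\<in>carrier ?D. f x)" using that(1) by (simp add: bidual_map_def)
    also have "\<dots> = \<Phi>"
      by (rule mod_hom_eqI[where R = R and X = ?D and Y = "ring_as_module R" and Z = "ring_as_module R"])
        (use ev[OF that(1)] that(2) * in auto)
    finally show "?b x = \<Phi>" .
  qed (use that in \<open>auto simp: bidual_map_def\<close>)
  have "inj_on ?b (carrier X) \<longleftrightarrow> (\<forall>x\<in>carrier X. (\<forall>f\<in>mod_hom R X (ring_as_module R). f x = \<zero>) \<longrightarrow> x = \<zero>\<^bsub>X\<^esub>)"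
  proof
    assume inj: "inj_on ?b (carrier X)"
    show "\<forall>x\<in>carrier X. (\<forall>f\<in>mod_hom R X (ring_as_module R). f x = \<zero>) \<longrightarrow> x = \<zero>\<^bsub>X\<^esub>"
      using bz inj mod_hom_zero[OF X DD bh] by (metis X.zero_closed inj_onD)
  next
    assume "\<forall>x\<in>carrier X. (\<forall>f\<in>mod_hom R X (ring_as_module R). f x = \<zero>) \<longrightarrow> x = \<zero>\<^bsub>X\<^esub>"
    then show "inj_on ?b (carrier X)" by (intro kernel_zero_inj[OF X DD bh]) (use bz in blast)
  qed
  moreover have "?b ` carrier X = carrier ?DD \<longleftrightarrow>
    (\<forall>\<Phi>\<in>mod_hom R ?D (ring_as_module R). \<exists>x\<in>carrier X. \<forall>f\<in>mod_hom R X (ring_as_module R). \<Phi> f = f x)"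
  proof -
    have "?b ` carrier X \<subseteq> carrier ?DD" using mod_hom_closed[OF bh] by blast
    then have "?b ` carrier X = carrier ?DD \<longleftrightarrow> (\<forall>\<Phi>\<in>carrier ?DD. \<Phi> \<in> ?b ` carrier X)"
      by (simp add: set_eq_subset subset_iff Ball_def)
    also have "\<dots> \<longleftrightarrow> (\<forall>\<Phi>\<in>carrier ?DD. \<exists>x\<in>carrier X. ?b x = \<Phi>)"
      unfolding image_iff by (simp only: eq_commute)
    also have "\<dots> \<longleftrightarrow> (\<forall>\<Phi>\<in>carrier ?DD. \<exists>x\<in>carrier X. \<forall>f\<in>mod_hom R X (ring_as_module R). \<Phi> f = f x)"
      using bs by (intro ball_cong bex_cong refl) blast
    finally show ?thesis by simp
  qed
  ultimately show ?thesis using bh unfolding mod_iso_def bij_betw_def reflexive_def by simp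
qed

text \<open>Dualising is left exact, and \<open>ext\<close> gives surjectivity onto the dual of
  \<open>K\<close>. The middle term is kept as R^n itself through the dot product:
  \<open>j f\<close> lists the values of \<open>f p\<close> on the basis, and \<open>q a\<close> is
  the form with coefficients \<open>a\<close> composed with \<open>t\<close>.\<close>

lemma dual_exseq:
  assumes K: "module R K" and X: "module R X" and t: "t \<in> mod_hom R K (free_mod R n)"
    and p: "p \<in> mod_hom R (free_mod R n) X" "p ` carrier (free_mod R n) = carrier X"
    and ker: "t ` carrier K = {v \<in> carrier (free_mod R n). p v = \<zero>\<^bsub>X\<^esub>}"
    and ext: "extends R K (free_mod R n) t"
  obtains j q where "exseq R (dual_mod R X) (free_mod R n) (dual_mod R K) j q"
    "\<And>f v. f \<in> mod_hom R X (ring_as_module R) \<Longrightarrow> v \<in> carrier (free_mod R n) \<Longrightarrow> dot R n (j f) v = f (p v)"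
    "\<And>a x. a \<in> carrier (free_mod R n) \<Longrightarrow> x \<in> carrier K \<Longrightarrow> q a x = dot R n a (t x)"
proof -
  let ?F = "free_mod R n"
  note tc = mod_hom_closed[OF t] and pc = mod_hom_closed[OF p(1)]
  interpret K: module R K by fact
  interpret F: module R ?F by (rule free_module)
  interpret DX: module R "dual_mod R X" by (rule dual_module[OF X])
  let ?j = "\<lambda>f\<in>carrier (dual_mod R X). \<lambda>k\<in>{..<n}. f (p (free_basis R n k))"
  let ?q = "\<lambda>a\<in>carrier ?F. \<lambda>x\<in>carrier K. dot R n a (t x)"
  have jh: "?j \<in> mod_hom R (dual_mod R X) ?F"
  proof (rule mod_homI[OF dual_module[OF X]])
    have jc: "(\<lambda>k\<in>{..<n}. f (p (free_basis R n k))) \<in> carrier ?F" if "f \<in> carrier (dual_mod R X)" for f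
      using mod_hom_closed[of f R X "ring_as_module R"] that pc by simp
    fix f g a assume fg: "f \<in> carrier (dual_mod R X)" "g \<in> carrier (dual_mod R X)"
    show "(\<lambda>k\<in>{..<n}. f (p (free_basis R n k))) \<in> carrier ?F" by (rule jc[OF fg(1)])
    show "(\<lambda>k\<in>{..<n}. (f \<oplus>\<^bsub>dual_mod R X\<^esub> g) (p (free_basis R n k))) =
        (\<lambda>k\<in>{..<n}. f (p (free_basis R n k))) \<oplus>\<^bsub>?F\<^esub> (\<lambda>k\<in>{..<n}. g (p (free_basis R n k)))"
      by (rule free_eqI[OF jc[OF DX.a_closed[OF fg]] free_closed(1)[OF jc[OF fg(1)] jc[OF fg(2)]]]) (use pc in simp)
    show "(\<lambda>k\<in>{..<n}. (a \<odot>\<^bsub>dual_mod R X\<^esub> f) (p (free_basis R n k))) =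
        a \<odot>\<^bsub>?F\<^esub> (\<lambda>k\<in>{..<n}. f (p (free_basis R n k)))" if a: "a \<in> carrier R"
      by (rule free_eqI[OF jc[OF DX.smult_closed[OF a fg(1)]] free_closed(2)[OF a jc[OF fg(1)]]]) (use pc in simp)
  qed
  have jd: "dot R n (?j f) v = f (p v)" if f: "f \<in> mod_hom R X (ring_as_module R)" and v: "v \<in> carrier ?F" for f v
  proof -
    have fp: "compose (carrier ?F) f p \<in> mod_hom R ?F (ring_as_module R)" by (rule mod_hom_compose[OF free_module p(1) f])
    have eq: "(\<lambda>k\<in>{..<n}. compose (carrier ?F) f p (free_basis R n k)) = ?j f"
      using f by (simp add: compose_def)
    have c: "?j f \<in> carrier ?F" by (subst eq[symmetric]) (rule free_dual_dot(1)[OF fp])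
    have "dot R n (?j f) v = dot R n v (?j f)" by (rule dot_comm[OF c v])
    also have "\<dots> = compose (carrier ?F) f p v"
      by (subst eq[symmetric]) (rule free_dual_dot(2)[OF fp v, symmetric])
    finally show ?thesis using v by (simp only: compose_eq)
  qed
  have qK: "(\<lambda>x\<in>carrier K. dot R n a (t x)) \<in> mod_hom R K (ring_as_module R)" if a: "a \<in> carrier ?F" for a
  proof -
    have "(\<lambda>x\<in>carrier K. dot R n a (t x)) = compose (carrier K) (\<lambda>v\<in>carrier ?F. dot R n v a) t"
      unfolding compose_def by (rule restrict_ext) (use tc a dot_comm in simp)
    then show ?thesis using mod_hom_compose[OF K t dot_hom[OF a]] by simp
  qed
  have qh: "?q \<in> mod_hom R ?F (dual_mod R K)"
    by (rule mod_homI[OF free_module]) (use qK tc in \<open>auto intro!: restrict_ext simp: dot_add dot_smult\<close>)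
  have rep: "\<exists>a\<in>carrier ?F. f = ?q a" if f: "f \<in> mod_hom R K (ring_as_module R)" for f
  proof -
    obtain g where g: "g \<in> mod_hom R ?F (ring_as_module R)" "\<And>k. k \<in> carrier K \<Longrightarrow> g (t k) = f k"
      using extendsD[OF ext f] by blast
    note a = free_dual_dot[OF g(1)]
    let ?a = "\<lambda>j\<in>{..<n}. g (free_basis R n j)"
    have "f = (\<lambda>x\<in>carrier K. dot R n ?a (t x))"
      by (rule mod_hom_eqI[OF f qK[OF a(1)]]) (use g(2) a(2)[OF tc] dot_comm[OF tc a(1)] in simp)
    then show ?thesis using a(1) by (intro bexI[OF _ a(1)]) simp
  qed
  have "exseq R (dual_mod R X) ?F (dual_mod R K) ?j ?q"
    unfolding exseq_def
  proof (intro conjI dual_module K X free_module jh qh)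
    show "inj_on ?j (carrier (dual_mod R X))"
    proof (rule inj_onI)
      fix f g assume fg: "f \<in> carrier (dual_mod R X)" "g \<in> carrier (dual_mod R X)" "?j f = ?j g"
      have "f x = g x" if x: "x \<in> carrier X" for x
      proof -
        obtain v where "v \<in> carrier ?F" "x = p v" using p(2) x by blast
        then show ?thesis using jd[of f v] jd[of g v] fg by simp
      qed
      then show "f = g" using mod_hom_eqI[of f R X "ring_as_module R" g "ring_as_module R"] fg by simp
    qed
    show "?q ` carrier ?F = carrier (dual_mod R K)"
    proof (rule subset_antisym; rule subsetI)
      fix f assume "f \<in> carrier (dual_mod R K)"
      then obtain a where a: "a \<in> carrier ?F" "f = ?q a" using rep by auto
      show "f \<in> ?q ` carrier ?F" unfolding a(2) by (rule imageI[OF a(1)])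
    next
      have "?q ` carrier ?F \<subseteq> carrier (dual_mod R K)" by (rule image_subsetI) (rule mod_hom_closed[OF qh])
      then show "\<And>f. f \<in> ?q ` carrier ?F \<Longrightarrow> f \<in> carrier (dual_mod R K)" by (rule subsetD)
    qed
    show "?j ` carrier (dual_mod R X) = {v \<in> carrier ?F. ?q v = \<zero>\<^bsub>dual_mod R K\<^esub>}"
    proof (rule subset_antisym; rule subsetI)
      fix a assume "a \<in> ?j ` carrier (dual_mod R X)"
      then obtain f where f: "f \<in> mod_hom R X (ring_as_module R)" "a = ?j f" by auto
      have a: "a \<in> carrier ?F" using mod_hom_closed[OF jh, of f] f by simp
      have "dot R n a (t x) = \<zero>" if x: "x \<in> carrier K" for x
      proof -
        have "p (t x) = \<zero>\<^bsub>X\<^esub>" using ker x by blast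
        then show ?thesis using jd[OF f(1) tc[OF x]] f(2) mod_hom_zero[OF X RR_module f(1)] by simp
      qed
      then show "a \<in> {v \<in> carrier ?F. ?q v = \<zero>\<^bsub>dual_mod R K\<^esub>}" using a by (auto intro!: restrict_ext)
    next
      fix a assume "a \<in> {v \<in> carrier ?F. ?q v = \<zero>\<^bsub>dual_mod R K\<^esub>}"
      then have a: "a \<in> carrier ?F" and z: "?q a = (\<lambda>x\<in>carrier K. \<zero>)" by auto
      have z': "dot R n a (t x) = \<zero>" if x: "x \<in> carrier K" for x using fun_cong[OF z, of x] x a by simp
      obtain f where f: "f \<in> mod_hom R X (ring_as_module R)" "\<And>v. v \<in> carrier ?F \<Longrightarrow> f (p v) = dot R n v a"
      proof (rule mod_hom_descend[OF free_module X RR_module p dot_hom[OF a]])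
        fix v assume v: "v \<in> carrier ?F" "p v = \<zero>\<^bsub>X\<^esub>"
        then obtain x where "x \<in> carrier K" "v = t x" using ker by blast
        then show "(\<lambda>v\<in>carrier ?F. dot R n v a) v = \<zero>\<^bsub>ring_as_module R\<^esub>"
          using z' v dot_comm[OF v(1) a] by simp
      qed auto
      have "?j f = a"
      proof (rule free_eqI[OF mod_hom_closed[OF jh] a])
        show "f \<in> carrier (dual_mod R X)" using f by simp
        fix k assume "k < n"
        then show "?j f k = a k" using f dot_basis[OF a] by simp
      qed
      then show "a \<in> ?j ` carrier (dual_mod R X)" using f(1) by force
    qed
  qed
  then show ?thesis using that[of ?j ?q] jd by simp
qed

text \<open>Vanishing of the first Ext, tested on one sequence with free middle term, extends forms
  along every sequence ending in \<open>X\<close>. Indeed \<open>B\<close> is the quotient of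
  \<open>A \<oplus> R^n\<close> by the elements \<open>(- h k, l k)\<close>; since
  \<open>u l = f h\<close>, the form \<open>f + u\<close> kills them and descends to
  \<open>B\<close>.\<close>

lemma extends_general:
  assumes E: "exseq R L (free_mod R n) X l \<pi>" and ext: "extends R L (free_mod R n) l" and S: "exseq R A B X i p"
  shows "extends R A B i"
  unfolding extends_def
proof
  let ?F = "free_mod R n" and ?RR = "ring_as_module R"
  note D = exseqD[OF E] and DS = exseqD[OF S]
  interpret A: module R A by (rule DS(1))
  interpret B: module R B by (rule DS(2))
  interpret F: module R ?F by (rule free_module)
  fix f assume f: "f \<in> mod_hom R A ?RR"
  obtain s where s: "s \<in> mod_hom R ?F B" "\<And>v. v \<in> carrier ?F \<Longrightarrow> p (s v) = \<pi> v"
    using free_projective[OF DS(2,3,6,7) D(6)] by blast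
  obtain h where h: "h \<in> mod_hom R L A" "\<And>x. x \<in> carrier L \<Longrightarrow> i (h x) = s (l x)"
  proof (rule exseq_into[OF S D(1) mod_hom_compose[OF D(1,4) s(1)]])
    show "\<And>x. x \<in> carrier L \<Longrightarrow> p (compose (carrier L) s l x) = \<zero>\<^bsub>X\<^esub>"
      using s(2) mod_hom_closed[OF D(4)] exseq_zero[OF E] by (simp add: compose_def)
  qed (auto simp: compose_def)
  obtain u where u: "u \<in> mod_hom R ?F ?RR" "\<And>x. x \<in> carrier L \<Longrightarrow> u (l x) = f (h x)"
    using extendsD[OF ext mod_hom_compose[OF D(1) h(1) f]] by (auto simp: compose_def)
  let ?P = "prod_mod A ?F"
  have P: "module R ?P" by (rule prod_mod_module[OF DS(1) free_module])
  have c: "i a \<in> carrier B" "f a \<in> carrier R" if "a \<in> carrier A" for a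
    using mod_hom_closed[OF DS(4) that] mod_hom_closed[OF f that] by auto
  have c': "s v \<in> carrier B" "u v \<in> carrier R" if "v \<in> carrier ?F" for v
    using mod_hom_closed[OF s(1) that] mod_hom_closed[OF u(1) that] by auto
  let ?r = "\<lambda>z\<in>carrier ?P. i (fst z) \<oplus>\<^bsub>B\<^esub> s (snd z)"
  let ?g = "\<lambda>z\<in>carrier ?P. f (fst z) \<oplus> u (snd z)"
  have r: "?r \<in> mod_hom R ?P B"
    by (rule mod_homI[OF P])
      (auto simp: c c' mod_hom_add[OF DS(4)] mod_hom_add[OF s(1)] mod_hom_smult[OF DS(4)] mod_hom_smult[OF s(1)]
        B.smult_r_distr B.a_ac)
  have g: "?g \<in> mod_hom R ?P ?RR"
    by (rule mod_homI[OF P])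
      (auto simp: c c' mod_hom_add[OF f] mod_hom_add[OF u(1)] mod_hom_smult[OF f] mod_hom_smult[OF u(1)]
        r_distr a_ac)
  have rs: "?r ` carrier ?P = carrier B"
  proof (rule subset_antisym; rule subsetI)
    fix b assume b: "b \<in> carrier B"
    obtain v where v: "v \<in> carrier ?F" "p b = \<pi> v" using exseq_surj[OF E mod_hom_closed[OF DS(6) b]] by blast
    have "p (b \<ominus>\<^bsub>B\<^esub> s v) = \<zero>\<^bsub>X\<^esub>"
      using v s(2) b c'(1)[OF v(1)] mod_hom_minus[OF DS(2,3,6)] mod_hom_closed[OF D(6) v(1)] module.sub_self[OF DS(3)] by simp
    then obtain a where a: "a \<in> carrier A" "b \<ominus>\<^bsub>B\<^esub> s v = i a"
      using exseq_exact[OF S] b c'(1)[OF v(1)] by (metis B.minus_closed)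
    have "?r (a, v) = b" using a v B.sub_add_cancel[OF b c'(1)[OF v(1)]] by simp
    then show "b \<in> ?r ` carrier ?P" using a v by (intro image_eqI[of _ _ "(a, v)"]) auto
  qed (use mod_hom_closed[OF r] in blast)
  obtain g' where g': "g' \<in> mod_hom R B ?RR" "\<And>z. z \<in> carrier ?P \<Longrightarrow> g' (?r z) = ?g z"
  proof (rule mod_hom_descend[OF P DS(2) RR_module r rs g])
    fix z assume z: "z \<in> carrier ?P" "?r z = \<zero>\<^bsub>B\<^esub>"
    obtain a v where av: "z = (a, v)" "a \<in> carrier A" "v \<in> carrier ?F" using z(1) by auto
    have eq: "i a \<oplus>\<^bsub>B\<^esub> s v = \<zero>\<^bsub>B\<^esub>" using z av by simp
    have "p (i a \<oplus>\<^bsub>B\<^esub> s v) = \<pi> v"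
      using av c(1) c'(1) s(2) exseq_zero[OF S] mod_hom_closed[OF D(6)] module.axioms(2)[OF DS(3)]
      by (simp add: mod_hom_add[OF DS(6)] abelian_group.axioms(1) abelian_monoid.l_zero)
    then have "\<pi> v = \<zero>\<^bsub>X\<^esub>" using eq mod_hom_zero[OF DS(2,3,6)] by simp
    then obtain k where k: "k \<in> carrier L" "v = l k" using exseq_exact[OF E av(3)] by blast
    note hk = mod_hom_closed[OF h(1) k(1)]
    have "i (a \<oplus>\<^bsub>A\<^esub> h k) = i \<zero>\<^bsub>A\<^esub>"
      using eq av(2) hk h(2)[OF k(1)] k(2) mod_hom_zero[OF DS(1,2,4)] by (simp add: mod_hom_add[OF DS(4)])
    then have "a \<oplus>\<^bsub>A\<^esub> h k = \<zero>\<^bsub>A\<^esub>" using exseq_inj[OF S] av(2) hk by simp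
    then have "f a \<oplus> f (h k) = \<zero>" using mod_hom_add[OF f av(2) hk] mod_hom_zero[OF DS(1) RR_module f] by simp
    then show "?g z = \<zero>\<^bsub>?RR\<^esub>" using av k u(2) by simp
  qed blast
  have "g' (i a) = f a" if a: "a \<in> carrier A" for a
    using g'(2)[of "(a, \<zero>\<^bsub>?F\<^esub>)"] a c[OF a] mod_hom_zero[OF free_module DS(2) s(1)] mod_hom_zero[OF free_module RR_module u(1)]
    by simp
  then show "\<exists>g\<in>mod_hom R B ?RR. \<forall>k\<in>carrier A. g (i k) = f k" using g'(1) by blast
qed

end

section \<open>Syzygies, cosyzygies and extensions of G-projective modules\<close>

context noetherian_cring
begin

lemma fg_dual: "fg_module R X \<Longrightarrow> fg_module R (dual_mod R X)"
proof -
  assume X: "fg_module R X"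
  have RR: "fg_module R (ring_as_module R)"
    using noeth_modD[OF noeth_RR module.carrier_is_submodule[OF RR_module]] RR_module unfolding fg_module_iff by blast
  have Xm: "module R X" using X by (simp add: fg_module_iff)
  note m = dual_module[OF Xm]
  have "noeth_mod R (dual_mod R X)" unfolding dual_mod_def by (rule noeth_Hom[OF X RR])
  then show ?thesis using noeth_modD module.carrier_is_submodule[OF m] m unfolding fg_module_iff by blast
qed

lemma G_projective_iff: "G_projective R X \<longleftrightarrow> Gp R X"
proof -
  have "Gp R X \<Longrightarrow> fg_module R X" unfolding Gp_def using fg_ext_orth by blast
  moreover have "G_projective R X \<longleftrightarrow> Gp R X" if X: "fg_module R X"
  proof -
    have Xm: "module R X" using X by (simp add: fg_module_iff)
    show ?thesis
      unfolding G_projective_def Gp_def reflexive_iff_bidual[OF Xm] ext_orth_iff_Ext[OF X] ext_orth_iff_Ext[OF fg_dual[OF X]]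
      using X by blast
  qed
  ultimately show ?thesis unfolding G_projective_def by blast
qed

lemma Gp_fg: "Gp R X \<Longrightarrow> fg_module R X"
  unfolding Gp_def using fg_ext_orth by blast

lemma Gp_module: "Gp R X \<Longrightarrow> module R X"
  by (drule Gp_fg) (simp add: fg_module_iff)

lemma Gp_extends:
  assumes "Gp R Y" "exseq R A B Y i p" shows "extends R A B i"
proof -
  have "ext_orth R Y" using assms(1) by (simp add: Gp_def)
  then obtain K :: "'a obj" and n l \<pi> where "exseq R K (free_mod R n) Y l \<pi>" "extends R K (free_mod R n) l"
    by (rule ext_orthE)
  then show ?thesis using extends_general assms(2) by blast
qed

text \<open>The dual of \<open>K\<close> is a cosyzygy of the dual of \<open>X\<close>, so its Ext
  condition reduces to extending linear forms from the dual of \<open>X\<close> to R^n, which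
  reflexivity of \<open>X\<close> provides.\<close>

lemma Gp_syzygy:
  assumes X: "Gp R X" and E: "exseq R K (free_mod R n) X i p"
  shows "Gp R K"
proof -
  let ?F = "free_mod R n" and ?RR = "ring_as_module R"
  note D = exseqD[OF E]
  have P: "ext_orth R X" "ext_orth R (dual_mod R X)" "reflexive R X" using X by (auto simp: Gp_def)
  note ext = ext_orth_syzygy[OF E P(1)]
  interpret K: module R K by (rule D(1))
  interpret F: module R ?F by (rule free_module)
  obtain j q where jq: "exseq R (dual_mod R X) ?F (dual_mod R K) j q"
    "\<And>f v. f \<in> mod_hom R X (ring_as_module R) \<Longrightarrow> v \<in> carrier (free_mod R n) \<Longrightarrow> dot R n (j f) v = f (p v)"
    "\<And>a x. a \<in> carrier (free_mod R n) \<Longrightarrow> x \<in> carrier K \<Longrightarrow> q a x = dot R n a (i x)"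
    using dual_exseq[OF D(1,3,4,6,7,8) ext(1)] by blast
  note DQ = exseqD[OF jq(1)]
  \<comment> \<open>A form on the dual of \<open>X\<close> is evaluation at some \<open>x\<close>; a
    lift \<open>v\<close> of \<open>x\<close> to the cover turns it into the dot product with
    \<open>v\<close>.\<close>
  have "extends R (dual_mod R X) ?F j"
    unfolding extends_def
  proof
    fix \<Phi> assume \<Phi>: "\<Phi> \<in> mod_hom R (dual_mod R X) ?RR"
    obtain x where x: "x \<in> carrier X" "\<And>f. f \<in> mod_hom R X ?RR \<Longrightarrow> \<Phi> f = f x"
      using reflexiveD2[OF P(3) \<Phi>] by blast
    obtain v where v: "v \<in> carrier ?F" "x = p v" using exseq_surj[OF E x(1)] by blast
    show "\<exists>g\<in>mod_hom R ?F ?RR. \<forall>f\<in>carrier (dual_mod R X). g (j f) = \<Phi> f"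
      by (rule bexI[OF _ dot_hom[OF v(1)]])
        (use x(2) v jq(2) mod_hom_closed[OF DQ(4)] in auto)
  qed
  then have "ext_orth R (dual_mod R K)" by (rule ext_orth_cosyzygy[OF jq(1) _ P(2)])
  moreover have "reflexive R K"
    unfolding reflexive_def
  proof (intro conjI ballI impI)
    fix x assume x: "x \<in> carrier K" and z: "\<forall>f\<in>mod_hom R K ?RR. f x = \<zero>"
    have "i x = \<zero>\<^bsub>?F\<^esub>"
    proof (rule free_eqI[OF mod_hom_closed[OF D(4) x] F.zero_closed])
      fix k assume k: "k < n"
      have "compose (carrier K) (\<lambda>v\<in>carrier ?F. v k) i x = \<zero>"
        using z mod_hom_compose[OF D(1,4) free_coord_hom[OF k]] by blast
      then show "i x k = \<zero>\<^bsub>?F\<^esub> k" using x mod_hom_closed[OF D(4) x] k by (simp add: compose_def)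
    qed
    then show "x = \<zero>\<^bsub>K\<^esub>" using exseq_inj[OF E x K.zero_closed] mod_hom_zero[OF D(1,2,4)] by simp
  next
    fix \<Phi> assume \<Phi>: "\<Phi> \<in> mod_hom R (dual_mod R K) ?RR"
    \<comment> \<open>Pulled back to R^n, \<open>\<Phi>\<close> is the dot product with a vector
      \<open>v\<close>. It vanishes on the forms that come from \<open>X\<close>, so all forms on
      \<open>X\<close> kill \<open>p v\<close>; hence \<open>p v = 0\<close> and \<open>v\<close>
      comes from \<open>K\<close>.\<close>
    note g = mod_hom_compose[OF free_module DQ(6) \<Phi>]
    obtain v where v: "v \<in> carrier ?F" "\<And>a. a \<in> carrier ?F \<Longrightarrow> compose (carrier ?F) \<Phi> q a = dot R n a v"
      using free_dual_dot[OF g] by blast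
    have v2: "\<Phi> (q a) = dot R n a v" if "a \<in> carrier ?F" for a
      using v(2)[OF that] that by (simp only: compose_eq)
    have "p v = \<zero>\<^bsub>X\<^esub>"
    proof (rule reflexiveD1[OF P(3) mod_hom_closed[OF D(6) v(1)]])
      fix f assume f: "f \<in> mod_hom R X ?RR"
      then have fc: "f \<in> carrier (dual_mod R X)" by simp
      have "\<Phi> (q (j f)) = \<zero>"
        using exseq_zero[OF jq(1) fc] mod_hom_zero[OF DQ(3) RR_module \<Phi>] by simp
      then show "f (p v) = \<zero>"
        using jq(2)[OF f v(1)] v2[OF mod_hom_closed[OF DQ(4) fc]] by simp
    qed
    then obtain x where x: "x \<in> carrier K" "v = i x" using exseq_exact[OF E v(1)] by blast
    have "\<Phi> f = f x" if f: "f \<in> mod_hom R K ?RR" for f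
    proof -
      obtain a where a: "a \<in> carrier ?F" "f = q a" using exseq_surj[OF jq(1)] f by auto
      then show ?thesis using v2[OF a(1)] jq(3)[OF a(1) x(1)] x(2) by simp
    qed
    then show "\<exists>x\<in>carrier K. \<forall>f\<in>mod_hom R K ?RR. \<Phi> f = f x" using x(1) by blast
  qed
  ultimately show ?thesis using ext(2) by (simp add: Gp_def)
qed

text \<open>Compared with \<open>Gp_syzygy\<close> the ends are exchanged: the dual of
  \<open>X\<close> is now a syzygy of the dual of \<open>K\<close>, so its Ext condition is
  inherited, while \<open>X\<close> itself is a cosyzygy along which linear forms extend.\<close>

lemma Gp_cosyzygy:
  assumes K: "Gp R K" and X: "module R X" and t: "t \<in> mod_hom R K (free_mod R n)"
    and ext: "extends R K (free_mod R n) t"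
    and p: "p \<in> mod_hom R (free_mod R n) X" "p ` carrier (free_mod R n) = carrier X"
    and ker: "t ` carrier K = {v \<in> carrier (free_mod R n). p v = \<zero>\<^bsub>X\<^esub>}"
  shows "Gp R X" "exseq R K (free_mod R n) X t p"
proof -
  let ?F = "free_mod R n" and ?RR = "ring_as_module R"
  have P: "ext_orth R K" "ext_orth R (dual_mod R K)" "reflexive R K" using K by (auto simp: Gp_def)
  note Km = Gp_module[OF K]
  \<comment> \<open>Linear forms separate the points of a reflexive module, and each of them extends
    along \<open>t\<close>; so no nonzero element is killed by \<open>t\<close>.\<close>
  have inj: "inj_on t (carrier K)"
  proof (rule kernel_zero_inj[OF Km free_module t])
    fix x assume x: "x \<in> carrier K" "t x = \<zero>\<^bsub>?F\<^esub>"
    show "x = \<zero>\<^bsub>K\<^esub>"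
    proof (rule reflexiveD1[OF P(3) x(1)])
      fix f assume "f \<in> mod_hom R K ?RR"
      then obtain g where g: "g \<in> mod_hom R ?F ?RR" "g (t x) = f x" using extendsD[OF ext] x(1) by metis
      then show "f x = \<zero>" using x(2) mod_hom_zero[OF free_module RR_module g(1)] by simp
    qed
  qed
  show E: "exseq R K ?F X t p" unfolding exseq_def using Km X t inj p ker free_module by blast
  note D = exseqD[OF E]
  have eX: "ext_orth R X" by (rule ext_orth_cosyzygy[OF E ext P(1)])
  obtain j q where jq: "exseq R (dual_mod R X) ?F (dual_mod R K) j q"
    "\<And>f v. f \<in> mod_hom R X (ring_as_module R) \<Longrightarrow> v \<in> carrier (free_mod R n) \<Longrightarrow> dot R n (j f) v = f (p v)"
    "\<And>a x. a \<in> carrier (free_mod R n) \<Longrightarrow> x \<in> carrier K \<Longrightarrow> q a x = dot R n a (t x)"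
    using dual_exseq[OF Km X t p ker ext] by blast
  note DQ = exseqD[OF jq(1)] and eD = ext_orth_syzygy[OF jq(1) P(2)]
  have "reflexive R X"
    unfolding reflexive_def
  proof (intro conjI ballI impI)
    fix x assume x: "x \<in> carrier X" and z: "\<forall>f\<in>mod_hom R X ?RR. f x = \<zero>"
    obtain v where v: "v \<in> carrier ?F" "x = p v" using exseq_surj[OF E x] by blast
    \<comment> \<open>If all forms on \<open>X\<close> kill \<open>p v\<close>, the dot product with
      \<open>v\<close> vanishes on the dual of \<open>X\<close> and descends to the dual of
      \<open>K\<close>. There it is evaluation at some \<open>y\<close>, which forces
      \<open>v = t y\<close>.\<close>
    obtain \<Psi> where \<Psi>: "\<Psi> \<in> mod_hom R (dual_mod R K) ?RR" "\<And>a. a \<in> carrier ?F \<Longrightarrow> \<Psi> (q a) = dot R n a v"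
    proof (rule exseq_descend[OF jq(1) RR_module dot_hom[OF v(1)]])
      fix f assume f: "f \<in> carrier (dual_mod R X)"
      then show "(\<lambda>a\<in>carrier ?F. dot R n a v) (j f) = \<zero>\<^bsub>?RR\<^esub>"
        using z v jq(2)[of f v] mod_hom_closed[OF DQ(4) f] by simp
    qed auto
    obtain y where y: "y \<in> carrier K" "\<And>f. f \<in> mod_hom R K ?RR \<Longrightarrow> \<Psi> f = f y"
      using reflexiveD2[OF P(3) \<Psi>(1)] by blast
    note ty = mod_hom_closed[OF t y(1)]
    have "v = t y"
    proof (rule free_eqI[OF v(1) ty])
      fix k assume k: "k < n"
      have "dot R n (free_basis R n k) v = dot R n (free_basis R n k) (t y)"
        using \<Psi>(2)[OF free_basis_carrier] y(2) mod_hom_closed[OF DQ(6) free_basis_carrier]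
          jq(3)[OF free_basis_carrier y(1)] by simp
      then show "v k = t y k" using dot_basis[OF v(1) k] dot_basis[OF ty k] by simp
    qed
    then show "x = \<zero>\<^bsub>X\<^esub>" using exseq_zero[OF E y(1)] v(2) by simp
  next
    fix \<Phi> assume \<Phi>: "\<Phi> \<in> mod_hom R (dual_mod R X) ?RR"
    obtain g where g: "g \<in> mod_hom R ?F ?RR" "\<And>f. f \<in> carrier (dual_mod R X) \<Longrightarrow> g (j f) = \<Phi> f"
      using extendsD[OF eD(1) \<Phi>] by blast
    obtain v where v: "v \<in> carrier ?F" "\<And>a. a \<in> carrier ?F \<Longrightarrow> g a = dot R n a v"
      using free_dual_dot[OF g(1)] by blast
    have "\<Phi> f = f (p v)" if f: "f \<in> mod_hom R X ?RR" for f
    proof -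
      have fc: "f \<in> carrier (dual_mod R X)" using f by simp
      show ?thesis using g(2)[OF fc] v(2)[OF mod_hom_closed[OF DQ(4) fc]] jq(2)[OF f v(1)] by simp
    qed
    then show "\<exists>x\<in>carrier X. \<forall>f\<in>mod_hom R X ?RR. \<Phi> f = f x" using mod_hom_closed[OF D(6) v(1)] by blast
  qed
  then show "Gp R X" using eX eD(2) by (simp add: Gp_def)
qed

text \<open>Forms on \<open>X\<close> extend to \<open>C\<close> by \<open>Gp_extends\<close>, so
  the dual sequence is exact as well and both Ext conditions pass to the middle term. Reflexivity of
  \<open>C\<close> is the five lemma for the maps into the biduals, chased on elements.\<close>

lemma Gp_extension:
  assumes E: "exseq R X C Y i p" and X: "Gp R X" and Y: "Gp R Y"
  shows "Gp R C"
proof -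
  let ?RR = "ring_as_module R"
  note D = exseqD[OF E]
  interpret X: module R X by (rule D(1))
  interpret C: module R C by (rule D(2))
  interpret RR: module R ?RR by (rule RR_module)
  have PX: "ext_orth R X" "ext_orth R (dual_mod R X)" "reflexive R X" using X by (auto simp: Gp_def)
  have PY: "ext_orth R Y" "ext_orth R (dual_mod R Y)" "reflexive R Y" using Y by (auto simp: Gp_def)
  have ext: "extends R X C i" by (rule Gp_extends[OF Y E])
  interpret DC: module R "dual_mod R C" by (rule dual_module[OF D(2)])
  let ?j = "\<lambda>f\<in>carrier (dual_mod R Y). compose (carrier C) f p"
  let ?q = "\<lambda>f\<in>carrier (dual_mod R C). compose (carrier X) f i"
  have jh: "?j \<in> mod_hom R (dual_mod R Y) (dual_mod R C)"
  proof (rule mod_homI[OF dual_module[OF D(3)]])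
    show "compose (carrier C) f p \<in> carrier (dual_mod R C)" if "f \<in> carrier (dual_mod R Y)" for f
      using mod_hom_compose[OF D(2,6), of f ?RR] that by simp
  qed (auto intro!: restrict_ext simp: compose_def mod_hom_closed[OF D(6)])
  have qh: "?q \<in> mod_hom R (dual_mod R C) (dual_mod R X)"
  proof (rule mod_homI[OF dual_module[OF D(2)]])
    show "compose (carrier X) f i \<in> carrier (dual_mod R X)" if "f \<in> carrier (dual_mod R C)" for f
      using mod_hom_compose[OF D(1,4), of f ?RR] that by simp
  qed (auto intro!: restrict_ext simp: compose_def mod_hom_closed[OF D(4)])
  have ED: "exseq R (dual_mod R Y) (dual_mod R C) (dual_mod R X) ?j ?q"
    unfolding exseq_def
  proof (intro conjI dual_module D(1-3) jh qh)
    show "inj_on ?j (carrier (dual_mod R Y))"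
    proof (rule inj_onI)
      fix f g assume fg: "f \<in> carrier (dual_mod R Y)" "g \<in> carrier (dual_mod R Y)" "?j f = ?j g"
      have "f y = g y" if "y \<in> carrier Y" for y
      proof -
        obtain c where c: "c \<in> carrier C" "y = p c" using exseq_surj[OF E \<open>y \<in> carrier Y\<close>] by blast
        then show ?thesis using fun_cong[OF fg(3), of c] fg(1,2) by (simp add: compose_def)
      qed
      then show "f = g" using mod_hom_eqI[of f R Y ?RR g ?RR] fg by simp
    qed
    show "?q ` carrier (dual_mod R C) = carrier (dual_mod R X)"
    proof (rule subset_antisym; rule subsetI)
      fix f assume f: "f \<in> carrier (dual_mod R X)"
      then have fh: "f \<in> mod_hom R X ?RR" by simp
      obtain g where g: "g \<in> mod_hom R C ?RR" "\<And>x. x \<in> carrier X \<Longrightarrow> g (i x) = f x"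
        using extendsD[OF ext fh] by blast
      have "compose (carrier X) g i = f"
        by (rule mod_hom_eqI[OF mod_hom_compose[OF D(1,4) g(1)] fh]) (use g(2) in \<open>simp add: compose_def\<close>)
      then show "f \<in> ?q ` carrier (dual_mod R C)" using g(1) by (intro image_eqI[of _ _ g]) auto
    qed (use mod_hom_closed[OF qh] in blast)
    show "?j ` carrier (dual_mod R Y) = {v \<in> carrier (dual_mod R C). ?q v = \<zero>\<^bsub>dual_mod R X\<^esub>}"
    proof (rule subset_antisym; rule subsetI)
      fix g assume "g \<in> ?j ` carrier (dual_mod R Y)"
      then obtain f where f: "f \<in> carrier (dual_mod R Y)" "g = ?j f" by blast
      have gc: "g \<in> carrier (dual_mod R C)" using mod_hom_closed[OF jh f(1)] f(2) by simp
      have "g (i x) = \<zero>" if "x \<in> carrier X" for x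
        using that f mod_hom_closed[OF D(4)] exseq_zero[OF E] mod_hom_zero[OF D(3) RR_module, of f]
        by (simp add: compose_def)
      then show "g \<in> {v \<in> carrier (dual_mod R C). ?q v = \<zero>\<^bsub>dual_mod R X\<^esub>}"
        using gc by (auto simp: compose_def intro!: restrict_ext)
    next
      fix g assume "g \<in> {v \<in> carrier (dual_mod R C). ?q v = \<zero>\<^bsub>dual_mod R X\<^esub>}"
      then have g: "g \<in> mod_hom R C ?RR" and z: "?q g = (\<lambda>x\<in>carrier X. \<zero>)" by auto
      have z': "g (i x) = \<zero>\<^bsub>?RR\<^esub>" if "x \<in> carrier X" for x using fun_cong[OF z, of x] g that by (simp add: compose_def)
      obtain f where f: "f \<in> mod_hom R Y ?RR" "\<And>c. c \<in> carrier C \<Longrightarrow> f (p c) = g c"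
        using exseq_descend[OF E RR_module g z'] by blast
      have "compose (carrier C) f p = g"
        by (rule mod_hom_eqI[OF mod_hom_compose[OF D(2,6) f(1)] g]) (use f(2) in \<open>simp add: compose_def\<close>)
      then show "g \<in> ?j ` carrier (dual_mod R Y)" using f(1) by (intro image_eqI[of _ _ f]) auto
    qed
  qed
  have "reflexive R C"
    unfolding reflexive_def
  proof (intro conjI ballI impI)
    fix c assume c: "c \<in> carrier C" and z: "\<forall>f\<in>mod_hom R C ?RR. f c = \<zero>"
    have "p c = \<zero>\<^bsub>Y\<^esub>"
    proof (rule reflexiveD1[OF PY(3) mod_hom_closed[OF D(6) c]])
      fix f assume "f \<in> mod_hom R Y ?RR"
      then have "compose (carrier C) f p c = \<zero>" using z mod_hom_compose[OF D(2,6)] by blast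
      then show "f (p c) = \<zero>" using c by (simp add: compose_def)
    qed
    then obtain x where x: "x \<in> carrier X" "c = i x" using exseq_exact[OF E c] by blast
    have "x = \<zero>\<^bsub>X\<^esub>"
    proof (rule reflexiveD1[OF PX(3) x(1)])
      fix f assume "f \<in> mod_hom R X ?RR"
      then obtain g where "g \<in> mod_hom R C ?RR" "g (i x) = f x" using extendsD[OF ext] x(1) by metis
      then show "f x = \<zero>" using z x(2) by metis
    qed
    then show "c = \<zero>\<^bsub>C\<^esub>" using x(2) mod_hom_zero[OF D(1,2,4)] by simp
  next
    fix \<Phi> assume \<Phi>: "\<Phi> \<in> mod_hom R (dual_mod R C) ?RR"
    obtain y where y: "y \<in> carrier Y" "\<And>f. f \<in> mod_hom R Y ?RR \<Longrightarrow> compose (carrier (dual_mod R Y)) \<Phi> ?j f = f y"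
      using reflexiveD2[OF PY(3) mod_hom_compose[OF dual_module[OF D(3)] jh \<Phi>]] by blast
    obtain c where c: "c \<in> carrier C" "y = p c" using exseq_surj[OF E y(1)] by blast
    \<comment> \<open>Evaluation at \<open>c\<close> agrees with \<open>\<Phi>\<close> on the forms
      that come from \<open>Y\<close>. The difference therefore descends to the dual of
      \<open>X\<close>, where it is evaluation at a point of \<open>X\<close>.\<close>
    let ?\<Psi> = "\<lambda>g\<in>carrier (dual_mod R C). \<Phi> g \<ominus> g c"
    have cl: "\<Phi> g \<in> carrier R" "g c \<in> carrier R" if "g \<in> mod_hom R C ?RR" for g
      using mod_hom_closed[OF \<Phi>, of g] mod_hom_closed[OF that c(1)] that by auto
    have ev: "(\<lambda>g\<in>carrier (dual_mod R C). g c) \<in> mod_hom R (dual_mod R C) ?RR"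
      by (rule mod_homI[OF dual_module[OF D(2)]]) (use c(1) cl in auto)
    have \<Psi>: "?\<Psi> \<in> mod_hom R (dual_mod R C) ?RR"
      using mod_hom_minus_map[OF dual_module[OF D(2)] RR_module \<Phi> ev] by (simp cong: restrict_cong)
    obtain \<Theta> where \<Theta>: "\<Theta> \<in> mod_hom R (dual_mod R X) ?RR" "\<And>g. g \<in> carrier (dual_mod R C) \<Longrightarrow> \<Theta> (?q g) = ?\<Psi> g"
    proof (rule exseq_descend[OF ED RR_module \<Psi>])
      fix f assume f: "f \<in> carrier (dual_mod R Y)"
      have jc: "?j f \<in> mod_hom R C ?RR" using mod_hom_closed[OF jh f] by simp
      have "\<Phi> (?j f) = f y" using y(2)[of f] f by (simp add: compose_def[of _ \<Phi>])
      moreover have "?j f c = f y" using f c by (simp add: compose_def)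
      ultimately have "\<Phi> (?j f) = ?j f c" by simp
      then show "?\<Psi> (?j f) = \<zero>\<^bsub>?RR\<^esub>" using jc cl[OF jc] RR.sub_self[of "\<Phi> (?j f)"] by (simp del: restrict_apply add: restrict_apply')
    qed blast
    obtain x where x: "x \<in> carrier X" "\<And>f. f \<in> mod_hom R X ?RR \<Longrightarrow> \<Theta> f = f x"
      using reflexiveD2[OF PX(3) \<Theta>(1)] by blast
    note ix = mod_hom_closed[OF D(4) x(1)]
    have "\<Phi> g = g (c \<oplus>\<^bsub>C\<^esub> i x)" if g: "g \<in> mod_hom R C ?RR" for g
    proof -
      have qg: "?q g \<in> mod_hom R X ?RR" using mod_hom_closed[OF qh, of g] g by simp
      have "\<Phi> g \<ominus> g c = ?q g x" using \<Theta>(2)[of g] x(2)[OF qg] g by simp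
      also have "\<dots> = g (i x)" using g x(1) by (simp add: compose_def)
      finally have "\<Phi> g = g (i x) \<oplus> g c" using RR.sub_add_cancel[of "\<Phi> g" "g c"] cl[OF g] by simp
      then show ?thesis using mod_hom_add[OF g c(1) ix] mod_hom_closed[OF g ix] cl[OF g] by (simp add: a_comm)
    qed
    then show "\<exists>x\<in>carrier C. \<forall>f\<in>mod_hom R C ?RR. \<Phi> f = f x" using c(1) ix by blast
  qed
  then show ?thesis using ext_orth_extension[OF E PX(1) PY(1)] ext_orth_extension[OF ED PY(2) PX(2)]
    by (simp add: Gp_def)
qed

lemma free_zero_carrier: "carrier (free_mod R 0) = {\<zero>\<^bsub>free_mod R 0\<^esub>}"
  by (auto simp: free_mod_def)

lemma zero_module_cover:
  assumes X: "module R X" "carrier X = {\<zero>\<^bsub>X\<^esub>}"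
  obtains K :: "'a obj" and i p where "exseq R K (free_mod R 0) X i p" "extends R K (free_mod R 0) i"
    "module R K" "carrier K = {\<zero>\<^bsub>K\<^esub>}"
proof -
  let ?F = "free_mod R 0"
  have p: "(\<lambda>x\<in>carrier ?F. \<zero>\<^bsub>X\<^esub>) \<in> mod_hom R ?F X" by (rule mod_hom_zero_map[OF free_module X(1)])
  have ps: "(\<lambda>x\<in>carrier ?F. \<zero>\<^bsub>X\<^esub>) ` carrier ?F = carrier X" unfolding X(2) free_zero_carrier by auto
  obtain K :: "'a obj" and i where E: "exseq R K ?F X i (\<lambda>x\<in>carrier ?F. \<zero>\<^bsub>X\<^esub>)"
    using X(1) p ps by (rule kernel_exseq)
  note D = exseqD[OF E]
  interpret K: module R K by (rule D(1))
  have "k = \<zero>\<^bsub>K\<^esub>" if k: "k \<in> carrier K" for k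
  proof (rule exseq_inj[OF E k K.zero_closed])
    show "i k = i \<zero>\<^bsub>K\<^esub>"
      using mod_hom_closed[OF D(4) k] mod_hom_closed[OF D(4) K.zero_closed] unfolding free_zero_carrier by simp
  qed
  then have K0: "carrier K = {\<zero>\<^bsub>K\<^esub>}" using K.zero_closed by blast
  have "extends R K ?F i"
    unfolding extends_def
  proof
    fix f assume f: "f \<in> mod_hom R K (ring_as_module R)"
    have "(\<lambda>x\<in>carrier ?F. \<zero>\<^bsub>ring_as_module R\<^esub>) (i k) = f k" if k: "k \<in> carrier K" for k
      using K0 k mod_hom_zero[OF D(1) RR_module f] mod_hom_closed[OF D(4) k] by simp
    then show "\<exists>g\<in>mod_hom R ?F (ring_as_module R). \<forall>k\<in>carrier K. g (i k) = f k"
      using mod_hom_zero_map[OF free_module RR_module] by blast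
  qed
  then show ?thesis using that E K0 K.module_axioms by blast
qed

text \<open>A zero module is covered by R^0 with zero kernel, so being zero is a coinductive
  invariant.\<close>

lemma ext_orth_zero:
  assumes X: "module R X" "carrier X = {\<zero>\<^bsub>X\<^esub>}"
  shows "ext_orth R X"
proof -
  have obj: "ext_orth_obj R K" if "module R K" "carrier K = {\<zero>\<^bsub>K\<^esub>}" for K :: "'a obj"
    using that
  proof (coinduction arbitrary: K)
    case (ext_orth_obj K)
    obtain L :: "'a obj" and i p where "exseq R L (free_mod R 0) K i p" "extends R L (free_mod R 0) i"
      "module R L" "carrier L = {\<zero>\<^bsub>L\<^esub>}"
      using ext_orth_obj by (rule zero_module_cover)
    then show ?case by (intro exI conjI disjI1) (assumption | rule refl)+
  qed
  obtain L :: "'a obj" and i p where L: "exseq R L (free_mod R 0) X i p" "extends R L (free_mod R 0) i"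
    "module R L" "carrier L = {\<zero>\<^bsub>L\<^esub>}"
    using X by (rule zero_module_cover)
  show ?thesis using ext_orthI[OF L(1,2)] obj[OF L(3,4)] unfolding ext_orth_obj_iff by blast
qed

lemma Gp_zero: "Gp R (free_mod R 0)"
proof -
  let ?F = "free_mod R 0" and ?RR = "ring_as_module R"
  have xz: "x = \<zero>\<^bsub>?F\<^esub>" if "x \<in> carrier ?F" for x using that free_zero_carrier by blast
  have f0: "f \<zero>\<^bsub>?F\<^esub> = \<zero>" if f: "f \<in> mod_hom R ?F ?RR" for f
    using mod_hom_zero[OF free_module RR_module f] by simp
  have fz: "f = \<zero>\<^bsub>dual_mod R ?F\<^esub>" if f: "f \<in> mod_hom R ?F ?RR" for f
  proof -
    have "f = (\<lambda>x\<in>carrier ?F. \<zero>\<^bsub>?RR\<^esub>)"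
    proof (rule mod_hom_eqI[OF f mod_hom_zero_map[OF free_module RR_module]])
      fix x assume x: "x \<in> carrier ?F"
      show "f x = (\<lambda>x\<in>carrier ?F. \<zero>\<^bsub>?RR\<^esub>) x" using f0[OF f] xz[OF x] x by simp
    qed
    then show ?thesis by simp
  qed
  interpret D: module R "dual_mod R ?F" by (rule dual_module[OF free_module])
  have d0: "carrier (dual_mod R ?F) = {\<zero>\<^bsub>dual_mod R ?F\<^esub>}"
  proof (rule subset_antisym; rule subsetI)
    fix f assume "f \<in> carrier (dual_mod R ?F)"
    then have "f = \<zero>\<^bsub>dual_mod R ?F\<^esub>" using fz unfolding dual_mod_simps(1) by blast
    then show "f \<in> {\<zero>\<^bsub>dual_mod R ?F\<^esub>}" by (simp only: singleton_iff)
  qed (use D.zero_closed in blast)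
  have "reflexive R ?F"
    unfolding reflexive_def
  proof (intro conjI ballI impI)
    show "\<And>x. x \<in> carrier ?F \<Longrightarrow> x = \<zero>\<^bsub>?F\<^esub>" by (rule xz)
    fix \<Phi> assume \<Phi>: "\<Phi> \<in> mod_hom R (dual_mod R ?F) ?RR"
    have "\<Phi> f = f \<zero>\<^bsub>?F\<^esub>" if f: "f \<in> mod_hom R ?F ?RR" for f
    proof -
      have "\<Phi> f = \<Phi> \<zero>\<^bsub>dual_mod R ?F\<^esub>" by (rule arg_cong[OF fz[OF f]])
      also have "\<dots> = \<zero>" using mod_hom_zero[OF D.module_axioms RR_module \<Phi>] by simp
      finally show ?thesis using f0[OF f] by simp
    qed
    then show "\<exists>x\<in>carrier ?F. \<forall>f\<in>mod_hom R ?F ?RR. \<Phi> f = f x" using free_zero_carrier by blast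
  qed
  then show ?thesis
    using ext_orth_zero[OF free_module free_zero_carrier] ext_orth_zero[OF D.module_axioms d0] by (simp add: Gp_def)
qed

text \<open>A free module is the cosyzygy of the zero module along
  \<open>0 \<rightarrow> R^n \<rightarrow> X\<close>, so G-projectivity has to be checked by hand
  only for zero.\<close>

lemma Gp_free:
  assumes X: "module R X" and p: "p \<in> mod_hom R (free_mod R n) X" "inj_on p (carrier (free_mod R n))"
    "p ` carrier (free_mod R n) = carrier X"
  shows "Gp R X"
proof -
  let ?Z = "free_mod R 0" and ?F = "free_mod R n" and ?RR = "ring_as_module R"
  interpret F: module R ?F by (rule free_module)
  note c0 = free_zero_carrier
  note t = mod_hom_zero_map[OF free_module free_module, of n 0]
  show ?thesis
  proof (rule Gp_cosyzygy(1)[OF Gp_zero X t _ p(1,3)])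
    show "extends R ?Z ?F (\<lambda>x\<in>carrier ?Z. \<zero>\<^bsub>?F\<^esub>)"
      unfolding extends_def
    proof
      fix f assume f: "f \<in> mod_hom R ?Z ?RR"
      have "(\<lambda>x\<in>carrier ?F. \<zero>\<^bsub>?RR\<^esub>) ((\<lambda>x\<in>carrier ?Z. \<zero>\<^bsub>?F\<^esub>) k) = f k" if "k \<in> carrier ?Z" for k
        using mod_hom_zero[OF free_module RR_module f] c0 that by simp
      then show "\<exists>g\<in>mod_hom R ?F ?RR. \<forall>k\<in>carrier ?Z. g ((\<lambda>x\<in>carrier ?Z. \<zero>\<^bsub>?F\<^esub>) k) = f k"
        using mod_hom_zero_map[OF free_module RR_module] by blast
    qed
    show "(\<lambda>x\<in>carrier ?Z. \<zero>\<^bsub>?F\<^esub>) ` carrier ?Z = {v \<in> carrier ?F. p v = \<zero>\<^bsub>X\<^esub>}"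
    proof -
      note pz = mod_hom_zero[OF free_module X p(1)]
      have "v = \<zero>\<^bsub>?F\<^esub>" if "v \<in> carrier ?F" "p v = \<zero>\<^bsub>X\<^esub>" for v
        by (rule inj_onD[OF p(2) _ that(1) F.zero_closed]) (simp only: that(2) pz)
      then have "{v \<in> carrier ?F. p v = \<zero>\<^bsub>X\<^esub>} = {\<zero>\<^bsub>?F\<^esub>}" using pz F.zero_closed by blast
      moreover have "(\<lambda>x\<in>carrier ?Z. \<zero>\<^bsub>?F\<^esub>) ` carrier ?Z = {\<zero>\<^bsub>?F\<^esub>}" unfolding c0 by simp
      ultimately show ?thesis by metis
    qed
  qed
qed

end

subsection \<open>Minimal left approximations over a local ring\<close>

locale noetherian_local_cring = noetherian_cring +
  assumes local: "local_cring R"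
begin

text \<open>In a Noetherian ring a chain of ideals contains its own union, which supplies the bound
  that Zorn's lemma asks for.\<close>

lemma maximal_ideal_above:
  assumes I: "ideal I R" "I \<noteq> carrier R"
  shows "\<exists>L. maximalideal L R \<and> I \<subseteq> L"
proof -
  let ?A = "{L. ideal L R \<and> I \<subseteq> L \<and> L \<noteq> carrier R}"
  have "\<exists>M\<in>?A. \<forall>X\<in>?A. M \<subseteq> X \<longrightarrow> X = M"
  proof (rule subset_Zorn_nonempty)
    show "?A \<noteq> {}" using I by blast
    fix C assume C: "C \<noteq> {}" "subset.chain ?A C"
    then have "subset.chain {L. ideal L R} C" unfolding pred_on.chain_def by blast
    from ideal_chain_is_trivial[OF C(1) this] show "\<Union>C \<in> ?A" using C(2) unfolding pred_on.chain_def by blast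
  qed
  then obtain M where M: "M \<in> ?A" "\<forall>X\<in>?A. M \<subseteq> X \<longrightarrow> X = M" by (rule bexE)
  have "maximalideal M R"
  proof (rule maximalidealI)
    fix J assume "ideal J R" "M \<subseteq> J" "J \<subseteq> carrier R"
    then show "J = M \<or> J = carrier R" using M(1) bspec[OF M(2), of J] by auto
  qed (use M in auto)
  then show ?thesis using M(1) by blast
qed

text \<open>A nonunit generates a proper ideal, and the only maximal ideal available to contain it
  is the one of the local ring.\<close>

lemma nonunits_ideal: "ideal (carrier R - Units R) R"
proof -
  obtain J where J: "maximalideal J R" "\<And>L. maximalideal L R \<Longrightarrow> L = J" using local unfolding local_cring_def by blast
  interpret J: maximalideal J R by (rule J(1))
  have "a \<in> J \<longleftrightarrow> a \<notin> Units R" if a: "a \<in> carrier R" for a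
  proof
    assume aJ: "a \<in> J"
    show "a \<notin> Units R"
    proof
      assume "a \<in> Units R"
      then have "inv a \<otimes> a = \<one>" "inv a \<in> carrier R" by auto
      then have "\<one> \<in> J" using J.I_l_closed[OF aJ] by metis
      then show False using J.one_imp_carrier J.I_notcarr by blast
    qed
  next
    assume nu: "a \<notin> Units R"
    have "PIdl a \<noteq> carrier R"
    proof
      assume "PIdl a = carrier R"
      then have "\<one> \<in> PIdl a" by simp
      then obtain x where "x \<in> carrier R" "\<one> = x \<otimes> a" unfolding cgenideal_def by blast
      then show False using nu a m_comm[of x a] unfolding Units_def by auto
    qed
    then obtain L where "maximalideal L R" "PIdl a \<subseteq> L" using maximal_ideal_above[OF cgenideal_ideal[OF a]] by blast
    then show "a \<in> J" using J(2) cgenideal_self[OF a] by blast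
  qed
  then have "carrier R - Units R = J" using J.Icarr by blast
  then show ?thesis using J.ideal_axioms by simp
qed

abbreviation (input) mm :: "'a set" where "mm \<equiv> carrier R - Units R"

lemma nonunits_submodule: "submodule mm R (ring_as_module R)"
proof -
  interpret J: ideal mm R by (rule nonunits_ideal)
  interpret RR: module R "ring_as_module R" by (rule RR_module)
  show ?thesis
    by (rule RR.submoduleI) (use J.I_l_closed J.a_closed J.a_inv_closed J.zero_closed in auto)
qed

lemma one_minus_nonunit:
  assumes c: "c \<in> mm" shows "\<one> \<ominus> c \<in> Units R"
proof (rule ccontr)
  interpret J: ideal mm R by (rule nonunits_ideal)
  assume "\<one> \<ominus> c \<notin> Units R"
  then have "\<one> \<ominus> c \<in> mm" using c by auto
  then have "(\<one> \<ominus> c) \<oplus> c \<in> mm" using c by (rule J.a_closed)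
  moreover have "(\<one> \<ominus> c) \<oplus> c = \<one>" using c by (simp add: a_minus_def a_assoc l_neg)
  ultimately show False using Units_one_closed by auto
qed

lemma hom_nonunits:
  assumes g: "g \<in> mod_hom R (free_mod R n) (ring_as_module R)" and v: "v \<in> carrier (free_mod R n)"
    and vm: "\<And>k. k < n \<Longrightarrow> v k \<in> mm"
  shows "g v \<in> mm"
proof -
  interpret J: ideal mm R by (rule nonunits_ideal)
  note w = free_dual_dot[OF g]
  let ?w = "\<lambda>j\<in>{..<n}. g (free_basis R n j)"
  have "k \<le> n \<Longrightarrow> lin_comb (ring_as_module R) ?w k v \<in> mm" for k
  proof (induction k)
    case 0 show ?case using J.zero_closed by simp
  next
    case (Suc k)
    then have "v k \<otimes> ?w k \<in> mm" using J.I_r_closed[OF vm] free_coord[OF w(1)] by simp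
    then show ?case using J.a_closed Suc by simp
  qed
  then show ?thesis using w(2)[OF v] by simp
qed

text \<open>The counterpart of \<open>hom_nonunits\<close>: the coefficients of the form, rather
  than the coordinates of the vector, are nonunits.\<close>

lemma hom_nonunits_basis:
  assumes g: "g \<in> mod_hom R (free_mod R n) (ring_as_module R)" and b: "\<And>j. j < n \<Longrightarrow> g (free_basis R n j) \<in> mm"
    and v: "v \<in> carrier (free_mod R n)"
  shows "g v \<in> mm"
  using free_spanned[OF mod_hom_preimage_submodule[OF free_module RR_module g nonunits_submodule] _ v] b by simp

lemma submodule_sum:
  assumes M: "module R M" and N: "submodule N R M" and V: "submodule V R M"
  shows "submodule {z. \<exists>x\<in>N. \<exists>y\<in>V. z = x \<oplus>\<^bsub>M\<^esub> y} R M"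
proof -
  interpret M: module R M by fact
  note NE = M.submoduleE[OF N] and VE = M.submoduleE[OF V]
  have Nc: "x \<in> carrier M" if "x \<in> N" for x using NE(1) that by blast
  have Vc: "x \<in> carrier M" if "x \<in> V" for x using VE(1) that by blast
  show ?thesis
  proof (rule M.submoduleI)
    show "{z. \<exists>x\<in>N. \<exists>y\<in>V. z = x \<oplus>\<^bsub>M\<^esub> y} \<subseteq> carrier M" using Nc Vc by auto
    show "\<zero>\<^bsub>M\<^esub> \<in> {z. \<exists>x\<in>N. \<exists>y\<in>V. z = x \<oplus>\<^bsub>M\<^esub> y}"
      using submodule_zero[OF M N] submodule_zero[OF M V] M.r_zero[OF M.zero_closed, symmetric] by blast
    fix a assume "a \<in> {z. \<exists>x\<in>N. \<exists>y\<in>V. z = x \<oplus>\<^bsub>M\<^esub> y}"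
    then obtain x y where a: "x \<in> N" "y \<in> V" "a = x \<oplus>\<^bsub>M\<^esub> y" by blast
    have "\<ominus>\<^bsub>M\<^esub> a = (\<ominus>\<^bsub>M\<^esub> x) \<oplus>\<^bsub>M\<^esub> (\<ominus>\<^bsub>M\<^esub> y)" using a Nc Vc by (simp add: M.minus_add)
    then show "\<ominus>\<^bsub>M\<^esub> a \<in> {z. \<exists>x\<in>N. \<exists>y\<in>V. z = x \<oplus>\<^bsub>M\<^esub> y}" using NE(3)[OF a(1)] VE(3)[OF a(2)] by blast
    show "r \<odot>\<^bsub>M\<^esub> a \<in> {z. \<exists>x\<in>N. \<exists>y\<in>V. z = x \<oplus>\<^bsub>M\<^esub> y}" if r: "r \<in> carrier R" for r
    proof -
      have "r \<odot>\<^bsub>M\<^esub> a = (r \<odot>\<^bsub>M\<^esub> x) \<oplus>\<^bsub>M\<^esub> (r \<odot>\<^bsub>M\<^esub> y)" using a Nc Vc r by (simp add: M.smult_r_distr)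
      then show ?thesis using NE(4)[OF r a(1)] VE(4)[OF r a(2)] by blast
    qed
    fix b assume "b \<in> {z. \<exists>x\<in>N. \<exists>y\<in>V. z = x \<oplus>\<^bsub>M\<^esub> y}"
    then obtain x' y' where b: "x' \<in> N" "y' \<in> V" "b = x' \<oplus>\<^bsub>M\<^esub> y'" by blast
    have "a \<oplus>\<^bsub>M\<^esub> b = (x \<oplus>\<^bsub>M\<^esub> x') \<oplus>\<^bsub>M\<^esub> (y \<oplus>\<^bsub>M\<^esub> y')" using a b Nc Vc by (simp add: M.a_ac)
    then show "a \<oplus>\<^bsub>M\<^esub> b \<in> {z. \<exists>x\<in>N. \<exists>y\<in>V. z = x \<oplus>\<^bsub>M\<^esub> y}" using NE(5)[OF a(1) b(1)] VE(5)[OF a(2) b(2)] by blast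
  qed
qed

text \<open>Nakayama's lemma for the image of \<open>h\<close>: coordinates are eliminated one at a time.\<close>

lemma free_endo_surj:
  assumes h: "h \<in> mod_hom R (free_mod R n) (free_mod R n)"
    and hm: "\<And>j k. j < n \<Longrightarrow> k < n \<Longrightarrow> (free_basis R n j \<ominus>\<^bsub>free_mod R n\<^esub> h (free_basis R n j)) k \<in> mm"
  shows "h ` carrier (free_mod R n) = carrier (free_mod R n)"
proof -
  let ?F = "free_mod R n"
  define N where "N = h ` carrier ?F"
  \<comment> \<open>\<open>V k\<close> consists of the vectors supported on the first
    \<open>k\<close> coordinates, and \<open>T k = N + V k\<close>. Thus \<open>T n\<close> is
    everything and \<open>T 0 = N\<close>, and each round of the induction lowers \<open>k\<close>
    by one.\<close>
  define V where "V k = {v \<in> carrier ?F. \<forall>i<n. k \<le> i \<longrightarrow> v i = \<zero>}" for k :: nat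
  define T where "T k = {z. \<exists>x\<in>N. \<exists>y\<in>V k. z = x \<oplus>\<^bsub>?F\<^esub> y}" for k :: nat
  interpret F: module R ?F by (rule free_module)
  have N: "submodule N R ?F" unfolding N_def
    by (rule mod_hom_image_submodule[OF free_module free_module h F.carrier_is_submodule])
  have V: "submodule (V k) R ?F" for k
    by (rule F.submoduleI) (auto simp: V_def free_neg_apply)
  have T: "submodule (T k) R ?F" for k unfolding T_def by (rule submodule_sum[OF free_module N V])
  note NE = F.submoduleE[OF N] and VE = F.submoduleE[OF V] and TE = F.submoduleE[OF T]
  have Nc: "x \<in> carrier ?F" if "x \<in> N" for x using NE(1) that by blast
  have Vc: "x \<in> carrier ?F" if "x \<in> V k" for x k using VE(1) that by blast
  have TI: "x \<oplus>\<^bsub>?F\<^esub> y \<in> T k" if "x \<in> N" "y \<in> V k" for x y k using that unfolding T_def by blast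
  have TE': "\<exists>x\<in>N. \<exists>y\<in>V k. z = x \<oplus>\<^bsub>?F\<^esub> y" if "z \<in> T k" for z k using that unfolding T_def by blast
  have NT: "N \<subseteq> T k" for k
  proof
    fix x assume "x \<in> N"
    then show "x \<in> T k" using TI[OF _ submodule_zero[OF free_module V]] Nc by fastforce
  qed
  have VT: "V k \<subseteq> T k" for k
  proof
    fix x assume "x \<in> V k"
    then show "x \<in> T k" using TI[OF submodule_zero[OF free_module N]] Vc by fastforce
  qed
  have "m \<le> n \<Longrightarrow> carrier ?F \<subseteq> T (n - m)" for m
  proof (induction m)
    case 0
    have "carrier ?F = V n" by (auto simp: V_def)
    then show ?case using VT by simp
  next
    case (Suc m)
    define k where "k = n - Suc m"
    have k: "k < n" "n - m = Suc k" using Suc.prems by (auto simp: k_def)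
    let ?e = "free_basis R n"
    have "\<exists>w\<in>V (Suc k). ?e j \<ominus>\<^bsub>?F\<^esub> w \<in> N" for j
    proof -
      have "?e j \<in> T (Suc k)" using Suc k(2) free_basis_carrier by auto
      then obtain x w where xw: "x \<in> N" "w \<in> V (Suc k)" "?e j = x \<oplus>\<^bsub>?F\<^esub> w" using TE' by blast
      then have "?e j \<ominus>\<^bsub>?F\<^esub> w = x" using F.add_sub_cancel[of x w] Nc Vc by simp
      then show ?thesis using xw by blast
    qed
    then obtain w where w: "\<And>j. w j \<in> V (Suc k)" "\<And>j. ?e j \<ominus>\<^bsub>?F\<^esub> w j \<in> N" by metis
    \<comment> \<open>Modulo \<open>N\<close> every vector agrees with one supported on the first
      \<open>k + 1\<close> coordinates; \<open>\<omega>\<close> makes this replacement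
      linearly.\<close>
    obtain \<omega> where \<omega>: "\<omega> \<in> mod_hom R ?F ?F" "\<And>j. j < n \<Longrightarrow> \<omega> (?e j) = w j"
      using free_lift_ex[OF free_module, of n w n] Vc[OF w(1)] by blast
    have wV: "\<omega> v \<in> V (Suc k)" if v: "v \<in> carrier ?F" for v
      using free_spanned[OF mod_hom_preimage_submodule[OF free_module free_module \<omega>(1) V] _ v] \<omega>(2) w(1) by simp
    have id: "(\<lambda>v\<in>carrier ?F. (\<lambda>x\<in>carrier ?F. x) v \<ominus>\<^bsub>?F\<^esub> \<omega> v) \<in> mod_hom R ?F ?F"
      by (rule mod_hom_minus_map[OF free_module free_module mod_hom_id[OF free_module] \<omega>(1)])
    have wN: "v \<ominus>\<^bsub>?F\<^esub> \<omega> v \<in> N" if v: "v \<in> carrier ?F" for v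
      using free_spanned[OF mod_hom_preimage_submodule[OF free_module free_module id N] _ v] \<omega>(2) w(2) v by simp
    let ?u = "?e k \<ominus>\<^bsub>?F\<^esub> h (?e k)"
    have he: "h (?e k) \<in> N" "h (?e k) \<in> carrier ?F" using mod_hom_closed[OF h] by (auto simp: N_def)
    have u: "?u \<in> carrier ?F" using he by simp
    have \<omega>u: "\<omega> ?u \<in> V (Suc k)" "\<omega> ?u \<in> carrier ?F" using wV[OF u] Vc by auto
    \<comment> \<open>\<open>?u\<close> has nonunit coordinates, so \<open>?c\<close> is a nonunit.
      Modulo \<open>N\<close> the basis vector \<open>k\<close> equals \<open>\<omega> ?u\<close>,
      which is \<open>?c\<close> times that vector up to \<open>V k\<close>. Hence
      \<open>1 - ?c\<close> times the basis vector lies in \<open>T k\<close>, and the unit can be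
      divided out.\<close>
    let ?c = "\<omega> ?u k"
    have c: "?c \<in> mm"
    proof -
      have "compose (carrier ?F) (\<lambda>v\<in>carrier ?F. v k) \<omega> ?u \<in> mm"
        by (rule hom_nonunits[OF mod_hom_compose[OF free_module \<omega>(1) free_coord_hom[OF k(1)]] u]) (rule hm[OF k(1)])
      then show ?thesis using u \<omega>u by (simp add: compose_def)
    qed
    then have cR: "?c \<in> carrier R" by blast
    have red: "w \<ominus>\<^bsub>?F\<^esub> (w k \<odot>\<^bsub>?F\<^esub> ?e k) \<in> V k" if "w \<in> V (Suc k)" for w
    proof -
      have wc: "w \<in> carrier ?F" using Vc that .
      then have wk: "w k \<odot>\<^bsub>?F\<^esub> ?e k \<in> carrier ?F" using free_coord[OF wc k(1)] by simp
      have "(w \<ominus>\<^bsub>?F\<^esub> (w k \<odot>\<^bsub>?F\<^esub> ?e k)) i = \<zero>" if i: "i < n" "k \<le> i" for i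
      proof -
        have "(w \<ominus>\<^bsub>?F\<^esub> (w k \<odot>\<^bsub>?F\<^esub> ?e k)) i = w i \<ominus> w k \<otimes> ?e k i"
          using free_minus_apply[OF wc wk i(1)] i(1) by simp
        also have "\<dots> = \<zero>"
        proof (cases "i = k")
          case True
          then show ?thesis using free_coord[OF wc k(1)] k(1) by (simp add: free_basis_apply a_minus_def r_neg)
        next
          case False
          then have "w i = \<zero>" using \<open>w \<in> V (Suc k)\<close> i unfolding V_def by simp
          then show ?thesis using False i free_coord[OF wc k(1)] by (simp add: free_basis_apply a_minus_def)
        qed
        finally show ?thesis .
      qed
      then show ?thesis using wc wk unfolding V_def by simp
    qed
    have n0: "?e k \<ominus>\<^bsub>?F\<^esub> \<omega> ?u \<in> N"
    proof -
      have "h (?e k) \<oplus>\<^bsub>?F\<^esub> (?u \<ominus>\<^bsub>?F\<^esub> \<omega> ?u) = ?e k \<ominus>\<^bsub>?F\<^esub> \<omega> ?u"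
        using he \<omega>u by (simp add: a_minus_def F.a_ac F.r_neg1 F.r_neg2)
      then show ?thesis using NE(5)[OF he(1) wN[OF u]] by simp
    qed
    have eT: "?e k \<in> T k"
    proof -
      let ?n = "?e k \<ominus>\<^bsub>?F\<^esub> \<omega> ?u" and ?w = "\<omega> ?u \<ominus>\<^bsub>?F\<^esub> (?c \<odot>\<^bsub>?F\<^esub> ?e k)"
      have "(\<one> \<ominus> ?c) \<odot>\<^bsub>?F\<^esub> ?e k = ?e k \<ominus>\<^bsub>?F\<^esub> (?c \<odot>\<^bsub>?F\<^esub> ?e k)"
        using cR by (simp add: a_minus_def F.smult_l_distr F.smult_l_minus)
      also have "\<dots> = ?n \<oplus>\<^bsub>?F\<^esub> ?w"
        using \<omega>u cR by (simp add: a_minus_def F.a_ac F.r_neg1 F.r_neg2)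
      finally have eq: "(\<one> \<ominus> ?c) \<odot>\<^bsub>?F\<^esub> ?e k \<in> T k" using TI[OF n0 red[OF \<omega>u(1)]] by simp
      obtain d where d: "d \<in> carrier R" "d \<otimes> (\<one> \<ominus> ?c) = \<one>"
        using one_minus_nonunit[OF c] unfolding Units_def by blast
      have "d \<odot>\<^bsub>?F\<^esub> ((\<one> \<ominus> ?c) \<odot>\<^bsub>?F\<^esub> ?e k) = ?e k"
        using d cR by (simp flip: F.smult_assoc1)
      then show ?thesis using TE(4)[OF d(1) eq] by simp
    qed
    show ?case
    proof
      fix v assume v: "v \<in> carrier ?F"
      then have "v \<in> T (Suc k)" using Suc k(2) by auto
      then obtain x w where xw: "x \<in> N" "w \<in> V (Suc k)" "v = x \<oplus>\<^bsub>?F\<^esub> w" using TE' by blast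
      have wk: "w k \<odot>\<^bsub>?F\<^esub> ?e k \<in> T k" using TE(4) eT free_coord[OF Vc[OF xw(2)] k(1)] by blast
      have "w = (w \<ominus>\<^bsub>?F\<^esub> (w k \<odot>\<^bsub>?F\<^esub> ?e k)) \<oplus>\<^bsub>?F\<^esub> (w k \<odot>\<^bsub>?F\<^esub> ?e k)"
        using F.sub_add_cancel[of w "w k \<odot>\<^bsub>?F\<^esub> ?e k"] Vc[OF xw(2)] free_coord[OF Vc[OF xw(2)] k(1)] by simp
      then have "w \<in> T k" using TE(5)[OF subsetD[OF VT red[OF xw(2)]] wk] by simp
      then show "v \<in> T (n - Suc m)" using TE(5)[OF subsetD[OF NT xw(1)]] xw(3) unfolding k_def by simp
    qed
  qed
  from this[of n] have "carrier ?F \<subseteq> T 0" by simp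
  moreover have "T 0 \<subseteq> N"
  proof
    fix z assume "z \<in> T 0"
    then obtain x w where xw: "x \<in> N" "w \<in> V 0" "z = x \<oplus>\<^bsub>?F\<^esub> w" using TE' by blast
    have "w = \<zero>\<^bsub>?F\<^esub>" by (rule free_eqI[OF Vc[OF xw(2)] F.zero_closed]) (use xw(2) in \<open>auto simp: V_def\<close>)
    then show "z \<in> N" using xw Nc by simp
  qed
  ultimately show ?thesis using NE(1) unfolding N_def by blast
qed

text \<open>Surjectivity gives a linear section \<open>r\<close>. From \<open>g r = 1\<close> it
  follows that \<open>r\<close>, too, is the identity modulo nonunits, hence surjective, and a
  surjective section makes \<open>g\<close> injective.\<close>

lemma free_endo_iso:
  assumes g: "g \<in> mod_hom R (free_mod R n) (free_mod R n)"
    and gm: "\<And>j k. j < n \<Longrightarrow> k < n \<Longrightarrow> (free_basis R n j \<ominus>\<^bsub>free_mod R n\<^esub> g (free_basis R n j)) k \<in> mm"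
  shows "g \<in> mod_iso R (free_mod R n) (free_mod R n)"
proof -
  let ?F = "free_mod R n"
  interpret F: module R ?F by (rule free_module)
  interpret J: ideal mm R by (rule nonunits_ideal)
  note gs = free_endo_surj[OF g gm]
  obtain r where r: "r \<in> mod_hom R ?F ?F" "\<And>v. v \<in> carrier ?F \<Longrightarrow> g (r v) = v"
    using free_projective[OF free_module free_module g gs mod_hom_id[OF free_module]] by auto
  have all: "(v \<ominus>\<^bsub>?F\<^esub> g v) k \<in> mm" if v: "v \<in> carrier ?F" and k: "k < n" for v k
  proof -
    have d: "(\<lambda>v\<in>carrier ?F. (\<lambda>x\<in>carrier ?F. x) v \<ominus>\<^bsub>?F\<^esub> g v) \<in> mod_hom R ?F ?F"
      by (rule mod_hom_minus_map[OF free_module free_module mod_hom_id[OF free_module] g])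
    have "compose (carrier ?F) (\<lambda>v\<in>carrier ?F. v k) (\<lambda>v\<in>carrier ?F. (\<lambda>x\<in>carrier ?F. x) v \<ominus>\<^bsub>?F\<^esub> g v) v \<in> mm"
    proof (rule hom_nonunits_basis[OF mod_hom_compose[OF free_module d free_coord_hom[OF k]] _ v])
      fix j assume j: "j < n"
      show "compose (carrier ?F) (\<lambda>v\<in>carrier ?F. v k) (\<lambda>v\<in>carrier ?F. (\<lambda>x\<in>carrier ?F. x) v \<ominus>\<^bsub>?F\<^esub> g v) (free_basis R n j) \<in> mm"
        using gm[OF j k] mod_hom_closed[OF g free_basis_carrier] by (simp add: compose_def)
    qed
    then show ?thesis using v mod_hom_closed[OF g v] by (simp add: compose_def)
  qed
  have rs: "r ` carrier ?F = carrier ?F"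
  proof (rule free_endo_surj[OF r(1)])
    fix j k assume j: "j < n" and k: "k < n"
    let ?e = "free_basis R n j"
    note re = mod_hom_closed[OF r(1) free_basis_carrier[of n j]]
    have "(r ?e \<ominus>\<^bsub>?F\<^esub> ?e) k \<in> mm" using all[OF re k] r(2)[OF free_basis_carrier] by simp
    then have "\<ominus> ((r ?e \<ominus>\<^bsub>?F\<^esub> ?e) k) \<in> mm" by (rule J.a_inv_closed)
    moreover have "\<ominus> ((r ?e \<ominus>\<^bsub>?F\<^esub> ?e) k) = (?e \<ominus>\<^bsub>?F\<^esub> r ?e) k"
      using free_minus_apply[OF re free_basis_carrier k] free_minus_apply[OF free_basis_carrier re k]
        free_coord[OF re k] free_coord[OF free_basis_carrier k] by (simp add: a_minus_def minus_add a_comm)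
    ultimately show "(?e \<ominus>\<^bsub>?F\<^esub> r ?e) k \<in> mm" by simp
  qed
  have "inj_on g (carrier ?F)"
  proof (rule inj_onI)
    fix x y assume xy: "x \<in> carrier ?F" "y \<in> carrier ?F" "g x = g y"
    have "x \<in> r ` carrier ?F" "y \<in> r ` carrier ?F" using xy(1,2) rs by auto
    then obtain x' y' where "x' \<in> carrier ?F" "y' \<in> carrier ?F" "x = r x'" "y = r y'" by blast
    then show "x = y" using xy(3) r(2) by simp
  qed
  then show ?thesis unfolding mod_iso_def bij_betw_def using g gs by blast
qed

end

section \<open>Existence of minimal left approximations by free modules\<close>

context cring
begin

lemma extends_free:
  assumes K: "module R K" and F: "module R F" and ext: "extends R K F i" and i: "i \<in> mod_hom R K F"
    and f: "f \<in> mod_hom R K (free_mod R m)"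
  obtains g where "g \<in> mod_hom R F (free_mod R m)" "\<And>k. k \<in> carrier K \<Longrightarrow> g (i k) = f k"
proof -
  have "\<exists>g. j < m \<longrightarrow> g \<in> mod_hom R F (ring_as_module R) \<and> (\<forall>k\<in>carrier K. g (i k) = f k j)" for j
  proof (cases "j < m")
    case True
    have "compose (carrier K) (\<lambda>v\<in>carrier (free_mod R m). v j) f \<in> mod_hom R K (ring_as_module R)"
      by (rule mod_hom_compose[OF K f free_coord_hom[OF True]])
    then obtain g where "g \<in> mod_hom R F (ring_as_module R)"
      "\<And>k. k \<in> carrier K \<Longrightarrow> g (i k) = compose (carrier K) (\<lambda>v\<in>carrier (free_mod R m). v j) f k"
      using extendsD[OF ext] by metis
    then show ?thesis using mod_hom_closed[OF f] by (intro exI[of _ g]) (simp add: compose_def)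
  qed auto
  then obtain g where g: "\<And>j. j < m \<Longrightarrow> g j \<in> mod_hom R F (ring_as_module R)"
    "\<And>j k. j < m \<Longrightarrow> k \<in> carrier K \<Longrightarrow> g j (i k) = f k j" by metis
  let ?g = "\<lambda>x\<in>carrier F. \<lambda>j\<in>{..<m}. g j x"
  have gh: "?g \<in> mod_hom R F (free_mod R m)" by (rule free_tuple_hom[OF F g(1)])
  have "?g (i k) = f k" if k: "k \<in> carrier K" for k
  proof (rule free_eqI[OF mod_hom_closed[OF gh mod_hom_closed[OF i k]] mod_hom_closed[OF f k]])
    fix j assume "j < m"
    then show "?g (i k) j = f k j" using g(2) k mod_hom_closed[OF i k] by simp
  qed
  then show ?thesis using that[OF gh] by blast
qed

text \<open>A linear form is read as a map to R^1, to which the approximation property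
  applies.\<close>

lemma left_approx_extends:
  assumes X: "module R X" and "min_left_free_approx R X n t"
  shows "extends R X (free_mod R n) t"
  unfolding extends_def
proof
  let ?RR = "ring_as_module R"
  have t: "t \<in> mod_hom R X (free_mod R n)" and ap: "\<And>m f. f \<in> mod_hom R X (free_mod R m) \<Longrightarrow>
        \<exists>g \<in> mod_hom R (free_mod R n) (free_mod R m). f = compose (carrier X) g t"
    using assms(2) unfolding min_left_free_approx_def by blast+
  fix f assume f: "f \<in> mod_hom R X ?RR"
  have "(\<lambda>x\<in>carrier X. \<lambda>j\<in>{..<1}. f x) \<in> mod_hom R X (free_mod R 1)"
    by (rule free_tuple_hom[OF X f])
  then obtain g where g: "g \<in> mod_hom R (free_mod R n) (free_mod R 1)"
    "(\<lambda>x\<in>carrier X. \<lambda>j\<in>{..<1}. f x) = compose (carrier X) g t" using ap by blast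
  have pi: "(\<lambda>v\<in>carrier (free_mod R 1). v 0) \<in> mod_hom R (free_mod R 1) ?RR" by (rule free_coord_hom) simp
  have "compose (carrier (free_mod R n)) (\<lambda>v\<in>carrier (free_mod R 1). v 0) g (t x) = f x" if x: "x \<in> carrier X" for x
  proof -
    have "g (t x) = (\<lambda>j\<in>{..<1}. f x)" using fun_cong[OF g(2), of x] x by (simp add: compose_def)
    moreover have "g (t x) \<in> carrier (free_mod R 1)" by (rule mod_hom_closed2[OF t g(1) x])
    ultimately show ?thesis using mod_hom_closed[OF t x] by (simp add: compose_def)
  qed
  then show "\<exists>g\<in>mod_hom R (free_mod R n) ?RR. \<forall>x\<in>carrier X. g (t x) = f x"
    using mod_hom_compose[OF free_module g(1) pi] by blast
qed

end

context noetherian_cring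
begin

text \<open>The coordinates of \<open>t\<close> are finitely many generators of the dual of
  \<open>X\<close>. Any linear form is a combination of them, and the coefficients define its
  extension.\<close>

lemma left_approx_ex:
  assumes X: "fg_module R X"
  shows "\<exists>n t. t \<in> mod_hom R X (free_mod R n) \<and> extends R X (free_mod R n) t"
proof -
  have Xm: "module R X" using X by (simp add: fg_module_iff)
  obtain n p where p: "p \<in> mod_hom R (free_mod R n) (dual_mod R X)" "p ` carrier (free_mod R n) = carrier (dual_mod R X)"
    using fg_dual[OF X] by (rule fg_coverE)
  have pe: "p (free_basis R n j) \<in> mod_hom R X (ring_as_module R)" for j using mod_hom_closed[OF p(1) free_basis_carrier] by simp
  let ?t = "\<lambda>x\<in>carrier X. \<lambda>j\<in>{..<n}. p (free_basis R n j) x"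
  have t: "?t \<in> mod_hom R X (free_mod R n)" by (rule free_tuple_hom[OF Xm pe])
  have "extends R X (free_mod R n) ?t"
    unfolding extends_def
  proof
    fix f assume "f \<in> mod_hom R X (ring_as_module R)"
    then obtain a where a: "a \<in> carrier (free_mod R n)" "f = p a" using p(2) by (metis dual_mod_simps(1) imageE)
    have "dot R n (?t x) a = p a x" if x: "x \<in> carrier X" for x
    proof -
      note tx = mod_hom_closed[OF t x]
      have ev: "(\<lambda>g\<in>carrier (dual_mod R X). g x) \<in> mod_hom R (dual_mod R X) (ring_as_module R)"
      proof (rule mod_homI[OF dual_module[OF Xm]])
        show "g x \<in> carrier (ring_as_module R)" if "g \<in> carrier (dual_mod R X)" for g
          using mod_hom_closed[of g R X "ring_as_module R" x] that x by simp
      qed (use x in auto)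
      let ?l = "compose (carrier (free_mod R n)) (\<lambda>g\<in>carrier (dual_mod R X). g x) p"
      have "?l a = (\<lambda>a\<in>carrier (free_mod R n). dot R n a (?t x)) a"
      proof (rule free_hom_eq[OF RR_module mod_hom_compose[OF free_module p(1) ev] dot_hom[OF tx] _ a(1)])
        fix j assume "j < n"
        then show "?l (free_basis R n j) = (\<lambda>a\<in>carrier (free_mod R n). dot R n a (?t x)) (free_basis R n j)"
          using dot_basis[OF tx] x pe by (simp add: compose_def)
      qed
      moreover have "?l a = p a x" using a(1) mod_hom_closed[OF p(1) a(1)] by (simp add: compose_def)
      ultimately show ?thesis using dot_comm[OF tx a(1)] a(1) by simp
    qed
    then show "\<exists>g\<in>mod_hom R (free_mod R n) (ring_as_module R). \<forall>x\<in>carrier X. g (?t x) = f x"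
      using mod_hom_closed[OF t] a(2) by (intro bexI[OF _ dot_hom[OF a(1)]]) simp
  qed
  then show ?thesis using t by blast
qed

end

context noetherian_local_cring
begin

text \<open>Among the maps to free modules along which linear forms extend, one of least rank is
  minimal: an endomorphism \<open>g\<close> with \<open>g t = t\<close> that is not the identity
  modulo nonunits would expose a redundant coordinate of \<open>t\<close>.\<close>

lemma min_left_approx_ex:
  assumes X: "fg_module R X"
  shows "\<exists>n t. min_left_free_approx R X n t"
proof -
  let ?RR = "ring_as_module R"
  let ?P = "\<lambda>n. \<exists>t. t \<in> mod_hom R X (free_mod R n) \<and> extends R X (free_mod R n) t"
  have Xm: "module R X" using X by (simp add: fg_module_iff)
  define n where "n = (LEAST n. ?P n)"
  have "?P n" unfolding n_def by (rule LeastI_ex[OF left_approx_ex[OF X]])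
  then obtain t where t: "t \<in> mod_hom R X (free_mod R n)" "extends R X (free_mod R n) t" by blast
  have least: "n \<le> m" if "?P m" for m unfolding n_def using Least_le[of ?P m] that by blast
  let ?F = "free_mod R n" and ?e = "free_basis R n"
  interpret F: module R ?F by (rule free_module)
  interpret RR: module R ?RR by (rule RR_module)
  have "g \<in> mod_iso R ?F ?F" if g: "g \<in> mod_hom R ?F ?F" and gt: "compose (carrier X) g t = t" for g
  proof (rule free_endo_iso[OF g], rule ccontr)
    fix j k assume j: "j < n" and k: "k < n" and c: "(?e j \<ominus>\<^bsub>?F\<^esub> g (?e j)) k \<notin> mm"
    have gt': "g (t x) = t x" if "x \<in> carrier X" for x using fun_cong[OF gt, of x] that by (simp add: compose_def)
    let ?d = "\<lambda>v\<in>carrier ?F. (\<lambda>x\<in>carrier ?F. x) v \<ominus>\<^bsub>?F\<^esub> g v"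
    have d: "?d \<in> mod_hom R ?F ?F"
      by (rule mod_hom_minus_map[OF free_module free_module mod_hom_id[OF free_module] g])
    \<comment> \<open>The \<open>k\<close>-th coordinate of \<open>1 - g\<close> vanishes on the
      image of \<open>t\<close> but takes a unit value at the basis vector \<open>j\<close>. It is a
      relation that expresses coordinate \<open>j\<close> of \<open>t\<close> through the
      others.\<close>
    define u where "u = compose (carrier ?F) (\<lambda>v\<in>carrier ?F. v k) ?d"
    have u: "u \<in> mod_hom R ?F ?RR" unfolding u_def by (rule mod_hom_compose[OF free_module d free_coord_hom[OF k]])
    have uv: "u v = (v \<ominus>\<^bsub>?F\<^esub> g v) k" if "v \<in> carrier ?F" for v
      using that mod_hom_closed[OF g that] by (simp add: u_def compose_def)
    have ut: "u (t x) = \<zero>" if x: "x \<in> carrier X" for x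
      using uv[OF mod_hom_closed[OF t(1) x]] gt'[OF x] mod_hom_closed[OF t(1) x] k by simp
    have "u (?e j) \<in> carrier R" using mod_hom_closed[OF u free_basis_carrier] by simp
    then have "u (?e j) \<in> Units R" using c uv[OF free_basis_carrier] by simp
    then obtain c' where c': "c' \<in> carrier R" "u (?e j) \<otimes> c' = \<one>" unfolding Units_def by blast
    define m where "m = n - 1"
    have m: "n = Suc m" using j by (simp add: m_def)
    \<comment> \<open>\<open>sk\<close> enumerates the indices other than \<open>j\<close>, so
      \<open>s\<close> below deletes coordinate \<open>j\<close>.\<close>
    define sk where "sk i = (if i < j then i else Suc i)" for i
    have sk: "sk i < n" if "i < m" for i using that m by (auto simp: sk_def)
    let ?G = "free_mod R m"
    define s where "s = (\<lambda>v\<in>carrier ?F. \<lambda>i\<in>{..<m}. v (sk i))"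
    have s: "s \<in> mod_hom R ?F ?G" unfolding s_def
      by (rule mod_homI[OF free_module]) (auto simp: free_coord sk intro!: free_eqI[of _ m])
    have "extends R X ?G (compose (carrier X) s t)"
      unfolding extends_def
    proof
      fix f assume f: "f \<in> mod_hom R X ?RR"
      obtain w where w: "w \<in> mod_hom R ?F ?RR" "\<And>x. x \<in> carrier X \<Longrightarrow> w (t x) = f x" using extendsD[OF t(2) f] by blast
      note wc = mod_hom_closed[OF w(1), simplified] and uc = mod_hom_closed[OF u, simplified]
      let ?a = "c' \<otimes> w (?e j)"
      have a: "?a \<in> carrier R" using c' wc by simp
      \<comment> \<open>Subtracting a multiple of \<open>u\<close> leaves \<open>w\<close> unchanged
        on the image of \<open>t\<close>. The factor is chosen to make the result vanish at the
        basis vector \<open>j\<close>, so that it factors through \<open>s\<close>.\<close>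
      define w' where "w' = (\<lambda>v\<in>carrier ?F. w v \<ominus>\<^bsub>?RR\<^esub> (\<lambda>v\<in>carrier ?F. ?a \<odot>\<^bsub>?RR\<^esub> u v) v)"
      have w'h: "w' \<in> mod_hom R ?F ?RR" unfolding w'_def
        by (rule mod_hom_minus_map[OF free_module RR_module w(1) mod_hom_smult_map[OF free_module RR_module u a]])
      have w'v: "w' v = w v \<ominus> ?a \<otimes> u v" if "v \<in> carrier ?F" for v using that by (simp add: w'_def)
      have w'e: "w' (?e j) = \<zero>"
      proof -
        have "?a \<otimes> u (?e j) = (u (?e j) \<otimes> c') \<otimes> w (?e j)" using c'(1) wc[OF free_basis_carrier] uc[OF free_basis_carrier] by (simp add: m_ac)
        then show ?thesis using w'v[OF free_basis_carrier] c'(2) wc RR.sub_self[of "w (?e j)"] by simp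
      qed
      obtain z where z: "z \<in> mod_hom R ?G ?RR" "\<And>i. i < m \<Longrightarrow> z (free_basis R m i) = w' (?e (sk i))"
        using free_lift_ex[OF RR_module, of m "\<lambda>i. w' (?e (sk i))"] mod_hom_closed[OF w'h free_basis_carrier] by blast
      have zs: "z (s v) = w' v" if v: "v \<in> carrier ?F" for v
      proof -
        have "compose (carrier ?F) z s v = w' v"
        proof (rule free_hom_eq[OF RR_module mod_hom_compose[OF free_module s z(1)] w'h _ v])
          fix i assume i: "i < n"
          show "compose (carrier ?F) z s (?e i) = w' (?e i)"
          proof (cases "i = j")
            case True
            have "s (?e j) = \<zero>\<^bsub>?G\<^esub>"
              by (rule free_eqI[OF mod_hom_closed[OF s free_basis_carrier]])
                (auto simp: s_def sk free_basis_apply, auto simp: sk_def split: if_splits)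
            then show ?thesis using True w'e mod_hom_zero[OF free_module RR_module z(1)] by (simp add: compose_def)
          next
            case False
            define i' where "i' = (if i < j then i else i - 1)"
            have i': "i' < m" "sk i' = i" using False i m j by (auto simp: i'_def sk_def)
            have "s (?e i) = free_basis R m i'"
            proof (rule free_eqI[OF mod_hom_closed[OF s free_basis_carrier] free_basis_carrier])
              fix l assume l: "l < m"
              have "sk l = i \<longleftrightarrow> l = i'" using False by (auto simp: sk_def i'_def)
              then show "s (?e i) l = free_basis R m i' l" using l sk[OF l] by (simp add: s_def free_basis_apply)
            qed
            then show ?thesis using z(2)[OF i'(1)] i'(2) by (simp add: compose_def)
          qed
        qed
        then show ?thesis using v by (simp add: compose_def)
      qed
      have "z (compose (carrier X) s t x) = f x" if x: "x \<in> carrier X" for x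
      proof -
        note tx = mod_hom_closed[OF t(1) x]
        have "z (s (t x)) = w (t x) \<ominus> ?a \<otimes> u (t x)" using zs[OF tx] w'v[OF tx] by simp
        also have "\<dots> = w (t x)" using ut[OF x] a wc[OF tx] by (simp add: a_minus_def)
        finally show ?thesis using w(2)[OF x] x by (simp add: compose_def)
      qed
      then show "\<exists>g\<in>mod_hom R ?G ?RR. \<forall>x\<in>carrier X. g (compose (carrier X) s t x) = f x" using z(1) by blast
    qed
    then have "?P m" using mod_hom_compose[OF Xm t(1) s] by blast
    then show False using least[of m] m by simp
  qed
  moreover have "\<exists>g\<in>mod_hom R ?F (free_mod R m). f = compose (carrier X) g t" if f: "f \<in> mod_hom R X (free_mod R m)" for m f
  proof -
    obtain g where g: "g \<in> mod_hom R ?F (free_mod R m)" "\<And>x. x \<in> carrier X \<Longrightarrow> g (t x) = f x"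
      using extends_free[OF Xm free_module t(2,1) f] by blast
    have "f = compose (carrier X) g t"
      by (rule mod_hom_eqI[OF f mod_hom_compose[OF Xm t(1) g(1)]]) (use g(2) in \<open>simp add: compose_def\<close>)
    then show ?thesis using g(1) by blast
  qed
  ultimately have "min_left_free_approx R X n t" unfolding min_left_free_approx_def using t(1) by blast
  then show ?thesis by blast
qed

subsection \<open>Syzygies and cosyzygies of G-projective modules\<close>

text \<open>Existence of some minimal cover licenses the choice operator; everything else is then
  derived for whichever sequence was chosen.\<close>

lemma chosen_syzygy:
  assumes X: "Gp R (X :: 'a obj)"
  obtains K i p where "chosen_syzygy_seq R X = (K, i, p)" "syzygy R X = K"
    "exseq R K (free_mod R (min_gens R X)) X i p" "extends R K (free_mod R (min_gens R X)) i" "Gp R K"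
proof -
  let ?F = "free_mod R (min_gens R X)"
  note Xm = Gp_module[OF X]
  obtain p where p: "p \<in> mod_hom R ?F X" "p ` carrier ?F = carrier X" using Gp_fg[OF X] by (rule min_gens_cover)
  obtain K :: "'a obj" and i where E: "exseq R K ?F X i p" using Xm p by (rule kernel_exseq)
  have "syzygy_seq R X K i p"
    using exseqD[OF E] unfolding syzygy_seq_def Let_def a_kernel_def' by blast
  then have "case chosen_syzygy_seq R X of (K, i, p) \<Rightarrow> syzygy_seq R X K i p"
    unfolding chosen_syzygy_seq_def by (intro someI[where P = "\<lambda>(K, i, p). syzygy_seq R X K i p" and x = "(K, i, p)"]) simp
  moreover obtain K i p where ch: "chosen_syzygy_seq R X = (K, i, p)" by (cases "chosen_syzygy_seq R X")
  ultimately have "syzygy_seq R X K i p" by simp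
  then have E: "exseq R K ?F X i p"
    unfolding syzygy_seq_def Let_def a_kernel_def' exseq_def using free_module Xm by blast
  show ?thesis
    by (rule that[OF ch _ E Gp_extends[OF X E] Gp_syzygy[OF X E]]) (simp add: syzygy_def ch)
qed

text \<open>The chosen sequence is only right exact by definition. Exactness on the left and
  G-projectivity of \<open>C\<close> come from \<open>Gp_cosyzygy\<close>, because a left
  approximation extends linear forms.\<close>

lemma chosen_cosyzygy:
  assumes X: "Gp R (X :: 'a obj)"
  obtains C n t q where "chosen_cosyzygy_seq R X = (C, n, t, q)" "cosyzygy R X = C"
    "exseq R X (free_mod R n) C t q" "extends R X (free_mod R n) t" "Gp R C"
proof -
  note Xm = Gp_module[OF X]
  interpret X: module R X by (rule Xm)
  obtain n t where t: "min_left_free_approx R X n t" using min_left_approx_ex[OF Gp_fg[OF X]] by blast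
  then have th: "t \<in> mod_hom R X (free_mod R n)" unfolding min_left_free_approx_def by (rule conjunct1)
  have N: "submodule (t ` carrier X) R (free_mod R n)"
    by (rule mod_hom_image_submodule[OF Xm free_module th X.carrier_is_submodule])
  obtain C :: "'a obj" and q where C: "fg_module R C" "q \<in> mod_hom R (free_mod R n) C"
    "q ` carrier (free_mod R n) = carrier C" "\<And>x. x \<in> carrier (free_mod R n) \<Longrightarrow> q x = \<zero>\<^bsub>C\<^esub> \<longleftrightarrow> x \<in> t ` carrier X"
    using obj_quotient[OF fg_free N] by blast
  have "cosyzygy_seq R X C n t q"
    unfolding cosyzygy_seq_def a_kernel_def' using C t fg_module_iff[of C] mod_hom_closed[OF th] by auto
  then have "case chosen_cosyzygy_seq R X of (C, n, t, q) \<Rightarrow> cosyzygy_seq R X C n t q"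
    unfolding chosen_cosyzygy_seq_def by (intro someI[where P = "\<lambda>(C, n, t, q). cosyzygy_seq R X C n t q" and x = "(C, n, t, q)"]) simp
  moreover obtain C n t q where ch: "chosen_cosyzygy_seq R X = (C, n, t, q)" by (cases "chosen_cosyzygy_seq R X")
  ultimately have cs: "cosyzygy_seq R X C n t q" by simp
  then have c: "module R C" "min_left_free_approx R X n t" "q \<in> mod_hom R (free_mod R n) C"
    "q ` carrier (free_mod R n) = carrier C" "t ` carrier X = {v \<in> carrier (free_mod R n). q v = \<zero>\<^bsub>C\<^esub>}"
    unfolding cosyzygy_seq_def a_kernel_def' by simp_all
  have th: "t \<in> mod_hom R X (free_mod R n)" using c(2) unfolding min_left_free_approx_def by (rule conjunct1)
  note ext = left_approx_extends[OF Xm c(2)]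
  show ?thesis
    by (rule that[OF ch _ Gp_cosyzygy(2)[OF X c(1) th ext c(3-5)] ext Gp_cosyzygy(1)[OF X c(1) th ext c(3-5)]])
      (simp add: cosyzygy_def ch)
qed

end

subsection \<open>Preadditive categories\<close>

locale preadditive =
  fixes A :: "('o, 'h) preadd_cat"
  assumes hom_group: "X \<in> cobj A \<Longrightarrow> Y \<in> cobj A \<Longrightarrow> comm_group (chom A X Y)"
    and comp_closed: "X \<in> cobj A \<Longrightarrow> Y \<in> cobj A \<Longrightarrow> Z \<in> cobj A \<Longrightarrow> g \<in> carrier (chom A Y Z) \<Longrightarrow>
      f \<in> carrier (chom A X Y) \<Longrightarrow> ccomp A X Y Z g f \<in> carrier (chom A X Z)"
    and id_closed: "X \<in> cobj A \<Longrightarrow> cid A X \<in> carrier (chom A X X)"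
    and comp_assoc: "W \<in> cobj A \<Longrightarrow> X \<in> cobj A \<Longrightarrow> Y \<in> cobj A \<Longrightarrow> Z \<in> cobj A \<Longrightarrow> h \<in> carrier (chom A Y Z) \<Longrightarrow>
      g \<in> carrier (chom A X Y) \<Longrightarrow> f \<in> carrier (chom A W X) \<Longrightarrow>
      ccomp A W X Z (ccomp A X Y Z h g) f = ccomp A W Y Z h (ccomp A W X Y g f)"
    and id_left: "X \<in> cobj A \<Longrightarrow> Y \<in> cobj A \<Longrightarrow> f \<in> carrier (chom A X Y) \<Longrightarrow> ccomp A X Y Y (cid A Y) f = f"
    and id_right: "X \<in> cobj A \<Longrightarrow> Y \<in> cobj A \<Longrightarrow> f \<in> carrier (chom A X Y) \<Longrightarrow> ccomp A X X Y f (cid A X) = f"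
    and comp_mult_left: "X \<in> cobj A \<Longrightarrow> Y \<in> cobj A \<Longrightarrow> Z \<in> cobj A \<Longrightarrow> g \<in> carrier (chom A Y Z) \<Longrightarrow>
      g' \<in> carrier (chom A Y Z) \<Longrightarrow> f \<in> carrier (chom A X Y) \<Longrightarrow>
      ccomp A X Y Z (g \<otimes>\<^bsub>chom A Y Z\<^esub> g') f = ccomp A X Y Z g f \<otimes>\<^bsub>chom A X Z\<^esub> ccomp A X Y Z g' f"
    and comp_mult_right: "X \<in> cobj A \<Longrightarrow> Y \<in> cobj A \<Longrightarrow> Z \<in> cobj A \<Longrightarrow> g \<in> carrier (chom A Y Z) \<Longrightarrow>
      f \<in> carrier (chom A X Y) \<Longrightarrow> f' \<in> carrier (chom A X Y) \<Longrightarrow>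
      ccomp A X Y Z g (f \<otimes>\<^bsub>chom A X Y\<^esub> f') = ccomp A X Y Z g f \<otimes>\<^bsub>chom A X Z\<^esub> ccomp A X Y Z g f'"
begin

lemma comp_hom_right: "X \<in> cobj A \<Longrightarrow> Y \<in> cobj A \<Longrightarrow> Z \<in> cobj A \<Longrightarrow> g \<in> carrier (chom A Y Z) \<Longrightarrow>
    (\<lambda>f. ccomp A X Y Z g f) \<in> hom (chom A X Y) (chom A X Z)"
  by (rule homI) (auto intro: comp_closed comp_mult_right)

lemma hom_grp: "X \<in> cobj A \<Longrightarrow> Y \<in> cobj A \<Longrightarrow> group (chom A X Y)"
  using hom_group comm_group.axioms(2) by blast

lemma comp_one_right: "X \<in> cobj A \<Longrightarrow> Y \<in> cobj A \<Longrightarrow> Z \<in> cobj A \<Longrightarrow> g \<in> carrier (chom A Y Z) \<Longrightarrow>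
    ccomp A X Y Z g \<one>\<^bsub>chom A X Y\<^esub> = \<one>\<^bsub>chom A X Z\<^esub>"
  using hom_one[OF comp_hom_right hom_grp hom_grp] by blast

end

section \<open>Right modules and their pullbacks along autoequivalences\<close>

lemma right_moduleD:
  assumes "right_module A F" "X \<in> cobj A" "Y \<in> cobj A"
  shows "comm_group (fobj F X)"
    and "f \<in> carrier (chom A X Y) \<Longrightarrow> fmap F X Y f \<in> hom (fobj F Y) (fobj F X)"
    and "x \<in> carrier (fobj F X) \<Longrightarrow> fmap F X X (cid A X) x = x"
    and "f \<in> carrier (chom A X Y) \<Longrightarrow> g \<in> carrier (chom A X Y) \<Longrightarrow> y \<in> carrier (fobj F Y) \<Longrightarrow>
      fmap F X Y (f \<otimes>\<^bsub>chom A X Y\<^esub> g) y = fmap F X Y f y \<otimes>\<^bsub>fobj F X\<^esub> fmap F X Y g y"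
    and "f \<in> carrier (chom A X Y) \<Longrightarrow> y \<in> carrier (fobj F Y) \<Longrightarrow> fmap F X Y f y \<in> carrier (fobj F X)"
  using assms unfolding right_module_def by (blast, blast, blast, blast, blast dest: hom_in_carrier)

lemma right_module_comp:
  assumes "right_module A F" "X \<in> cobj A" "Y \<in> cobj A" "Z \<in> cobj A" "f \<in> carrier (chom A X Y)" "g \<in> carrier (chom A Y Z)"
    "z \<in> carrier (fobj F Z)"
  shows "fmap F X Z (ccomp A X Y Z g f) z = fmap F X Y f (fmap F Y Z g z)"
  using assms unfolding right_module_def by blast

text \<open>By Yoneda, a transformation from the functor represented by \<open>X\<close> is an
  element of \<open>F\<close> at \<open>X\<close>, and it is surjective when the restrictions of
  this element exhaust \<open>F\<close>.\<close>

definition generated_by ::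
  "('o,'h) preadd_cat \<Rightarrow> ('o,'h,'g) contra_functor \<Rightarrow> 'o \<Rightarrow> 'g \<Rightarrow> bool" where
  "generated_by A F X x \<longleftrightarrow> X \<in> cobj A \<and> x \<in> carrier (fobj F X) \<and>
     (\<forall>Z\<in>cobj A. \<forall>z\<in>carrier (fobj F Z). \<exists>g\<in>carrier (chom A Z X). z = fmap F Z X g x)"

text \<open>\<open>F\<close> is the direct summand of the functor represented by \<open>X\<close> that is cut out by the idempotent \<open>e\<close>,
  with universal element \<open>x\<close>.\<close>

definition split_generated :: "('o,'h) preadd_cat \<Rightarrow> ('o,'h,'g) contra_functor \<Rightarrow> bool" where
  "split_generated A F \<longleftrightarrow> right_module A F \<and> (\<exists>X x. generated_by A F X x \<and>
     (\<exists>e\<in>carrier (chom A X X). fmap F X X e x = x \<and>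
       (\<forall>Z\<in>cobj A. \<forall>g\<in>carrier (chom A Z X). fmap F Z X g x = \<one>\<^bsub>fobj F Z\<^esub> \<longrightarrow> ccomp A Z X X e g = \<one>\<^bsub>chom A Z X\<^esub>)))"

definition pullback ::
  "('o \<Rightarrow> 'o) \<Rightarrow> ('o \<Rightarrow> 'o \<Rightarrow> 'h \<Rightarrow> 'h) \<Rightarrow> ('o,'h,'g) contra_functor \<Rightarrow> ('o,'h,'g) contra_functor" where
  "pullback ob mo F = \<lparr>fobj = (\<lambda>X. fobj F (ob X)), fmap = (\<lambda>X Y f. fmap F (ob X) (ob Y) (mo X Y f))\<rparr>"

lemma pullback_simps [simp]:
  "fobj (pullback ob mo F) X = fobj F (ob X)" "fmap (pullback ob mo F) X Y f = fmap F (ob X) (ob Y) (mo X Y f)"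
  by (auto simp: pullback_def)

text \<open>The form fully faithful and dense avoids building a quasi-inverse. Faithfulness at zero
  is enough because \<open>mo\<close> is additive.\<close>

locale autoequivalence = preadditive A for A :: "('o, 'h) preadd_cat" +
  fixes ob :: "'o \<Rightarrow> 'o" and mo :: "'o \<Rightarrow> 'o \<Rightarrow> 'h \<Rightarrow> 'h"
  assumes ob_closed: "X \<in> cobj A \<Longrightarrow> ob X \<in> cobj A"
    and mo_closed: "X \<in> cobj A \<Longrightarrow> Y \<in> cobj A \<Longrightarrow> f \<in> carrier (chom A X Y) \<Longrightarrow> mo X Y f \<in> carrier (chom A (ob X) (ob Y))"
    and mo_mult: "X \<in> cobj A \<Longrightarrow> Y \<in> cobj A \<Longrightarrow> f \<in> carrier (chom A X Y) \<Longrightarrow> g \<in> carrier (chom A X Y) \<Longrightarrow>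
      mo X Y (f \<otimes>\<^bsub>chom A X Y\<^esub> g) = mo X Y f \<otimes>\<^bsub>chom A (ob X) (ob Y)\<^esub> mo X Y g"
    and mo_id: "X \<in> cobj A \<Longrightarrow> mo X X (cid A X) = cid A (ob X)"
    and mo_comp: "X \<in> cobj A \<Longrightarrow> Y \<in> cobj A \<Longrightarrow> Z \<in> cobj A \<Longrightarrow> g \<in> carrier (chom A Y Z) \<Longrightarrow> f \<in> carrier (chom A X Y) \<Longrightarrow>
      mo X Z (ccomp A X Y Z g f) = ccomp A (ob X) (ob Y) (ob Z) (mo Y Z g) (mo X Y f)"
    and mo_full: "X \<in> cobj A \<Longrightarrow> Y \<in> cobj A \<Longrightarrow> h \<in> carrier (chom A (ob X) (ob Y)) \<Longrightarrow>
      \<exists>f\<in>carrier (chom A X Y). h = mo X Y f"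
    and mo_faithful: "X \<in> cobj A \<Longrightarrow> Y \<in> cobj A \<Longrightarrow> f \<in> carrier (chom A X Y) \<Longrightarrow>
      mo X Y f = \<one>\<^bsub>chom A (ob X) (ob Y)\<^esub> \<Longrightarrow> f = \<one>\<^bsub>chom A X Y\<^esub>"
    and dense: "Y \<in> cobj A \<Longrightarrow> \<exists>X\<in>cobj A. \<exists>a\<in>carrier (chom A (ob X) Y). \<exists>b\<in>carrier (chom A Y (ob X)).
      ccomp A (ob X) Y (ob X) b a = cid A (ob X) \<and> ccomp A Y (ob X) Y a b = cid A Y"
begin

lemma pullback_right_module:
  assumes F: "right_module A F" shows "right_module A (pullback ob mo F)"
proof -
  have 1: "\<forall>X\<in>cobj A. comm_group (fobj (pullback ob mo F) X)"
    using right_moduleD(1)[OF F ob_closed ob_closed] by simp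
  have 2: "\<forall>X\<in>cobj A. \<forall>Y\<in>cobj A. \<forall>f\<in>carrier (chom A X Y).
      fmap (pullback ob mo F) X Y f \<in> hom (fobj (pullback ob mo F) Y) (fobj (pullback ob mo F) X)"
    using right_moduleD(2)[OF F ob_closed ob_closed] mo_closed by simp
  have 3: "\<forall>X\<in>cobj A. \<forall>x\<in>carrier (fobj (pullback ob mo F) X). fmap (pullback ob mo F) X X (cid A X) x = x"
    using right_moduleD(3)[OF F ob_closed ob_closed] by (simp add: mo_id)
  have 4: "\<forall>X\<in>cobj A. \<forall>Y\<in>cobj A. \<forall>Z\<in>cobj A. \<forall>f\<in>carrier (chom A X Y). \<forall>g\<in>carrier (chom A Y Z).
        \<forall>z\<in>carrier (fobj (pullback ob mo F) Z). fmap (pullback ob mo F) X Z (ccomp A X Y Z g f) z =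
          fmap (pullback ob mo F) X Y f (fmap (pullback ob mo F) Y Z g z)"
    using right_module_comp[OF F ob_closed ob_closed ob_closed mo_closed mo_closed] by (simp add: mo_comp)
  have 5: "\<forall>X\<in>cobj A. \<forall>Y\<in>cobj A. \<forall>f\<in>carrier (chom A X Y). \<forall>g\<in>carrier (chom A X Y).
        \<forall>y\<in>carrier (fobj (pullback ob mo F) Y). fmap (pullback ob mo F) X Y (f \<otimes>\<^bsub>chom A X Y\<^esub> g) y =
          fmap (pullback ob mo F) X Y f y \<otimes>\<^bsub>fobj (pullback ob mo F) X\<^esub> fmap (pullback ob mo F) X Y g y"
    using right_moduleD(4)[OF F ob_closed ob_closed mo_closed mo_closed] by (simp add: mo_mult)
  show ?thesis unfolding right_module_def using 1 2 3 4 5 by blast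
qed

text \<open>Every \<open>Y\<close> is isomorphic to some \<open>ob Z\<close>, so its elements are
  restrictions of elements at \<open>ob Z\<close>, which \<open>x\<close> generates.\<close>

lemma generated_by_pullback:
  assumes F: "right_module A F" and gen: "generated_by A (pullback ob mo F) X x"
  shows "generated_by A F (ob X) x"
  unfolding generated_by_def
proof (intro conjI ballI)
  have X: "X \<in> cobj A" and x: "x \<in> carrier (fobj F (ob X))"
    and g: "\<And>Z z. Z \<in> cobj A \<Longrightarrow> z \<in> carrier (fobj F (ob Z)) \<Longrightarrow> \<exists>g\<in>carrier (chom A Z X). z = fmap F (ob Z) (ob X) (mo Z X g) x"
    using gen unfolding generated_by_def by auto
  show "ob X \<in> cobj A" "x \<in> carrier (fobj F (ob X))" using ob_closed X x by auto
  fix Y y assume Y: "Y \<in> cobj A" and y: "y \<in> carrier (fobj F Y)"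
  obtain Z a b where Z: "Z \<in> cobj A" and a: "a \<in> carrier (chom A (ob Z) Y)" and b: "b \<in> carrier (chom A Y (ob Z))"
    and ab: "ccomp A Y (ob Z) Y a b = cid A Y" using dense[OF Y] by blast
  note oZ = ob_closed[OF Z] and oX = ob_closed[OF X]
  have ay: "fmap F (ob Z) Y a y \<in> carrier (fobj F (ob Z))" by (rule right_moduleD(5)[OF F oZ Y a y])
  obtain h where h: "h \<in> carrier (chom A Z X)" "fmap F (ob Z) Y a y = fmap F (ob Z) (ob X) (mo Z X h) x" using g[OF Z ay] by blast
  note mh = mo_closed[OF Z X h(1)]
  have "y = fmap F Y (ob Z) b (fmap F (ob Z) Y a y)"
    using right_module_comp[OF F Y oZ Y b a y] right_moduleD(3)[OF F Y Y y] ab by simp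
  also have "\<dots> = fmap F Y (ob X) (ccomp A Y (ob Z) (ob X) (mo Z X h) b) x"
    using right_module_comp[OF F Y oZ oX b mh x] h(2) by simp
  finally show "\<exists>g\<in>carrier (chom A Y (ob X)). y = fmap F Y (ob X) g x"
    using comp_closed[OF Y oZ oX mh b] by blast
qed

text \<open>The generating object \<open>Y\<close> is isomorphic to some \<open>ob X\<close>;
  element and endomorphism are transported along the isomorphism, and faithfulness allows the kernel
  condition to be checked after applying \<open>mo\<close>.\<close>

lemma split_generated_pullback:
  assumes "split_generated A F" shows "split_generated A (pullback ob mo F)"
proof -
  obtain Y y e where F: "right_module A F" and Y: "Y \<in> cobj A" and y: "y \<in> carrier (fobj F Y)"
    and gen: "\<And>Z z. Z \<in> cobj A \<Longrightarrow> z \<in> carrier (fobj F Z) \<Longrightarrow> \<exists>g\<in>carrier (chom A Z Y). z = fmap F Z Y g y"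
    and e: "e \<in> carrier (chom A Y Y)" "fmap F Y Y e y = y"
    and ker: "\<And>Z g. Z \<in> cobj A \<Longrightarrow> g \<in> carrier (chom A Z Y) \<Longrightarrow> fmap F Z Y g y = \<one>\<^bsub>fobj F Z\<^esub> \<Longrightarrow> ccomp A Z Y Y e g = \<one>\<^bsub>chom A Z Y\<^esub>"
    using assms unfolding split_generated_def generated_by_def by blast
  obtain X a b where X: "X \<in> cobj A" and a: "a \<in> carrier (chom A (ob X) Y)" and b: "b \<in> carrier (chom A Y (ob X))"
    and ba: "ccomp A (ob X) Y (ob X) b a = cid A (ob X)" and ab: "ccomp A Y (ob X) Y a b = cid A Y" using dense[OF Y] by blast
  note oX = ob_closed[OF X]
  let ?x = "fmap F (ob X) Y a y"
  have x: "?x \<in> carrier (fobj F (ob X))" by (rule right_moduleD(5)[OF F oX Y a y])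
  have bx: "fmap F Y (ob X) b ?x = y"
    using right_module_comp[OF F Y oX Y b a y] right_moduleD(3)[OF F Y Y y] ab by simp
  have ea: "ccomp A (ob X) Y Y e a \<in> carrier (chom A (ob X) Y)" by (rule comp_closed[OF oX Y Y e(1) a])
  \<comment> \<open>Conjugating \<open>e\<close> gives the endomorphism \<open>b e a\<close> of
    \<open>ob X\<close>; fullness makes it come from \<open>X\<close>.\<close>
  obtain e' where e': "e' \<in> carrier (chom A X X)" "ccomp A (ob X) Y (ob X) b (ccomp A (ob X) Y Y e a) = mo X X e'"
    using mo_full[OF X X comp_closed[OF oX Y oX b ea]] by blast
  have gen': "\<exists>g\<in>carrier (chom A Z X). z = fmap F (ob Z) (ob X) (mo Z X g) ?x"
    if Z: "Z \<in> cobj A" and z: "z \<in> carrier (fobj F (ob Z))" for Z z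
  proof -
    note oZ = ob_closed[OF Z]
    obtain h where h: "h \<in> carrier (chom A (ob Z) Y)" "z = fmap F (ob Z) Y h y" using gen[OF oZ z] by blast
    obtain g where g: "g \<in> carrier (chom A Z X)" "ccomp A (ob Z) Y (ob X) b h = mo Z X g"
      using mo_full[OF Z X comp_closed[OF oZ Y oX b h(1)]] by blast
    have "fmap F (ob Z) (ob X) (mo Z X g) ?x = fmap F (ob Z) Y h (fmap F Y (ob X) b ?x)"
      using right_module_comp[OF F oZ Y oX h(1) b x] g(2) by simp
    then show ?thesis using g(1) h(2) bx by (intro bexI[OF _ g(1)]) simp
  qed
  have fix_x: "fmap F (ob X) (ob X) (mo X X e') ?x = ?x"
  proof -
    have "fmap F (ob X) (ob X) (mo X X e') ?x = fmap F (ob X) Y (ccomp A (ob X) Y Y e a) (fmap F Y (ob X) b ?x)"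
      using right_module_comp[OF F oX Y oX ea b x] e'(2) by simp
    also have "\<dots> = fmap F (ob X) Y a (fmap F Y Y e y)" using right_module_comp[OF F oX Y Y a e(1) y] bx by simp
    finally show ?thesis using e(2) by simp
  qed
  have ker': "ccomp A Z X X e' g = \<one>\<^bsub>chom A Z X\<^esub>"
    if Z: "Z \<in> cobj A" and g: "g \<in> carrier (chom A Z X)" and z: "fmap F (ob Z) (ob X) (mo Z X g) ?x = \<one>\<^bsub>fobj F (ob Z)\<^esub>" for Z g
  proof (rule mo_faithful[OF Z X comp_closed[OF Z X X e'(1) g]])
    note oZ = ob_closed[OF Z] and mg = mo_closed[OF Z X g]
    note amg = comp_closed[OF oZ oX Y a mg]
    have "fmap F (ob Z) Y (ccomp A (ob Z) (ob X) Y a (mo Z X g)) y = \<one>\<^bsub>fobj F (ob Z)\<^esub>"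
      using right_module_comp[OF F oZ oX Y mg a y] z by simp
    then have k: "ccomp A (ob Z) Y Y e (ccomp A (ob Z) (ob X) Y a (mo Z X g)) = \<one>\<^bsub>chom A (ob Z) Y\<^esub>"
      by (rule ker[OF oZ amg])
    have "mo Z X (ccomp A Z X X e' g) = ccomp A (ob Z) (ob X) (ob X) (mo X X e') (mo Z X g)"
      by (rule mo_comp[OF Z X X e'(1) g])
    also have "\<dots> = ccomp A (ob Z) Y (ob X) b (ccomp A (ob Z) (ob X) Y (ccomp A (ob X) Y Y e a) (mo Z X g))"
      unfolding e'(2)[symmetric] by (rule comp_assoc[OF oZ oX Y oX b ea mg])
    also have "ccomp A (ob Z) (ob X) Y (ccomp A (ob X) Y Y e a) (mo Z X g) = \<one>\<^bsub>chom A (ob Z) Y\<^esub>"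
      using comp_assoc[OF oZ oX Y Y e(1) a mg] k by simp
    also have "ccomp A (ob Z) Y (ob X) b \<one>\<^bsub>chom A (ob Z) Y\<^esub> = \<one>\<^bsub>chom A (ob Z) (ob X)\<^esub>"
      by (rule comp_one_right[OF oZ Y oX b])
    finally show "mo Z X (ccomp A Z X X e' g) = \<one>\<^bsub>chom A (ob Z) (ob X)\<^esub>" .
  qed
  have "generated_by A (pullback ob mo F) X ?x"
    unfolding generated_by_def using X x gen' by simp
  then show ?thesis
    unfolding split_generated_def using pullback_right_module[OF F] e'(1) fix_x ker'
    by (intro conjI exI bexI[of _ e'] ballI impI) simp_all
qed

end

lemma (in preadditive) autoequivalence_id: "autoequivalence A (\<lambda>X. X) (\<lambda>X Y f. f)"
proof unfold_locales
  fix Y assume Y: "Y \<in> cobj A"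
  show "\<exists>X\<in>cobj A. \<exists>a\<in>carrier (chom A X Y). \<exists>b\<in>carrier (chom A Y X).
      ccomp A X Y X b a = cid A X \<and> ccomp A Y X Y a b = cid A Y"
    using Y id_closed[OF Y] id_left[OF Y Y id_closed[OF Y]] by blast
qed auto

lemma autoequivalence_comp:
  assumes "autoequivalence A ob mo" "autoequivalence A ob' mo'"
  shows "autoequivalence A (\<lambda>X. ob' (ob X)) (\<lambda>X Y f. mo' (ob X) (ob Y) (mo X Y f))"
proof -
  interpret S: autoequivalence A ob mo by fact
  interpret T: autoequivalence A ob' mo' by fact
  show ?thesis
  proof unfold_locales
    fix X Y h assume X: "X \<in> cobj A" and Y: "Y \<in> cobj A" and h: "h \<in> carrier (chom A (ob' (ob X)) (ob' (ob Y)))"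
    show "\<exists>f\<in>carrier (chom A X Y). h = mo' (ob X) (ob Y) (mo X Y f)"
      using T.mo_full[OF S.ob_closed[OF X] S.ob_closed[OF Y] h] S.mo_full[OF X Y] by blast
  next
    fix X Y f assume X: "X \<in> cobj A" and Y: "Y \<in> cobj A" and f: "f \<in> carrier (chom A X Y)"
      and z: "mo' (ob X) (ob Y) (mo X Y f) = \<one>\<^bsub>chom A (ob' (ob X)) (ob' (ob Y))\<^esub>"
    show "f = \<one>\<^bsub>chom A X Y\<^esub>"
      by (rule S.mo_faithful[OF X Y f T.mo_faithful[OF S.ob_closed[OF X] S.ob_closed[OF Y] S.mo_closed[OF X Y f] z]])
  next
    fix Y assume Y: "Y \<in> cobj A"
    obtain W a b where W: "W \<in> cobj A" and a: "a \<in> carrier (chom A (ob' W) Y)" and b: "b \<in> carrier (chom A Y (ob' W))"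
      and ba: "ccomp A (ob' W) Y (ob' W) b a = cid A (ob' W)" and ab: "ccomp A Y (ob' W) Y a b = cid A Y"
      using T.dense[OF Y] by blast
    obtain X c d where X: "X \<in> cobj A" and c: "c \<in> carrier (chom A (ob X) W)" and d: "d \<in> carrier (chom A W (ob X))"
      and dc: "ccomp A (ob X) W (ob X) d c = cid A (ob X)" and cd: "ccomp A W (ob X) W c d = cid A W"
      using S.dense[OF W] by blast
    note oX = S.ob_closed[OF X] and oW = T.ob_closed[OF W]
    note ooX = T.ob_closed[OF oX]
    let ?c = "mo' (ob X) W c" and ?d = "mo' W (ob X) d"
    note mc = T.mo_closed[OF oX W c] and md = T.mo_closed[OF W oX d]
    have dc': "ccomp A (ob' (ob X)) (ob' W) (ob' (ob X)) ?d ?c = cid A (ob' (ob X))"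
      using T.mo_comp[OF oX W oX d c] dc T.mo_id[OF oX] by simp
    have cd': "ccomp A (ob' W) (ob' (ob X)) (ob' W) ?c ?d = cid A (ob' W)"
      using T.mo_comp[OF W oX W c d] cd T.mo_id[OF W] by simp
    let ?a = "ccomp A (ob' (ob X)) (ob' W) Y a ?c" and ?b = "ccomp A Y (ob' W) (ob' (ob X)) ?d b"
    have a': "?a \<in> carrier (chom A (ob' (ob X)) Y)" by (rule S.comp_closed[OF ooX oW Y a mc])
    have b': "?b \<in> carrier (chom A Y (ob' (ob X)))" by (rule S.comp_closed[OF Y oW ooX md b])
    have "ccomp A (ob' (ob X)) Y (ob' (ob X)) ?b ?a = ccomp A (ob' (ob X)) (ob' W) (ob' (ob X)) ?d (ccomp A (ob' (ob X)) Y (ob' W) b ?a)"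
      by (rule S.comp_assoc[OF ooX Y oW ooX md b a'])
    also have "ccomp A (ob' (ob X)) Y (ob' W) b ?a = ccomp A (ob' (ob X)) (ob' W) (ob' W) (cid A (ob' W)) ?c"
      using S.comp_assoc[OF ooX oW Y oW b a mc] ba by simp
    also have "\<dots> = ?c" by (rule S.id_left[OF ooX oW mc])
    finally have 1: "ccomp A (ob' (ob X)) Y (ob' (ob X)) ?b ?a = cid A (ob' (ob X))" using dc' by simp
    have "ccomp A Y (ob' (ob X)) Y ?a ?b = ccomp A Y (ob' W) Y a (ccomp A Y (ob' (ob X)) (ob' W) ?c ?b)"
      by (rule S.comp_assoc[OF Y ooX oW Y a mc b'])
    also have "ccomp A Y (ob' (ob X)) (ob' W) ?c ?b = ccomp A Y (ob' W) (ob' W) (cid A (ob' W)) b"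
      using S.comp_assoc[OF Y oW ooX oW mc md b] cd' by simp
    also have "\<dots> = b" by (rule S.id_left[OF Y oW b])
    finally have 2: "ccomp A Y (ob' (ob X)) Y ?a ?b = cid A Y" using ab by simp
    show "\<exists>X\<in>cobj A. \<exists>a\<in>carrier (chom A (ob' (ob X)) Y). \<exists>b\<in>carrier (chom A Y (ob' (ob X))).
      ccomp A (ob' (ob X)) Y (ob' (ob X)) b a = cid A (ob' (ob X)) \<and> ccomp A Y (ob' (ob X)) Y a b = cid A Y"
      using X a' b' 1 2 by blast
  qed (simp_all add: S.ob_closed T.ob_closed S.mo_closed T.mo_closed S.mo_mult S.mo_id S.mo_comp T.mo_mult T.mo_id T.mo_comp)
qed

subsection \<open>Finitely presented and projective functors\<close>

context preadditive
begin

text \<open>The generating element is the image of the identity of \<open>X\<close>.\<close>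

lemma fin_generatedD:
  assumes "fin_generated A F"
  shows "right_module A F" "\<exists>X x. generated_by A F X x"
proof -
  show "right_module A F" using assms unfolding fin_generated_def by blast
  obtain X \<eta> where X: "X \<in> cobj A" and nt: "nat_trans A (repr_functor A X) F \<eta>"
    and surj: "\<And>Z. Z \<in> cobj A \<Longrightarrow> \<eta> Z ` carrier (chom A Z X) = carrier (fobj F Z)"
    using assms unfolding fin_generated_def by blast
  have "generated_by A F X (\<eta> X (cid A X))"
    unfolding generated_by_def
  proof (intro conjI ballI X)
    show "\<eta> X (cid A X) \<in> carrier (fobj F X)" using surj[OF X] id_closed[OF X] by blast
    fix Z z assume Z: "Z \<in> cobj A" "z \<in> carrier (fobj F Z)"
    then obtain g where g: "g \<in> carrier (chom A Z X)" "z = \<eta> Z g" using surj[OF Z(1)] by blast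
    have "\<eta> Z (fmap (repr_functor A X) Z X g (cid A X)) = fmap F Z X g (\<eta> X (cid A X))"
      using nt Z(1) X g(1) id_closed[OF X] unfolding nat_trans_def repr_functor_def by simp
    then show "\<exists>g\<in>carrier (chom A Z X). z = fmap F Z X g (\<eta> X (cid A X))"
      using g id_left[OF Z(1) X g(1)] by (auto simp: repr_functor_def)
  qed
  then show "\<exists>X x. generated_by A F X x" by blast
qed

lemma yoneda_nat_trans:
  assumes F: "right_module A F" and X: "X \<in> cobj A" and x: "x \<in> carrier (fobj F X)"
  shows "nat_trans A (repr_functor A X) F (\<lambda>Z g. fmap F Z X g x)"
  unfolding nat_trans_def repr_functor_def
  by (auto intro!: homI simp: right_moduleD(5)[OF F _ X _ x] right_moduleD(4)[OF F _ X _ _ x] right_module_comp[OF F _ _ X _ _ x])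

lemma repr_nat_trans:
  assumes X: "X \<in> cobj A" and Y: "Y \<in> cobj A" and f: "f \<in> carrier (chom A X Y)"
  shows "nat_trans A (repr_functor A X) (repr_functor A Y) (\<lambda>Z g. ccomp A Z X Y f g)"
  unfolding nat_trans_def repr_functor_def
  using comp_hom_right[OF _ X Y f] comp_assoc[OF _ _ X Y f] by simp

lemma repr_nat_trans_eq:
  assumes "nat_trans A (repr_functor A X) (repr_functor A Y) \<xi>" and X: "X \<in> cobj A" and Z: "Z \<in> cobj A"
    and g: "g \<in> carrier (chom A Z X)"
  shows "\<xi> Z g = ccomp A Z X Y (\<xi> X (cid A X)) g"
proof -
  have "\<xi> Z (ccomp A Z X X (cid A X) g) = ccomp A Z X Y (\<xi> X (cid A X)) g"
    using assms id_closed[OF X] unfolding nat_trans_def repr_functor_def by simp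
  then show ?thesis using id_left[OF Z X g] by simp
qed

lemma fin_presented_imp_generated: "fin_presented A F \<Longrightarrow> fin_generated A F"
  unfolding fin_presented_def fin_generated_def by blast

text \<open>The relations are generated by \<open>1 - e\<close>: it kills \<open>x\<close> because
  \<open>e\<close> fixes \<open>x\<close>, and a map \<open>h\<close> that kills \<open>x\<close>
  satisfies \<open>e h = 0\<close>, hence \<open>h = (1 - e) h\<close>.\<close>

lemma split_generated_fin_presented:
  assumes "split_generated A F" shows "fin_presented A F"
proof -
  obtain X x e where F: "right_module A F" and X: "X \<in> cobj A" and x: "x \<in> carrier (fobj F X)"
    and gen: "\<And>Z z. Z \<in> cobj A \<Longrightarrow> z \<in> carrier (fobj F Z) \<Longrightarrow> \<exists>g\<in>carrier (chom A Z X). z = fmap F Z X g x"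
    and e: "e \<in> carrier (chom A X X)" "fmap F X X e x = x"
    and ker: "\<And>Z g. Z \<in> cobj A \<Longrightarrow> g \<in> carrier (chom A Z X) \<Longrightarrow> fmap F Z X g x = \<one>\<^bsub>fobj F Z\<^esub> \<Longrightarrow> ccomp A Z X X e g = \<one>\<^bsub>chom A Z X\<^esub>"
    using assms unfolding split_generated_def generated_by_def by blast
  interpret E: comm_group "chom A X X" by (rule hom_group[OF X X])
  \<comment> \<open>This is \<open>1 - e\<close>; groups of morphisms are written
    multiplicatively.\<close>
  let ?f = "cid A X \<otimes>\<^bsub>chom A X X\<^esub> inv\<^bsub>chom A X X\<^esub> e"
  have f: "?f \<in> carrier (chom A X X)" using id_closed[OF X] e(1) by simp
  interpret FX: comm_group "fobj F X" by (rule right_moduleD(1)[OF F X X])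
  have fx: "fmap F X X ?f x = \<one>\<^bsub>fobj F X\<^esub>"
  proof -
    have "fmap F X X (?f \<otimes>\<^bsub>chom A X X\<^esub> e) x = fmap F X X ?f x \<otimes>\<^bsub>fobj F X\<^esub> fmap F X X e x"
      by (rule right_moduleD(4)[OF F X X f e(1) x])
    moreover have "?f \<otimes>\<^bsub>chom A X X\<^esub> e = cid A X" using id_closed[OF X] e(1) by (simp add: E.m_assoc)
    ultimately have "x = fmap F X X ?f x \<otimes>\<^bsub>fobj F X\<^esub> x" using right_moduleD(3)[OF F X X x] e(2) by simp
    then show ?thesis using right_moduleD(5)[OF F X X f x] x by (metis FX.r_cancel_one)
  qed
  have k: "(\<lambda>g. ccomp A Z X X ?f g) ` carrier (chom A Z X) = kernel (chom A Z X) (fobj F Z) (\<lambda>g. fmap F Z X g x)"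
    if Z: "Z \<in> cobj A" for Z
  proof (rule subset_antisym; rule subsetI)
    interpret C: comm_group "chom A Z X" by (rule hom_group[OF Z X])
    {
      fix h assume "h \<in> (\<lambda>g. ccomp A Z X X ?f g) ` carrier (chom A Z X)"
      then obtain g where g: "g \<in> carrier (chom A Z X)" "h = ccomp A Z X X ?f g" by blast
      have "fmap F Z X h x = fmap F Z X g \<one>\<^bsub>fobj F X\<^esub>" using right_module_comp[OF F Z X X g(1) f x] fx g(2) by simp
      also have "\<dots> = \<one>\<^bsub>fobj F Z\<^esub>"
        using hom_one[OF right_moduleD(2)[OF F Z X g(1)]] right_moduleD(1)[OF F X X] right_moduleD(1)[OF F Z Z] comm_group.axioms(2) by blast
      finally show "h \<in> kernel (chom A Z X) (fobj F Z) (\<lambda>g. fmap F Z X g x)"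
        using comp_closed[OF Z X X f g(1)] g(2) unfolding kernel_def by simp
    }
    fix h assume "h \<in> kernel (chom A Z X) (fobj F Z) (\<lambda>g. fmap F Z X g x)"
    then have h: "h \<in> carrier (chom A Z X)" "fmap F Z X h x = \<one>\<^bsub>fobj F Z\<^esub>" unfolding kernel_def by auto
    have "ccomp A Z X X (?f \<otimes>\<^bsub>chom A X X\<^esub> e) h = ccomp A Z X X ?f h \<otimes>\<^bsub>chom A Z X\<^esub> ccomp A Z X X e h"
      by (rule comp_mult_left[OF Z X X f e(1) h(1)])
    moreover have "?f \<otimes>\<^bsub>chom A X X\<^esub> e = cid A X" using id_closed[OF X] e(1) by (simp add: E.m_assoc)
    ultimately have "h = ccomp A Z X X ?f h" using ker[OF Z h] id_left[OF Z X h(1)] comp_closed[OF Z X X f h(1)] by simp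
    then show "h \<in> (\<lambda>g. ccomp A Z X X ?f g) ` carrier (chom A Z X)" using h(1) by blast
  qed
  have s: "(\<lambda>g. fmap F Z X g x) ` carrier (chom A Z X) = carrier (fobj F Z)" if Z: "Z \<in> cobj A" for Z
    using gen[OF Z] right_moduleD(5)[OF F Z X _ x] by blast
  show ?thesis
    unfolding fin_presented_def
    by (intro conjI F bexI[OF _ X] exI[of _ "\<lambda>Z g. ccomp A Z X X ?f g"] exI[of _ "\<lambda>Z g. fmap F Z X g x"]
        repr_nat_trans[OF X X f] yoneda_nat_trans[OF F X x] ballI k s)
qed

end

text \<open>\<open>S\<close> is a biproduct up to the identity \<open>i1 p1 + i2 p2 = 1\<close>, which is omitted.\<close>

locale additive_category = preadditive A for A :: "('o, 'h) preadd_cat" +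
  assumes biproduct: "X \<in> cobj A \<Longrightarrow> Y \<in> cobj A \<Longrightarrow> \<exists>S\<in>cobj A. \<exists>i1\<in>carrier (chom A X S). \<exists>i2\<in>carrier (chom A Y S).
    \<exists>p1\<in>carrier (chom A S X). \<exists>p2\<in>carrier (chom A S Y). ccomp A X S X p1 i1 = cid A X \<and> ccomp A Y S Y p2 i2 = cid A Y \<and>
      ccomp A Y S X p1 i2 = \<one>\<^bsub>chom A Y X\<^esub> \<and> ccomp A X S Y p2 i1 = \<one>\<^bsub>chom A X Y\<^esub>"
begin

text \<open>The quotient of the represented functor by the image of \<open>c\<close> is presented by
  construction. Realising it by cosets gives it the value type of \<open>mod_cat A\<close>, against
  which epimorphisms are tested.\<close>

lemma cokernel_functor:
  assumes S: "S \<in> cobj A" and X: "X \<in> cobj A" and c: "c \<in> carrier (chom A S X)"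
  obtains D :: "('o,'h,'h set) contra_functor" where "D \<in> mod_cat A"
    "nat_trans A (repr_functor A X) D (\<lambda>Z h. (\<lambda>w. ccomp A Z S X c w) ` carrier (chom A Z S) #>\<^bsub>chom A Z X\<^esub> h)"
    "\<And>Z. Z \<in> cobj A \<Longrightarrow> \<one>\<^bsub>fobj D Z\<^esub> = (\<lambda>w. ccomp A Z S X c w) ` carrier (chom A Z S)"
proof -
  let ?N = "\<lambda>Z. (\<lambda>w. ccomp A Z S X c w) ` carrier (chom A Z S)"
  define q where "q Z h = ?N Z #>\<^bsub>chom A Z X\<^esub> h" for Z h
  \<comment> \<open>A coset is restricted by restricting all its members. Their cosets coincide, so
    the union is that coset and no representative is chosen.\<close>
  define D where "D = \<lparr>fobj = (\<lambda>Z. chom A Z X Mod ?N Z), fmap = (\<lambda>Z W f K. \<Union>k\<in>K. q Z (ccomp A Z W X k f))\<rparr>"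
  have N: "subgroup (?N Z) (chom A Z X)" if Z: "Z \<in> cobj A" for Z
  proof -
    interpret H: group_hom "chom A Z S" "chom A Z X" "\<lambda>w. ccomp A Z S X c w"
      by (intro group_hom.intro group_hom_axioms.intro hom_grp comp_hom_right Z S X c)
    show ?thesis by (rule H.img_is_subgroup)
  qed
  have Nn: "?N Z \<lhd> chom A Z X" if Z: "Z \<in> cobj A" for Z
    using comm_group.subgroup_imp_normal[OF hom_group[OF Z X] N[OF Z]] .
  have qh: "q Z \<in> hom (chom A Z X) (fobj D Z)" if Z: "Z \<in> cobj A" for Z
    using normal.r_coset_hom_Mod[OF Nn[OF Z]] by (simp add: q_def[abs_def] D_def)
  have qs: "q Z ` carrier (chom A Z X) = carrier (fobj D Z)" for Z
    by (auto simp: q_def D_def FactGroup_def RCOSETS_def)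
  have qm: "q Z k = q Z h" if Z: "Z \<in> cobj A" and h: "h \<in> carrier (chom A Z X)" and k: "k \<in> q Z h" for Z h k
  proof -
    interpret G: group "chom A Z X" by (rule hom_grp[OF Z X])
    show ?thesis using G.repr_independence[OF _ h N[OF Z]] k unfolding q_def by simp
  qed
  have qc: "h \<in> q Z h" "\<And>k. k \<in> q Z h \<Longrightarrow> k \<in> carrier (chom A Z X)" if Z: "Z \<in> cobj A" and h: "h \<in> carrier (chom A Z X)" for Z h
  proof -
    interpret G: group "chom A Z X" by (rule hom_grp[OF Z X])
    show "h \<in> q Z h" unfolding q_def by (rule G.rcos_self[OF h N[OF Z]])
    show "\<And>k. k \<in> q Z h \<Longrightarrow> k \<in> carrier (chom A Z X)"
      unfolding q_def using G.r_coset_subset_G[OF subgroup.subset[OF N[OF Z]] h] by blast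
  qed
  have q1: "q Z h = ?N Z \<longleftrightarrow> h \<in> ?N Z" if Z: "Z \<in> cobj A" and h: "h \<in> carrier (chom A Z X)" for Z h
  proof -
    interpret G: group "chom A Z X" by (rule hom_grp[OF Z X])
    show ?thesis unfolding q_def using G.coset_join1[OF _ h N[OF Z]] G.coset_join2[OF h N[OF Z]] by blast
  qed
  have fq: "fmap D Z W f (q W h) = q Z (ccomp A Z W X h f)"
    if Z: "Z \<in> cobj A" and W: "W \<in> cobj A" and f: "f \<in> carrier (chom A Z W)" and h: "h \<in> carrier (chom A W X)" for Z W f h
  proof -
    interpret GW: group "chom A W X" by (rule hom_grp[OF W X])
    interpret GZ: group "chom A Z X" by (rule hom_grp[OF Z X])
    note hf = comp_closed[OF Z W X h f]
    have "q Z (ccomp A Z W X k f) = q Z (ccomp A Z W X h f)" if k: "k \<in> q W h" for k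
    proof -
      obtain w where w: "w \<in> carrier (chom A W S)" "k = ccomp A W S X c w \<otimes>\<^bsub>chom A W X\<^esub> h"
        using k unfolding q_def r_coset_def by blast
      note cw = comp_closed[OF W S X c w(1)] and wf = comp_closed[OF Z W S w(1) f]
      have eq: "ccomp A Z W X k f = ccomp A Z S X c (ccomp A Z W S w f) \<otimes>\<^bsub>chom A Z X\<^esub> ccomp A Z W X h f"
        using comp_mult_left[OF Z W X cw h f] comp_assoc[OF Z W S X c w(1) f] w(2) by simp
      have "ccomp A Z W X k f \<in> q Z (ccomp A Z W X h f)"
        unfolding eq unfolding q_def r_coset_def using wf by blast
      then show ?thesis by (rule qm[OF Z hf])
    qed
    then have "(\<Union>k\<in>q W h. q Z (ccomp A Z W X k f)) = (\<Union>k\<in>q W h. q Z (ccomp A Z W X h f))"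
      by (rule SUP_cong[OF refl])
    also have "\<dots> = q Z (ccomp A Z W X h f)" using qc(1)[OF W h] by blast
    finally show ?thesis by (simp add: D_def)
  qed
  have D1: "comm_group (fobj D Z)" if Z: "Z \<in> cobj A" for Z
    using comm_group.abelian_FactGroup[OF hom_group[OF Z X] N[OF Z]] by (simp add: D_def)
  have D2: "\<exists>h\<in>carrier (chom A Z X). y = q Z h" if "y \<in> carrier (fobj D Z)" for Z y
    using qs that by blast
  have rm: "right_module A D"
    unfolding right_module_def
  proof (intro conjI ballI)
    fix Z assume Z: "Z \<in> cobj A"
    show "comm_group (fobj D Z)" by (rule D1[OF Z])
    show "fmap D Z Z (cid A Z) y = y" if "y \<in> carrier (fobj D Z)" for y
      using D2[OF that] fq[OF Z Z id_closed[OF Z]] id_right[OF Z X] by auto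
    fix W assume W: "W \<in> cobj A"
    fix f assume f: "f \<in> carrier (chom A Z W)"
    show "fmap D Z W f \<in> hom (fobj D W) (fobj D Z)"
    proof (rule homI)
      show "fmap D Z W f y \<in> carrier (fobj D Z)" if "y \<in> carrier (fobj D W)" for y
        using D2[OF that] fq[OF Z W f] comp_closed[OF Z W X _ f] qs[of Z] by auto
      fix y y' assume "y \<in> carrier (fobj D W)" "y' \<in> carrier (fobj D W)"
      then obtain h h' where h: "h \<in> carrier (chom A W X)" "h' \<in> carrier (chom A W X)" "y = q W h" "y' = q W h'"
        using D2[of y W] D2[of y' W] by blast
      interpret GW: group "chom A W X" by (rule hom_grp[OF W X])
      have "y \<otimes>\<^bsub>fobj D W\<^esub> y' = q W (h \<otimes>\<^bsub>chom A W X\<^esub> h')" using hom_mult[OF qh[OF W] h(1,2)] h by simp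
      then show "fmap D Z W f (y \<otimes>\<^bsub>fobj D W\<^esub> y') = fmap D Z W f y \<otimes>\<^bsub>fobj D Z\<^esub> fmap D Z W f y'"
        using fq[OF Z W f] h comp_mult_left[OF Z W X h(1,2) f]
          hom_mult[OF qh[OF Z] comp_closed[OF Z W X h(1) f] comp_closed[OF Z W X h(2) f]] by simp
    qed
    show "fmap D Z W (f \<otimes>\<^bsub>chom A Z W\<^esub> g) y = fmap D Z W f y \<otimes>\<^bsub>fobj D Z\<^esub> fmap D Z W g y"
      if g: "g \<in> carrier (chom A Z W)" and y: "y \<in> carrier (fobj D W)" for g y
    proof -
      interpret G: group "chom A Z W" by (rule hom_grp[OF Z W])
      obtain h where h: "h \<in> carrier (chom A W X)" "y = q W h" using D2[OF y] by blast
      show ?thesis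
        using fq[OF Z W _ h(1)] f g h(2) comp_mult_right[OF Z W X h(1) f g]
          hom_mult[OF qh[OF Z] comp_closed[OF Z W X h(1) f] comp_closed[OF Z W X h(1) g]] by simp
    qed
    fix V assume V: "V \<in> cobj A"
    fix g assume g: "g \<in> carrier (chom A W V)"
    fix y assume "y \<in> carrier (fobj D V)"
    then obtain h where h: "h \<in> carrier (chom A V X)" "y = q V h" using D2 by blast
    show "fmap D Z V (ccomp A Z W V g f) y = fmap D Z W f (fmap D W V g y)"
      using fq[OF Z V comp_closed[OF Z W V g f] h(1)] fq[OF W V g h(1)] fq[OF Z W f comp_closed[OF W V X h(1) g]]
        comp_assoc[OF Z W V X h(1) g f] h(2) by simp
  qed
  have qn: "nat_trans A (repr_functor A X) D q"
    unfolding nat_trans_def repr_functor_def using qh fq by simp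
  have one: "\<one>\<^bsub>fobj D Z\<^esub> = ?N Z" for Z by (simp add: D_def FactGroup_def)
  have "fin_presented A D"
    unfolding fin_presented_def
  proof (rule conjI[OF rm], rule bexI[OF _ S], rule bexI[OF _ X], rule exI[of _ "\<lambda>Z g. ccomp A Z S X c g"],
      rule exI[of _ q], intro conjI)
    show "nat_trans A (repr_functor A S) (repr_functor A X) (\<lambda>Z g. ccomp A Z S X c g)" by (rule repr_nat_trans[OF S X c])
    show "nat_trans A (repr_functor A X) D q" by (rule qn)
    show "\<forall>Z\<in>cobj A. q Z ` carrier (chom A Z X) = carrier (fobj D Z)" using qs by blast
    show "\<forall>Z\<in>cobj A. ?N Z = kernel (chom A Z X) (fobj D Z) (q Z)"
    proof
      fix Z assume Z: "Z \<in> cobj A"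
      have "h \<in> ?N Z \<longleftrightarrow> h \<in> carrier (chom A Z X) \<and> q Z h = ?N Z" for h
        using q1[OF Z, of h] subgroup.subset[OF N[OF Z]] by blast
      then show "?N Z = kernel (chom A Z X) (fobj D Z) (q Z)" unfolding kernel_def one by blast
    qed
  qed
  then show ?thesis using that[of D] qn one by (simp add: mod_cat_def q_def[abs_def])
qed

lemma mod_catE:
  assumes "F \<in> mod_cat A"
  obtains X1 X0 \<xi> \<eta> where "right_module A F" "X1 \<in> cobj A" "X0 \<in> cobj A"
    "nat_trans A (repr_functor A X1) (repr_functor A X0) \<xi>" "nat_trans A (repr_functor A X0) F \<eta>"
    "\<forall>Z\<in>cobj A. \<xi> Z ` carrier (chom A Z X1) = kernel (chom A Z X0) (fobj F Z) (\<eta> Z)"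
    "\<forall>Z\<in>cobj A. \<eta> Z ` carrier (chom A Z X0) = carrier (fobj F Z)"
  using assms unfolding mod_cat_def fin_presented_def mem_Collect_eq
  by (elim conjE bexE exE) (rule that; assumption)

text \<open>If \<open>r\<close> from \<open>X1\<close> to \<open>X0\<close> presents
  \<open>C\<close>, and \<open>p\<close> sends the generator of \<open>B\<close> to the class of
  \<open>l\<close> from \<open>X0'\<close> to \<open>X0\<close>, then the cokernel of
  \<open>p\<close> is that of \<open>r\<close> and \<open>l\<close> together, a finitely presented
  functor thanks to the direct sum. The projection onto it and the zero map agree after
  \<open>p\<close>, so the epimorphism property forces it to vanish.\<close>

lemma epi_in_mod_surj:
  assumes B: "B \<in> mod_cat A" and C: "C \<in> mod_cat A" and epi: "epi_in_mod A B C p" and Z: "Z \<in> cobj A"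
    and y: "y \<in> carrier (fobj C Z)"
  shows "y \<in> p Z ` carrier (fobj B Z)"
proof -
  obtain X1 X0 \<xi> \<eta> where C: "right_module A C" "X1 \<in> cobj A" "X0 \<in> cobj A"
    "nat_trans A (repr_functor A X1) (repr_functor A X0) \<xi>" "nat_trans A (repr_functor A X0) C \<eta>"
    "\<And>Z. Z \<in> cobj A \<Longrightarrow> \<xi> Z ` carrier (chom A Z X1) = kernel (chom A Z X0) (fobj C Z) (\<eta> Z)"
    "\<And>Z. Z \<in> cobj A \<Longrightarrow> \<eta> Z ` carrier (chom A Z X0) = carrier (fobj C Z)"
    by (rule mod_catE[OF C]) blast
  obtain X0' \<eta>' where B: "right_module A B" "X0' \<in> cobj A" "nat_trans A (repr_functor A X0') B \<eta>'"
    "\<And>Z. Z \<in> cobj A \<Longrightarrow> \<eta>' Z ` carrier (chom A Z X0') = carrier (fobj B Z)"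
    by (rule mod_catE[OF B]) blast
  have p: "nat_trans A B C p" using epi unfolding epi_in_mod_def by blast
  have \<eta>h: "\<eta> Z \<in> hom (chom A Z X0) (fobj C Z)" if "Z \<in> cobj A" for Z
    using C(5) that unfolding nat_trans_def repr_functor_def by simp
  have \<eta>n: "\<eta> Z (ccomp A Z W X0 h f) = fmap C Z W f (\<eta> W h)"
    if "Z \<in> cobj A" "W \<in> cobj A" "f \<in> carrier (chom A Z W)" "h \<in> carrier (chom A W X0)" for Z W f h
    using C(5) that unfolding nat_trans_def repr_functor_def by simp
  have \<eta>'n: "\<eta>' Z (ccomp A Z W X0' h f) = fmap B Z W f (\<eta>' W h)"
    if "Z \<in> cobj A" "W \<in> cobj A" "f \<in> carrier (chom A Z W)" "h \<in> carrier (chom A W X0')" for Z W f h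
    using B(3) that unfolding nat_trans_def repr_functor_def by simp
  have pn: "p Z (fmap B Z W f y) = fmap C Z W f (p W y)" "p W y \<in> carrier (fobj C W)"
    if "Z \<in> cobj A" "W \<in> cobj A" "f \<in> carrier (chom A Z W)" "y \<in> carrier (fobj B W)" for Z W f y
    using p that unfolding nat_trans_def by (auto dest: hom_in_carrier)
  define r where "r = \<xi> X1 (cid A X1)"
  have r: "r \<in> carrier (chom A X1 X0)"
    using C(4) C(2) id_closed[OF C(2)] unfolding r_def nat_trans_def repr_functor_def by (auto dest: hom_in_carrier)
  have \<xi>: "\<xi> Z g = ccomp A Z X1 X0 r g" if "Z \<in> cobj A" "g \<in> carrier (chom A Z X1)" for Z g
    unfolding r_def by (rule repr_nat_trans_eq[OF C(4,2) that])
  define b where "b = \<eta>' X0' (cid A X0')"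
  have b: "b \<in> carrier (fobj B X0')" using B(4)[OF B(2)] id_closed[OF B(2)] unfolding b_def by blast
  have "p X0' b \<in> carrier (fobj C X0')" by (rule pn(2)[OF B(2) B(2) id_closed[OF B(2)] b])
  then obtain l where l: "l \<in> carrier (chom A X0' X0)" "p X0' b = \<eta> X0' l" using C(7)[OF B(2)] by blast
  have pl: "p Z (\<eta>' Z g) = \<eta> Z (ccomp A Z X0' X0 l g)" if Z: "Z \<in> cobj A" and g: "g \<in> carrier (chom A Z X0')" for Z g
  proof -
    have "\<eta>' Z g = fmap B Z X0' g b"
      using \<eta>'n[OF Z B(2) g id_closed[OF B(2)]] id_left[OF Z B(2) g] unfolding b_def by simp
    then show ?thesis using pn(1)[OF Z B(2) g b] \<eta>n[OF Z B(2) g l(1)] l(2) by simp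
  qed
  obtain S i1 i2 p1 p2 where S: "S \<in> cobj A" and i: "i1 \<in> carrier (chom A X1 S)" "i2 \<in> carrier (chom A X0' S)"
    and pp: "p1 \<in> carrier (chom A S X1)" "p2 \<in> carrier (chom A S X0')"
    and pi: "ccomp A X1 S X1 p1 i1 = cid A X1" "ccomp A X0' S X0' p2 i2 = cid A X0'"
      "ccomp A X0' S X1 p1 i2 = \<one>\<^bsub>chom A X0' X1\<^esub>" "ccomp A X1 S X0' p2 i1 = \<one>\<^bsub>chom A X1 X0'\<^esub>"
    using biproduct[OF C(2) B(2)] by blast
  let ?rp = "ccomp A S X1 X0 r p1" and ?lp = "ccomp A S X0' X0 l p2"
  have rp: "?rp \<in> carrier (chom A S X0)" and lp: "?lp \<in> carrier (chom A S X0)"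
    using comp_closed[OF S C(2,3) r pp(1)] comp_closed[OF S B(2) C(3) l(1) pp(2)] by auto
  \<comment> \<open>\<open>c = r p1 + l p2\<close> combines the relations of \<open>C\<close> with
    the image of \<open>p\<close>; composing with \<open>i1\<close> and \<open>i2\<close> recovers
    \<open>r\<close> and \<open>l\<close>.\<close>
  define c where "c = ?rp \<otimes>\<^bsub>chom A S X0\<^esub> ?lp"
  interpret HS: comm_group "chom A S X0" by (rule hom_group[OF S C(3)])
  have c: "c \<in> carrier (chom A S X0)" unfolding c_def using rp lp by simp
  let ?N = "\<lambda>Z. (\<lambda>w. ccomp A Z S X0 c w) ` carrier (chom A Z S)"
  have cw: "ccomp A Z S X0 c w = ccomp A Z X1 X0 r (ccomp A Z S X1 p1 w) \<otimes>\<^bsub>chom A Z X0\<^esub> ccomp A Z X0' X0 l (ccomp A Z S X0' p2 w)"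
    if Z: "Z \<in> cobj A" and w: "w \<in> carrier (chom A Z S)" for Z w
    unfolding c_def comp_mult_left[OF Z S C(3) rp lp w]
    using comp_assoc[OF Z S C(2,3) r pp(1) w] comp_assoc[OF Z S B(2) C(3) l(1) pp(2) w] by simp
  have ri: "ccomp A X1 S X0 c i1 = r"
  proof -
    interpret G: group "chom A X1 X0" by (rule hom_grp[OF C(2,3)])
    show ?thesis using cw[OF C(2) i(1)] pi(1,4) id_right[OF C(2,3) r] comp_one_right[OF C(2) B(2) C(3) l(1)] r by simp
  qed
  have li: "ccomp A X0' S X0 c i2 = l"
  proof -
    interpret G: group "chom A X0' X0" by (rule hom_grp[OF B(2) C(3)])
    show ?thesis using cw[OF B(2) i(2)] pi(2,3) id_right[OF B(2) C(3) l(1)] comp_one_right[OF B(2) C(2,3) r] l(1) by simp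
  qed
  have rN: "ccomp A Z X1 X0 r g \<in> ?N Z" if Z: "Z \<in> cobj A" and g: "g \<in> carrier (chom A Z X1)" for Z g
  proof (rule image_eqI)
    show "ccomp A Z X1 X0 r g = ccomp A Z S X0 c (ccomp A Z X1 S i1 g)"
      using comp_assoc[OF Z C(2) S C(3) c i(1) g] ri by simp
  qed (rule comp_closed[OF Z C(2) S i(1) g])
  have lN: "ccomp A Z X0' X0 l g \<in> ?N Z" if Z: "Z \<in> cobj A" and g: "g \<in> carrier (chom A Z X0')" for Z g
  proof (rule image_eqI)
    show "ccomp A Z X0' X0 l g = ccomp A Z S X0 c (ccomp A Z X0' S i2 g)"
      using comp_assoc[OF Z B(2) S C(3) c i(2) g] li by simp
  qed (rule comp_closed[OF Z B(2) S i(2) g])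
  obtain D :: "('o,'h,'h set) contra_functor" where D: "D \<in> mod_cat A"
    "nat_trans A (repr_functor A X0) D (\<lambda>Z h. ?N Z #>\<^bsub>chom A Z X0\<^esub> h)"
    "\<And>Z. Z \<in> cobj A \<Longrightarrow> \<one>\<^bsub>fobj D Z\<^esub> = ?N Z"
    by (rule cokernel_functor[OF S C(3) c]) (rule that; assumption)
  have Dm: "right_module A D" by (rule mod_catE[OF D(1)])
  define q where "q Z h = ?N Z #>\<^bsub>chom A Z X0\<^esub> h" for Z h
  have qh: "q Z \<in> hom (chom A Z X0) (fobj D Z)" if "Z \<in> cobj A" for Z
    using D(2) that unfolding nat_trans_def repr_functor_def q_def[abs_def] by simp
  have qn: "q Z (ccomp A Z W X0 h f) = fmap D Z W f (q W h)"
    if "Z \<in> cobj A" "W \<in> cobj A" "f \<in> carrier (chom A Z W)" "h \<in> carrier (chom A W X0)" for Z W f h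
    using D(2) that unfolding nat_trans_def repr_functor_def q_def[abs_def] by simp
  have N: "subgroup (?N Z) (chom A Z X0)" if Z: "Z \<in> cobj A" for Z
  proof -
    interpret H: group_hom "chom A Z S" "chom A Z X0" "\<lambda>w. ccomp A Z S X0 c w"
      by (intro group_hom.intro group_hom_axioms.intro hom_grp comp_hom_right Z S C(3) c)
    show ?thesis by (rule H.img_is_subgroup)
  qed
  have q1: "q Z h = \<one>\<^bsub>fobj D Z\<^esub> \<longleftrightarrow> h \<in> ?N Z" if Z: "Z \<in> cobj A" and h: "h \<in> carrier (chom A Z X0)" for Z h
  proof -
    interpret G: group "chom A Z X0" by (rule hom_grp[OF Z C(3)])
    show ?thesis unfolding q_def D(3)[OF Z] using G.coset_join1[OF _ h N[OF Z]] G.coset_join2[OF h N[OF Z]] by blast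
  qed
  have qq: "q Z h = q Z h'" if Z: "Z \<in> cobj A" and h: "h \<in> carrier (chom A Z X0)" "h' \<in> carrier (chom A Z X0)" and e: "\<eta> Z h = \<eta> Z h'" for Z h h'
  proof -
    interpret G: group_hom "chom A Z X0" "fobj C Z" "\<eta> Z"
      by (intro group_hom.intro group_hom_axioms.intro hom_grp \<eta>h Z C(3) comm_group.axioms(2)[OF right_moduleD(1)[OF C(1) Z Z]])
    interpret Q: group_hom "chom A Z X0" "fobj D Z" "q Z"
      by (intro group_hom.intro group_hom_axioms.intro hom_grp qh Z C(3) comm_group.axioms(2)[OF right_moduleD(1)[OF Dm Z Z]])
    let ?k = "h \<otimes>\<^bsub>chom A Z X0\<^esub> inv\<^bsub>chom A Z X0\<^esub> h'"
    have k: "?k \<in> carrier (chom A Z X0)" using h by simp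
    have "\<eta> Z ?k = \<one>\<^bsub>fobj C Z\<^esub>" using h e by simp
    then have "?k \<in> \<xi> Z ` carrier (chom A Z X1)" using C(6)[OF Z] k unfolding kernel_def by simp
    then have "?k \<in> ?N Z" using \<xi>[OF Z] rN[OF Z] by auto
    then have "q Z ?k = \<one>\<^bsub>fobj D Z\<^esub>" using q1[OF Z k] by simp
    then have "q Z h \<otimes>\<^bsub>fobj D Z\<^esub> inv\<^bsub>fobj D Z\<^esub> q Z h' = \<one>\<^bsub>fobj D Z\<^esub>" using h by simp
    then show ?thesis using h Q.H.inv_equality[of "q Z h" "inv\<^bsub>fobj D Z\<^esub> q Z h'"] by simp
  qed
  have ex: "\<exists>h\<in>carrier (chom A Z X0). y = \<eta> Z h" if "Z \<in> cobj A" "y \<in> carrier (fobj C Z)" for Z y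
    using that(2) unfolding C(7)[OF that(1), symmetric] by (rule imageE) (rule bexI)
  define s where "s Z y = (SOME h. h \<in> carrier (chom A Z X0) \<and> \<eta> Z h = y)" for Z y
  have s: "s Z y \<in> carrier (chom A Z X0)" "\<eta> Z (s Z y) = y" if "Z \<in> cobj A" "y \<in> carrier (fobj C Z)" for Z y
  proof -
    have "\<exists>h. h \<in> carrier (chom A Z X0) \<and> \<eta> Z h = y" using ex[OF that] by auto
    from someI_ex[OF this] have "s Z y \<in> carrier (chom A Z X0) \<and> \<eta> Z (s Z y) = y" unfolding s_def .
    then show "s Z y \<in> carrier (chom A Z X0)" "\<eta> Z (s Z y) = y" by simp_all
  qed
  \<comment> \<open>The projection of \<open>C\<close> onto the cokernel, through a lift to
    \<open>X0\<close>. Two lifts differ by something in the image of \<open>r\<close>, which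
    \<open>q\<close> kills.\<close>
  define u where "u Z y = q Z (s Z y)" for Z y
  have u\<eta>: "u Z (\<eta> Z h) = q Z h" if Z: "Z \<in> cobj A" and h: "h \<in> carrier (chom A Z X0)" for Z h
    using qq[OF Z s(1)[OF Z] h s(2)[OF Z]] hom_in_carrier[OF \<eta>h[OF Z] h] unfolding u_def by blast
  have u: "nat_trans A C D u"
    unfolding nat_trans_def
  proof (intro conjI ballI)
    fix Z assume Z: "Z \<in> cobj A"
    interpret G: group "chom A Z X0" by (rule hom_grp[OF Z C(3)])
    show "u Z \<in> hom (fobj C Z) (fobj D Z)"
    proof (rule homI)
      show "u Z y \<in> carrier (fobj D Z)" if "y \<in> carrier (fobj C Z)" for y
        using hom_in_carrier[OF qh[OF Z] s(1)[OF Z that]] unfolding u_def .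
      fix y y' assume "y \<in> carrier (fobj C Z)" "y' \<in> carrier (fobj C Z)"
      then obtain h h' where h: "h \<in> carrier (chom A Z X0)" "h' \<in> carrier (chom A Z X0)" "y = \<eta> Z h" "y' = \<eta> Z h'"
        using ex[OF Z, of y] ex[OF Z, of y'] by blast
      have "y \<otimes>\<^bsub>fobj C Z\<^esub> y' = \<eta> Z (h \<otimes>\<^bsub>chom A Z X0\<^esub> h')" using hom_mult[OF \<eta>h[OF Z] h(1,2)] h by simp
      then show "u Z (y \<otimes>\<^bsub>fobj C Z\<^esub> y') = u Z y \<otimes>\<^bsub>fobj D Z\<^esub> u Z y'"
        using u\<eta>[OF Z] h hom_mult[OF qh[OF Z] h(1,2)] by simp
    qed
    fix W f y assume W: "W \<in> cobj A" and f: "f \<in> carrier (chom A Z W)" and y: "y \<in> carrier (fobj C W)"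
    obtain h where h: "h \<in> carrier (chom A W X0)" "y = \<eta> W h" using ex[OF W y] by blast
    show "u Z (fmap C Z W f y) = fmap D Z W f (u W y)"
      using \<eta>n[OF Z W f h(1)] u\<eta>[OF Z comp_closed[OF Z W C(3) h(1) f]] qn[OF Z W f h(1)] u\<eta>[OF W h(1)] h(2) by simp
  qed
  have v: "nat_trans A C D (\<lambda>Z y. \<one>\<^bsub>fobj D Z\<^esub>)"
    unfolding nat_trans_def
  proof (intro conjI ballI)
    fix Z assume Z: "Z \<in> cobj A"
    interpret G: comm_group "fobj D Z" by (rule right_moduleD(1)[OF Dm Z Z])
    show "(\<lambda>y. \<one>\<^bsub>fobj D Z\<^esub>) \<in> hom (fobj C Z) (fobj D Z)" by (rule homI) auto
    fix W f y assume W: "W \<in> cobj A" and f: "f \<in> carrier (chom A Z W)"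
    interpret GW: comm_group "fobj D W" by (rule right_moduleD(1)[OF Dm W W])
    show "\<one>\<^bsub>fobj D Z\<^esub> = fmap D Z W f \<one>\<^bsub>fobj D W\<^esub>"
      using hom_one[OF right_moduleD(2)[OF Dm Z W f] GW.group_axioms G.group_axioms] by simp
  qed
  have "nat_eq A B (nat_comp u p) (nat_comp (\<lambda>Z y. \<one>\<^bsub>fobj D Z\<^esub>) p)"
    unfolding nat_eq_def nat_comp_def
  proof (intro ballI)
    fix Z y assume Z: "Z \<in> cobj A" and y: "y \<in> carrier (fobj B Z)"
    obtain g where g: "g \<in> carrier (chom A Z X0')" "y = \<eta>' Z g" using B(4)[OF Z] y by blast
    note lg = comp_closed[OF Z B(2) C(3) l(1) g(1)]
    show "(u Z \<circ> p Z) y = ((\<lambda>y. \<one>\<^bsub>fobj D Z\<^esub>) \<circ> p Z) y"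
      using pl[OF Z g(1)] g(2) u\<eta>[OF Z lg] q1[OF Z lg] lN[OF Z g(1)] by simp
  qed
  then have "nat_eq A C u (\<lambda>Z y. \<one>\<^bsub>fobj D Z\<^esub>)" using epi D(1) u v unfolding epi_in_mod_def by blast
  then have uy: "u Z y = \<one>\<^bsub>fobj D Z\<^esub>" using Z y unfolding nat_eq_def by blast
  obtain h where h: "h \<in> carrier (chom A Z X0)" "y = \<eta> Z h" using ex[OF Z y] by blast
  then have "h \<in> ?N Z" using uy u\<eta>[OF Z h(1)] q1[OF Z h(1)] by simp
  then obtain w where w: "w \<in> carrier (chom A Z S)" "h = ccomp A Z S X0 c w" by blast
  \<comment> \<open>Vanishing of the class of \<open>h\<close> splits \<open>h\<close> as
    \<open>r g1 + l g2\<close>. The first summand is zero in \<open>C\<close>, and the second is the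
    value of \<open>p\<close> at the element of \<open>B\<close> given by \<open>g2\<close>.\<close>
  let ?g1 = "ccomp A Z S X1 p1 w" and ?g2 = "ccomp A Z S X0' p2 w"
  have g1: "?g1 \<in> carrier (chom A Z X1)" and g2: "?g2 \<in> carrier (chom A Z X0')"
    using comp_closed[OF Z S C(2) pp(1) w(1)] comp_closed[OF Z S B(2) pp(2) w(1)] by auto
  note rg = comp_closed[OF Z C(2,3) r g1] and lg = comp_closed[OF Z B(2) C(3) l(1) g2]
  interpret CZ: comm_group "fobj C Z" by (rule right_moduleD(1)[OF C(1) Z Z])
  have "ccomp A Z X1 X0 r ?g1 \<in> kernel (chom A Z X0) (fobj C Z) (\<eta> Z)" 
    using imageI[OF g1, of "\<xi> Z"] C(6)[OF Z] \<xi>[OF Z g1] by simp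
  then have "\<eta> Z (ccomp A Z X1 X0 r ?g1) = \<one>\<^bsub>fobj C Z\<^esub>" unfolding kernel_def by simp
  moreover have "y = \<eta> Z (ccomp A Z X1 X0 r ?g1) \<otimes>\<^bsub>fobj C Z\<^esub> \<eta> Z (ccomp A Z X0' X0 l ?g2)"
    using h(2) w(2) cw[OF Z w(1)] hom_mult[OF \<eta>h[OF Z] rg lg] by simp
  moreover have "\<eta> Z (ccomp A Z X0' X0 l ?g2) = p Z (\<eta>' Z ?g2)" using pl[OF Z g2] by simp
  moreover have "\<eta>' Z ?g2 \<in> carrier (fobj B Z)" using B(4)[OF Z] g2 by blast
  moreover have "p Z (\<eta>' Z ?g2) \<in> carrier (fobj C Z)"
    using pn(2)[OF Z Z id_closed[OF Z]] \<open>\<eta>' Z ?g2 \<in> carrier (fobj B Z)\<close> by blast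
  ultimately have "y = p Z (\<eta>' Z ?g2)" by simp
  then show ?thesis using \<open>\<eta>' Z ?g2 \<in> carrier (fobj B Z)\<close> by blast
qed

text \<open>A transformation out of \<open>F\<close> is determined by its value at \<open>x\<close>,
  which must be killed by whatever kills \<open>x\<close>. Restricting an arbitrary preimage along
  \<open>e\<close> achieves this, and it still has the prescribed image because \<open>e\<close>
  fixes \<open>x\<close>.\<close>

lemma split_generated_projective:
  assumes F: "split_generated A F" shows "projective_in_mod A F"
  unfolding projective_in_mod_def
proof (intro conjI ballI allI impI)
  show "fin_presented A F" by (rule split_generated_fin_presented[OF F])
  fix B C p g assume B: "B \<in> mod_cat A" and C: "C \<in> mod_cat A" and pg: "epi_in_mod A B C p \<and> nat_trans A F C g"
  obtain X x e where F: "right_module A F" and X: "X \<in> cobj A" and x: "x \<in> carrier (fobj F X)"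
    and gen: "\<And>Z z. Z \<in> cobj A \<Longrightarrow> z \<in> carrier (fobj F Z) \<Longrightarrow> \<exists>g\<in>carrier (chom A Z X). z = fmap F Z X g x"
    and e: "e \<in> carrier (chom A X X)" "fmap F X X e x = x"
    and ker: "\<And>Z g. Z \<in> cobj A \<Longrightarrow> g \<in> carrier (chom A Z X) \<Longrightarrow> fmap F Z X g x = \<one>\<^bsub>fobj F Z\<^esub> \<Longrightarrow> ccomp A Z X X e g = \<one>\<^bsub>chom A Z X\<^esub>"
    using F unfolding split_generated_def generated_by_def by blast
  have Bm: "right_module A B" and Cm: "right_module A C" by (rule mod_catE[OF B], assumption) (rule mod_catE[OF C], assumption)
  have gn: "g Z (fmap F Z W f y) = fmap C Z W f (g W y)" "g W y \<in> carrier (fobj C W)"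
    if "Z \<in> cobj A" "W \<in> cobj A" "f \<in> carrier (chom A Z W)" "y \<in> carrier (fobj F W)" for Z W f y
    using pg that unfolding nat_trans_def by (auto dest: hom_in_carrier)
  have pn: "p Z (fmap B Z W f y) = fmap C Z W f (p W y)"
    if "Z \<in> cobj A" "W \<in> cobj A" "f \<in> carrier (chom A Z W)" "y \<in> carrier (fobj B W)" for Z W f y
    using pg that unfolding epi_in_mod_def nat_trans_def by blast
  have "g X x \<in> carrier (fobj C X)" by (rule gn(2)[OF X X e(1) x])
  then obtain b where b: "b \<in> carrier (fobj B X)" "g X x = p X b" using epi_in_mod_surj[OF B C _ X] pg by blast
  define b' where "b' = fmap B X X e b"
  have b': "b' \<in> carrier (fobj B X)" unfolding b'_def by (rule right_moduleD(5)[OF Bm X X e(1) b(1)])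
  have pb': "p X b' = g X x" unfolding b'_def using pn[OF X X e(1) b(1)] gn(1)[OF X X e(1) x] e(2) b(2) by simp
  \<comment> \<open>If \<open>k\<close> and \<open>k'\<close> agree on \<open>x\<close>, their
    difference \<open>d\<close> kills \<open>x\<close>, so \<open>e d = 0\<close>; since
    \<open>b'\<close> is \<open>b\<close> restricted along \<open>e\<close>, it is killed by
    \<open>d\<close>.\<close>
  have wd: "fmap B Z X k b' = fmap B Z X k' b'"
    if Z: "Z \<in> cobj A" and k: "k \<in> carrier (chom A Z X)" "k' \<in> carrier (chom A Z X)" and eq: "fmap F Z X k x = fmap F Z X k' x" for Z k k'
  proof -
    interpret G: comm_group "chom A Z X" by (rule hom_group[OF Z X])
    interpret FZ: comm_group "fobj F Z" by (rule right_moduleD(1)[OF F Z Z])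
    interpret BZ: comm_group "fobj B Z" by (rule right_moduleD(1)[OF Bm Z Z])
    let ?d = "k \<otimes>\<^bsub>chom A Z X\<^esub> inv\<^bsub>chom A Z X\<^esub> k'"
    have d: "?d \<in> carrier (chom A Z X)" "k = ?d \<otimes>\<^bsub>chom A Z X\<^esub> k'" using k by (auto simp: G.m_assoc)
    have "fmap F Z X k x = fmap F Z X ?d x \<otimes>\<^bsub>fobj F Z\<^esub> fmap F Z X k' x"
      using right_moduleD(4)[OF F Z X d(1) k(2) x] d(2) by simp
    then have "fmap F Z X ?d x = \<one>\<^bsub>fobj F Z\<^esub>"
      using eq right_moduleD(5)[OF F Z X d(1) x] right_moduleD(5)[OF F Z X k(2) x] by (metis FZ.r_cancel_one)
    then have "ccomp A Z X X e ?d = \<one>\<^bsub>chom A Z X\<^esub>" by (rule ker[OF Z d(1)])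
    then have "fmap B Z X ?d b' = fmap B Z X \<one>\<^bsub>chom A Z X\<^esub> b"
      unfolding b'_def using right_module_comp[OF Bm Z X X d(1) e(1) b(1)] by simp
    also have "\<dots> = \<one>\<^bsub>fobj B Z\<^esub>"
    proof -
      have "fmap B Z X \<one>\<^bsub>chom A Z X\<^esub> b = fmap B Z X \<one>\<^bsub>chom A Z X\<^esub> b \<otimes>\<^bsub>fobj B Z\<^esub> fmap B Z X \<one>\<^bsub>chom A Z X\<^esub> b"
        using right_moduleD(4)[OF Bm Z X G.one_closed G.one_closed b(1)] by simp
      then show ?thesis using right_moduleD(5)[OF Bm Z X G.one_closed b(1)] by (metis BZ.r_cancel_one)
    qed
    finally have "fmap B Z X ?d b' = \<one>\<^bsub>fobj B Z\<^esub>" .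
    then show ?thesis
      using right_moduleD(4)[OF Bm Z X d(1) k(2) b'] d(2) right_moduleD(5)[OF Bm Z X k(2) b'] by simp
  qed
  define s where "s Z z = (SOME k. k \<in> carrier (chom A Z X) \<and> z = fmap F Z X k x)" for Z z
  have s: "s Z z \<in> carrier (chom A Z X)" "fmap F Z X (s Z z) x = z" if "Z \<in> cobj A" "z \<in> carrier (fobj F Z)" for Z z
  proof -
    have "\<exists>k. k \<in> carrier (chom A Z X) \<and> z = fmap F Z X k x" using gen[OF that] by blast
    from someI_ex[OF this] have "s Z z \<in> carrier (chom A Z X) \<and> z = fmap F Z X (s Z z) x" unfolding s_def .
    then show "s Z z \<in> carrier (chom A Z X)" "fmap F Z X (s Z z) x = z" by simp_all
  qed
  define h where "h Z z = fmap B Z X (s Z z) b'" for Z z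
  have hk: "h Z (fmap F Z X k x) = fmap B Z X k b'" if Z: "Z \<in> cobj A" and k: "k \<in> carrier (chom A Z X)" for Z k
    unfolding h_def using wd[OF Z s(1)[OF Z] k s(2)[OF Z]] right_moduleD(5)[OF F Z X k x] by blast
  have "nat_trans A F B h"
    unfolding nat_trans_def
  proof (intro conjI ballI)
    fix Z assume Z: "Z \<in> cobj A"
    interpret G: comm_group "chom A Z X" by (rule hom_group[OF Z X])
    show "h Z \<in> hom (fobj F Z) (fobj B Z)"
    proof (rule homI)
      show "h Z z \<in> carrier (fobj B Z)" if "z \<in> carrier (fobj F Z)" for z
        unfolding h_def by (rule right_moduleD(5)[OF Bm Z X s(1)[OF Z that] b'])
      fix z z' assume "z \<in> carrier (fobj F Z)" "z' \<in> carrier (fobj F Z)"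
      then obtain k k' where k: "k \<in> carrier (chom A Z X)" "k' \<in> carrier (chom A Z X)" "z = fmap F Z X k x" "z' = fmap F Z X k' x"
        using gen[OF Z, of z] gen[OF Z, of z'] by blast
      have "z \<otimes>\<^bsub>fobj F Z\<^esub> z' = fmap F Z X (k \<otimes>\<^bsub>chom A Z X\<^esub> k') x" using right_moduleD(4)[OF F Z X k(1,2) x] k by simp
      then show "h Z (z \<otimes>\<^bsub>fobj F Z\<^esub> z') = h Z z \<otimes>\<^bsub>fobj B Z\<^esub> h Z z'"
        using hk[OF Z] k right_moduleD(4)[OF Bm Z X k(1,2) b'] by simp
    qed
    fix W f y assume W: "W \<in> cobj A" and f: "f \<in> carrier (chom A Z W)" and y: "y \<in> carrier (fobj F W)"
    obtain k where k: "k \<in> carrier (chom A W X)" "y = fmap F W X k x" using gen[OF W y] by blast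
    show "h Z (fmap F Z W f y) = fmap B Z W f (h W y)"
      using right_module_comp[OF F Z W X f k(1) x] right_module_comp[OF Bm Z W X f k(1) b'] hk[OF Z comp_closed[OF Z W X k(1) f]]
        hk[OF W k(1)] k(2) by simp
  qed
  moreover have "nat_eq A F (nat_comp p h) g"
    unfolding nat_eq_def nat_comp_def
  proof (intro ballI)
    fix Z z assume Z: "Z \<in> cobj A" and z: "z \<in> carrier (fobj F Z)"
    obtain k where k: "k \<in> carrier (chom A Z X)" "z = fmap F Z X k x" using gen[OF Z z] by blast
    show "(p Z \<circ> h Z) z = g Z z"
      using hk[OF Z k(1)] k(2) pn[OF Z X k(1) b'] pb' gn(1)[OF Z X k(1) x] by simp
  qed
  ultimately show "\<exists>h. nat_trans A F B h \<and> nat_eq A F (nat_comp p h) g" by blast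
qed

end

subsection \<open>The stable category\<close>

context cring
begin

lemma factor_freeI:
  assumes X: "module R X" and a: "a \<in> mod_hom R X (free_mod R n)" and b: "b \<in> mod_hom R (free_mod R n) Y"
    and f: "f \<in> mod_hom R X Y" and eq: "\<And>x. x \<in> carrier X \<Longrightarrow> f x = b (a x)"
  shows "f \<in> factor_free R X Y"
proof -
  have "f = compose (carrier X) b a"
    by (rule mod_hom_eqI[OF f mod_hom_compose[OF X a b]]) (simp add: eq compose_def)
  then show ?thesis unfolding factor_free_def using a b by blast
qed

lemma factor_freeE:
  assumes X: "module R X" and f: "f \<in> factor_free R X Y"
  obtains n a b where "a \<in> mod_hom R X (free_mod R n)" "b \<in> mod_hom R (free_mod R n) Y" "f \<in> mod_hom R X Y"
    "\<And>x. x \<in> carrier X \<Longrightarrow> f x = b (a x)"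
proof -
  obtain n a b where *: "a \<in> mod_hom R X (free_mod R n)" "b \<in> mod_hom R (free_mod R n) Y" "f = compose (carrier X) b a"
    using f unfolding factor_free_def by blast
  show ?thesis
  proof (rule that[OF *(1,2)])
    show "f \<in> mod_hom R X Y" unfolding *(3) by (rule mod_hom_compose[OF X *(1,2)])
    show "\<And>x. x \<in> carrier X \<Longrightarrow> f x = b (a x)" unfolding *(3) by (simp add: compose_def)
  qed
qed

lemma factor_free_hom: "module R X \<Longrightarrow> f \<in> factor_free R X Y \<Longrightarrow> f \<in> mod_hom R X Y"
  by (erule (1) factor_freeE)

lemma factor_free_compose:
  assumes X: "module R X" and Y: "module R Y" and f: "f \<in> mod_hom R X Y" and g: "g \<in> mod_hom R Y Z"
    and ff: "f \<in> factor_free R X Y \<or> g \<in> factor_free R Y Z"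
  shows "compose (carrier X) g f \<in> factor_free R X Z"
  using ff
proof
  assume "f \<in> factor_free R X Y"
  then obtain n a b where ab: "a \<in> mod_hom R X (free_mod R n)" "b \<in> mod_hom R (free_mod R n) Y"
    "\<And>x. x \<in> carrier X \<Longrightarrow> f x = b (a x)" using factor_freeE[OF X] by metis
  show ?thesis
    by (rule factor_freeI[OF X ab(1) mod_hom_compose[OF free_module ab(2) g] mod_hom_compose[OF X f g]])
      (use ab(3) mod_hom_closed[OF ab(1)] in \<open>simp add: compose_def\<close>)
next
  assume "g \<in> factor_free R Y Z"
  then obtain n a b where ab: "a \<in> mod_hom R Y (free_mod R n)" "b \<in> mod_hom R (free_mod R n) Z"
    "\<And>x. x \<in> carrier Y \<Longrightarrow> g x = b (a x)" using factor_freeE[OF Y] by metis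
  show ?thesis
    by (rule factor_freeI[OF X mod_hom_compose[OF X f ab(1)] ab(2) mod_hom_compose[OF X f g]])
      (use ab(3) mod_hom_closed[OF f] in \<open>simp add: compose_def\<close>)
qed

text \<open>Two factorisations are added by passing through the direct sum of their free modules;
  this is where \<open>free_split\<close> is needed.\<close>

lemma factor_free_submodule:
  assumes X: "module R X" and Y: "module R Y"
  shows "submodule (factor_free R X Y) R (Hom_mod R X Y)"
proof -
  interpret H: module R "Hom_mod R X Y" by (rule Hom_mod_module[OF X Y])
  interpret Y: module R Y by (rule Y)
  show ?thesis
  proof (rule H.submoduleI)
    show "factor_free R X Y \<subseteq> carrier (Hom_mod R X Y)" using factor_free_hom[OF X] by auto
    show "\<zero>\<^bsub>Hom_mod R X Y\<^esub> \<in> factor_free R X Y"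
      by (rule factor_freeI[OF X mod_hom_zero_map[OF X free_module, of 0] mod_hom_zero_map[OF free_module Y]])
        (auto simp: mod_hom_zero_map[OF X Y] free_mod_def)
    fix f assume f: "f \<in> factor_free R X Y"
    then obtain n a b where ab: "a \<in> mod_hom R X (free_mod R n)" "b \<in> mod_hom R (free_mod R n) Y" "f \<in> mod_hom R X Y"
      "\<And>x. x \<in> carrier X \<Longrightarrow> f x = b (a x)" using factor_freeE[OF X] by metis
    note ac = mod_hom_closed[OF ab(1)]
    show "\<ominus>\<^bsub>Hom_mod R X Y\<^esub> f \<in> factor_free R X Y"
      unfolding Hom_mod_neg[OF X Y ab(3)]
      by (rule factor_freeI[OF X ab(1) mod_hom_neg_map[OF free_module Y ab(2)] mod_hom_neg_map[OF X Y ab(3)]])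
        (use ab(4) ac in simp)
    show "r \<odot>\<^bsub>Hom_mod R X Y\<^esub> f \<in> factor_free R X Y" if r: "r \<in> carrier R" for r
      unfolding Hom_mod_simps
      by (rule factor_freeI[OF X ab(1) mod_hom_smult_map[OF free_module Y ab(2) r] mod_hom_smult_map[OF X Y ab(3) r]])
        (use ab(4) ac in simp)
    fix g assume "g \<in> factor_free R X Y"
    then obtain m c d where cd: "c \<in> mod_hom R X (free_mod R m)" "d \<in> mod_hom R (free_mod R m) Y" "g \<in> mod_hom R X Y"
      "\<And>x. x \<in> carrier X \<Longrightarrow> g x = d (c x)" using factor_freeE[OF X] by metis
    note cc = mod_hom_closed[OF cd(1)]
    obtain i1 i2 p1 p2 where s:
      "i1 \<in> mod_hom R (free_mod R n) (free_mod R (n + m))" "i2 \<in> mod_hom R (free_mod R m) (free_mod R (n + m))"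
      "p1 \<in> mod_hom R (free_mod R (n + m)) (free_mod R n)" "p2 \<in> mod_hom R (free_mod R (n + m)) (free_mod R m)"
      "\<And>v. v \<in> carrier (free_mod R n) \<Longrightarrow> p1 (i1 v) = v"
      "\<And>v. v \<in> carrier (free_mod R n) \<Longrightarrow> p2 (i1 v) = \<zero>\<^bsub>free_mod R m\<^esub>"
      "\<And>v. v \<in> carrier (free_mod R m) \<Longrightarrow> p1 (i2 v) = \<zero>\<^bsub>free_mod R n\<^esub>"
      "\<And>v. v \<in> carrier (free_mod R m) \<Longrightarrow> p2 (i2 v) = v"
      by (rule free_split[of n m]) blast
    interpret Fn: module R "free_mod R n" by (rule free_module)
    interpret Fm: module R "free_mod R m" by (rule free_module)
    let ?u = "\<lambda>x\<in>carrier X. compose (carrier X) i1 a x \<oplus>\<^bsub>free_mod R (n + m)\<^esub> compose (carrier X) i2 c x"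
    have u: "?u \<in> mod_hom R X (free_mod R (n + m))"
      by (rule mod_hom_add_map[OF X free_module mod_hom_compose[OF X ab(1) s(1)] mod_hom_compose[OF X cd(1) s(2)]])
    note v = free_copair[OF Y ab(2) cd(2) s(3,4) free_module]
    show "f \<oplus>\<^bsub>Hom_mod R X Y\<^esub> g \<in> factor_free R X Y"
      unfolding Hom_mod_simps
    proof (rule factor_freeI[OF X u v mod_hom_add_map[OF X Y ab(3) cd(3)]])
      fix x assume x: "x \<in> carrier X"
      have c: "i1 (a x) \<in> carrier (free_mod R (n + m))" "i2 (c x) \<in> carrier (free_mod R (n + m))"
        using mod_hom_closed[OF s(1) ac[OF x]] mod_hom_closed[OF s(2) cc[OF x]] by auto
      have "p1 (?u x) = a x" "p2 (?u x) = c x"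
        using x c ac[OF x] cc[OF x] s(5-8) by (simp_all add: compose_def mod_hom_add[OF s(3)] mod_hom_add[OF s(4)])
      then show "(\<lambda>x\<in>carrier X. f x \<oplus>\<^bsub>Y\<^esub> g x) x = (\<lambda>v\<in>carrier (free_mod R (n + m)). b (p1 v) \<oplus>\<^bsub>Y\<^esub> d (p2 v)) (?u x)"
        using x mod_hom_closed[OF u x] ab(4)[OF x] cd(4)[OF x] by simp
    qed
  qed
qed

lemma factor_free_abelian_subgroup:
  assumes X: "module R X" and Y: "module R Y"
  shows "abelian_subgroup (factor_free R X Y) (Hom_mod R X Y)"
  by (rule abelian_subgroupI3)
    (use factor_free_submodule[OF X Y] Hom_mod_module[OF X Y] in \<open>auto simp: submodule_def module_def intro: additive_subgroup.intro\<close>)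

lemma stable_comm_group: "module R X \<Longrightarrow> module R Y \<Longrightarrow> comm_group (stable_hom R X Y)"
  unfolding stable_hom_def by (rule abelian_subgroup.a_factorgroup_is_comm_group[OF factor_free_abelian_subgroup])

lemma stable_carrier: "carrier (stable_hom R X Y) = stable_class R X Y ` mod_hom R X Y"
  unfolding stable_hom_def stable_class_def A_FactGroup_def' A_RCOSETS_def' by auto

lemma stable_class_closed: "f \<in> mod_hom R X Y \<Longrightarrow> stable_class R X Y f \<in> carrier (stable_hom R X Y)"
  unfolding stable_carrier by (rule imageI)

lemma stable_carrierE:
  assumes "\<phi> \<in> carrier (stable_hom R X Y)"
  obtains f where "f \<in> mod_hom R X Y" "\<phi> = stable_class R X Y f"
  using assms unfolding stable_carrier by blast

lemma stable_class_mem: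
  assumes X: "module R X" and Y: "module R Y" and f: "f \<in> mod_hom R X Y"
  shows "g \<in> stable_class R X Y f \<longleftrightarrow> g \<in> mod_hom R X Y \<and> (\<lambda>x\<in>carrier X. g x \<ominus>\<^bsub>Y\<^esub> f x) \<in> factor_free R X Y"
    and "f \<in> stable_class R X Y f"
    and "g \<in> mod_hom R X Y \<Longrightarrow> stable_class R X Y g = stable_class R X Y f \<longleftrightarrow>
      (\<lambda>x\<in>carrier X. g x \<ominus>\<^bsub>Y\<^esub> f x) \<in> factor_free R X Y"
proof -
  interpret S: abelian_subgroup "factor_free R X Y" "Hom_mod R X Y" by (rule factor_free_abelian_subgroup[OF X Y])
  have fc: "f \<in> carrier (Hom_mod R X Y)" using f by simp
  show 1: "g \<in> stable_class R X Y f \<longleftrightarrow> g \<in> mod_hom R X Y \<and> (\<lambda>x\<in>carrier X. g x \<ominus>\<^bsub>Y\<^esub> f x) \<in> factor_free R X Y" for g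
  proof -
    have "g \<in> carrier (Hom_mod R X Y)" if "g \<in> stable_class R X Y f"
      using S.a_elemrcos_carrier[OF fc] that unfolding stable_class_def by blast
    moreover have "g \<in> stable_class R X Y f \<longleftrightarrow> (\<lambda>x\<in>carrier X. g x \<ominus>\<^bsub>Y\<^esub> f x) \<in> factor_free R X Y"
      if g: "g \<in> mod_hom R X Y"
    proof -
      have gc: "g \<in> carrier (Hom_mod R X Y)" using g by simp
      show ?thesis
        unfolding stable_class_def S.a_rcos_module[OF fc gc] using Hom_mod_minus[OF X Y g f] by (simp only: a_minus_def)
    qed
    ultimately show ?thesis by auto
  qed
  show 2: "f \<in> stable_class R X Y f" unfolding stable_class_def by (rule S.a_rcos_self[OF fc])
  show "stable_class R X Y g = stable_class R X Y f \<longleftrightarrow> (\<lambda>x\<in>carrier X. g x \<ominus>\<^bsub>Y\<^esub> f x) \<in> factor_free R X Y"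
    if g: "g \<in> mod_hom R X Y"
  proof
    have gc: "g \<in> carrier (Hom_mod R X Y)" using g by simp
    assume "stable_class R X Y g = stable_class R X Y f"
    then have "g \<in> stable_class R X Y f" using S.a_rcos_self[OF gc] unfolding stable_class_def by simp
    then show "(\<lambda>x\<in>carrier X. g x \<ominus>\<^bsub>Y\<^esub> f x) \<in> factor_free R X Y" using 1 by blast
  next
    assume "(\<lambda>x\<in>carrier X. g x \<ominus>\<^bsub>Y\<^esub> f x) \<in> factor_free R X Y"
    then have "g \<in> stable_class R X Y f" using 1 g by blast
    then show "stable_class R X Y g = stable_class R X Y f"
      unfolding stable_class_def using S.a_repr_independence'[OF _ fc] by metis
  qed
qed

lemma stable_mult:
  assumes X: "module R X" and Y: "module R Y" and f: "f \<in> mod_hom R X Y" and g: "g \<in> mod_hom R X Y"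
  shows "stable_class R X Y f \<otimes>\<^bsub>stable_hom R X Y\<^esub> stable_class R X Y g = stable_class R X Y (\<lambda>x\<in>carrier X. f x \<oplus>\<^bsub>Y\<^esub> g x)"
proof -
  interpret S: abelian_subgroup "factor_free R X Y" "Hom_mod R X Y" by (rule factor_free_abelian_subgroup[OF X Y])
  have "f \<in> carrier (Hom_mod R X Y)" "g \<in> carrier (Hom_mod R X Y)" using f g by auto
  from S.a_rcos_sum[OF this] show ?thesis unfolding stable_hom_def stable_class_def add_A_FactGroup by simp
qed

lemma stable_one_iff:
  assumes X: "module R X" and Y: "module R Y" and f: "f \<in> mod_hom R X Y"
  shows "stable_class R X Y f = \<one>\<^bsub>stable_hom R X Y\<^esub> \<longleftrightarrow> f \<in> factor_free R X Y"
proof -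
  interpret S: abelian_subgroup "factor_free R X Y" "Hom_mod R X Y" by (rule factor_free_abelian_subgroup[OF X Y])
  have "f \<in> carrier (Hom_mod R X Y)" using f by simp
  then show ?thesis
    unfolding stable_class_def stable_hom_def A_FactGroup_def'
    using S.a_coset_join1[OF _ _ S.a_subgroup] S.a_coset_join2[OF _ S.a_subgroup] S.a_rcos_self by auto
qed

lemma stable_class_eqI:
  assumes X: "module R X" and Y: "module R Y" and f: "f \<in> mod_hom R X Y" and g: "g \<in> mod_hom R X Y"
    and d: "d \<in> factor_free R X Y" and eq: "\<And>x. x \<in> carrier X \<Longrightarrow> f x \<ominus>\<^bsub>Y\<^esub> g x = d x"
  shows "stable_class R X Y f = stable_class R X Y g"
proof -
  have "(\<lambda>x\<in>carrier X. f x \<ominus>\<^bsub>Y\<^esub> g x) = d"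
    by (rule mod_hom_eqI[OF mod_hom_minus_map[OF X Y f g] factor_free_hom[OF X d]]) (simp add: eq)
  then show ?thesis using stable_class_mem(3)[OF X Y g f] d by simp
qed

lemma stable_comp_class:
  assumes X: "module R X" and Y: "module R Y" and Z: "module R Z" and f: "f \<in> mod_hom R X Y" and g: "g \<in> mod_hom R Y Z"
  shows "stable_comp R X Y Z (stable_class R Y Z g) (stable_class R X Y f) = stable_class R X Z (compose (carrier X) g f)"
proof -
  have "stable_class R X Z (compose (carrier X) g' f') = stable_class R X Z (compose (carrier X) g f)"
    if g': "g' \<in> stable_class R Y Z g" and f': "f' \<in> stable_class R X Y f" for g' f'
  proof -
    have g'h: "g' \<in> mod_hom R Y Z" and dg: "(\<lambda>x\<in>carrier Y. g' x \<ominus>\<^bsub>Z\<^esub> g x) \<in> factor_free R Y Z"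
      using g' stable_class_mem(1)[OF Y Z g] by auto
    have f'h: "f' \<in> mod_hom R X Y" and df: "(\<lambda>x\<in>carrier X. f' x \<ominus>\<^bsub>Y\<^esub> f x) \<in> factor_free R X Y"
      using f' stable_class_mem(1)[OF X Y f] by auto
    have "stable_class R X Z (compose (carrier X) g' f') = stable_class R X Z (compose (carrier X) g f')"
      by (rule stable_class_eqI[OF X Z mod_hom_compose[OF X f'h g'h] mod_hom_compose[OF X f'h g]
          factor_free_compose[OF X Y f'h mod_hom_minus_map[OF Y Z g'h g] disjI2[OF dg]]])
        (use mod_hom_closed[OF f'h] in \<open>simp add: compose_def\<close>)
    also have "\<dots> = stable_class R X Z (compose (carrier X) g f)"
      by (rule stable_class_eqI[OF X Z mod_hom_compose[OF X f'h g] mod_hom_compose[OF X f g]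
          factor_free_compose[OF X Y mod_hom_minus_map[OF X Y f'h f] g disjI1[OF df]]])
        (use mod_hom_closed[OF f'h] mod_hom_closed[OF f] in \<open>simp add: compose_def mod_hom_minus[OF Y Z g]\<close>)
    finally show ?thesis .
  qed
  then show ?thesis
    unfolding stable_comp_def using stable_class_mem(2)[OF X Y f] stable_class_mem(2)[OF Y Z g] by blast
qed

lemma stable_comp_closed:
  assumes "module R X" "module R Y" "module R Z" "\<psi> \<in> carrier (stable_hom R Y Z)" "\<phi> \<in> carrier (stable_hom R X Y)"
  shows "stable_comp R X Y Z \<psi> \<phi> \<in> carrier (stable_hom R X Z)"
  using assms(4,5)
  by (elim stable_carrierE) (simp add: stable_comp_class[OF assms(1-3)] stable_class_closed mod_hom_compose[OF assms(1)])

lemma stable_comp_assoc: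
  assumes M: "module R W" "module R X" "module R Y" "module R Z"
    and "\<chi> \<in> carrier (stable_hom R Y Z)" "\<psi> \<in> carrier (stable_hom R X Y)" "\<phi> \<in> carrier (stable_hom R W X)"
  shows "stable_comp R W X Z (stable_comp R X Y Z \<chi> \<psi>) \<phi> = stable_comp R W Y Z \<chi> (stable_comp R W X Y \<psi> \<phi>)"
proof -
  obtain h g f where h: "h \<in> mod_hom R Y Z" "\<chi> = stable_class R Y Z h" and g: "g \<in> mod_hom R X Y" "\<psi> = stable_class R X Y g"
    and f: "f \<in> mod_hom R W X" "\<phi> = stable_class R W X f" using assms(5-7) by (elim stable_carrierE) blast
  have "compose (carrier W) (compose (carrier X) h g) f = compose (carrier W) h (compose (carrier W) g f)"
    unfolding compose_def by (rule restrict_ext) (use mod_hom_closed[OF f(1)] in simp)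
  then show ?thesis
    unfolding h(2) g(2) f(2)
    by (simp add: stable_comp_class M h(1) g(1) f(1) mod_hom_compose[OF M(1) f(1) g(1)] mod_hom_compose[OF M(2) g(1) h(1)])
qed

lemma stable_comp_id:
  assumes X: "module R X" and Y: "module R Y" and \<phi>: "\<phi> \<in> carrier (stable_hom R X Y)"
  shows "stable_comp R X Y Y (stable_class R Y Y (\<lambda>y\<in>carrier Y. y)) \<phi> = \<phi>"
    and "stable_comp R X X Y \<phi> (stable_class R X X (\<lambda>x\<in>carrier X. x)) = \<phi>"
proof -
  obtain f where f: "f \<in> mod_hom R X Y" "\<phi> = stable_class R X Y f" using \<phi> by (rule stable_carrierE)
  have "compose (carrier X) (\<lambda>y\<in>carrier Y. y) f = f"
    by (rule mod_hom_eqI[OF mod_hom_compose[OF X f(1) mod_hom_id[OF Y]] f(1)]) (simp add: compose_def mod_hom_closed[OF f(1)])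
  then show "stable_comp R X Y Y (stable_class R Y Y (\<lambda>y\<in>carrier Y. y)) \<phi> = \<phi>"
    using stable_comp_class[OF X Y Y f(1) mod_hom_id[OF Y]] f(2) by simp
  have "compose (carrier X) f (\<lambda>x\<in>carrier X. x) = f"
    by (rule mod_hom_eqI[OF mod_hom_compose[OF X mod_hom_id[OF X] f(1)] f(1)]) (simp add: compose_def)
  then show "stable_comp R X X Y \<phi> (stable_class R X X (\<lambda>x\<in>carrier X. x)) = \<phi>"
    using stable_comp_class[OF X X Y mod_hom_id[OF X] f(1)] f(2) by simp
qed

lemma stable_comp_mult:
  assumes X: "module R X" and Y: "module R Y" and Z: "module R Z"
  shows "\<psi> \<in> carrier (stable_hom R Y Z) \<Longrightarrow> \<psi>' \<in> carrier (stable_hom R Y Z) \<Longrightarrow> \<phi> \<in> carrier (stable_hom R X Y) \<Longrightarrow>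
      stable_comp R X Y Z (\<psi> \<otimes>\<^bsub>stable_hom R Y Z\<^esub> \<psi>') \<phi> = stable_comp R X Y Z \<psi> \<phi> \<otimes>\<^bsub>stable_hom R X Z\<^esub> stable_comp R X Y Z \<psi>' \<phi>"
    and "\<psi> \<in> carrier (stable_hom R Y Z) \<Longrightarrow> \<phi> \<in> carrier (stable_hom R X Y) \<Longrightarrow> \<phi>' \<in> carrier (stable_hom R X Y) \<Longrightarrow>
      stable_comp R X Y Z \<psi> (\<phi> \<otimes>\<^bsub>stable_hom R X Y\<^esub> \<phi>') = stable_comp R X Y Z \<psi> \<phi> \<otimes>\<^bsub>stable_hom R X Z\<^esub> stable_comp R X Y Z \<psi> \<phi>'"
proof -
  assume "\<psi> \<in> carrier (stable_hom R Y Z)" "\<psi>' \<in> carrier (stable_hom R Y Z)" "\<phi> \<in> carrier (stable_hom R X Y)"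
  then obtain g g' f where g: "g \<in> mod_hom R Y Z" "\<psi> = stable_class R Y Z g" and g': "g' \<in> mod_hom R Y Z" "\<psi>' = stable_class R Y Z g'"
    and f: "f \<in> mod_hom R X Y" "\<phi> = stable_class R X Y f" by (elim stable_carrierE) blast
  have "compose (carrier X) (\<lambda>y\<in>carrier Y. g y \<oplus>\<^bsub>Z\<^esub> g' y) f =
      (\<lambda>x\<in>carrier X. compose (carrier X) g f x \<oplus>\<^bsub>Z\<^esub> compose (carrier X) g' f x)"
    unfolding compose_def by (rule restrict_ext) (use mod_hom_closed[OF f(1)] in simp)
  then show "stable_comp R X Y Z (\<psi> \<otimes>\<^bsub>stable_hom R Y Z\<^esub> \<psi>') \<phi> = stable_comp R X Y Z \<psi> \<phi> \<otimes>\<^bsub>stable_hom R X Z\<^esub> stable_comp R X Y Z \<psi>' \<phi>"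
    unfolding g(2) g'(2) f(2) stable_mult[OF Y Z g(1) g'(1)]
      stable_comp_class[OF X Y Z f(1) g(1)] stable_comp_class[OF X Y Z f(1) g'(1)]
      stable_comp_class[OF X Y Z f(1) mod_hom_add_map[OF Y Z g(1) g'(1)]]
      stable_mult[OF X Z mod_hom_compose[OF X f(1) g(1)] mod_hom_compose[OF X f(1) g'(1)]] by (rule arg_cong)
next
  assume "\<psi> \<in> carrier (stable_hom R Y Z)" "\<phi> \<in> carrier (stable_hom R X Y)" "\<phi>' \<in> carrier (stable_hom R X Y)"
  then obtain g f f' where g: "g \<in> mod_hom R Y Z" "\<psi> = stable_class R Y Z g"
    and f: "f \<in> mod_hom R X Y" "\<phi> = stable_class R X Y f" and f': "f' \<in> mod_hom R X Y" "\<phi>' = stable_class R X Y f'"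
    by (elim stable_carrierE) blast
  have "compose (carrier X) g (\<lambda>x\<in>carrier X. f x \<oplus>\<^bsub>Y\<^esub> f' x) =
      (\<lambda>x\<in>carrier X. compose (carrier X) g f x \<oplus>\<^bsub>Z\<^esub> compose (carrier X) g f' x)"
    unfolding compose_def by (rule restrict_ext) (use mod_hom_closed[OF f(1)] mod_hom_closed[OF f'(1)] in \<open>simp add: mod_hom_add[OF g(1)]\<close>)
  then show "stable_comp R X Y Z \<psi> (\<phi> \<otimes>\<^bsub>stable_hom R X Y\<^esub> \<phi>') = stable_comp R X Y Z \<psi> \<phi> \<otimes>\<^bsub>stable_hom R X Z\<^esub> stable_comp R X Y Z \<psi> \<phi>'"
    unfolding g(2) f(2) f'(2) stable_mult[OF X Y f(1) f'(1)]
      stable_comp_class[OF X Y Z f(1) g(1)] stable_comp_class[OF X Y Z f'(1) g(1)]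
      stable_comp_class[OF X Y Z mod_hom_add_map[OF X Y f(1) f'(1)] g(1)]
      stable_mult[OF X Z mod_hom_compose[OF X f(1) g(1)] mod_hom_compose[OF X f'(1) g(1)]] by (rule arg_cong)
qed

section \<open>The stable category as a preadditive category, and its right modules\<close>

lemma stable_cat_simps [simp]:
  "cobj (stable_cat R \<X>) = \<X>" "chom (stable_cat R \<X>) = stable_hom R" "ccomp (stable_cat R \<X>) = stable_comp R"
  "cid (stable_cat R \<X>) X = stable_class R X X (\<lambda>x\<in>carrier X. x)"
  by (auto simp: stable_cat_def)

lemma stable_preadditive:
  assumes m: "\<And>X. X \<in> \<X> \<Longrightarrow> module R X"
  shows "preadditive (stable_cat R \<X>)"
  by (rule preadditive.intro)
    (simp_all add: m stable_comm_group stable_comp_closed stable_class_closed mod_hom_id stable_comp_assoc stable_comp_id stable_comp_mult)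

text \<open>This is \<open>H\<close>. As \<open>M\<close> has an arbitrary carrier type and need not
  be G-projective, it is in general not one of the represented functors.\<close>

definition stable_functor ::
  "('a,'m,'s) module_scheme \<Rightarrow> ('a obj, ((nat \<Rightarrow> 'a) set \<Rightarrow> (nat \<Rightarrow> 'a) set) set, ((nat \<Rightarrow> 'a) set \<Rightarrow> 'm) set) contra_functor" where
  "stable_functor M = \<lparr>fobj = (\<lambda>X. stable_hom R X M), fmap = (\<lambda>X Y \<phi> \<psi>. stable_comp R X Y M \<psi> \<phi>)\<rparr>"

lemma stable_functor_simps [simp]:
  "fobj (stable_functor M) X = stable_hom R X M" "fmap (stable_functor M) X Y \<phi> \<psi> = stable_comp R X Y M \<psi> \<phi>"
  by (auto simp: stable_functor_def)

lemma stable_functor_right_module: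
  assumes m: "\<And>X. X \<in> \<X> \<Longrightarrow> module R X" and M: "module R M"
  shows "right_module (stable_cat R \<X>) (stable_functor M)"
proof -
  have 1: "\<forall>X\<in>\<X>. comm_group (stable_hom R X M)" by (intro ballI stable_comm_group m M)
  have 2: "\<forall>X\<in>\<X>. \<forall>Y\<in>\<X>. \<forall>f\<in>carrier (stable_hom R X Y). (\<lambda>\<psi>. stable_comp R X Y M \<psi> f) \<in> hom (stable_hom R Y M) (stable_hom R X M)"
  proof (intro ballI homI)
    fix X Y f y assume "X \<in> \<X>" "Y \<in> \<X>" "f \<in> carrier (stable_hom R X Y)" "y \<in> carrier (stable_hom R Y M)"
    then show "stable_comp R X Y M y f \<in> carrier (stable_hom R X M)"
      by (simp add: stable_comp_closed[OF m m M])
    fix z assume "z \<in> carrier (stable_hom R Y M)"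
    then show "stable_comp R X Y M (y \<otimes>\<^bsub>stable_hom R Y M\<^esub> z) f =
        stable_comp R X Y M y f \<otimes>\<^bsub>stable_hom R X M\<^esub> stable_comp R X Y M z f"
      using stable_comp_mult(1)[OF m[OF \<open>X \<in> \<X>\<close>] m[OF \<open>Y \<in> \<X>\<close>] M \<open>y \<in> _\<close> _ \<open>f \<in> _\<close>] by simp
  qed
  have 3: "\<forall>X\<in>\<X>. \<forall>x\<in>carrier (stable_hom R X M). stable_comp R X X M x (stable_class R X X (\<lambda>x\<in>carrier X. x)) = x"
    by (intro ballI stable_comp_id(2) m M)
  have 4: "\<forall>X\<in>\<X>. \<forall>Y\<in>\<X>. \<forall>Z\<in>\<X>. \<forall>f\<in>carrier (stable_hom R X Y). \<forall>g\<in>carrier (stable_hom R Y Z). \<forall>z\<in>carrier (stable_hom R Z M).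
      stable_comp R X Z M z (stable_comp R X Y Z g f) = stable_comp R X Y M (stable_comp R Y Z M z g) f"
    by (intro ballI stable_comp_assoc[symmetric] m M)
  have 5: "\<forall>X\<in>\<X>. \<forall>Y\<in>\<X>. \<forall>f\<in>carrier (stable_hom R X Y). \<forall>g\<in>carrier (stable_hom R X Y). \<forall>y\<in>carrier (stable_hom R Y M).
      stable_comp R X Y M y (f \<otimes>\<^bsub>stable_hom R X Y\<^esub> g) = stable_comp R X Y M y f \<otimes>\<^bsub>stable_hom R X M\<^esub> stable_comp R X Y M y g"
    by (intro ballI stable_comp_mult(2) m M)
  show ?thesis unfolding right_module_def stable_cat_simps stable_functor_simps by (intro conjI 1 2 3 4 5)
qed

lemma Tate_Ext_pullback: "Tate_Ext R i M = pullback (Omega R i) (Omega_mor R i) (stable_functor M)"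
  by (simp add: Tate_Ext_def pullback_def stable_functor_def)

subsection \<open>Morphisms of exact sequences\<close>

text \<open>The outer maps of a morphism of exact sequences, with the middle map forgotten. A
  relation rather than a function, since either end determines the other only up to maps through
  free modules, and syzygies and cosyzygies read it in opposite directions.\<close>

definition ladder ::
  "('a,'k,'s1) module_scheme \<Rightarrow> ('a,'f,'s2) module_scheme \<Rightarrow> ('a,'x,'s3) module_scheme \<Rightarrow> ('k \<Rightarrow> 'f) \<Rightarrow> ('f \<Rightarrow> 'x) \<Rightarrow>
   ('a,'k','t1) module_scheme \<Rightarrow> ('a,'f','t2) module_scheme \<Rightarrow> ('a,'x','t3) module_scheme \<Rightarrow> ('k' \<Rightarrow> 'f') \<Rightarrow> ('f' \<Rightarrow> 'x') \<Rightarrow>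
   ('x \<Rightarrow> 'x') \<Rightarrow> ('k \<Rightarrow> 'k') \<Rightarrow> bool" where
  "ladder K F X i p K' F' X' i' p' f g \<longleftrightarrow> f \<in> mod_hom R X X' \<and> g \<in> mod_hom R K K' \<and>
     (\<exists>h\<in>mod_hom R F F'. (\<forall>v\<in>carrier F. p' (h v) = f (p v)) \<and> (\<forall>k\<in>carrier K. i' (g k) = h (i k)))"

lemma ladder_lift:
  assumes E: "exseq R K (free_mod R n) X i p" and E': "exseq R K' F' X' i' p'" and f: "f \<in> mod_hom R X X'"
  shows "\<exists>g. ladder K (free_mod R n) X i p K' F' X' i' p' f g"
proof -
  let ?F = "free_mod R n"
  note D = exseqD[OF E] and D' = exseqD[OF E']
  obtain h where h: "h \<in> mod_hom R ?F F'" "\<And>v. v \<in> carrier ?F \<Longrightarrow> p' (h v) = f (p v)"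
    using free_projective[OF D'(2,3,6,7) mod_hom_compose[OF free_module D(6) f]] by (auto simp: compose_def)
  obtain g where g: "g \<in> mod_hom R K K'" "\<And>k. k \<in> carrier K \<Longrightarrow> i' (g k) = compose (carrier K) h i k"
  proof (rule exseq_into[OF E' D(1) mod_hom_compose[OF D(1,4) h(1)]])
    fix k assume k: "k \<in> carrier K"
    show "p' (compose (carrier K) h i k) = \<zero>\<^bsub>X'\<^esub>"
      using h(2)[OF mod_hom_closed[OF D(4) k]] exseq_zero[OF E k] mod_hom_zero[OF D(3) D'(3) f] k by (simp add: compose_def)
  qed blast
  have "i' (g k) = h (i k)" if "k \<in> carrier K" for k using g(2)[OF that] that by (simp add: compose_def)
  then show ?thesis unfolding ladder_def using f g(1) h by blast
qed

text \<open>The middle map extends \<open>i' g\<close> along \<open>i\<close>, coordinate by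
  coordinate, because linear forms extend; then it descends to the quotients.\<close>

lemma ladder_extend:
  assumes E: "exseq R K F X i p" and ext: "extends R K F i" and E': "exseq R K' (free_mod R n) X' i' p'" and g: "g \<in> mod_hom R K K'"
  shows "\<exists>f. ladder K F X i p K' (free_mod R n) X' i' p' f g"
proof -
  let ?F' = "free_mod R n"
  note D = exseqD[OF E] and D' = exseqD[OF E']
  obtain h where h: "h \<in> mod_hom R F ?F'" "\<And>k. k \<in> carrier K \<Longrightarrow> h (i k) = compose (carrier K) i' g k"
    using extends_free[OF D(1,2) ext D(4) mod_hom_compose[OF D(1) g D'(4)]] by blast
  have hk: "h (i k) = i' (g k)" if "k \<in> carrier K" for k using h(2)[OF that] that by (simp add: compose_def)
  obtain f where f: "f \<in> mod_hom R X X'" "\<And>v. v \<in> carrier F \<Longrightarrow> f (p v) = compose (carrier F) p' h v"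
  proof (rule exseq_descend[OF E D'(3) mod_hom_compose[OF D(2) h(1) D'(6)]])
    fix k assume k: "k \<in> carrier K"
    show "compose (carrier F) p' h (i k) = \<zero>\<^bsub>X'\<^esub>"
      using mod_hom_closed[OF D(4) k] hk[OF k] exseq_zero[OF E' mod_hom_closed[OF g k]] by (simp add: compose_def)
  qed blast
  have "p' (h v) = f (p v)" if "v \<in> carrier F" for v using f(2)[OF that] that by (simp add: compose_def)
  then show ?thesis unfolding ladder_def using f(1) g h(1) hk by force
qed

text \<open>Applied to differences of maps, this makes the passage between the ends well defined on
  stable classes; applied to single maps, it makes the passage faithful.\<close>

lemma ladder_factor_free:
  assumes E: "exseq R K (free_mod R n) X i p" and E': "exseq R K' (free_mod R n') X' i' p'"
    and ext: "extends R K (free_mod R n) i" and L: "ladder K (free_mod R n) X i p K' (free_mod R n') X' i' p' f g"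
  shows "f \<in> factor_free R X X' \<longleftrightarrow> g \<in> factor_free R K K'"
proof -
  let ?F = "free_mod R n" and ?F' = "free_mod R n'"
  note D = exseqD[OF E] and D' = exseqD[OF E']
  interpret K': module R K' by (rule D'(1))
  interpret F: module R ?F by (rule D(2))
  interpret F': module R ?F' by (rule D'(2))
  interpret X': module R X' by (rule D'(3))
  obtain h where f: "f \<in> mod_hom R X X'" and g: "g \<in> mod_hom R K K'" and h: "h \<in> mod_hom R ?F ?F'"
    "\<And>v. v \<in> carrier ?F \<Longrightarrow> p' (h v) = f (p v)" "\<And>k. k \<in> carrier K \<Longrightarrow> i' (g k) = h (i k)"
    using L unfolding ladder_def by blast
  show ?thesis
  proof
    assume "f \<in> factor_free R X X'"
    then obtain m a b where ab: "a \<in> mod_hom R X (free_mod R m)" "b \<in> mod_hom R (free_mod R m) X'"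
      "\<And>x. x \<in> carrier X \<Longrightarrow> f x = b (a x)" using factor_freeE[OF D(3)] by metis
    obtain c where c: "c \<in> mod_hom R (free_mod R m) ?F'" "\<And>v. v \<in> carrier (free_mod R m) \<Longrightarrow> p' (c v) = b v"
      using free_projective[OF D'(2,3,6,7) ab(2)] by blast
    note ap = mod_hom_compose[OF D(2,6) ab(1)]
    note cap = mod_hom_compose[OF D(2) ap c(1)]
    \<comment> \<open>\<open>b\<close> lifts along \<open>p'\<close> to \<open>c\<close>. Then
      \<open>h - c a p\<close> lies over zero, so it takes values in \<open>K'\<close>, and on
      \<open>K\<close> it still gives \<open>g\<close> because \<open>p i = 0\<close>.\<close>
    let ?d = "\<lambda>v\<in>carrier ?F. h v \<ominus>\<^bsub>?F'\<^esub> compose (carrier ?F) c (compose (carrier ?F) a p) v"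
    have capv: "compose (carrier ?F) c (compose (carrier ?F) a p) v = c (a (p v))" if "v \<in> carrier ?F" for v
      using that by (simp add: compose_def)
    obtain u where u: "u \<in> mod_hom R ?F K'" "\<And>v. v \<in> carrier ?F \<Longrightarrow> i' (u v) = ?d v"
    proof (rule exseq_into[OF E' D(2) mod_hom_minus_map[OF D(2) D'(2) h(1) cap]])
      fix v assume v: "v \<in> carrier ?F"
      note pv = mod_hom_closed[OF D(6) v]
      have cc: "c (a (p v)) \<in> carrier ?F'" by (rule mod_hom_closed2[OF ab(1) c(1) pv])
      have "p' (?d v) = f (p v) \<ominus>\<^bsub>X'\<^esub> b (a (p v))"
        using v capv[OF v] mod_hom_closed[OF h(1) v] cc h(2)[OF v] c(2)[OF mod_hom_closed[OF ab(1) pv]]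
        by (simp add: mod_hom_minus[OF D'(2,3,6)])
      then show "p' (?d v) = \<zero>\<^bsub>X'\<^esub>" using ab(3)[OF pv] mod_hom_closed[OF f pv] by simp
    qed blast
    have ui: "g k = u (i k)" if k: "k \<in> carrier K" for k
    proof -
      note ik = mod_hom_closed[OF D(4) k]
      have "c (a (p (i k))) = \<zero>\<^bsub>?F'\<^esub>"
        using exseq_zero[OF E k] mod_hom_zero[OF D(3) free_module ab(1)] mod_hom_zero[OF free_module D'(2) c(1)] by simp
      then have "i' (u (i k)) = h (i k)"
        using u(2)[OF ik] capv[OF ik] ik mod_hom_closed[OF h(1) ik] by (simp add: a_minus_def)
      then show ?thesis using h(3)[OF k] exseq_inj[OF E' mod_hom_closed[OF g k] mod_hom_closed[OF u(1) ik]] by simp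
    qed
    show "g \<in> factor_free R K K'" by (rule factor_freeI[OF D(1) D(4) u(1) g ui])
  next
    assume "g \<in> factor_free R K K'"
    then obtain m a b where ab: "a \<in> mod_hom R K (free_mod R m)" "b \<in> mod_hom R (free_mod R m) K'"
      "\<And>x. x \<in> carrier K \<Longrightarrow> g x = b (a x)" using factor_freeE[OF D(1)] by metis
    obtain c where c: "c \<in> mod_hom R ?F (free_mod R m)" "\<And>k. k \<in> carrier K \<Longrightarrow> c (i k) = a k"
      using extends_free[OF D(1,2) ext D(4) ab(1)] by blast
    note bc = mod_hom_compose[OF D(2) c(1) ab(2)]
    note ibc = mod_hom_compose[OF D(2) bc D'(4)]
    have ibcv: "compose (carrier ?F) i' (compose (carrier ?F) b c) v = i' (b (c v))" if "v \<in> carrier ?F" for v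
      using that by (simp add: compose_def)
    \<comment> \<open>\<open>a\<close> extends from \<open>K\<close> to the map \<open>c\<close> on
      the free module. Then \<open>h - i' b c\<close> vanishes on \<open>K\<close>, descends to
      \<open>X\<close>, and yields \<open>f\<close> after \<open>p'\<close> because
      \<open>p' i' = 0\<close>.\<close>
    let ?d = "\<lambda>v\<in>carrier ?F. h v \<ominus>\<^bsub>?F'\<^esub> compose (carrier ?F) i' (compose (carrier ?F) b c) v"
    obtain s where s: "s \<in> mod_hom R X ?F'" "\<And>v. v \<in> carrier ?F \<Longrightarrow> s (p v) = ?d v"
    proof (rule exseq_descend[OF E D'(2) mod_hom_minus_map[OF D(2) D'(2) h(1) ibc]])
      fix k assume k: "k \<in> carrier K"
      note ik = mod_hom_closed[OF D(4) k]
      show "?d (i k) = \<zero>\<^bsub>?F'\<^esub>"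
        using ik ibcv[OF ik] c(2)[OF k] ab(3)[OF k] h(3)[OF k] mod_hom_closed[OF h(1) ik] by simp
    qed blast
    show "f \<in> factor_free R X X'"
    proof (rule factor_freeI[OF D(3) s(1) D'(6) f])
      fix x assume "x \<in> carrier X"
      then obtain v where v: "v \<in> carrier ?F" "x = p v" by (rule exseq_surj[OF E])
      have bcv: "b (c v) \<in> carrier K'" by (rule mod_hom_closed2[OF c(1) ab(2) v(1)])
      have "p' (s (p v)) = p' (h v) \<ominus>\<^bsub>X'\<^esub> p' (i' (b (c v)))"
        using s(2)[OF v(1)] v(1) ibcv[OF v(1)] mod_hom_minus[OF D'(2,3,6) mod_hom_closed[OF h(1) v(1)] mod_hom_closed[OF D'(4) bcv]]
        by simp
      then show "f x = p' (s x)"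
        using exseq_zero[OF E' bcv] h(2)[OF v(1)] mod_hom_closed[OF f mod_hom_closed[OF D(6) v(1)]] v(2)
        by (simp add: a_minus_def)
    qed
  qed
qed

lemma ladder_id:
  assumes "exseq R K F X i p"
  shows "ladder K F X i p K F X i p (\<lambda>x\<in>carrier X. x) (\<lambda>k\<in>carrier K. k)"
proof -
  note D = exseqD[OF assms]
  show ?thesis
    unfolding ladder_def using mod_hom_id[OF D(1)] mod_hom_id[OF D(2)] mod_hom_id[OF D(3)]
    by (auto intro!: bexI[of _ "\<lambda>v\<in>carrier F. v"] simp: mod_hom_closed[OF D(4)] mod_hom_closed[OF D(6)])
qed

lemma ladder_compose:
  assumes E: "exseq R K F X i p" and E': "exseq R K' F' X' i' p'"
    and L: "ladder K F X i p K' F' X' i' p' f g" and L': "ladder K' F' X' i' p' K2 F2 X2 i2 p2 f' g'"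
  shows "ladder K F X i p K2 F2 X2 i2 p2 (compose (carrier X) f' f) (compose (carrier K) g' g)"
proof -
  note D = exseqD[OF E] and D' = exseqD[OF E']
  obtain h where f: "f \<in> mod_hom R X X'" and g: "g \<in> mod_hom R K K'" and h: "h \<in> mod_hom R F F'"
    "\<And>v. v \<in> carrier F \<Longrightarrow> p' (h v) = f (p v)" "\<And>k. k \<in> carrier K \<Longrightarrow> i' (g k) = h (i k)"
    using L unfolding ladder_def by blast
  obtain h' where f': "f' \<in> mod_hom R X' X2" and g': "g' \<in> mod_hom R K' K2" and h': "h' \<in> mod_hom R F' F2"
    "\<And>v. v \<in> carrier F' \<Longrightarrow> p2 (h' v) = f' (p' v)" "\<And>k. k \<in> carrier K' \<Longrightarrow> i2 (g' k) = h' (i' k)"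
    using L' unfolding ladder_def by blast
  show ?thesis
    unfolding ladder_def
  proof (intro conjI bexI[OF _ mod_hom_compose[OF D(2) h(1) h'(1)]] ballI)
    show "p2 (compose (carrier F) h' h v) = compose (carrier X) f' f (p v)" if v: "v \<in> carrier F" for v
      using v h(2)[OF v] h'(2)[OF mod_hom_closed[OF h(1) v]] mod_hom_closed[OF D(6) v] by (simp add: compose_def)
    show "i2 (compose (carrier K) g' g k) = compose (carrier F) h' h (i k)" if k: "k \<in> carrier K" for k
      using k h(3)[OF k] h'(3)[OF mod_hom_closed[OF g k]] mod_hom_closed[OF D(4) k] by (simp add: compose_def)
  qed (rule mod_hom_compose[OF D(3) f f'] mod_hom_compose[OF D(1) g g'])+
qed

lemma ladder_add:
  assumes E: "exseq R K F X i p" and E': "exseq R K' F' X' i' p'"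
    and L1: "ladder K F X i p K' F' X' i' p' f1 g1" and L2: "ladder K F X i p K' F' X' i' p' f2 g2"
  shows "ladder K F X i p K' F' X' i' p' (\<lambda>x\<in>carrier X. f1 x \<oplus>\<^bsub>X'\<^esub> f2 x) (\<lambda>k\<in>carrier K. g1 k \<oplus>\<^bsub>K'\<^esub> g2 k)"
    and "ladder K F X i p K' F' X' i' p' (\<lambda>x\<in>carrier X. f1 x \<ominus>\<^bsub>X'\<^esub> f2 x) (\<lambda>k\<in>carrier K. g1 k \<ominus>\<^bsub>K'\<^esub> g2 k)"
proof -
  note D = exseqD[OF E] and D' = exseqD[OF E']
  obtain h1 where 1: "f1 \<in> mod_hom R X X'" "g1 \<in> mod_hom R K K'" "h1 \<in> mod_hom R F F'"
    "\<And>v. v \<in> carrier F \<Longrightarrow> p' (h1 v) = f1 (p v)" "\<And>k. k \<in> carrier K \<Longrightarrow> i' (g1 k) = h1 (i k)"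
    using L1 unfolding ladder_def by blast
  obtain h2 where 2: "f2 \<in> mod_hom R X X'" "g2 \<in> mod_hom R K K'" "h2 \<in> mod_hom R F F'"
    "\<And>v. v \<in> carrier F \<Longrightarrow> p' (h2 v) = f2 (p v)" "\<And>k. k \<in> carrier K \<Longrightarrow> i' (g2 k) = h2 (i k)"
    using L2 unfolding ladder_def by blast
  show "ladder K F X i p K' F' X' i' p' (\<lambda>x\<in>carrier X. f1 x \<oplus>\<^bsub>X'\<^esub> f2 x) (\<lambda>k\<in>carrier K. g1 k \<oplus>\<^bsub>K'\<^esub> g2 k)"
    unfolding ladder_def
  proof (intro conjI bexI[OF _ mod_hom_add_map[OF D(2) D'(2) 1(3) 2(3)]] ballI)
    show "p' ((\<lambda>x\<in>carrier F. h1 x \<oplus>\<^bsub>F'\<^esub> h2 x) v) = (\<lambda>x\<in>carrier X. f1 x \<oplus>\<^bsub>X'\<^esub> f2 x) (p v)" if v: "v \<in> carrier F" for v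
      using v 1(4)[OF v] 2(4)[OF v] mod_hom_closed[OF D(6) v] mod_hom_add[OF D'(6) mod_hom_closed[OF 1(3) v] mod_hom_closed[OF 2(3) v]]
      by simp
    show "i' ((\<lambda>k\<in>carrier K. g1 k \<oplus>\<^bsub>K'\<^esub> g2 k) k) = (\<lambda>x\<in>carrier F. h1 x \<oplus>\<^bsub>F'\<^esub> h2 x) (i k)" if k: "k \<in> carrier K" for k
      using k 1(5)[OF k] 2(5)[OF k] mod_hom_closed[OF D(4) k] mod_hom_add[OF D'(4) mod_hom_closed[OF 1(2) k] mod_hom_closed[OF 2(2) k]]
      by simp
  qed (rule mod_hom_add_map[OF D(3) D'(3) 1(1) 2(1)] mod_hom_add_map[OF D(1) D'(1) 1(2) 2(2)])+
  show "ladder K F X i p K' F' X' i' p' (\<lambda>x\<in>carrier X. f1 x \<ominus>\<^bsub>X'\<^esub> f2 x) (\<lambda>k\<in>carrier K. g1 k \<ominus>\<^bsub>K'\<^esub> g2 k)"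
    unfolding ladder_def
  proof (intro conjI bexI[OF _ mod_hom_minus_map[OF D(2) D'(2) 1(3) 2(3)]] ballI)
    show "p' ((\<lambda>x\<in>carrier F. h1 x \<ominus>\<^bsub>F'\<^esub> h2 x) v) = (\<lambda>x\<in>carrier X. f1 x \<ominus>\<^bsub>X'\<^esub> f2 x) (p v)" if v: "v \<in> carrier F" for v
      using v 1(4)[OF v] 2(4)[OF v] mod_hom_closed[OF D(6) v] mod_hom_minus[OF D'(2,3,6) mod_hom_closed[OF 1(3) v] mod_hom_closed[OF 2(3) v]]
      by simp
    show "i' ((\<lambda>k\<in>carrier K. g1 k \<ominus>\<^bsub>K'\<^esub> g2 k) k) = (\<lambda>x\<in>carrier F. h1 x \<ominus>\<^bsub>F'\<^esub> h2 x) (i k)" if k: "k \<in> carrier K" for k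
      using k 1(5)[OF k] 2(5)[OF k] mod_hom_closed[OF D(4) k] mod_hom_minus[OF D'(1,2,4) mod_hom_closed[OF 1(2) k] mod_hom_closed[OF 2(2) k]]
      by simp
  qed (rule mod_hom_minus_map[OF D(3) D'(3) 1(1) 2(1)] mod_hom_minus_map[OF D(1) D'(1) 1(2) 2(2)])+
qed

section \<open>Stable isomorphisms and Schanuel's lemma\<close>

definition stably_iso :: "('a,'k,'s) module_scheme \<Rightarrow> ('a,'l,'t) module_scheme \<Rightarrow> bool" where
  "stably_iso K L \<longleftrightarrow> (\<exists>a\<in>mod_hom R K L. \<exists>b\<in>mod_hom R L K.
     (\<lambda>x\<in>carrier K. b (a x) \<ominus>\<^bsub>K\<^esub> x) \<in> factor_free R K K \<and> (\<lambda>x\<in>carrier L. a (b x) \<ominus>\<^bsub>L\<^esub> x) \<in> factor_free R L L)"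

lemma zero_factor_free: "module R X \<Longrightarrow> module R Y \<Longrightarrow> (\<lambda>x\<in>carrier X. \<zero>\<^bsub>Y\<^esub>) \<in> factor_free R X Y"
  using submodule_zero[OF Hom_mod_module factor_free_submodule] by simp

text \<open>\<open>b a - 1\<close> is the end over \<open>K\<close> of a ladder whose end over
  \<open>X\<close> is zero, so it factors through a free module.\<close>

lemma ladder_inverse_sub:
  assumes E: "exseq R K (free_mod R n) X i p" and E': "exseq R K' (free_mod R n') X i' p'"
    and ext: "extends R K (free_mod R n) i"
    and L: "ladder K (free_mod R n) X i p K' (free_mod R n') X i' p' (\<lambda>x\<in>carrier X. x) a"
    and L': "ladder K' (free_mod R n') X i' p' K (free_mod R n) X i p (\<lambda>x\<in>carrier X. x) b"
  shows "(\<lambda>x\<in>carrier K. b (a x) \<ominus>\<^bsub>K\<^esub> x) \<in> factor_free R K K"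
proof -
  note D = exseqD[OF E]
  interpret X: module R X by (rule D(3))
  note L1 = ladder_add(2)[OF E E ladder_compose[OF E E' L L'] ladder_id[OF E]]
  have 1: "(\<lambda>x\<in>carrier X. compose (carrier X) (\<lambda>x\<in>carrier X. x) (\<lambda>x\<in>carrier X. x) x \<ominus>\<^bsub>X\<^esub> (\<lambda>x\<in>carrier X. x) x) = (\<lambda>x\<in>carrier X. \<zero>\<^bsub>X\<^esub>)"
    by (rule restrict_ext) (simp add: compose_def)
  have 2: "(\<lambda>k\<in>carrier K. compose (carrier K) b a k \<ominus>\<^bsub>K\<^esub> (\<lambda>k\<in>carrier K. k) k) = (\<lambda>x\<in>carrier K. b (a x) \<ominus>\<^bsub>K\<^esub> x)"
    by (rule restrict_ext) (simp add: compose_def)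
  show ?thesis using ladder_factor_free[OF E E ext L1[unfolded 1 2]] zero_factor_free[OF D(3) D(3)] by (rule iffD1)
qed

lemma ladder_inverse_quot:
  assumes E: "exseq R K (free_mod R n) X i p" and E': "exseq R K (free_mod R n') X' i' p'"
    and ext: "extends R K (free_mod R n) i"
    and L: "ladder K (free_mod R n) X i p K (free_mod R n') X' i' p' a (\<lambda>x\<in>carrier K. x)"
    and L': "ladder K (free_mod R n') X' i' p' K (free_mod R n) X i p b (\<lambda>x\<in>carrier K. x)"
  shows "(\<lambda>x\<in>carrier X. b (a x) \<ominus>\<^bsub>X\<^esub> x) \<in> factor_free R X X"
proof -
  note D = exseqD[OF E]
  interpret K: module R K by (rule D(1))
  note L1 = ladder_add(2)[OF E E ladder_compose[OF E E' L L'] ladder_id[OF E]]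
  have 1: "(\<lambda>x\<in>carrier K. compose (carrier K) (\<lambda>x\<in>carrier K. x) (\<lambda>x\<in>carrier K. x) x \<ominus>\<^bsub>K\<^esub> (\<lambda>x\<in>carrier K. x) x) = (\<lambda>x\<in>carrier K. \<zero>\<^bsub>K\<^esub>)"
    by (rule restrict_ext) (simp add: compose_def)
  have 2: "(\<lambda>k\<in>carrier X. compose (carrier X) b a k \<ominus>\<^bsub>X\<^esub> (\<lambda>k\<in>carrier X. k) k) = (\<lambda>x\<in>carrier X. b (a x) \<ominus>\<^bsub>X\<^esub> x)"
    by (rule restrict_ext) (simp add: compose_def)
  show ?thesis using ladder_factor_free[OF E E ext L1[unfolded 1 2]] zero_factor_free[OF D(1) D(1)] by (rule iffD2)
qed

text \<open>The identity of \<open>X\<close> lifts to ladders in both directions, and their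
  composites are stably the identity.\<close>

lemma schanuel:
  assumes E: "exseq R K (free_mod R n) X i p" and E': "exseq R K' (free_mod R n') X i' p'"
    and ext: "extends R K (free_mod R n) i" and ext': "extends R K' (free_mod R n') i'"
  shows "stably_iso K K'"
proof -
  note id = mod_hom_id[OF exseqD(3)[OF E]]
  obtain a where a: "ladder K (free_mod R n) X i p K' (free_mod R n') X i' p' (\<lambda>x\<in>carrier X. x) a"
    using ladder_lift[OF E E' id] by blast
  obtain b where b: "ladder K' (free_mod R n') X i' p' K (free_mod R n) X i p (\<lambda>x\<in>carrier X. x) b"
    using ladder_lift[OF E' E id] by blast
  have "a \<in> mod_hom R K K'" "b \<in> mod_hom R K' K" using a b unfolding ladder_def by blast+
  then show ?thesis
    unfolding stably_iso_def using ladder_inverse_sub[OF E E' ext a b] ladder_inverse_sub[OF E' E ext' b a] by blast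
qed

text \<open>The same with the identity of \<open>K\<close>, extended in both directions instead of
  lifted.\<close>

lemma schanuel_dual:
  assumes E: "exseq R K (free_mod R n) X i p" and E': "exseq R K (free_mod R n') X' i' p'"
    and ext: "extends R K (free_mod R n) i" and ext': "extends R K (free_mod R n') i'"
  shows "stably_iso X X'"
proof -
  note id = mod_hom_id[OF exseqD(1)[OF E]]
  obtain a where a: "ladder K (free_mod R n) X i p K (free_mod R n') X' i' p' a (\<lambda>x\<in>carrier K. x)"
    using ladder_extend[OF E ext E' id] by blast
  obtain b where b: "ladder K (free_mod R n') X' i' p' K (free_mod R n) X i p b (\<lambda>x\<in>carrier K. x)"
    using ladder_extend[OF E' ext' E id] by blast
  have "a \<in> mod_hom R X X'" "b \<in> mod_hom R X' X" using a b unfolding ladder_def by blast+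
  then show ?thesis
    unfolding stably_iso_def using ladder_inverse_quot[OF E E' ext a b] ladder_inverse_quot[OF E' E ext' b a] by blast
qed

text \<open>Two choices have to be absorbed, the representative \<open>f\<close> and the map
  \<open>g\<close> related to it. The hypothesis \<open>diff\<close> covers both, since for equal
  representatives the difference is zero.\<close>

lemma stable_class_Union:
  assumes M: "module R X" "module R Y" "module R X'" "module R Y'"
    and hom: "\<And>f g. S f g \<Longrightarrow> g \<in> mod_hom R X' Y'"
    and total: "\<And>f. f \<in> mod_hom R X Y \<Longrightarrow> \<exists>g. S f g"
    and diff: "\<And>f g f' g'. f \<in> mod_hom R X Y \<Longrightarrow> f' \<in> mod_hom R X Y \<Longrightarrow> S f g \<Longrightarrow> S f' g' \<Longrightarrow>
      (\<lambda>x\<in>carrier X. f x \<ominus>\<^bsub>Y\<^esub> f' x) \<in> factor_free R X Y \<longleftrightarrow> (\<lambda>x\<in>carrier X'. g x \<ominus>\<^bsub>Y'\<^esub> g' x) \<in> factor_free R X' Y'"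
    and f: "f \<in> mod_hom R X Y" and g: "S f g"
  shows "(\<Union>f\<in>stable_class R X Y f. \<Union>g\<in>{g. S f g}. stable_class R X' Y' g) = stable_class R X' Y' g"
proof -
  have "stable_class R X' Y' g' = stable_class R X' Y' g" if f': "f' \<in> stable_class R X Y f" and g': "S f' g'" for f' g'
  proof -
    have "f' \<in> mod_hom R X Y" "(\<lambda>x\<in>carrier X. f' x \<ominus>\<^bsub>Y\<^esub> f x) \<in> factor_free R X Y"
      using f' stable_class_mem(1)[OF M(1,2) f] by auto
    then have "(\<lambda>x\<in>carrier X'. g' x \<ominus>\<^bsub>Y'\<^esub> g x) \<in> factor_free R X' Y'" using diff[OF _ f g' g] by blast
    then show ?thesis using stable_class_mem(3)[OF M(3,4) hom[OF g] hom[OF g']] by blast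
  qed
  then show ?thesis using stable_class_mem(2)[OF M(1,2) f] g by blast
qed

text \<open>The common skeleton for syzygies and cosyzygies: \<open>total\<close> and
  \<open>diff\<close> define the functor on stable classes, \<open>full\<close> and
  \<open>ff\<close> make it fully faithful, and \<open>dense\<close> is supplied by a form of
  Schanuel's lemma.\<close>

lemma autoequivalenceI:
  fixes \<X> :: "'a obj set"
  assumes m: "\<And>X. X \<in> \<X> \<Longrightarrow> module R X" and ob: "\<And>X. X \<in> \<X> \<Longrightarrow> ob X \<in> \<X>"
    and mo: "\<And>X Y \<phi>. mo X Y \<phi> = (\<Union>f\<in>\<phi>. \<Union>g\<in>{g. S X Y f g}. stable_class R (ob X) (ob Y) g)"
    and hom: "\<And>X Y f g. X \<in> \<X> \<Longrightarrow> Y \<in> \<X> \<Longrightarrow> S X Y f g \<Longrightarrow> g \<in> mod_hom R (ob X) (ob Y)"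
    and total: "\<And>X Y f. X \<in> \<X> \<Longrightarrow> Y \<in> \<X> \<Longrightarrow> f \<in> mod_hom R X Y \<Longrightarrow> \<exists>g. S X Y f g"
    and full: "\<And>X Y g. X \<in> \<X> \<Longrightarrow> Y \<in> \<X> \<Longrightarrow> g \<in> mod_hom R (ob X) (ob Y) \<Longrightarrow> \<exists>f\<in>mod_hom R X Y. S X Y f g"
    and diff: "\<And>X Y f g f' g'. X \<in> \<X> \<Longrightarrow> Y \<in> \<X> \<Longrightarrow> f \<in> mod_hom R X Y \<Longrightarrow> f' \<in> mod_hom R X Y \<Longrightarrow>
      S X Y f g \<Longrightarrow> S X Y f' g' \<Longrightarrow> (\<lambda>x\<in>carrier X. f x \<ominus>\<^bsub>Y\<^esub> f' x) \<in> factor_free R X Y \<longleftrightarrow>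
        (\<lambda>x\<in>carrier (ob X). g x \<ominus>\<^bsub>ob Y\<^esub> g' x) \<in> factor_free R (ob X) (ob Y)"
    and ff: "\<And>X Y f g. X \<in> \<X> \<Longrightarrow> Y \<in> \<X> \<Longrightarrow> f \<in> mod_hom R X Y \<Longrightarrow> S X Y f g \<Longrightarrow>
      f \<in> factor_free R X Y \<longleftrightarrow> g \<in> factor_free R (ob X) (ob Y)"
    and id: "\<And>X. X \<in> \<X> \<Longrightarrow> S X X (\<lambda>x\<in>carrier X. x) (\<lambda>x\<in>carrier (ob X). x)"
    and comp: "\<And>X Y Z f g f' g'. X \<in> \<X> \<Longrightarrow> Y \<in> \<X> \<Longrightarrow> Z \<in> \<X> \<Longrightarrow> f \<in> mod_hom R X Y \<Longrightarrow> f' \<in> mod_hom R Y Z \<Longrightarrow>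
      S X Y f g \<Longrightarrow> S Y Z f' g' \<Longrightarrow> S X Z (compose (carrier X) f' f) (compose (carrier (ob X)) g' g)"
    and add: "\<And>X Y f g f' g'. X \<in> \<X> \<Longrightarrow> Y \<in> \<X> \<Longrightarrow> f \<in> mod_hom R X Y \<Longrightarrow> f' \<in> mod_hom R X Y \<Longrightarrow>
      S X Y f g \<Longrightarrow> S X Y f' g' \<Longrightarrow> S X Y (\<lambda>x\<in>carrier X. f x \<oplus>\<^bsub>Y\<^esub> f' x) (\<lambda>x\<in>carrier (ob X). g x \<oplus>\<^bsub>ob Y\<^esub> g' x)"
    and dense: "\<And>Y. Y \<in> \<X> \<Longrightarrow> \<exists>X\<in>\<X>. stably_iso (ob X) Y"
  shows "autoequivalence (stable_cat R \<X>) ob mo"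
proof -
  have mo_class: "mo X Y (stable_class R X Y f) = stable_class R (ob X) (ob Y) g"
    if X: "X \<in> \<X>" and Y: "Y \<in> \<X>" and f: "f \<in> mod_hom R X Y" and g: "S X Y f g" for X Y f g
    unfolding mo
    by (rule stable_class_Union[where S = "S X Y", OF m[OF X] m[OF Y] m[OF ob[OF X]] m[OF ob[OF Y]] hom[OF X Y] total[OF X Y] diff[OF X Y] f g])
  interpret preadditive "stable_cat R \<X>" by (rule stable_preadditive[OF m])
  show ?thesis
  proof (unfold_locales, unfold stable_cat_simps)
    show "X \<in> \<X> \<Longrightarrow> ob X \<in> \<X>" for X by (rule ob)
    show "mo X X (stable_class R X X (\<lambda>x\<in>carrier X. x)) = stable_class R (ob X) (ob X) (\<lambda>x\<in>carrier (ob X). x)" if "X \<in> \<X>" for X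
      by (rule mo_class[OF that that mod_hom_id[OF m[OF that]] id[OF that]])
    show "\<exists>X\<in>\<X>. \<exists>a\<in>carrier (stable_hom R (ob X) Y). \<exists>b\<in>carrier (stable_hom R Y (ob X)).
        stable_comp R (ob X) Y (ob X) b a = stable_class R (ob X) (ob X) (\<lambda>x\<in>carrier (ob X). x) \<and>
        stable_comp R Y (ob X) Y a b = stable_class R Y Y (\<lambda>x\<in>carrier Y. x)" if Y: "Y \<in> \<X>" for Y
    proof -
      obtain X a b where X: "X \<in> \<X>" and a: "a \<in> mod_hom R (ob X) Y" and b: "b \<in> mod_hom R Y (ob X)"
        and ba: "(\<lambda>x\<in>carrier (ob X). b (a x) \<ominus>\<^bsub>ob X\<^esub> x) \<in> factor_free R (ob X) (ob X)"
        and ab: "(\<lambda>x\<in>carrier Y. a (b x) \<ominus>\<^bsub>Y\<^esub> x) \<in> factor_free R Y Y"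
        using dense[OF Y] unfolding stably_iso_def by blast
      note mX = m[OF ob[OF X]] and mY = m[OF Y]
      have 1: "stable_comp R (ob X) Y (ob X) (stable_class R Y (ob X) b) (stable_class R (ob X) Y a) =
          stable_class R (ob X) (ob X) (\<lambda>x\<in>carrier (ob X). x)"
        unfolding stable_comp_class[OF mX mY mX a b]
        by (rule stable_class_eqI[OF mX mX mod_hom_compose[OF mX a b] mod_hom_id[OF mX] ba]) (simp add: compose_def)
      have 2: "stable_comp R Y (ob X) Y (stable_class R (ob X) Y a) (stable_class R Y (ob X) b) =
          stable_class R Y Y (\<lambda>x\<in>carrier Y. x)"
        unfolding stable_comp_class[OF mY mX mY b a]
        by (rule stable_class_eqI[OF mY mY mod_hom_compose[OF mY b a] mod_hom_id[OF mY] ab]) (simp add: compose_def)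
      show ?thesis
        by (intro bexI[OF _ X] bexI[OF _ stable_class_closed[OF a]] bexI[OF _ stable_class_closed[OF b]] conjI 1 2)
    qed
    fix X Y assume X: "X \<in> \<X>" and Y: "Y \<in> \<X>"
    note mX = m[OF X] and mY = m[OF Y] and oX = m[OF ob[OF X]] and oY = m[OF ob[OF Y]]
    show "\<exists>f\<in>carrier (stable_hom R X Y). h = mo X Y f" if h: "h \<in> carrier (stable_hom R (ob X) (ob Y))" for h
    proof -
      obtain g where g: "g \<in> mod_hom R (ob X) (ob Y)" "h = stable_class R (ob X) (ob Y) g" using h by (rule stable_carrierE)
      obtain f where f: "f \<in> mod_hom R X Y" "S X Y f g" using full[OF X Y g(1)] by blast
      have "h = mo X Y (stable_class R X Y f)" using mo_class[OF X Y f] g(2) by simp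
      then show ?thesis using stable_class_closed[OF f(1)] by blast
    qed
    fix \<phi> assume "\<phi> \<in> carrier (stable_hom R X Y)"
    then obtain f where f: "f \<in> mod_hom R X Y" "\<phi> = stable_class R X Y f" by (rule stable_carrierE)
    obtain g where g: "S X Y f g" using total[OF X Y f(1)] by blast
    note gh = hom[OF X Y g] and mof = mo_class[OF X Y f(1) g]
    show "mo X Y \<phi> \<in> carrier (stable_hom R (ob X) (ob Y))" unfolding f(2) mof by (rule stable_class_closed[OF gh])
    show "\<phi> = \<one>\<^bsub>stable_hom R X Y\<^esub>" if "mo X Y \<phi> = \<one>\<^bsub>stable_hom R (ob X) (ob Y)\<^esub>"
      using that unfolding f(2) mof stable_one_iff[OF oX oY gh] stable_one_iff[OF mX mY f(1)] ff[OF X Y f(1) g] .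
    show "mo X Y (\<phi> \<otimes>\<^bsub>stable_hom R X Y\<^esub> \<psi>) = mo X Y \<phi> \<otimes>\<^bsub>stable_hom R (ob X) (ob Y)\<^esub> mo X Y \<psi>"
      if "\<psi> \<in> carrier (stable_hom R X Y)" for \<psi>
    proof -
      obtain f' where f': "f' \<in> mod_hom R X Y" "\<psi> = stable_class R X Y f'" using \<open>\<psi> \<in> _\<close> by (rule stable_carrierE)
      obtain g' where g': "S X Y f' g'" using total[OF X Y f'(1)] by blast
      show ?thesis
        unfolding f(2) f'(2) mof mo_class[OF X Y f'(1) g'] stable_mult[OF mX mY f(1) f'(1)] stable_mult[OF oX oY gh hom[OF X Y g']]
        by (rule mo_class[OF X Y mod_hom_add_map[OF mX mY f(1) f'(1)] add[OF X Y f(1) f'(1) g g']])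
    qed
    show "mo X Z (stable_comp R X Y Z \<psi> \<phi>) = stable_comp R (ob X) (ob Y) (ob Z) (mo Y Z \<psi>) (mo X Y \<phi>)"
      if Z: "Z \<in> \<X>" and "\<psi> \<in> carrier (stable_hom R Y Z)" for Z \<psi>
    proof -
      obtain f' where f': "f' \<in> mod_hom R Y Z" "\<psi> = stable_class R Y Z f'" using \<open>\<psi> \<in> _\<close> by (rule stable_carrierE)
      obtain g' where g': "S Y Z f' g'" using total[OF Y Z f'(1)] by blast
      show ?thesis
        unfolding f(2) f'(2) mof mo_class[OF Y Z f'(1) g'] stable_comp_class[OF mX mY m[OF Z] f(1) f'(1)]
          stable_comp_class[OF oX oY m[OF ob[OF Z]] gh hom[OF Y Z g']]
        by (rule mo_class[OF X Z mod_hom_compose[OF mX f(1) f'(1)] comp[OF X Y Z f(1) f'(1) g g']])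
    qed
  qed
qed

end

subsection \<open>The shifts of the stable category\<close>

context noetherian_local_cring
begin

lemma G_proj_iff [simp]: "X \<in> G_proj R \<longleftrightarrow> Gp R X"
  by (simp add: G_proj_def G_projective_iff)

lemma syzygy_lift_iff_ladder:
  fixes X Y :: "'a obj"
  assumes cX: "chosen_syzygy_seq R X = (K, i, p)" and EX: "exseq R K (free_mod R (min_gens R X)) X i p"
    and cY: "chosen_syzygy_seq R Y = (K', i', p')" and f: "f \<in> mod_hom R X Y"
  shows "syzygy_lift R X Y f g \<longleftrightarrow> ladder K (free_mod R (min_gens R X)) X i p K' (free_mod R (min_gens R Y)) Y i' p' f g"
  unfolding syzygy_lift_def ladder_def cX cY Let_def case_prod_conv compose_eq_iff using f by blast

text \<open>\<open>X\<close> sits at the kernel end of its cosyzygy sequence, so \<open>f\<close>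
  and \<open>g\<close> trade places in the ladder, and lifting and extending exchange their
  roles.\<close>

lemma cosyzygy_ext_iff_ladder:
  fixes X Y :: "'a obj"
  assumes cX: "chosen_cosyzygy_seq R X = (C, n, t, q)" and cY: "chosen_cosyzygy_seq R Y = (C', n', t', q')"
    and f: "f \<in> mod_hom R X Y"
  shows "cosyzygy_ext R X Y f g \<longleftrightarrow> ladder X (free_mod R n) C t q Y (free_mod R n') C' t' q' g f"
  unfolding cosyzygy_ext_def ladder_def cX cY Let_def case_prod_conv compose_eq_iff using f by metis

lemma syzygy_autoequivalence: "autoequivalence (stable_cat R (G_proj R)) (syzygy R) (syzygy_mor R)"
proof (rule autoequivalenceI[where S = "syzygy_lift R"], unfold G_proj_iff)
  show "module R X" if "Gp R X" for X :: "'a obj" by (rule Gp_module[OF that])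
  show "Gp R (syzygy R X)" if "Gp R X" for X :: "'a obj" using chosen_syzygy[OF that] by metis
  show "syzygy_mor R X Y \<phi> = (\<Union>f\<in>\<phi>. \<Union>g\<in>{g. syzygy_lift R X Y f g}. stable_class R (syzygy R X) (syzygy R Y) g)" for X Y \<phi>
    by (rule syzygy_mor_def)
  \<comment> \<open>\<open>Y\<close> and the syzygy of its cosyzygy \<open>C\<close> are both
    kernels of free covers of \<open>C\<close>, hence stably isomorphic by Schanuel's lemma.\<close>
  show "\<exists>X\<in>G_proj R. stably_iso (syzygy R X) Y" if Y: "Gp R Y" for Y :: "'a obj"
  proof -
    obtain C n t q where c: "exseq R Y (free_mod R n) C t q" "extends R Y (free_mod R n) t" "Gp R C" "C = cosyzygy R Y"
      by (rule chosen_cosyzygy[OF Y]) blast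
    obtain K i p where k: "syzygy R C = K" "exseq R K (free_mod R (min_gens R C)) C i p" "extends R K (free_mod R (min_gens R C)) i"
      by (rule chosen_syzygy[OF c(3)]) blast
    show ?thesis using schanuel[OF k(2) c(1) k(3) c(2)] k(1) c(3) by (intro bexI[of _ C]) simp_all
  qed
  fix X Y :: "'a obj" assume X: "Gp R X" and Y: "Gp R Y"
  obtain K i p where cX: "chosen_syzygy_seq R X = (K, i, p)" and K: "syzygy R X = K"
    and E: "exseq R K (free_mod R (min_gens R X)) X i p" "extends R K (free_mod R (min_gens R X)) i"
    by (rule chosen_syzygy[OF X]) blast
  obtain K' i' p' where cY: "chosen_syzygy_seq R Y = (K', i', p')" and K': "syzygy R Y = K'"
    and E': "exseq R K' (free_mod R (min_gens R Y)) Y i' p'" "extends R K' (free_mod R (min_gens R Y)) i'"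
    by (rule chosen_syzygy[OF Y]) blast
  note L = syzygy_lift_iff_ladder[OF cX E(1) cY] and LX = syzygy_lift_iff_ladder[OF cX E(1) cX]
  show "syzygy_lift R X X (\<lambda>x\<in>carrier X. x) (\<lambda>x\<in>carrier (syzygy R X). x)"
    unfolding LX[OF mod_hom_id[OF Gp_module[OF X]]] K by (rule ladder_id[OF E(1)])
  show "g \<in> mod_hom R (syzygy R X) (syzygy R Y)" if "syzygy_lift R X Y f g" for f g
    using that unfolding syzygy_lift_def cX cY Let_def case_prod_conv K K' by (rule conjunct1)
  show "\<exists>f\<in>mod_hom R X Y. syzygy_lift R X Y f g" if g: "g \<in> mod_hom R (syzygy R X) (syzygy R Y)" for g
  proof -
    obtain f where f: "ladder K (free_mod R (min_gens R X)) X i p K' (free_mod R (min_gens R Y)) Y i' p' f g"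
      using ladder_extend[OF E E'(1) g[unfolded K K']] by blast
    have fh: "f \<in> mod_hom R X Y" using f unfolding ladder_def by (rule conjunct1)
    show ?thesis using f L[OF fh] fh by blast
  qed
  fix f assume f: "f \<in> mod_hom R X Y"
  show "\<exists>g. syzygy_lift R X Y f g" unfolding L[OF f] by (rule ladder_lift[OF E(1) E'(1) f])
  show "f \<in> factor_free R X Y \<longleftrightarrow> g \<in> factor_free R (syzygy R X) (syzygy R Y)" if "syzygy_lift R X Y f g" for g
    using that unfolding L[OF f] K K' by (rule ladder_factor_free[OF E(1) E'(1) E(2)])
  show "syzygy_lift R X Z (compose (carrier X) f' f) (compose (carrier (syzygy R X)) g' g)"
    if Z: "Gp R Z" and f': "f' \<in> mod_hom R Y Z" and g: "syzygy_lift R X Y f g" and g': "syzygy_lift R Y Z f' g'" for Z f' g g'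
  proof -
    obtain K2 i2 p2 where cZ: "chosen_syzygy_seq R Z = (K2, i2, p2)" by (rule chosen_syzygy[OF Z]) blast
    show ?thesis
      unfolding syzygy_lift_iff_ladder[OF cX E(1) cZ mod_hom_compose[OF Gp_module[OF X] f f']] K
      by (rule ladder_compose[OF E(1) E'(1) g[unfolded L[OF f]] g'[unfolded syzygy_lift_iff_ladder[OF cY E'(1) cZ f']]])
  qed
  fix f' assume f': "f' \<in> mod_hom R X Y"
  fix g g' assume g: "syzygy_lift R X Y f g" and g': "syzygy_lift R X Y f' g'"
  note lad = g[unfolded L[OF f]] g'[unfolded L[OF f']]
  show "syzygy_lift R X Y (\<lambda>x\<in>carrier X. f x \<oplus>\<^bsub>Y\<^esub> f' x) (\<lambda>x\<in>carrier (syzygy R X). g x \<oplus>\<^bsub>syzygy R Y\<^esub> g' x)"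
    unfolding L[OF mod_hom_add_map[OF Gp_module[OF X] Gp_module[OF Y] f f']] K K' by (rule ladder_add(1)[OF E(1) E'(1) lad])
  show "(\<lambda>x\<in>carrier X. f x \<ominus>\<^bsub>Y\<^esub> f' x) \<in> factor_free R X Y \<longleftrightarrow>
        (\<lambda>x\<in>carrier (syzygy R X). g x \<ominus>\<^bsub>syzygy R Y\<^esub> g' x) \<in> factor_free R (syzygy R X) (syzygy R Y)"
    unfolding K K' by (rule ladder_factor_free[OF E(1) E'(1) E(2) ladder_add(2)[OF E(1) E'(1) lad]])
qed

lemma cosyzygy_autoequivalence: "autoequivalence (stable_cat R (G_proj R)) (cosyzygy R) (cosyzygy_mor R)"
proof (rule autoequivalenceI[where S = "cosyzygy_ext R"], unfold G_proj_iff)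
  show "module R X" if "Gp R X" for X :: "'a obj" by (rule Gp_module[OF that])
  show "Gp R (cosyzygy R X)" if "Gp R X" for X :: "'a obj" using chosen_cosyzygy[OF that] by metis
  show "cosyzygy_mor R X Y \<phi> = (\<Union>f\<in>\<phi>. \<Union>g\<in>{g. cosyzygy_ext R X Y f g}. stable_class R (cosyzygy R X) (cosyzygy R Y) g)" for X Y \<phi>
    by (rule cosyzygy_mor_def)
  \<comment> \<open>\<open>Y\<close> and the cosyzygy of its syzygy \<open>K\<close> are both
    cokernels of embeddings of \<open>K\<close> into free modules along which linear forms extend;
    the dual form of Schanuel's lemma compares them.\<close>
  show "\<exists>X\<in>G_proj R. stably_iso (cosyzygy R X) Y" if Y: "Gp R Y" for Y :: "'a obj"
  proof -
    obtain K i p where k: "exseq R K (free_mod R (min_gens R Y)) Y i p" "extends R K (free_mod R (min_gens R Y)) i" "Gp R K" "K = syzygy R Y"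
      by (rule chosen_syzygy[OF Y]) blast
    obtain C n t q where c: "cosyzygy R K = C" "exseq R K (free_mod R n) C t q" "extends R K (free_mod R n) t"
      by (rule chosen_cosyzygy[OF k(3)]) blast
    show ?thesis using schanuel_dual[OF c(2) k(1) c(3) k(2)] c(1) k(3) by (intro bexI[of _ K]) simp_all
  qed
  fix X Y :: "'a obj" assume X: "Gp R X" and Y: "Gp R Y"
  obtain C n t q where cX: "chosen_cosyzygy_seq R X = (C, n, t, q)" and C: "cosyzygy R X = C"
    and E: "exseq R X (free_mod R n) C t q" "extends R X (free_mod R n) t"
    by (rule chosen_cosyzygy[OF X]) blast
  obtain C' n' t' q' where cY: "chosen_cosyzygy_seq R Y = (C', n', t', q')" and C': "cosyzygy R Y = C'"
    and E': "exseq R Y (free_mod R n') C' t' q'" "extends R Y (free_mod R n') t'"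
    by (rule chosen_cosyzygy[OF Y]) blast
  note L = cosyzygy_ext_iff_ladder[OF cX cY] and LX = cosyzygy_ext_iff_ladder[OF cX cX]
  show "cosyzygy_ext R X X (\<lambda>x\<in>carrier X. x) (\<lambda>x\<in>carrier (cosyzygy R X). x)"
    unfolding LX[OF mod_hom_id[OF Gp_module[OF X]]] C by (rule ladder_id[OF E(1)])
  show "g \<in> mod_hom R (cosyzygy R X) (cosyzygy R Y)" if "cosyzygy_ext R X Y f g" for f g
    using that unfolding cosyzygy_ext_def cX cY Let_def case_prod_conv C C' by (rule conjunct1)
  show "\<exists>f\<in>mod_hom R X Y. cosyzygy_ext R X Y f g" if g: "g \<in> mod_hom R (cosyzygy R X) (cosyzygy R Y)" for g
  proof -
    obtain f where f: "ladder X (free_mod R n) C t q Y (free_mod R n') C' t' q' g f"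
      using ladder_lift[OF E(1) E'(1) g[unfolded C C']] by blast
    have fh: "f \<in> mod_hom R X Y" using f unfolding ladder_def by blast
    show ?thesis using f L[OF fh] fh by blast
  qed
  fix f assume f: "f \<in> mod_hom R X Y"
  show "\<exists>g. cosyzygy_ext R X Y f g" unfolding L[OF f] by (rule ladder_extend[OF E E'(1) f])
  show "f \<in> factor_free R X Y \<longleftrightarrow> g \<in> factor_free R (cosyzygy R X) (cosyzygy R Y)" if "cosyzygy_ext R X Y f g" for g
    using that unfolding L[OF f] C C' by (rule ladder_factor_free[OF E(1) E'(1) E(2), symmetric])
  show "cosyzygy_ext R X Z (compose (carrier X) f' f) (compose (carrier (cosyzygy R X)) g' g)"
    if Z: "Gp R Z" and f': "f' \<in> mod_hom R Y Z" and g: "cosyzygy_ext R X Y f g" and g': "cosyzygy_ext R Y Z f' g'" for Z f' g g'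
  proof -
    obtain C2 n2 t2 q2 where cZ: "chosen_cosyzygy_seq R Z = (C2, n2, t2, q2)" by (rule chosen_cosyzygy[OF Z]) blast
    show ?thesis
      unfolding cosyzygy_ext_iff_ladder[OF cX cZ mod_hom_compose[OF Gp_module[OF X] f f']] C
      by (rule ladder_compose[OF E(1) E'(1) g[unfolded L[OF f]] g'[unfolded cosyzygy_ext_iff_ladder[OF cY cZ f']]])
  qed
  fix f' assume f': "f' \<in> mod_hom R X Y"
  fix g g' assume g: "cosyzygy_ext R X Y f g" and g': "cosyzygy_ext R X Y f' g'"
  note lad = g[unfolded L[OF f]] g'[unfolded L[OF f']]
  show "cosyzygy_ext R X Y (\<lambda>x\<in>carrier X. f x \<oplus>\<^bsub>Y\<^esub> f' x) (\<lambda>x\<in>carrier (cosyzygy R X). g x \<oplus>\<^bsub>cosyzygy R Y\<^esub> g' x)"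
    unfolding L[OF mod_hom_add_map[OF Gp_module[OF X] Gp_module[OF Y] f f']] C C' by (rule ladder_add(1)[OF E(1) E'(1) lad])
  show "(\<lambda>x\<in>carrier X. f x \<ominus>\<^bsub>Y\<^esub> f' x) \<in> factor_free R X Y \<longleftrightarrow>
        (\<lambda>x\<in>carrier (cosyzygy R X). g x \<ominus>\<^bsub>cosyzygy R Y\<^esub> g' x) \<in> factor_free R (cosyzygy R X) (cosyzygy R Y)"
    unfolding C C' by (rule ladder_factor_free[OF E(1) E'(1) E(2) ladder_add(2)[OF E(1) E'(1) lad], symmetric])
qed

lemma stable_preadditive_G: "preadditive (stable_cat R (G_proj R))"
  by (rule stable_preadditive) (simp add: Gp_module)

lemma syzygy_pow_autoequivalence: "autoequivalence (stable_cat R (G_proj R)) (syzygy R ^^ n) (syzygy_pow_mor R n)"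
proof (induction n)
  case 0
  show ?case using preadditive.autoequivalence_id[OF stable_preadditive_G] by (simp add: id_def)
next
  case (Suc n)
  show ?case using autoequivalence_comp[OF Suc syzygy_autoequivalence] by (simp add: comp_def)
qed

lemma cosyzygy_pow_autoequivalence: "autoequivalence (stable_cat R (G_proj R)) (cosyzygy R ^^ n) (cosyzygy_pow_mor R n)"
proof (induction n)
  case 0
  show ?case using preadditive.autoequivalence_id[OF stable_preadditive_G] by (simp add: id_def)
next
  case (Suc n)
  show ?case using autoequivalence_comp[OF Suc cosyzygy_autoequivalence] by (simp add: comp_def)
qed

lemma Omega_autoequivalence: "autoequivalence (stable_cat R (G_proj R)) (Omega R i) (Omega_mor R i)"
proof (cases "i \<ge> 0")
  case True
  then have "Omega R i = syzygy R ^^ nat i" "Omega_mor R i = syzygy_pow_mor R (nat i)"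
    by (auto simp: Omega_def Omega_mor_def fun_eq_iff)
  then show ?thesis using syzygy_pow_autoequivalence by simp
next
  case False
  then have "Omega R i = cosyzygy R ^^ nat (- i)" "Omega_mor R i = cosyzygy_pow_mor R (nat (- i))"
    by (auto simp: Omega_def Omega_mor_def fun_eq_iff)
  then show ?thesis using cosyzygy_pow_autoequivalence by simp
qed

end

subsection \<open>Right approximations\<close>

context cring
begin

lemma prod_exseq:
  assumes X: "module R X" and Y: "module R Y"
  shows "exseq R X (prod_mod X Y) Y (\<lambda>x\<in>carrier X. (x, \<zero>\<^bsub>Y\<^esub>)) (\<lambda>z\<in>carrier (prod_mod X Y). snd z)"
proof -
  interpret X: module R X by (rule X)
  interpret Y: module R Y by (rule Y)
  have i: "(\<lambda>x\<in>carrier X. (x, \<zero>\<^bsub>Y\<^esub>)) \<in> mod_hom R X (prod_mod X Y)" by (rule mod_homI[OF X]) auto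
  have p: "(\<lambda>z\<in>carrier (prod_mod X Y). snd z) \<in> mod_hom R (prod_mod X Y) Y"
    by (rule mod_homI[OF prod_mod_module[OF X Y]]) auto
  have "inj_on (\<lambda>x\<in>carrier X. (x, \<zero>\<^bsub>Y\<^esub>)) (carrier X)" by (rule inj_onI) simp
  moreover have "(\<lambda>z\<in>carrier (prod_mod X Y). snd z) ` carrier (prod_mod X Y) = carrier Y"
    using X.zero_closed by force
  moreover have "(\<lambda>x\<in>carrier X. (x, \<zero>\<^bsub>Y\<^esub>)) ` carrier X = {v \<in> carrier (prod_mod X Y). (\<lambda>z\<in>carrier (prod_mod X Y). snd z) v = \<zero>\<^bsub>Y\<^esub>}"
    by auto
  ultimately show ?thesis unfolding exseq_def using X Y prod_mod_module[OF X Y] i p by blast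
qed

text \<open>Linearity of composition is what turns the maps with stably zero composite into a
  submodule.\<close>

lemma compose_hom:
  assumes X: "module R X" and Y: "module R Y" and Z: "module R Z" and e: "e \<in> mod_hom R Y Z"
  shows "(\<lambda>k\<in>carrier (Hom_mod R X Y). compose (carrier X) e k) \<in> mod_hom R (Hom_mod R X Y) (Hom_mod R X Z)"
proof (rule mod_homI[OF Hom_mod_module[OF X Y]])
  fix f assume f: "f \<in> carrier (Hom_mod R X Y)"
  then have fc: "\<And>x. x \<in> carrier X \<Longrightarrow> f x \<in> carrier Y" by (simp add: mod_hom_closed)
  show "compose (carrier X) e f \<in> carrier (Hom_mod R X Z)" using f mod_hom_compose[OF X _ e] by simp
  show "compose (carrier X) e (f \<oplus>\<^bsub>Hom_mod R X Y\<^esub> g) = compose (carrier X) e f \<oplus>\<^bsub>Hom_mod R X Z\<^esub> compose (carrier X) e g"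
    if "g \<in> carrier (Hom_mod R X Y)" for g
    unfolding Hom_mod_simps compose_def
    by (rule restrict_ext) (use that in \<open>simp add: fc mod_hom_closed mod_hom_add[OF e]\<close>)
  show "compose (carrier X) e (r \<odot>\<^bsub>Hom_mod R X Y\<^esub> f) = r \<odot>\<^bsub>Hom_mod R X Z\<^esub> compose (carrier X) e f" if "r \<in> carrier R" for r
    unfolding Hom_mod_simps compose_def
    by (rule restrict_ext) (use that in \<open>simp add: fc mod_hom_smult[OF e]\<close>)
qed

end

context noetherian_cring
begin

lemma Gp_free_mod: "Gp R (free_mod R n)"
  by (rule Gp_free[OF free_module mod_hom_id[OF free_module]]) auto

text \<open>The sum is formed on pairs and copied into the type of objects, where approximations and
  stable morphisms live.\<close>

lemma Gp_biproduct:
  assumes X: "Gp R X" and Y: "Gp R Y"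
  obtains S :: "'a obj" and i1 i2 p1 p2 where "Gp R S"
    "i1 \<in> mod_hom R X S" "i2 \<in> mod_hom R Y S" "p1 \<in> mod_hom R S X" "p2 \<in> mod_hom R S Y"
    "\<And>x. x \<in> carrier X \<Longrightarrow> p1 (i1 x) = x" "\<And>x. x \<in> carrier X \<Longrightarrow> p2 (i1 x) = \<zero>\<^bsub>Y\<^esub>"
    "\<And>y. y \<in> carrier Y \<Longrightarrow> p1 (i2 y) = \<zero>\<^bsub>X\<^esub>" "\<And>y. y \<in> carrier Y \<Longrightarrow> p2 (i2 y) = y"
    "\<And>s. s \<in> carrier S \<Longrightarrow> i1 (p1 s) \<oplus>\<^bsub>S\<^esub> i2 (p2 s) = s"
proof -
  note Xm = Gp_module[OF X] and Ym = Gp_module[OF Y]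
  interpret X: module R X by (rule Xm)
  interpret Y: module R Y by (rule Ym)
  let ?P = "prod_mod X Y"
  note Pm = prod_mod_module[OF Xm Ym]
  note E = prod_exseq[OF Xm Ym]
  note GP = Gp_extension[OF E X Y]
  obtain S :: "'a obj" and f g where S: "fg_module R S" and f: "f \<in> mod_hom R ?P S" and g: "g \<in> mod_hom R S ?P"
    and gf: "\<And>x. x \<in> carrier ?P \<Longrightarrow> g (f x) = x" and fg: "\<And>y. y \<in> carrier S \<Longrightarrow> f (g y) = y"
    using Gp_fg[OF GP] by (rule obj_copy) blast
  have Sm: "module R S" using S by (simp add: fg_module_iff)
  have a1: "(\<lambda>x\<in>carrier X. (x, \<zero>\<^bsub>Y\<^esub>)) \<in> mod_hom R X ?P" by (rule mod_homI[OF Xm]) auto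
  have a2: "(\<lambda>y\<in>carrier Y. (\<zero>\<^bsub>X\<^esub>, y)) \<in> mod_hom R Y ?P" by (rule mod_homI[OF Ym]) auto
  have b1: "(\<lambda>z\<in>carrier ?P. fst z) \<in> mod_hom R ?P X" by (rule mod_homI[OF Pm]) auto
  have b2: "(\<lambda>z\<in>carrier ?P. snd z) \<in> mod_hom R ?P Y" by (rule mod_homI[OF Pm]) auto
  let ?i1 = "compose (carrier X) f (\<lambda>x\<in>carrier X. (x, \<zero>\<^bsub>Y\<^esub>))" and ?i2 = "compose (carrier Y) f (\<lambda>y\<in>carrier Y. (\<zero>\<^bsub>X\<^esub>, y))"
  let ?p1 = "compose (carrier S) (\<lambda>z\<in>carrier ?P. fst z) g" and ?p2 = "compose (carrier S) (\<lambda>z\<in>carrier ?P. snd z) g"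
  note i1 = mod_hom_compose[OF Xm a1 f] and i2 = mod_hom_compose[OF Ym a2 f]
  note p1 = mod_hom_compose[OF Sm g b1] and p2 = mod_hom_compose[OF Sm g b2]
  have i1v: "?i1 x = f (x, \<zero>\<^bsub>Y\<^esub>)" if "x \<in> carrier X" for x using that by (simp add: compose_def)
  have i2v: "?i2 y = f (\<zero>\<^bsub>X\<^esub>, y)" if "y \<in> carrier Y" for y using that by (simp add: compose_def)
  have p1v: "?p1 s = fst (g s)" and p2v: "?p2 s = snd (g s)" if "s \<in> carrier S" for s
    using that mod_hom_closed[OF g that] by (simp_all add: compose_def)
  have 1: "?p1 (?i1 x) = x" "?p2 (?i1 x) = \<zero>\<^bsub>Y\<^esub>" if x: "x \<in> carrier X" for x
    using p1v[OF mod_hom_closed[OF i1 x]] p2v[OF mod_hom_closed[OF i1 x]] i1v[OF x] gf[of "(x, \<zero>\<^bsub>Y\<^esub>)"] x by simp_all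
  have 2: "?p1 (?i2 y) = \<zero>\<^bsub>X\<^esub>" "?p2 (?i2 y) = y" if y: "y \<in> carrier Y" for y
    using p1v[OF mod_hom_closed[OF i2 y]] p2v[OF mod_hom_closed[OF i2 y]] i2v[OF y] gf[of "(\<zero>\<^bsub>X\<^esub>, y)"] y by simp_all
  have 3: "?i1 (?p1 s) \<oplus>\<^bsub>S\<^esub> ?i2 (?p2 s) = s" if s: "s \<in> carrier S" for s
  proof -
    obtain x y where xy: "g s = (x, y)" "x \<in> carrier X" "y \<in> carrier Y" using mod_hom_closed[OF g s] by (cases "g s") auto
    have "?i1 (?p1 s) \<oplus>\<^bsub>S\<^esub> ?i2 (?p2 s) = f (x, \<zero>\<^bsub>Y\<^esub>) \<oplus>\<^bsub>S\<^esub> f (\<zero>\<^bsub>X\<^esub>, y)"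
      unfolding p1v[OF s] p2v[OF s] xy(1) fst_conv snd_conv i1v[OF xy(2)] i2v[OF xy(3)] ..
    also have "\<dots> = f (x, y)"
      using mod_hom_add[OF f, of "(x, \<zero>\<^bsub>Y\<^esub>)" "(\<zero>\<^bsub>X\<^esub>, y)"] xy(2,3) by simp
    finally show ?thesis using fg[OF s] xy(1) by simp
  qed
  \<comment> \<open>The copy is shown G-projective by viewing it, too, as an extension of
    \<open>Y\<close> by \<open>X\<close>.\<close>
  have "exseq R X S Y ?i1 ?p2"
  proof -
    have "inj_on ?i1 (carrier X)" by (rule inj_on_inverseI[where g = ?p1]) (rule 1(1))
    moreover have "?p2 ` carrier S = carrier Y"
    proof (rule subset_antisym; rule subsetI)
      show "y \<in> ?p2 ` carrier S" if y: "y \<in> carrier Y" for y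
        using imageI[OF mod_hom_closed[OF i2 y], of ?p2] unfolding 2(2)[OF y] .
    qed (erule imageE, use mod_hom_closed[OF p2] in blast)
    moreover have "?i1 ` carrier X = {s \<in> carrier S. ?p2 s = \<zero>\<^bsub>Y\<^esub>}"
    proof (rule subset_antisym; rule subsetI)
      show "s \<in> {s \<in> carrier S. ?p2 s = \<zero>\<^bsub>Y\<^esub>}" if "s \<in> ?i1 ` carrier X" for s
        using that 1(2) mod_hom_closed[OF i1] by (elim imageE) blast
      fix s assume "s \<in> {s \<in> carrier S. ?p2 s = \<zero>\<^bsub>Y\<^esub>}"
      then have s: "s \<in> carrier S" "?p2 s = \<zero>\<^bsub>Y\<^esub>" by auto
      interpret S: module R S by (rule Sm)
      have "?i1 (?p1 s) = s"
        using 3[OF s(1)] mod_hom_zero[OF Ym Sm i2] mod_hom_closed[OF i1 mod_hom_closed[OF p1 s(1)]] unfolding s(2) by simp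
      then show "s \<in> ?i1 ` carrier X" using imageI[OF mod_hom_closed[OF p1 s(1)], of ?i1] by simp
    qed
    ultimately show ?thesis unfolding exseq_def using Xm Sm Ym i1 p2 by (intro conjI)
  qed
  then have "Gp R S" using X Y by (rule Gp_extension)
  then show ?thesis by (rule that) (fact i1 i2 p1 p2 1 2 3)+
qed

text \<open>The pushout of \<open>X \<leftarrow> Z \<rightarrow> R\<^sup>n\<close> is an extension of G-projective modules, so the map it receives from
  the approximation property yields an endomorphism of \<open>X\<close> over \<open>M\<close> that annihilates \<open>g\<close> stably.\<close>

lemma approximation_annihilator:
  fixes X Z :: "'a obj"
  assumes X: "Gp R X" and M: "module R M" and \<phi>: "\<phi> \<in> mod_hom R X M"
    and approx: "\<And>(X' :: 'a obj) \<psi>. Gp R X' \<Longrightarrow> \<psi> \<in> mod_hom R X' M \<Longrightarrow> \<exists>\<chi>\<in>mod_hom R X' X. \<psi> = compose (carrier X') \<phi> \<chi>"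
    and Ez: "exseq R Z (free_mod R n) C0 t q" and xz: "extends R Z (free_mod R n) t" and C0: "Gp R C0"
    and g: "g \<in> mod_hom R Z X" and ff: "compose (carrier Z) \<phi> g \<in> factor_free R Z M"
  obtains e where "e \<in> mod_hom R X X" "\<And>x. x \<in> carrier X \<Longrightarrow> \<phi> (e x) = \<phi> x"
    "compose (carrier Z) e g \<in> factor_free R Z X"
proof -
  let ?F = "free_mod R n"
  note D = exseqD[OF Ez] and Xm = Gp_module[OF X]
  interpret Z: module R Z by (rule D(1))
  interpret X: module R X by (rule Xm)
  interpret F: module R ?F by (rule D(2))
  interpret C0: module R C0 by (rule D(3))
  interpret M: module R M by (rule M)
  obtain m a b where ab: "a \<in> mod_hom R Z (free_mod R m)" "b \<in> mod_hom R (free_mod R m) M"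
    "\<And>z. z \<in> carrier Z \<Longrightarrow> compose (carrier Z) \<phi> g z = b (a z)" using factor_freeE[OF D(1) ff] by metis
  \<comment> \<open>Extending \<open>a\<close> along \<open>t\<close> writes \<open>\<phi> g\<close>
    as \<open>k t\<close> with \<open>k\<close> defined on R^n. This commuting square lets
    \<open>\<phi>\<close> and \<open>k\<close> be glued on the pushout.\<close>
  obtain a' where a': "a' \<in> mod_hom R ?F (free_mod R m)" "\<And>z. z \<in> carrier Z \<Longrightarrow> a' (t z) = a z"
    using extends_free[OF D(1,2) xz D(4) ab(1)] by blast
  define k where "k = compose (carrier ?F) b a'"
  have k: "k \<in> mod_hom R ?F M" unfolding k_def by (rule mod_hom_compose[OF D(2) a'(1) ab(2)])
  have kt: "k (t z) = \<phi> (g z)" if z: "z \<in> carrier Z" for z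
    using z ab(3)[OF z] a'(2)[OF z] mod_hom_closed[OF D(4) z] by (simp add: k_def compose_def)
  obtain S :: "'a obj" and i1 i2 p1 p2 where S: "Gp R S"
    and s: "i1 \<in> mod_hom R X S" "i2 \<in> mod_hom R ?F S" "p1 \<in> mod_hom R S X" "p2 \<in> mod_hom R S ?F"
    and s1: "\<And>x. x \<in> carrier X \<Longrightarrow> p1 (i1 x) = x" "\<And>x. x \<in> carrier X \<Longrightarrow> p2 (i1 x) = \<zero>\<^bsub>?F\<^esub>"
    and s2: "\<And>y. y \<in> carrier ?F \<Longrightarrow> p1 (i2 y) = \<zero>\<^bsub>X\<^esub>" "\<And>y. y \<in> carrier ?F \<Longrightarrow> p2 (i2 y) = y"
    and s3: "\<And>s. s \<in> carrier S \<Longrightarrow> i1 (p1 s) \<oplus>\<^bsub>S\<^esub> i2 (p2 s) = s"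
    using X Gp_free_mod[of n] by (rule Gp_biproduct) blast
  note Sm = Gp_module[OF S]
  interpret S: module R S by (rule Sm)
  \<comment> \<open>The pushout of \<open>g\<close> and \<open>t\<close> is the cokernel of
    \<open>(g, - t)\<close> into \<open>X \<oplus> R^n\<close>.\<close>
  define j where "j = (\<lambda>z\<in>carrier Z. compose (carrier Z) i1 g z \<ominus>\<^bsub>S\<^esub> compose (carrier Z) i2 t z)"
  have j: "j \<in> mod_hom R Z S" unfolding j_def
    by (rule mod_hom_minus_map[OF D(1) Sm mod_hom_compose[OF D(1) g s(1)] mod_hom_compose[OF D(1) D(4) s(2)]])
  have gc: "g z \<in> carrier X" and tc: "t z \<in> carrier ?F" if "z \<in> carrier Z" for z
    using mod_hom_closed[OF g that] mod_hom_closed[OF D(4) that] by auto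
  have i1c: "i1 (g z) \<in> carrier S" and i2c: "i2 (t z) \<in> carrier S" if "z \<in> carrier Z" for z
    using mod_hom_closed[OF s(1) gc[OF that]] mod_hom_closed[OF s(2) tc[OF that]] by auto
  have jv: "j z = i1 (g z) \<ominus>\<^bsub>S\<^esub> i2 (t z)" if "z \<in> carrier Z" for z using that by (simp add: j_def compose_def)
  have pj: "p1 (j z) = g z" "p2 (j z) = \<ominus>\<^bsub>?F\<^esub> t z" if z: "z \<in> carrier Z" for z
    using jv[OF z] mod_hom_minus[OF Sm Xm s(3) i1c[OF z] i2c[OF z]] mod_hom_minus[OF Sm D(2) s(4) i1c[OF z] i2c[OF z]]
      s1[OF gc[OF z]] s2[OF tc[OF z]] gc[OF z] tc[OF z] by (simp_all add: a_minus_def)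
  have N: "submodule (j ` carrier Z) R S" by (rule mod_hom_image_submodule[OF D(1) Sm j Z.carrier_is_submodule])
  obtain C :: "'a obj" and f where C: "fg_module R C" "f \<in> mod_hom R S C" "f ` carrier S = carrier C"
    "\<And>x. x \<in> carrier S \<Longrightarrow> f x = \<zero>\<^bsub>C\<^esub> \<longleftrightarrow> x \<in> j ` carrier Z" using obj_quotient[OF Gp_fg[OF S] N] by blast
  have Cm: "module R C" using C(1) by (simp add: fg_module_iff)
  interpret C: module R C by (rule Cm)
  have fj: "f (j z) = \<zero>\<^bsub>C\<^esub>" if z: "z \<in> carrier Z" for z using C(4)[OF mod_hom_closed[OF j z]] z by blast
  note qp2 = mod_hom_compose[OF Sm s(4) D(6)]
  \<comment> \<open>Pushing out along \<open>g\<close> preserves the cokernel of \<open>t\<close>;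
    with \<open>C0\<close> as quotient and \<open>X\<close> as kernel, the pushout \<open>C\<close>
    becomes an extension of G-projective modules.\<close>
  obtain r where r: "r \<in> mod_hom R C C0" "\<And>x. x \<in> carrier S \<Longrightarrow> r (f x) = compose (carrier S) q p2 x"
  proof (rule mod_hom_descend[OF Sm Cm D(3) C(2,3) qp2])
    fix x assume x: "x \<in> carrier S" "f x = \<zero>\<^bsub>C\<^esub>"
    then obtain z where z: "z \<in> carrier Z" "x = j z" using C(4) by blast
    show "compose (carrier S) q p2 x = \<zero>\<^bsub>C0\<^esub>"
      using x(1) pj(2)[OF z(1)] mod_hom_neg[OF D(2,3,6) tc[OF z(1)]] exseq_zero[OF Ez z(1)] z(2) by (simp add: compose_def)
  qed blast
  have rf: "r (f x) = q (p2 x)" if "x \<in> carrier S" for x using r(2)[OF that] that by (simp add: compose_def)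
  define i where "i = compose (carrier X) f i1"
  have i: "i \<in> mod_hom R X C" unfolding i_def by (rule mod_hom_compose[OF Xm s(1) C(2)])
  have iv: "i x = f (i1 x)" if "x \<in> carrier X" for x using that by (simp add: i_def compose_def)
  have "exseq R X C C0 i r"
    unfolding exseq_def
  proof (intro conjI Xm Cm D(3) i r(1))
    show "inj_on i (carrier X)"
    proof (rule kernel_zero_inj[OF Xm Cm i])
      fix x assume x: "x \<in> carrier X" "i x = \<zero>\<^bsub>C\<^esub>"
      then obtain z where z: "z \<in> carrier Z" "i1 x = j z" using C(4)[OF mod_hom_closed[OF s(1) x(1)]] iv[OF x(1)] by auto
      have "\<ominus>\<^bsub>?F\<^esub> t z = \<zero>\<^bsub>?F\<^esub>" using s1(2)[OF x(1)] pj(2)[OF z(1)] z(2) by simp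
      then have "\<ominus>\<^bsub>?F\<^esub> (\<ominus>\<^bsub>?F\<^esub> t z) = \<ominus>\<^bsub>?F\<^esub> \<zero>\<^bsub>?F\<^esub>" by (rule arg_cong)
      then have "t z = t \<zero>\<^bsub>Z\<^esub>" using tc[OF z(1)] mod_hom_zero[OF D(1,2,4)] by simp
      then have "z = \<zero>\<^bsub>Z\<^esub>" by (rule exseq_inj[OF Ez z(1) Z.zero_closed])
      then show "x = \<zero>\<^bsub>X\<^esub>" using s1(1)[OF x(1)] pj(1)[OF z(1)] z(2) mod_hom_zero[OF D(1) Xm g] by simp
    qed
    show "r ` carrier C = carrier C0"
    proof (rule subset_antisym; rule subsetI)
      fix c assume "c \<in> carrier C0"
      then obtain v where v: "v \<in> carrier ?F" "c = q v" by (rule exseq_surj[OF Ez])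
      note i2v = mod_hom_closed[OF s(2) v(1)]
      have "c = r (f (i2 v))" using rf[OF i2v] s2(2)[OF v(1)] v(2) by simp
      then show "c \<in> r ` carrier C" using mod_hom_closed[OF C(2) i2v] by (rule image_eqI)
    qed (erule imageE, use mod_hom_closed[OF r(1)] in blast)
    show "i ` carrier X = {v \<in> carrier C. r v = \<zero>\<^bsub>C0\<^esub>}"
    proof (rule subset_antisym; rule subsetI)
      fix c assume "c \<in> i ` carrier X"
      then obtain x where x: "x \<in> carrier X" "c = i x" by (elim imageE) blast
      have "r c = \<zero>\<^bsub>C0\<^esub>"
        using x rf[OF mod_hom_closed[OF s(1) x(1)]] s1(2)[OF x(1)] mod_hom_zero[OF D(2,3,6)] iv[OF x(1)] by simp
      then show "c \<in> {v \<in> carrier C. r v = \<zero>\<^bsub>C0\<^esub>}" using x mod_hom_closed[OF i x(1)] by simp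
    next
      fix c assume "c \<in> {v \<in> carrier C. r v = \<zero>\<^bsub>C0\<^esub>}"
      then have c: "c \<in> carrier C" "r c = \<zero>\<^bsub>C0\<^esub>" by auto
      then obtain y where y: "y \<in> carrier S" "c = f y" using C(3) by blast
      have "q (p2 y) = \<zero>\<^bsub>C0\<^esub>" using c(2) rf[OF y(1)] y(2) by simp
      then obtain z where z: "z \<in> carrier Z" "p2 y = t z" by (rule exseq_exact[OF Ez mod_hom_closed[OF s(4) y(1)]])
      let ?x = "p1 y \<oplus>\<^bsub>X\<^esub> g z"
      note p1y = mod_hom_closed[OF s(3) y(1)]
      have xc: "?x \<in> carrier X" using p1y gc[OF z(1)] by simp
      have cl: "i1 (p1 y) \<in> carrier S" "i1 (g z) \<in> carrier S" "i2 (t z) \<in> carrier S"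
        using mod_hom_closed[OF s(1) p1y] i1c[OF z(1)] i2c[OF z(1)] by auto
      have "i1 ?x = (i1 (p1 y) \<oplus>\<^bsub>S\<^esub> i2 (t z)) \<oplus>\<^bsub>S\<^esub> j z"
        using cl S.add_sub_cancel[of "i1 (g z)" "i2 (t z)"] unfolding jv[OF z(1)] mod_hom_add[OF s(1) p1y gc[OF z(1)]]
        by (simp add: a_minus_def S.a_ac S.r_neg1 S.r_neg2)
      then have "i1 ?x = y \<oplus>\<^bsub>S\<^esub> j z" using s3[OF y(1)] z(2) by simp
      then have "i ?x = f y" using iv[OF xc] mod_hom_add[OF C(2) y(1) mod_hom_closed[OF j z(1)]] fj[OF z(1)] mod_hom_closed[OF C(2) y(1)] by simp
      then show "c \<in> i ` carrier X" using xc y(2) by (metis imageI)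
    qed
  qed
  then have GC: "Gp R C" using X C0 by (rule Gp_extension)
  \<comment> \<open>On the image of \<open>j\<close> this map is \<open>\<phi> g - k t = 0\<close>,
    so it descends to the pushout, where the approximation property factors it through
    \<open>\<phi>\<close>.\<close>
  define w where "w = (\<lambda>x\<in>carrier S. compose (carrier S) \<phi> p1 x \<oplus>\<^bsub>M\<^esub> compose (carrier S) k p2 x)"
  have w: "w \<in> mod_hom R S M" unfolding w_def
    by (rule mod_hom_add_map[OF Sm M mod_hom_compose[OF Sm s(3) \<phi>] mod_hom_compose[OF Sm s(4) k]])
  have wv: "w x = \<phi> (p1 x) \<oplus>\<^bsub>M\<^esub> k (p2 x)" if "x \<in> carrier S" for x using that by (simp add: w_def compose_def)
  obtain \<psi> where \<psi>: "\<psi> \<in> mod_hom R C M" "\<And>x. x \<in> carrier S \<Longrightarrow> \<psi> (f x) = w x"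
  proof (rule mod_hom_descend[OF Sm Cm M C(2,3) w])
    fix x assume x: "x \<in> carrier S" "f x = \<zero>\<^bsub>C\<^esub>"
    then obtain z where z: "z \<in> carrier Z" "x = j z" using C(4) by blast
    have "w x = \<phi> (g z) \<ominus>\<^bsub>M\<^esub> k (t z)"
      using wv[OF x(1)] pj[OF z(1)] z(2) mod_hom_neg[OF D(2) M k tc[OF z(1)]] by (simp add: a_minus_def)
    then show "w x = \<zero>\<^bsub>M\<^esub>" using kt[OF z(1)] mod_hom_closed[OF \<phi> gc[OF z(1)]] by simp
  qed blast
  obtain d where d: "d \<in> mod_hom R C X" "\<psi> = compose (carrier C) \<phi> d" using approx[OF GC \<psi>(1)] by blast
  define e where "e = compose (carrier X) d i"
  have e: "e \<in> mod_hom R X X" unfolding e_def by (rule mod_hom_compose[OF Xm i d(1)])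
  have ev: "e x = d (f (i1 x))" if "x \<in> carrier X" for x using that iv[OF that] by (simp add: e_def compose_def)
  show ?thesis
  proof (rule that[OF e])
    fix x assume x: "x \<in> carrier X"
    note i1x = mod_hom_closed[OF s(1) x]
    have "\<phi> (e x) = \<psi> (f (i1 x))" using ev[OF x] d(2) mod_hom_closed[OF C(2) i1x] by (simp add: compose_def)
    also have "\<dots> = \<phi> x"
      using \<psi>(2)[OF i1x] wv[OF i1x] s1[OF x] mod_hom_zero[OF D(2) M k] mod_hom_closed[OF \<phi> x] by simp
    finally show "\<phi> (e x) = \<phi> x" .
  next
    note df = mod_hom_compose[OF D(2) s(2) mod_hom_compose[OF Sm C(2) d(1)]]
    show "compose (carrier Z) e g \<in> factor_free R Z X"
    proof (rule factor_freeI[OF D(1,4) df mod_hom_compose[OF D(1) g e]])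
      fix z assume z: "z \<in> carrier Z"
      \<comment> \<open>In the pushout the images of \<open>g\<close> and \<open>t\<close> coincide,
        so \<open>e g\<close> factors through \<open>t\<close> and hence through R^n.\<close>
      have "f (i1 (g z)) \<ominus>\<^bsub>C\<^esub> f (i2 (t z)) = \<zero>\<^bsub>C\<^esub>"
        using fj[OF z] jv[OF z] mod_hom_minus[OF Sm Cm C(2) i1c[OF z] i2c[OF z]] by simp
      then have "f (i1 (g z)) = f (i2 (t z))" using mod_hom_closed[OF C(2) i1c[OF z]] mod_hom_closed[OF C(2) i2c[OF z]] by simp
      then show "compose (carrier Z) e g z = compose (carrier ?F) (compose (carrier S) d f) i2 (t z)"
        using z ev[OF gc[OF z]] tc[OF z] i2c[OF z] by (simp add: compose_def)
    qed
  qed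
qed

end

section \<open>From approximations to split functors, and back from generators\<close>

context noetherian_local_cring
begin

lemma approximation_splitting:
  fixes X :: "'a obj"
  assumes X: "Gp R X" and M: "fg_module R M" and \<phi>: "\<phi> \<in> mod_hom R X M"
    and approx: "\<And>(X' :: 'a obj) \<psi>. Gp R X' \<Longrightarrow> \<psi> \<in> mod_hom R X' M \<Longrightarrow> \<exists>\<chi>\<in>mod_hom R X' X. \<psi> = compose (carrier X') \<phi> \<chi>"
  obtains e where "e \<in> mod_hom R X X" "\<And>x. x \<in> carrier X \<Longrightarrow> \<phi> (e x) = \<phi> x"
    "\<And>(Z :: 'a obj) g. Gp R Z \<Longrightarrow> g \<in> mod_hom R Z X \<Longrightarrow> compose (carrier Z) \<phi> g \<in> factor_free R Z M \<Longrightarrow>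
      compose (carrier Z) e g \<in> factor_free R Z X"
proof -
  have Mm: "module R M" using M by (simp add: fg_module_iff)
  note Xm = Gp_module[OF X]
  interpret M: module R M by (rule Mm)
  interpret X: module R X by (rule Xm)
  have ann: "\<exists>e\<in>mod_hom R X X. (\<forall>x\<in>carrier X. \<phi> (e x) = \<phi> x) \<and> compose (carrier Z) e g \<in> factor_free R Z X"
    if Z: "Gp R Z" and g: "g \<in> mod_hom R Z X" and ff: "compose (carrier Z) \<phi> g \<in> factor_free R Z M" for Z :: "'a obj" and g
  proof -
    obtain C :: "'a obj" and n t q where C: "exseq R Z (free_mod R n) C t q" "extends R Z (free_mod R n) t" "Gp R C"
      by (rule chosen_cosyzygy[OF Z]) blast
    show ?thesis using approximation_annihilator[OF X Mm \<phi> approx C g ff] by metis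
  qed
  let ?H = "Hom_mod R X X"
  note Hm = Hom_mod_module[OF Xm Xm]
  let ?c = "\<lambda>k\<in>carrier ?H. compose (carrier X) \<phi> k"
  \<comment> \<open>\<open>K\<close> is a submodule of the Noetherian module of endomorphisms of
    \<open>X\<close>, being the preimage of a submodule under composition with
    \<open>\<phi>\<close>.\<close>
  define K where "K = {k \<in> carrier ?H. ?c k \<in> factor_free R X M}"
  have "submodule K R ?H" unfolding K_def
    by (rule mod_hom_preimage_submodule[OF Hm Hom_mod_module[OF Xm Mm] compose_hom[OF Xm Xm Mm \<phi>] factor_free_submodule[OF Xm Mm]])
  then have "fg_sub R ?H K" by (rule noeth_modD[OF noeth_Hom[OF Gp_fg[OF X] Gp_fg[OF X]]])
  then obtain m p where p: "p \<in> mod_hom R (free_mod R m) ?H" "p ` carrier (free_mod R m) = K" unfolding fg_sub_def by blast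
  have pK: "p v \<in> mod_hom R X X" "compose (carrier X) \<phi> (p v) \<in> factor_free R X M" if "v \<in> carrier (free_mod R m)" for v
    using imageI[OF that, of p] unfolding p(2) K_def by auto
  \<comment> \<open>Generators are killed one at a time. The annihilator \<open>e'\<close> is taken
    for \<open>e\<close> composed with the next generator, whose composite with
    \<open>\<phi>\<close> is still stably zero because \<open>\<phi> e = \<phi>\<close>; then
    \<open>e' e\<close> keeps killing the earlier generators.\<close>
  have "\<exists>e\<in>mod_hom R X X. (\<forall>x\<in>carrier X. \<phi> (e x) = \<phi> x) \<and>
      (\<forall>l<j. compose (carrier X) e (p (free_basis R m l)) \<in> factor_free R X X)" for j
  proof (induction j)
    case 0
    show ?case by (rule bexI[OF _ mod_hom_id[OF Xm]]) simp
  next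
    case (Suc j)
    then obtain e where e: "e \<in> mod_hom R X X" "\<And>x. x \<in> carrier X \<Longrightarrow> \<phi> (e x) = \<phi> x"
      "\<And>l. l < j \<Longrightarrow> compose (carrier X) e (p (free_basis R m l)) \<in> factor_free R X X" by blast
    note pb = pK[OF free_basis_carrier]
    let ?g = "compose (carrier X) e (p (free_basis R m j))"
    have g: "?g \<in> mod_hom R X X" by (rule mod_hom_compose[OF Xm pb(1) e(1)])
    have "compose (carrier X) \<phi> ?g = compose (carrier X) \<phi> (p (free_basis R m j))"
      unfolding compose_eq_iff using e(2) mod_hom_closed[OF pb(1)] by (simp add: compose_def)
    then have "compose (carrier X) \<phi> ?g \<in> factor_free R X M" using pb(2) by simp
    from ann[OF X g this] obtain e' where e': "e' \<in> mod_hom R X X" "\<And>x. x \<in> carrier X \<Longrightarrow> \<phi> (e' x) = \<phi> x"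
      "compose (carrier X) e' ?g \<in> factor_free R X X" by blast
    have *: "compose (carrier X) (compose (carrier X) e' e) (p (free_basis R m l)) = compose (carrier X) e' (compose (carrier X) e (p (free_basis R m l)))" for l
      unfolding compose_eq_iff using mod_hom_closed[OF pb(1)] by (simp add: compose_def)
    have "compose (carrier X) (compose (carrier X) e' e) (p (free_basis R m l)) \<in> factor_free R X X" if l: "l < Suc j" for l
    proof (cases "l = j")
      case True then show ?thesis using e'(3) unfolding * by simp
    next
      case False
      then have "l < j" using l by simp
      show ?thesis unfolding *
        by (rule factor_free_compose[OF Xm Xm mod_hom_compose[OF Xm pb(1) e(1)] e'(1) disjI1[OF e(3)[OF \<open>l < j\<close>]]])
    qed
    moreover have "\<phi> (compose (carrier X) e' e x) = \<phi> x" if x: "x \<in> carrier X" for x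
      using e(2)[OF x] e'(2)[OF mod_hom_closed[OF e(1) x]] x by (simp add: compose_def)
    ultimately show ?case using mod_hom_compose[OF Xm e(1) e'(1)] by blast
  qed
  from this[of m] obtain e where e: "e \<in> mod_hom R X X" "\<And>x. x \<in> carrier X \<Longrightarrow> \<phi> (e x) = \<phi> x"
    "\<And>l. l < m \<Longrightarrow> compose (carrier X) e (p (free_basis R m l)) \<in> factor_free R X X" by blast
  have eK: "compose (carrier X) e k \<in> factor_free R X X" if k: "k \<in> K" for k
  proof -
    let ?ep = "compose (carrier (free_mod R m)) (\<lambda>k\<in>carrier ?H. compose (carrier X) e k) p"
    have ep: "?ep \<in> mod_hom R (free_mod R m) ?H" by (rule mod_hom_compose[OF free_module p(1) compose_hom[OF Xm Xm Xm e(1)]])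
    have epv: "?ep v = compose (carrier X) e (p v)" if "v \<in> carrier (free_mod R m)" for v
      using that pK(1)[OF that] by (simp add: compose_def)
    let ?N = "{v \<in> carrier (free_mod R m). ?ep v \<in> factor_free R X X}"
    have N: "submodule ?N R (free_mod R m)" by (rule mod_hom_preimage_submodule[OF free_module Hm ep factor_free_submodule[OF Xm Xm]])
    obtain v where v: "v \<in> carrier (free_mod R m)" "k = p v" using k p(2) by blast
    have "v \<in> ?N"
    proof (rule free_spanned[OF N _ v(1)])
      fix l assume "l < m"
      then show "free_basis R m l \<in> ?N" using e(3) epv[OF free_basis_carrier] free_basis_carrier by simp
    qed
    then show ?thesis using epv[OF v(1)] v(2) by simp
  qed
  show ?thesis
  proof (rule that[OF e(1,2)])
    fix Z :: "'a obj" and g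
    assume Z: "Gp R Z" and g: "g \<in> mod_hom R Z X" and ff: "compose (carrier Z) \<phi> g \<in> factor_free R Z M"
    note Zm = Gp_module[OF Z]
    from ann[OF Z g ff] obtain e' where e': "e' \<in> mod_hom R X X" "\<And>x. x \<in> carrier X \<Longrightarrow> \<phi> (e' x) = \<phi> x"
      "compose (carrier Z) e' g \<in> factor_free R Z X" by blast
    let ?k = "\<lambda>x\<in>carrier X. (\<lambda>x\<in>carrier X. x) x \<ominus>\<^bsub>X\<^esub> e' x"
    have k: "?k \<in> mod_hom R X X" by (rule mod_hom_minus_map[OF Xm Xm mod_hom_id[OF Xm] e'(1)])
    have "compose (carrier X) \<phi> ?k = (\<lambda>x\<in>carrier X. \<zero>\<^bsub>M\<^esub>)"
      unfolding compose_def
    proof (rule restrict_ext)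
      fix x assume x: "x \<in> carrier X"
      show "\<phi> (?k x) = \<zero>\<^bsub>M\<^esub>"
        using x e'(2)[OF x] mod_hom_minus[OF Xm Mm \<phi> x mod_hom_closed[OF e'(1) x]] mod_hom_closed[OF \<phi> x] by simp
    qed
    then have "?k \<in> K" using k zero_factor_free[OF Xm Mm] unfolding K_def by simp
    note f1 = factor_free_compose[OF Zm Xm g mod_hom_compose[OF Xm k e(1)] disjI2[OF eK[OF \<open>?k \<in> K\<close>]]]
    note f2 = factor_free_compose[OF Zm Xm factor_free_hom[OF Zm e'(3)] e(1) disjI1[OF e'(3)]]
    interpret H: module R "Hom_mod R Z X" by (rule Hom_mod_module[OF Zm Xm])
    have sum: "compose (carrier Z) (compose (carrier X) e ?k) g \<oplus>\<^bsub>Hom_mod R Z X\<^esub> compose (carrier Z) e (compose (carrier Z) e' g) =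
        compose (carrier Z) e g"
      unfolding Hom_mod_simps
    proof (rule mod_hom_eqI[OF mod_hom_add_map[OF Zm Xm factor_free_hom[OF Zm f1] factor_free_hom[OF Zm f2]] mod_hom_compose[OF Zm g e(1)]])
      fix z assume z: "z \<in> carrier Z"
      note gz = mod_hom_closed[OF g z]
      note egz = mod_hom_closed[OF e'(1) gz]
      show "(\<lambda>x\<in>carrier Z. compose (carrier Z) (compose (carrier X) e ?k) g x \<oplus>\<^bsub>X\<^esub> compose (carrier Z) e (compose (carrier Z) e' g) x) z =
          compose (carrier Z) e g z"
        using z gz mod_hom_minus[OF Xm Xm e(1) gz egz] X.sub_add_cancel[OF mod_hom_closed[OF e(1) gz] mod_hom_closed[OF e(1) egz]]
        by (simp add: compose_def)
    qed
    show "compose (carrier Z) e g \<in> factor_free R Z X"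
      using H.submoduleE(5)[OF factor_free_submodule[OF Zm Xm] f1 f2] unfolding sum .
  qed
qed

lemma right_approximation_split_generated:
  assumes M: "fg_module R M" and "has_right_approximation R (G_proj R) M"
  shows "split_generated (stable_cat R (G_proj R)) (stable_functor M)"
proof -
  have Mm: "module R M" using M by (simp add: fg_module_iff)
  obtain X :: "'a obj" and \<phi> where X: "Gp R X" and \<phi>: "\<phi> \<in> mod_hom R X M"
    and approx: "\<And>(X' :: 'a obj) \<psi>. Gp R X' \<Longrightarrow> \<psi> \<in> mod_hom R X' M \<Longrightarrow> \<exists>\<chi>\<in>mod_hom R X' X. \<psi> = compose (carrier X') \<phi> \<chi>"
    using assms(2) unfolding has_right_approximation_def Ball_def Bex_def G_proj_iff by (elim exE conjE) blast
  note Xm = Gp_module[OF X]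
  obtain e where e: "e \<in> mod_hom R X X" "\<And>x. x \<in> carrier X \<Longrightarrow> \<phi> (e x) = \<phi> x"
    "\<And>(Z :: 'a obj) g. Gp R Z \<Longrightarrow> g \<in> mod_hom R Z X \<Longrightarrow> compose (carrier Z) \<phi> g \<in> factor_free R Z M \<Longrightarrow>
      compose (carrier Z) e g \<in> factor_free R Z X"
    by (rule approximation_splitting[OF X M \<phi> approx]) blast+
  let ?x = "stable_class R X M \<phi>" and ?e = "stable_class R X X e"
  have gen: "generated_by (stable_cat R (G_proj R)) (stable_functor M) X ?x"
    unfolding generated_by_def stable_cat_simps stable_functor_simps G_proj_iff
  proof (intro conjI ballI X stable_class_closed \<phi>)
    fix Z z assume "Z \<in> G_proj R" and z: "z \<in> carrier (stable_hom R Z M)"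
    then have Z: "Gp R Z" by simp
    obtain \<psi> where \<psi>: "\<psi> \<in> mod_hom R Z M" "z = stable_class R Z M \<psi>" using z by (rule stable_carrierE)
    obtain \<chi> where \<chi>: "\<chi> \<in> mod_hom R Z X" "\<psi> = compose (carrier Z) \<phi> \<chi>" using approx[OF Z \<psi>(1)] by blast
    have "z = stable_comp R Z X M ?x (stable_class R Z X \<chi>)"
      unfolding \<psi>(2) \<chi>(2) by (rule stable_comp_class[OF Gp_module[OF Z] Xm Mm \<chi>(1) \<phi>, symmetric])
    then show "\<exists>g\<in>carrier (stable_hom R Z X). z = stable_comp R Z X M ?x g" using stable_class_closed[OF \<chi>(1)] by blast
  qed
  have "compose (carrier X) \<phi> e = \<phi>"
    by (rule mod_hom_eqI[OF mod_hom_compose[OF Xm e(1) \<phi>] \<phi>]) (simp add: compose_def e(2))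
  then have fixed: "stable_comp R X X M ?x ?e = ?x" using stable_comp_class[OF Xm Xm Mm e(1) \<phi>] by simp
  have ker: "stable_comp R Z X X ?e \<gamma> = \<one>\<^bsub>stable_hom R Z X\<^esub>"
    if Z: "Gp R Z" and \<gamma>: "\<gamma> \<in> carrier (stable_hom R Z X)" and one: "stable_comp R Z X M ?x \<gamma> = \<one>\<^bsub>stable_hom R Z M\<^esub>" for Z :: "'a obj" and \<gamma>
  proof -
    note Zm = Gp_module[OF Z]
    obtain g where g: "g \<in> mod_hom R Z X" "\<gamma> = stable_class R Z X g" using \<gamma> by (rule stable_carrierE)
    have "compose (carrier Z) \<phi> g \<in> factor_free R Z M"
      using one unfolding g(2) stable_comp_class[OF Zm Xm Mm g(1) \<phi>] stable_one_iff[OF Zm Mm mod_hom_compose[OF Zm g(1) \<phi>]] .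
    then show ?thesis
      unfolding g(2) stable_comp_class[OF Zm Xm Xm g(1) e(1)] stable_one_iff[OF Zm Xm mod_hom_compose[OF Zm g(1) e(1)]]
      by (rule e(3)[OF Z g(1)])
  qed
  show ?thesis
    unfolding split_generated_def
  proof (intro conjI exI[of _ X] exI[of _ ?x])
    show "right_module (stable_cat R (G_proj R)) (stable_functor M)"
      by (rule stable_functor_right_module[OF _ Mm]) (simp add: Gp_module)
    show "\<exists>e\<in>carrier (chom (stable_cat R (G_proj R)) X X). fmap (stable_functor M) X X e ?x = ?x \<and>
       (\<forall>Z\<in>cobj (stable_cat R (G_proj R)). \<forall>g\<in>carrier (chom (stable_cat R (G_proj R)) Z X).
          fmap (stable_functor M) Z X g ?x = \<one>\<^bsub>fobj (stable_functor M) Z\<^esub> \<longrightarrow>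
          ccomp (stable_cat R (G_proj R)) Z X X e g = \<one>\<^bsub>chom (stable_cat R (G_proj R)) Z X\<^esub>)"
      unfolding stable_cat_simps stable_functor_simps using stable_class_closed[OF e(1)] fixed ker by auto
  qed (rule gen)
qed

text \<open>Stable generation factors a map to \<open>M\<close> through \<open>\<phi>\<close> up to
  an error that passes through a free module. The error lifts along the cover \<open>\<pi>\<close>,
  so \<open>X \<oplus> R^m\<close> receives the whole map.\<close>

lemma generated_right_approximation:
  assumes M: "fg_module R M" and gen: "generated_by (stable_cat R (G_proj R)) (stable_functor M) X x"
  shows "has_right_approximation R (G_proj R) M"
proof -
  have Mm: "module R M" using M by (simp add: fg_module_iff)
  interpret M: module R M by (rule Mm)
  have X: "Gp R X" and x: "x \<in> carrier (stable_hom R X M)"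
    and g: "\<And>(Z :: 'a obj) z. Gp R Z \<Longrightarrow> z \<in> carrier (stable_hom R Z M) \<Longrightarrow> \<exists>g\<in>carrier (stable_hom R Z X). z = stable_comp R Z X M x g"
    using gen unfolding generated_by_def stable_cat_simps stable_functor_simps G_proj_iff by (simp_all add: Ball_def)
  note Xm = Gp_module[OF X]
  obtain \<phi> where \<phi>: "\<phi> \<in> mod_hom R X M" "x = stable_class R X M \<phi>" using x by (rule stable_carrierE)
  obtain m \<pi> where \<pi>: "\<pi> \<in> mod_hom R (free_mod R m) M" "\<pi> ` carrier (free_mod R m) = carrier M"
    using M by (rule fg_coverE)
  let ?F = "free_mod R m"
  interpret X: module R X by (rule Xm)
  interpret F: module R ?F by (rule free_module)
  obtain S :: "'a obj" and i1 i2 p1 p2 where S: "Gp R S"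
    and s: "i1 \<in> mod_hom R X S" "i2 \<in> mod_hom R ?F S" "p1 \<in> mod_hom R S X" "p2 \<in> mod_hom R S ?F"
    and s1: "\<And>x. x \<in> carrier X \<Longrightarrow> p1 (i1 x) = x" "\<And>x. x \<in> carrier X \<Longrightarrow> p2 (i1 x) = \<zero>\<^bsub>?F\<^esub>"
    and s2: "\<And>y. y \<in> carrier ?F \<Longrightarrow> p1 (i2 y) = \<zero>\<^bsub>X\<^esub>" "\<And>y. y \<in> carrier ?F \<Longrightarrow> p2 (i2 y) = y"
    using X Gp_free_mod[of m] by (rule Gp_biproduct) blast
  note Sm = Gp_module[OF S]
  define w where "w = (\<lambda>x\<in>carrier S. compose (carrier S) \<phi> p1 x \<oplus>\<^bsub>M\<^esub> compose (carrier S) \<pi> p2 x)"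
  have w: "w \<in> mod_hom R S M" unfolding w_def
    by (rule mod_hom_add_map[OF Sm Mm mod_hom_compose[OF Sm s(3) \<phi>(1)] mod_hom_compose[OF Sm s(4) \<pi>(1)]])
  have wv: "w x = \<phi> (p1 x) \<oplus>\<^bsub>M\<^esub> \<pi> (p2 x)" if "x \<in> carrier S" for x using that by (simp add: w_def compose_def)
  have "\<exists>\<chi>\<in>mod_hom R X' S. \<psi> = compose (carrier X') w \<chi>" if X': "Gp R X'" and \<psi>: "\<psi> \<in> mod_hom R X' M" for X' :: "'a obj" and \<psi>
  proof -
    note X'm = Gp_module[OF X']
    obtain \<gamma> where \<gamma>: "\<gamma> \<in> carrier (stable_hom R X' X)" "stable_class R X' M \<psi> = stable_comp R X' X M x \<gamma>"
      using g[OF X' stable_class_closed[OF \<psi>]] by blast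
    obtain h where h: "h \<in> mod_hom R X' X" "\<gamma> = stable_class R X' X h" using \<gamma>(1) by (rule stable_carrierE)
    note \<phi>h = mod_hom_compose[OF X'm h(1) \<phi>(1)]
    have "stable_class R X' M \<psi> = stable_class R X' M (compose (carrier X') \<phi> h)"
      using \<gamma>(2) unfolding h(2) \<phi>(2) stable_comp_class[OF X'm Xm Mm h(1) \<phi>(1)] .
    then have df: "(\<lambda>x\<in>carrier X'. \<psi> x \<ominus>\<^bsub>M\<^esub> compose (carrier X') \<phi> h x) \<in> factor_free R X' M"
      unfolding stable_class_mem(3)[OF X'm Mm \<phi>h \<psi>] .
    obtain n a b where ab: "a \<in> mod_hom R X' (free_mod R n)" "b \<in> mod_hom R (free_mod R n) M"
      "\<And>x. x \<in> carrier X' \<Longrightarrow> (\<lambda>x\<in>carrier X'. \<psi> x \<ominus>\<^bsub>M\<^esub> compose (carrier X') \<phi> h x) x = b (a x)"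
      by (rule factor_freeE[OF X'm df]) (rule that)
    obtain c where c: "c \<in> mod_hom R (free_mod R n) ?F" "\<And>v. v \<in> carrier (free_mod R n) \<Longrightarrow> \<pi> (c v) = b v"
      using free_projective[OF free_module Mm \<pi> ab(2)] by blast
    note ca = mod_hom_compose[OF X'm ab(1) c(1)]
    let ?\<chi> = "\<lambda>x\<in>carrier X'. compose (carrier X') i1 h x \<oplus>\<^bsub>S\<^esub> compose (carrier X') i2 (compose (carrier X') c a) x"
    have \<chi>: "?\<chi> \<in> mod_hom R X' S"
      by (rule mod_hom_add_map[OF X'm Sm mod_hom_compose[OF X'm h(1) s(1)] mod_hom_compose[OF X'm ca s(2)]])
    have "\<psi> = compose (carrier X') w ?\<chi>"
    proof (rule mod_hom_eqI[OF \<psi> mod_hom_compose[OF X'm \<chi> w]])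
      fix x assume x: "x \<in> carrier X'"
      note hx = mod_hom_closed[OF h(1) x] and ax = mod_hom_closed[OF ab(1) x]
      note cax = mod_hom_closed[OF c(1) ax]
      note i1h = mod_hom_closed[OF s(1) hx] and i2c = mod_hom_closed[OF s(2) cax]
      have \<chi>x: "?\<chi> x = i1 (h x) \<oplus>\<^bsub>S\<^esub> i2 (c (a x))" using x by (simp add: compose_def)
      have "p1 (?\<chi> x) = h x" "p2 (?\<chi> x) = c (a x)"
        unfolding \<chi>x mod_hom_add[OF s(3) i1h i2c] mod_hom_add[OF s(4) i1h i2c] s1[OF hx] s2[OF cax]
        using hx cax by simp_all
      then have "w (?\<chi> x) = \<phi> (h x) \<oplus>\<^bsub>M\<^esub> (\<psi> x \<ominus>\<^bsub>M\<^esub> \<phi> (h x))"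
        using wv[OF mod_hom_closed[OF \<chi> x]] c(2)[OF ax] ab(3)[OF x] x by (simp add: compose_def)
      also have "\<dots> = \<psi> x"
        using M.sub_add_cancel[OF mod_hom_closed[OF \<psi> x] mod_hom_closed[OF \<phi>(1) hx]] mod_hom_closed[OF \<psi> x] mod_hom_closed[OF \<phi>(1) hx]
        by (simp add: M.a_comm)
      finally show "\<psi> x = compose (carrier X') w ?\<chi> x" using x by (simp add: compose_def)
    qed
    then show ?thesis using \<chi> by blast
  qed
  then show ?thesis unfolding has_right_approximation_def using S w by (metis G_proj_iff)
qed

lemma stable_additive: "additive_category (stable_cat R (G_proj R))"
proof -
  interpret preadditive "stable_cat R (G_proj R)" by (rule stable_preadditive_G)
  show ?thesis
  proof (unfold_locales, unfold stable_cat_simps G_proj_iff)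
    fix X Y :: "'a obj" assume X: "Gp R X" and Y: "Gp R Y"
    obtain S :: "'a obj" and i1 i2 p1 p2 where S: "Gp R S"
      and s: "i1 \<in> mod_hom R X S" "i2 \<in> mod_hom R Y S" "p1 \<in> mod_hom R S X" "p2 \<in> mod_hom R S Y"
      and s1: "\<And>x. x \<in> carrier X \<Longrightarrow> p1 (i1 x) = x" "\<And>x. x \<in> carrier X \<Longrightarrow> p2 (i1 x) = \<zero>\<^bsub>Y\<^esub>"
      and s2: "\<And>y. y \<in> carrier Y \<Longrightarrow> p1 (i2 y) = \<zero>\<^bsub>X\<^esub>" "\<And>y. y \<in> carrier Y \<Longrightarrow> p2 (i2 y) = y"
      using X Y by (rule Gp_biproduct) blast
    note m = Gp_module[OF X] Gp_module[OF Y] Gp_module[OF S]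
    have "compose (carrier X) p1 i1 = (\<lambda>x\<in>carrier X. x)" "compose (carrier Y) p2 i2 = (\<lambda>y\<in>carrier Y. y)"
      "compose (carrier Y) p1 i2 = (\<lambda>y\<in>carrier Y. \<zero>\<^bsub>X\<^esub>)" "compose (carrier X) p2 i1 = (\<lambda>x\<in>carrier X. \<zero>\<^bsub>Y\<^esub>)"
      unfolding compose_def using s1 s2 by (auto intro!: restrict_ext)
    then have "stable_comp R X S X (stable_class R S X p1) (stable_class R X S i1) = stable_class R X X (\<lambda>x\<in>carrier X. x)"
      "stable_comp R Y S Y (stable_class R S Y p2) (stable_class R Y S i2) = stable_class R Y Y (\<lambda>x\<in>carrier Y. x)"
      "stable_comp R Y S X (stable_class R S X p1) (stable_class R Y S i2) = \<one>\<^bsub>stable_hom R Y X\<^esub>"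
      "stable_comp R X S Y (stable_class R S Y p2) (stable_class R X S i1) = \<one>\<^bsub>stable_hom R X Y\<^esub>"
      using stable_comp_class[OF m(1,3,1) s(1,3)] stable_comp_class[OF m(2,3,2) s(2,4)]
        stable_comp_class[OF m(2,3,1) s(2,3)] stable_comp_class[OF m(1,3,2) s(1,4)]
        stable_one_iff[OF m(1,2) mod_hom_zero_map[OF m(1,2)]] stable_one_iff[OF m(2,1) mod_hom_zero_map[OF m(2,1)]]
        zero_factor_free[OF m(1,2)] zero_factor_free[OF m(2,1)] by simp_all
    then show "\<exists>S\<in>G_proj R. \<exists>i1\<in>carrier (stable_hom R X S). \<exists>i2\<in>carrier (stable_hom R Y S).
      \<exists>p1\<in>carrier (stable_hom R S X). \<exists>p2\<in>carrier (stable_hom R S Y).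
        stable_comp R X S X p1 i1 = stable_class R X X (\<lambda>x\<in>carrier X. x) \<and>
        stable_comp R Y S Y p2 i2 = stable_class R Y Y (\<lambda>x\<in>carrier Y. x) \<and>
        stable_comp R Y S X p1 i2 = \<one>\<^bsub>stable_hom R Y X\<^esub> \<and> stable_comp R X S Y p2 i1 = \<one>\<^bsub>stable_hom R X Y\<^esub>"
      by (intro bexI[of _ S] bexI[OF _ stable_class_closed[OF s(1)]] bexI[OF _ stable_class_closed[OF s(2)]]
          bexI[OF _ stable_class_closed[OF s(3)]] bexI[OF _ stable_class_closed[OF s(4)]] conjI) (simp_all add: S)
  qed
qed

lemma Tate_Ext_split_generated:
  assumes "fg_module R M" "has_right_approximation R (G_proj R) M"
  shows "split_generated (stable_cat R (G_proj R)) (Tate_Ext R i M)"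
  unfolding Tate_Ext_pullback
  by (rule autoequivalence.split_generated_pullback[OF Omega_autoequivalence right_approximation_split_generated[OF assms]])

lemma Tate_Ext_generated_approximation:
  assumes M: "fg_module R M" and fg: "fin_generated (stable_cat R (G_proj R)) (Tate_Ext R i M)"
  shows "has_right_approximation R (G_proj R) M"
proof -
  obtain X x where "generated_by (stable_cat R (G_proj R)) (Tate_Ext R i M) X x"
    using preadditive.fin_generatedD(2)[OF stable_preadditive_G fg] by blast
  then have "generated_by (stable_cat R (G_proj R)) (pullback (Omega R i) (Omega_mor R i) (stable_functor M)) X x"
    unfolding Tate_Ext_pullback .
  moreover have "right_module (stable_cat R (G_proj R)) (stable_functor M)"
    by (rule stable_functor_right_module) (use M in \<open>simp_all add: Gp_module fg_module_iff\<close>)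
  ultimately have "generated_by (stable_cat R (G_proj R)) (stable_functor M) (Omega R i X) x"
    by (intro autoequivalence.generated_by_pullback[OF Omega_autoequivalence])
  then show ?thesis by (rule generated_right_approximation[OF M])
qed

end

theorem theorem7p5:
  fixes R :: "('a,'r) ring_scheme" and M :: "('a,'m,'s) module_scheme"
  assumes "noetherian_ring R"
    and "henselian_local_ring R"
    and "fg_module R M"
  shows "(has_right_approximation R (G_proj R) M \<longleftrightarrow>
            (\<forall>i. fin_generated (stable_cat R (G_proj R)) (Tate_Ext R i M))) \<and>
         (has_right_approximation R (G_proj R) M \<longleftrightarrow>
            (\<exists>i. fin_generated (stable_cat R (G_proj R)) (Tate_Ext R i M))) \<and>
         (has_right_approximation R (G_proj R) M \<longleftrightarrow>
            (\<forall>i. fin_presented (stable_cat R (G_proj R)) (Tate_Ext R i M))) \<and>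
         (has_right_approximation R (G_proj R) M \<longleftrightarrow>
            (\<exists>i. fin_presented (stable_cat R (G_proj R)) (Tate_Ext R i M))) \<and>
         (has_right_approximation R (G_proj R) M \<longleftrightarrow>
            (\<forall>i. projective_in_mod (stable_cat R (G_proj R)) (Tate_Ext R i M))) \<and>
         (has_right_approximation R (G_proj R) M \<longleftrightarrow>
            (\<exists>i. projective_in_mod (stable_cat R (G_proj R)) (Tate_Ext R i M)))"
proof -
  have local: "local_cring R" using assms(2) unfolding henselian_local_ring_def by blast
  then have cring: "cring R" unfolding local_cring_def by blast
  interpret noetherian_local_cring R
    by (intro noetherian_local_cring.intro noetherian_cring.intro noetherian_local_cring_axioms.intro cring assms(1) local)
  interpret additive_category "stable_cat R (G_proj R)" by (rule stable_additive)
  let ?A = "stable_cat R (G_proj R)"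
  have proj: "projective_in_mod ?A (Tate_Ext R i M)" if "has_right_approximation R (G_proj R) M" for i
    by (rule split_generated_projective[OF Tate_Ext_split_generated[OF assms(3) that]])
  have fp: "fin_presented ?A (Tate_Ext R i M)" if "projective_in_mod ?A (Tate_Ext R i M)" for i
    using that unfolding projective_in_mod_def by (rule conjunct1)
  have fg: "fin_generated ?A (Tate_Ext R i M)" if "fin_presented ?A (Tate_Ext R i M)" for i
    using that by (rule fin_presented_imp_generated)
  have ap: "has_right_approximation R (G_proj R) M" if "fin_generated ?A (Tate_Ext R i M)" for i
    using assms(3) that by (rule Tate_Ext_generated_approximation)
  \<comment> \<open>For each \<open>i\<close> the conditions form a cycle through the approximation
    property, which does not mention \<open>i\<close>; this is why a single degree controls all of
    them.\<close>
  show ?thesis using proj fp fg ap by blast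
qed

end
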